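(* Let $(M,\pi)$ be a Poisson manifold, with map $\sharp\colon T^*M\to TM$ given by contraction with $\pi$. Then $(M,\pi)$ is almost regular if and only if: (i) the subset $M_{\mathrm{reg}}\subset M$ where $\sharp$ has maximal rank is dense in $M$, and (ii) there is a (constant rank) distribution $D$ on $M$ such that at every $x\in M_{\mathrm{reg}}$ the symplectic leaf of $(M,\pi)$ at $x$ is an open subset of the leaf of $D$ at $x$. In this case, the distribution $D$ is unique, it is integrable (involutive), and its leaves are Poisson submanifolds of $(M,\pi)$.
   Context: For a Poisson manifold $(M,\pi)$ let $\mathcal{F}:=\sharp(\Gamma_c(T^*M))$, the $C^\infty(M)$-submodule of the compactly supported vector fields $\mathfrak{X}_c(M)$ given by the images under $\sharp$ of compactly supported $1$-forms. $(M,\pi)$ is called almost regular if there is a vector bundle $A\to M$ and an isomorphism of $C^\infty(M)$-modules $\mathcal{F}\cong\Gamma_c(A)$ (compactly supported sections). Vector bundles have constant rank. "Maximal rank" means that the rank of $\sharp_x$ equals $\max_{y\in M}\mathrm{rank}(\sharp_y)$. Condition (ii) on $D$ means: $D_x=T_xL$ for all $x\in M_{\mathrm{reg}}$, where $L$ is the symplectic leaf through $x$ (so that the symplectic leaves in $M_{\mathrm{reg}}$ are integral manifolds of $D$ of dimension $\mathrm{rank}(D)$). A Poisson submanifold is an (immersed) submanifold $P$ such that $\pi$ is tangent to $P$, i.e. $\pi_x\in\wedge^2T_xP$ for all $x\in P$. *)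

theory Defs
  imports "HOL-Analysis.Analysis" "HOL-Analysis.Finite_Function_Topology"
begin

section \<open>Smooth maps on open subsets of normed spaces\<close>

text \<open>
  All smoothness predicates below are meant for open sets, and are only applied to open sets.
\<close>

primrec times_differentiable_on ::
    "nat \<Rightarrow> 'e::real_normed_vector set \<Rightarrow> ('e \<Rightarrow> 'b::real_normed_vector) \<Rightarrow> bool" where
  "times_differentiable_on 0 S f \<longleftrightarrow> continuous_on S f"
| "times_differentiable_on (Suc n) S f \<longleftrightarrow>
     (\<forall>x\<in>S. f differentiable (at x)) \<and>
     (\<forall>v. times_differentiable_on n S (\<lambda>x. frechet_derivative f (at x) v))"

definition smooth_on ::
    "'e::real_normed_vector set \<Rightarrow> ('e \<Rightarrow> 'b::real_normed_vector) \<Rightarrow> bool" where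
  "smooth_on S f \<longleftrightarrow> (\<forall>n. times_differentiable_on n S f)"


section \<open>Smooth manifolds\<close>

text \<open>
  The manifold is the whole of a Hausdorff, second countable type \<open>'a\<close>, equipped with an atlas
  (not required to be maximal) of charts with values in \<open>'e\<close>; its dimension is \<open>DIM('e)\<close>.
  It is not assumed to be connected.  A chart is a pair of a domain and a map, the values of
  the map outside the domain being irrelevant.
\<close>

type_synonym ('a, 'e) chart = "'a set \<times> ('a \<Rightarrow> 'e)"

abbreviation chart_inv :: "('a, 'e) chart \<Rightarrow> 'e \<Rightarrow> 'a" where
  "chart_inv c \<equiv> inv_into (fst c) (snd c)"

definition is_chart :: "('a::topological_space, 'e::euclidean_space) chart \<Rightarrow> bool" where
  "is_chart c \<longleftrightarrow> open (fst c) \<and> open (snd c ` fst c) \<and>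
     homeomorphism (fst c) (snd c ` fst c) (snd c) (chart_inv c)"

definition smooth_transition ::
    "('a, 'e::euclidean_space) chart \<Rightarrow> ('a, 'e) chart \<Rightarrow> bool" where
  "smooth_transition c d \<longleftrightarrow> smooth_on (snd c ` (fst c \<inter> fst d)) (snd d \<circ> chart_inv c)"

definition smooth_atlas ::
    "('a::{t2_space, second_countable_topology}, 'e::euclidean_space) chart set \<Rightarrow> bool" where
  "smooth_atlas A \<longleftrightarrow> (\<forall>c\<in>A. is_chart c) \<and> (\<Union>c\<in>A. fst c) = UNIV \<and>
     (\<forall>c\<in>A. \<forall>d\<in>A. smooth_transition c d)"

text \<open>The charts of the maximal atlas determined by \<open>A\<close>.\<close>

definition admissible_chart ::
    "('a::topological_space, 'e::euclidean_space) chart set \<Rightarrow> ('a, 'e) chart \<Rightarrow> bool" where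
  "admissible_chart A c \<longleftrightarrow>
     is_chart c \<and> (\<forall>d\<in>A. smooth_transition c d \<and> smooth_transition d c)"

definition smooth_fun_on ::
    "('a, 'e::euclidean_space) chart set \<Rightarrow> 'a set \<Rightarrow> ('a \<Rightarrow> real) \<Rightarrow> bool" where
  "smooth_fun_on A U f \<longleftrightarrow> (\<forall>c\<in>A. smooth_on (snd c ` (fst c \<inter> U)) (f \<circ> chart_inv c))"


section \<open>Tangent and cotangent vectors\<close>

text \<open>
  A tangent vector at \<open>p\<close> is a family of vectors of \<open>'e\<close>, one for each chart around \<open>p\<close>, related by
  the derivatives of the transition maps.  Such a family is determined by its member for one
  chart, so \<open>T\<^sub>pM\<close> is identified with \<open>'e\<close> through a chart \<open>chart_at A p\<close> selected
  once and for all.  Nothing is assumed about how the selected chart varies with \<open>p\<close>; smoothness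
  is always tested in a fixed chart.  Cotangent vectors at \<open>p\<close> are the linear forms on
  \<open>T\<^sub>pM\<close>, that is, elements of \<open>'e \<Rightarrow>\<^sub>L real\<close>.
\<close>

definition chart_at :: "('a, 'e) chart set \<Rightarrow> 'a \<Rightarrow> ('a, 'e) chart" where
  "chart_at A p = (SOME c. c \<in> A \<and> p \<in> fst c)"

definition coord_change ::
    "('a, 'e::euclidean_space) chart \<Rightarrow> ('a, 'e) chart \<Rightarrow> 'a \<Rightarrow> 'e \<Rightarrow> 'e" where
  "coord_change c d p = frechet_derivative (snd d \<circ> chart_inv c) (at (snd c p))"

text \<open>
  The differential of the chart \<open>c\<close> at \<open>p\<close>, from \<open>T\<^sub>pM\<close> to \<open>'e\<close>, and its inverse.
\<close>

definition dchart ::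
    "('a, 'e::euclidean_space) chart set \<Rightarrow> ('a, 'e) chart \<Rightarrow> 'a \<Rightarrow> 'e \<Rightarrow> 'e" where
  "dchart A c p = coord_change (chart_at A p) c p"

definition dchart_inv ::
    "('a, 'e::euclidean_space) chart set \<Rightarrow> ('a, 'e) chart \<Rightarrow> 'a \<Rightarrow> 'e \<Rightarrow> 'e" where
  "dchart_inv A c p = coord_change c (chart_at A p) p"

definition differential ::
    "('a, 'e::euclidean_space) chart set \<Rightarrow> ('a \<Rightarrow> real) \<Rightarrow> 'a \<Rightarrow> ('e \<Rightarrow>\<^sub>L real)" where
  "differential A f p =
     Blinfun (frechet_derivative (f \<circ> chart_inv (chart_at A p)) (at (snd (chart_at A p) p)))"

definition local_rep ::
    "('a, 'e::euclidean_space) chart set \<Rightarrow> ('a, 'e) chart \<Rightarrow> ('a \<Rightarrow> 'e) \<Rightarrow> 'e \<Rightarrow> 'e" where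
  "local_rep A c X y = dchart A c (chart_inv c y) (X (chart_inv c y))"

definition smooth_vf_on ::
    "('a, 'e::euclidean_space) chart set \<Rightarrow> 'a set \<Rightarrow> ('a \<Rightarrow> 'e) \<Rightarrow> bool" where
  "smooth_vf_on A U X \<longleftrightarrow> (\<forall>c\<in>A. smooth_on (snd c ` (fst c \<inter> U)) (local_rep A c X))"

definition smooth_form ::
    "('a, 'e::euclidean_space) chart set \<Rightarrow> ('a \<Rightarrow> ('e \<Rightarrow>\<^sub>L real)) \<Rightarrow> bool" where
  "smooth_form A \<alpha> \<longleftrightarrow> (\<forall>c\<in>A. \<forall>v. smooth_on (snd c ` fst c)
     (\<lambda>y. blinfun_apply (\<alpha> (chart_inv c y)) (dchart_inv A c (chart_inv c y) v)))"

definition lie_bracket ::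
    "('a, 'e::euclidean_space) chart set \<Rightarrow> ('a \<Rightarrow> 'e) \<Rightarrow> ('a \<Rightarrow> 'e) \<Rightarrow> 'a \<Rightarrow> 'e" where
  "lie_bracket A X Y p =
     (let c = chart_at A p
      in frechet_derivative (local_rep A c Y) (at (snd c p)) (X p)
       - frechet_derivative (local_rep A c X) (at (snd c p)) (Y p))"

definition compact_support :: "('a::topological_space \<Rightarrow> 'v::zero) \<Rightarrow> bool" where
  "compact_support s \<longleftrightarrow> compact (closure {p. s p \<noteq> 0})"


section \<open>Poisson structures\<close>

type_synonym 'e biform = "('e \<Rightarrow>\<^sub>L real) \<Rightarrow> ('e \<Rightarrow>\<^sub>L real) \<Rightarrow> real"

text \<open>
  The second exterior power of a subspace \<open>V\<close> of a tangent space, whose elements, the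
  finite sums of wedge products of vectors of \<open>V\<close>, are regarded as alternating
  bilinear forms on the cotangent space.
\<close>

definition wedge2 :: "'e::euclidean_space set \<Rightarrow> 'e biform set" where
  "wedge2 V = {b. \<exists>(m::nat) v w. (\<forall>i<m. v i \<in> V \<and> w i \<in> V) \<and>
     (\<forall>\<xi> \<eta>. b \<xi> \<eta> = (\<Sum>i<m. blinfun_apply \<xi> (v i) * blinfun_apply \<eta> (w i)
                            - blinfun_apply \<xi> (w i) * blinfun_apply \<eta> (v i)))}"

definition smooth_bivector ::
    "('a, 'e::euclidean_space) chart set \<Rightarrow> ('a \<Rightarrow> 'e biform) \<Rightarrow> bool" where
  "smooth_bivector A \<pi> \<longleftrightarrow> (\<forall>p. \<pi> p \<in> wedge2 UNIV) \<and>
     (\<forall>c\<in>A. \<forall>\<xi> \<eta>. smooth_on (snd c ` fst c)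
        (\<lambda>y. \<pi> (chart_inv c y)
           (Blinfun (\<lambda>v. blinfun_apply \<xi> (dchart A c (chart_inv c y) v)))
           (Blinfun (\<lambda>v. blinfun_apply \<eta> (dchart A c (chart_inv c y) v)))))"

definition poisson_bracket ::
    "('a, 'e::euclidean_space) chart set \<Rightarrow> ('a \<Rightarrow> 'e biform) \<Rightarrow>
     ('a \<Rightarrow> real) \<Rightarrow> ('a \<Rightarrow> real) \<Rightarrow> 'a \<Rightarrow> real" where
  "poisson_bracket A \<pi> f g p = \<pi> p (differential A f p) (differential A g p)"

definition poisson_manifold ::
    "('a::{t2_space, second_countable_topology}, 'e::euclidean_space) chart set \<Rightarrow>
     ('a \<Rightarrow> 'e biform) \<Rightarrow> bool" where
  "poisson_manifold A \<pi> \<longleftrightarrow> smooth_atlas A \<and> smooth_bivector A \<pi> \<and>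
     (\<forall>f g h. smooth_fun_on A UNIV f \<and> smooth_fun_on A UNIV g \<and> smooth_fun_on A UNIV h \<longrightarrow>
        (\<forall>p. poisson_bracket A \<pi> f (poisson_bracket A \<pi> g h) p
           + poisson_bracket A \<pi> g (poisson_bracket A \<pi> h f) p
           + poisson_bracket A \<pi> h (poisson_bracket A \<pi> f g) p = 0))"

text \<open>\<open>sharp \<pi> p \<xi>\<close> is the contraction of \<open>\<xi>\<close> with \<open>\<pi>\<close> at \<open>p\<close>.\<close>

definition sharp ::
    "('a \<Rightarrow> 'e::euclidean_space biform) \<Rightarrow> 'a \<Rightarrow> ('e \<Rightarrow>\<^sub>L real) \<Rightarrow> 'e" where
  "sharp \<pi> p \<xi> = (THE v. \<forall>\<eta>. blinfun_apply \<eta> v = \<pi> p \<xi> \<eta>)"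

definition sharp_rank :: "('a \<Rightarrow> 'e::euclidean_space biform) \<Rightarrow> 'a \<Rightarrow> nat" where
  "sharp_rank \<pi> p = dim (range (sharp \<pi> p))"

definition M_reg :: "('a \<Rightarrow> 'e::euclidean_space biform) \<Rightarrow> 'a set" where
  "M_reg \<pi> = {p. sharp_rank \<pi> p = Max (range (sharp_rank \<pi>))}"

definition sharp_module ::
    "('a::topological_space, 'e::euclidean_space) chart set \<Rightarrow> ('a \<Rightarrow> 'e biform) \<Rightarrow>
     ('a \<Rightarrow> 'e) set" where
  "sharp_module A \<pi> =
     {X. \<exists>\<alpha>. smooth_form A \<alpha> \<and> compact_support \<alpha> \<and> X = (\<lambda>p. sharp \<pi> p (\<alpha> p))}"


section \<open>Vector bundles and almost regular Poisson manifolds\<close>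

text \<open>
  A vector bundle of rank \<open>r\<close> is given by its fibres \<open>E p\<close>, subspaces of \<open>'v\<close>, and by
  local trivialisations.  A trivialisation over \<open>U\<close> is recorded by its frame
  \<open>b p 0, \<dots>, b p (r - 1)\<close>, the images of the standard basis vectors under
  \<open>\<real>\<^sup>r \<rightarrow> E p\<close>; the transition functions have to be smooth.  The topology of \<open>'v\<close>, if any,
  and the way the fibres lie in \<open>'v\<close> play no role.
\<close>

definition smooth_combination_on ::
    "('a, 'e::euclidean_space) chart set \<Rightarrow> nat \<Rightarrow> 'a set \<Rightarrow> ('a \<Rightarrow> nat \<Rightarrow> 'v::real_vector) \<Rightarrow>
     ('a \<Rightarrow> 'v) \<Rightarrow> bool" where
  "smooth_combination_on A r U b s \<longleftrightarrow>
     (\<exists>g. (\<forall>i<r. smooth_fun_on A U (g i)) \<and> (\<forall>p\<in>U. s p = (\<Sum>i<r. g i p *\<^sub>R b p i)))"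

definition vector_bundle ::
    "('a::topological_space, 'e::euclidean_space) chart set \<Rightarrow> nat \<Rightarrow>
     ('a \<Rightarrow> 'v::real_vector set) \<Rightarrow> ('a set \<times> ('a \<Rightarrow> nat \<Rightarrow> 'v)) set \<Rightarrow> bool" where
  "vector_bundle A r E T \<longleftrightarrow>
     (\<forall>(U, b)\<in>T. open U \<and>
        (\<forall>p\<in>U. inj_on (b p) {..<r} \<and> independent (b p ` {..<r}) \<and> span (b p ` {..<r}) = E p)) \<and>
     (\<Union>(U, b)\<in>T. U) = UNIV \<and>
     (\<forall>(U, b)\<in>T. \<forall>(U', b')\<in>T. \<forall>j<r. smooth_combination_on A r (U \<inter> U') b (\<lambda>p. b' p j))"

definition compact_sections ::
    "('a::topological_space, 'e::euclidean_space) chart set \<Rightarrow> nat \<Rightarrow>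
     ('a \<Rightarrow> 'v::real_vector set) \<Rightarrow> ('a set \<times> ('a \<Rightarrow> nat \<Rightarrow> 'v)) set \<Rightarrow> ('a \<Rightarrow> 'v) set" where
  "compact_sections A r E T =
     {s. (\<forall>p. s p \<in> E p) \<and> (\<forall>(U, b)\<in>T. smooth_combination_on A r U b s) \<and> compact_support s}"

definition module_iso ::
    "('a, 'e::euclidean_space) chart set \<Rightarrow> ('a \<Rightarrow> 'v::real_vector) set \<Rightarrow>
     ('a \<Rightarrow> 'w::real_vector) set \<Rightarrow> (('a \<Rightarrow> 'v) \<Rightarrow> ('a \<Rightarrow> 'w)) \<Rightarrow> bool" where
  "module_iso A \<Gamma> \<Gamma>' \<Phi> \<longleftrightarrow> bij_betw \<Phi> \<Gamma> \<Gamma>' \<and>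
     (\<forall>s\<in>\<Gamma>. \<forall>t\<in>\<Gamma>. \<Phi> (\<lambda>p. s p + t p) = (\<lambda>p. \<Phi> s p + \<Phi> t p)) \<and>
     (\<forall>f. \<forall>s\<in>\<Gamma>. smooth_fun_on A UNIV f \<longrightarrow> \<Phi> (\<lambda>p. f p *\<^sub>R s p) = (\<lambda>p. f p *\<^sub>R \<Phi> s p))"

text \<open>
  The fibres are taken inside the space \<open>nat \<Rightarrow>\<^sub>0 real\<close> of finitely supported sequences.
  This is no restriction on the bundle or on its rank: a choice of a basis of each fibre, not depending
  smoothly on the base point, identifies any vector bundle of rank \<open>r\<close> with one whose
  fibres all equal \<open>\<real>\<^sup>r\<close>, the smooth structure being transported to the local frames.
\<close>

definition almost_regular ::
    "('a::topological_space, 'e::euclidean_space) chart set \<Rightarrow> ('a \<Rightarrow> 'e biform) \<Rightarrow> bool" where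
  "almost_regular A \<pi> \<longleftrightarrow>
     (\<exists>r (E :: 'a \<Rightarrow> (nat \<Rightarrow>\<^sub>0 real) set) T. vector_bundle A r E T \<and>
        (\<exists>\<Phi>. module_iso A (compact_sections A r E T) (sharp_module A \<pi>) \<Phi>))"


section \<open>Distributions, immersed submanifolds and leaves\<close>

definition distribution ::
    "('a::topological_space, 'e::euclidean_space) chart set \<Rightarrow> nat \<Rightarrow> ('a \<Rightarrow> 'e set) \<Rightarrow> bool" where
  "distribution A k D \<longleftrightarrow> (\<forall>p. subspace (D p) \<and> dim (D p) = k \<and>
     (\<exists>U (X :: nat \<Rightarrow> 'a \<Rightarrow> 'e). open U \<and> p \<in> U \<and> (\<forall>i<k. smooth_vf_on A U (X i)) \<and>
        (\<forall>q\<in>U. D q = span ((\<lambda>i. X i q) ` {..<k}))))"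

definition involutive ::
    "('a::topological_space, 'e::euclidean_space) chart set \<Rightarrow> ('a \<Rightarrow> 'e set) \<Rightarrow> bool" where
  "involutive A D \<longleftrightarrow>
     (\<forall>U X Y. open U \<and> smooth_vf_on A U X \<and> smooth_vf_on A U Y \<and>
        (\<forall>p\<in>U. X p \<in> D p \<and> Y p \<in> D p) \<longrightarrow> (\<forall>p\<in>U. lie_bracket A X Y p \<in> D p))"

text \<open>
  An immersed submanifold is a subset \<open>P\<close> with its own topology, usually finer than the
  subspace topology, for which the inclusion is a smooth immersion.  Its smooth structure is
  determined by its topology, so that \<open>P\<close> is encoded as an abstract topology \<open>L\<close> with
  \<open>topspace L = P\<close>.  By the local form of immersions, the condition is that every point has
  a neighbourhood \<open>N\<close> in \<open>P\<close> which carries the subspace topology of the ambient manifold and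
  is a slice (of the dimension of \<open>P\<close>) in an admissible chart.  Second countability of \<open>P\<close>
  is not demanded; it is automatic for connected \<open>P\<close>, in particular for leaves.
\<close>

definition slice_at ::
    "('a::topological_space, 'e::euclidean_space) chart set \<Rightarrow> 'a topology \<Rightarrow> 'a \<Rightarrow>
     ('a, 'e) chart \<Rightarrow> 'e set \<Rightarrow> bool" where
  "slice_at A L p c S \<longleftrightarrow> admissible_chart A c \<and> p \<in> fst c \<and> subspace S \<and>
     (let N = {q \<in> fst c. snd c q - snd c p \<in> S}
      in openin L N \<and> subtopology L N = top_of_set N)"

definition immersed_submanifold ::
    "('a::topological_space, 'e::euclidean_space) chart set \<Rightarrow> nat \<Rightarrow> 'a topology \<Rightarrow> bool" where
  "immersed_submanifold A k L \<longleftrightarrow>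
     (\<forall>p\<in>topspace L. \<exists>c S. slice_at A L p c S \<and> dim S = k)"

definition tangent_space ::
    "('a::topological_space, 'e::euclidean_space) chart set \<Rightarrow> 'a topology \<Rightarrow> 'a \<Rightarrow> 'e set" where
  "tangent_space A L p = {v. \<exists>c S. slice_at A L p c S \<and> dchart A c p v \<in> S}"

text \<open>
  Leaves are the maximal connected integral manifolds.  The (possibly singular) distribution \<open>D\<close> is
  an arbitrary assignment of subspaces, so that the symplectic leaves are covered as well.
\<close>

definition connected_integral_manifold ::
    "('a::topological_space, 'e::euclidean_space) chart set \<Rightarrow> ('a \<Rightarrow> 'e set) \<Rightarrow>
     'a topology \<Rightarrow> bool" where
  "connected_integral_manifold A D L \<longleftrightarrow>
     (\<exists>k. immersed_submanifold A k L) \<and> (\<forall>p\<in>topspace L. tangent_space A L p = D p) \<and>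
     connected_space L \<and> topspace L \<noteq> {}"

definition leaf ::
    "('a::topological_space, 'e::euclidean_space) chart set \<Rightarrow> ('a \<Rightarrow> 'e set) \<Rightarrow>
     'a topology \<Rightarrow> bool" where
  "leaf A D L \<longleftrightarrow> connected_integral_manifold A D L \<and>
     (\<forall>N. connected_integral_manifold A D N \<and> topspace L \<subseteq> topspace N \<longrightarrow> topspace N = topspace L)"

definition integrable_distribution ::
    "('a::topological_space, 'e::euclidean_space) chart set \<Rightarrow> ('a \<Rightarrow> 'e set) \<Rightarrow> bool" where
  "integrable_distribution A D \<longleftrightarrow> (\<forall>p. \<exists>L. leaf A D L \<and> p \<in> topspace L)"

definition symplectic_leaf ::
    "('a::topological_space, 'e::euclidean_space) chart set \<Rightarrow> ('a \<Rightarrow> 'e biform) \<Rightarrow>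
     'a topology \<Rightarrow> bool" where
  "symplectic_leaf A \<pi> L \<longleftrightarrow> leaf A (\<lambda>p. range (sharp \<pi> p)) L"

definition poisson_submanifold ::
    "('a::topological_space, 'e::euclidean_space) chart set \<Rightarrow> ('a \<Rightarrow> 'e biform) \<Rightarrow>
     'a topology \<Rightarrow> bool" where
  "poisson_submanifold A \<pi> P \<longleftrightarrow> (\<exists>k. immersed_submanifold A k P) \<and>
     (\<forall>p\<in>topspace P. \<pi> p \<in> wedge2 (tangent_space A P p))"

definition extends_symplectic_foliation ::
    "('a::topological_space, 'e::euclidean_space) chart set \<Rightarrow> ('a \<Rightarrow> 'e biform) \<Rightarrow>
     ('a \<Rightarrow> 'e set) \<Rightarrow> bool" where
  "extends_symplectic_foliation A \<pi> D \<longleftrightarrow> (\<exists>k. distribution A k D) \<and>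
     (\<forall>p\<in>M_reg \<pi>. \<exists>L. symplectic_leaf A \<pi> L \<and> p \<in> topspace L \<and> tangent_space A L p = D p)"

end

theory Submission
  imports Defs
begin

text \<open>
  If \<open>D\<close> is a constant rank distribution that agrees with the image of \<open>\<sharp>\<close> on the dense set
  \<open>M\<^sub>r\<^sub>e\<^sub>g\<close>, then by continuity \<open>D\<close> is involutive and contains the image of \<open>\<sharp>\<close> everywhere; as
  \<open>\<pi>\<close> is skew, \<open>\<sharp>\<close> factors through the restriction of forms to \<open>D\<close>, and the induced map
  \<open>D\<^sup>* \<rightarrow> TM\<close> is injective on the dense set \<open>M\<^sub>r\<^sub>e\<^sub>g\<close>, hence on sections. This identifies the
  compactly supported sections of \<open>D\<^sup>*\<close> with the module of the Poisson structure.

  Conversely, transport a local frame of the bundle to elements \<open>Y\<^sub>k = \<sharp> \<alpha>\<^sub>k\<close> of the module. They generate it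
  locally, without relations over the smooth functions, so that they are linearly independent on a dense set.
  Writing \<open>\<sharp> \<xi> = (\<Sum>k. \<xi> \<gamma>\<^sub>k Y\<^sub>k)\<close> with smooth vector fields \<open>\<gamma>\<^sub>k\<close>, the absence of relations gives
  \<open>\<alpha>\<^sub>i \<gamma>\<^sub>k = \<delta>\<^sub>i\<^sub>k\<close>, hence the \<open>\<gamma>\<^sub>k\<close> are independent everywhere, while skewness of \<open>\<pi>\<close>
  places the image of \<open>\<sharp>\<close> in their span. That span is the distribution \<open>D\<close>.

  The symplectic leaves through regular points, and the leaves of \<open>D\<close>, come from the Frobenius theorem.
  Its proof straightens a commuting frame by a flow that is obtained, with smooth dependence on
  parameters, as the fixed point of an integral equation.
\<close>

section \<open>Calculus of smooth maps\<close>

text \<open>On the plane, let \<pi> be a function f times the standard bivector, with f nonzero on a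
  dense set. The generators \<open>Y\<^sub>k\<close> vanish together with f, so their span is no
  candidate for \<open>D\<close> at singular points; the coefficient fields
  \<open>\<gamma>\<^sub>k\<close> remain a frame there. This is why the converse direction looks at
  the coefficients and not at the generators.

  Smoothness means that all iterated directional derivatives exist, so flows and inverse maps must
  be controlled to every order. Their derivatives solve linear fixed point equations, and solutions
  of such equations have derivatives that solve equations of the same kind, which closes an
  induction on the order. Linear independence is witnessed by dual families: coefficients become
  inner products and membership in a span becomes a closed equation, without determinants. The
  module isomorphism is linear only over functions on the whole manifold, hence the many cut-offs.
  Leaves are maximal among all integral manifolds, also those of the singular distribution; since
  such a manifold has a single dimension, it cannot leave the regular part.\<close>

abbreviation "td \<equiv> times_differentiable_on"

text \<open>On an open set the derivative at a point depends only on the germ there, so agreement on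
  \<open>S\<close> passes to all iterated derivatives, although \<open>frechet_derivative\<close>
  also sees the functions outside \<open>S\<close>.\<close>

lemma td_cong:
  fixes f g :: "'a::real_normed_vector \<Rightarrow> 'b::real_normed_vector"
  assumes "open S" "\<And>x. x \<in> S \<Longrightarrow> f x = g x"
  shows "td n S f = td n S g"
  using assms(2)
proof (induction n arbitrary: f g)
  case 0
  then show ?case by (auto intro!: continuous_on_cong)
next
  case (Suc n)
  \<comment> \<open>The claim is symmetric in \<open>f\<close> and \<open>g\<close>, so one
    implication for arbitrary functions suffices.\<close>
  have imp: "td (Suc n) S g" if eq: "\<And>x. x \<in> S \<Longrightarrow> f x = g x" and f: "td (Suc n) S f" for f g :: "'a \<Rightarrow> 'b"
  proof -
    have der: "(g has_derivative frechet_derivative f (at x)) (at x)" if "x \<in> S" for x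
    proof -
      have "(f has_derivative frechet_derivative f (at x)) (at x)"
        using f that frechet_derivative_works by auto
      then show ?thesis
        using has_derivative_transform_within_open[OF _ \<open>open S\<close> that] eq by blast
    qed
    have "frechet_derivative g (at x) = frechet_derivative f (at x)" if "x \<in> S" for x
      using frechet_derivative_at[OF der[OF that]] by (rule sym)
    then have "td n S (\<lambda>x. frechet_derivative g (at x) v)" for v
      using f Suc.IH[of "\<lambda>x. frechet_derivative g (at x) v" "\<lambda>x. frechet_derivative f (at x) v"] by simp
    then show ?thesis using der unfolding times_differentiable_on.simps differentiable_def by blast
  qed
  show ?case
  proof
    show "td (Suc n) S g" if "td (Suc n) S f" using imp[OF _ that] Suc.prems by simp
    show "td (Suc n) S f" if "td (Suc n) S g" using imp[OF _ that] Suc.prems by simp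
  qed
qed

text \<open>Replaces the chosen \<open>frechet_derivative\<close> by any derivative formula at hand;
  the inductions on the order advance through this form.\<close>

lemma td_Suc_iff:
  assumes "open S" "\<And>x. x \<in> S \<Longrightarrow> (f has_derivative f' x) (at x)"
  shows "td (Suc n) S f \<longleftrightarrow> (\<forall>v. td n S (\<lambda>x. f' x v))"
proof -
  have "frechet_derivative f (at x) = f' x" if "x \<in> S" for x
    using frechet_derivative_at[OF assms(2)[OF that]] by (rule sym)
  then show ?thesis
    using assms td_cong[OF assms(1), of "\<lambda>x. frechet_derivative f (at x) v" "\<lambda>x. f' x v" n for v]
    by (auto simp: differentiable_def)
qed

lemma td_subset: "td n S f \<Longrightarrow> T \<subseteq> S \<Longrightarrow> td n T f"
  by (induction n arbitrary: f) (auto intro: continuous_on_subset)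

lemma td_continuous: "td n S f \<Longrightarrow> continuous_on S f"
  by (cases n)
    (auto intro!: differentiable_imp_continuous_on differentiable_at_imp_differentiable_on)

lemma td_SucD: "td (Suc n) S f \<Longrightarrow> td n S f"
proof (induction n arbitrary: f)
  case 0
  then show ?case using td_continuous[of "Suc 0"] by auto
next
  case (Suc n)
  then show ?case by (metis times_differentiable_on.simps(2))
qed

lemma td_has_derivative:
  "td (Suc n) S f \<Longrightarrow> x \<in> S \<Longrightarrow> (f has_derivative frechet_derivative f (at x)) (at x)"
  using frechet_derivative_works by auto

lemma td_const: "open S \<Longrightarrow> td n S (\<lambda>x. c)"
  by (induction n arbitrary: c) (auto simp: frechet_derivative_const)

lemma td_linear_compose:
  assumes "bounded_linear L" "open S" "td n S f"
  shows "td n S (\<lambda>x. L (f x))"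
  using assms(3)
proof (induction n arbitrary: f)
  case 0
  then show ?case using assms(1) by (auto intro: bounded_linear.continuous_on)
next
  case (Suc n)
  have "((\<lambda>x. L (f x)) has_derivative (\<lambda>v. L (frechet_derivative f (at x) v))) (at x)" if "x \<in> S" for x
    using bounded_linear.has_derivative[OF assms(1) td_has_derivative[OF Suc.prems that]] .
  from td_Suc_iff[OF assms(2) this] Suc show ?case by simp
qed

lemma td_bounded_linear:
  assumes "bounded_linear L" "open S"
  shows "td n S L"
proof (cases n)
  case 0
  then show ?thesis using assms by (auto intro: linear_continuous_on)
next
  case (Suc m)
  have "(L has_derivative L) (at x)" for x
    using assms(1) by (rule bounded_linear_imp_has_derivative)
  from td_Suc_iff[OF assms(2) this] show ?thesis unfolding Suc by (simp add: td_const assms)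
qed

lemma td_add:
  assumes "open S" "td n S f" "td n S g"
  shows "td n S (\<lambda>x. f x + g x)"
  using assms(2,3)
proof (induction n arbitrary: f g)
  case 0
  then show ?case by (auto intro: continuous_intros)
next
  case (Suc n)
  have "((\<lambda>x. f x + g x) has_derivative (\<lambda>v. frechet_derivative f (at x) v + frechet_derivative g (at x) v)) (at x)"
    if "x \<in> S" for x
    by (intro has_derivative_add td_has_derivative[OF Suc.prems(1) that] td_has_derivative[OF Suc.prems(2) that])
  from td_Suc_iff[OF assms(1) this] Suc show ?case by simp
qed

text \<open>The product rule returns products of the same kind with one factor differentiated, hence
  the induction over arbitrary \<open>f\<close> and \<open>g\<close>.\<close>

lemma (in bounded_bilinear) td_bilinear:
  assumes "open S" "td n S f" "td n S g"
  shows "td n S (\<lambda>x. prod (f x) (g x))"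
  using assms(2,3)
proof (induction n arbitrary: f g)
  case 0
  then show ?case by (auto intro: continuous_on)
next
  case (Suc n)
  have der: "((\<lambda>x. prod (f x) (g x)) has_derivative
      (\<lambda>v. prod (f x) (frechet_derivative g (at x) v) + prod (frechet_derivative f (at x) v) (g x))) (at x)"
    if "x \<in> S" for x
    by (rule FDERIV[OF td_has_derivative[OF Suc.prems(1) that] td_has_derivative[OF Suc.prems(2) that]])
  have *: "td n S (\<lambda>x. prod (f x) (frechet_derivative g (at x) v) + prod (frechet_derivative f (at x) v) (g x))" for v
    using Suc.prems by (intro td_add assms(1) Suc.IH td_SucD[OF Suc.prems(1)] td_SucD[OF Suc.prems(2)]) auto
  show ?case using td_Suc_iff[OF assms(1) der] * by blast
qed

lemma td_sum:
  assumes "open S" "\<And>i. i \<in> I \<Longrightarrow> td n S (f i)"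
  shows "td n S (\<lambda>x. \<Sum>i\<in>I. f i x)"
  using assms(2)
  by (induction I rule: infinite_finite_induct) (auto intro: td_const td_add assms(1))

lemma td_local:
  assumes "\<And>x. x \<in> S \<Longrightarrow> \<exists>U. open U \<and> x \<in> U \<and> td n U f"
  shows "td n S f"
  using assms
proof (induction n arbitrary: f)
  case 0
  then show ?case
    by simp (metis continuous_on_eq_continuous_at continuous_at_imp_continuous_on)
next
  case (Suc n)
  have "td n S (\<lambda>x. frechet_derivative f (at x) v)" for v
    by (rule Suc.IH) (metis Suc.prems times_differentiable_on.simps(2))
  moreover have "\<forall>x\<in>S. f differentiable (at x)"
    using Suc.prems by (metis times_differentiable_on.simps(2))
  ultimately show ?case by simp
qed

text \<open>The middle space is Euclidean because the chain rule evaluates the derivative of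
  \<open>g\<close> in a direction that varies with the point, while higher differentiability is
  known only for fixed directions.\<close>

lemma td_compose:
  fixes f :: "'e::real_normed_vector \<Rightarrow> 'b::euclidean_space" and g :: "'b \<Rightarrow> 'c::real_normed_vector"
  assumes "open S" "open T" "f ` S \<subseteq> T" "td n S f" "td n T g"
  shows "td n S (\<lambda>x. g (f x))"
  using assms(4,5)
proof (induction n arbitrary: g)
  case 0
  then show ?case using assms(3) by (auto intro: continuous_on_compose2)
next
  case (Suc n)
  let ?f' = "\<lambda>x. frechet_derivative f (at x)" and ?g' = "\<lambda>x. frechet_derivative g (at x)"
  have der: "((\<lambda>x. g (f x)) has_derivative (\<lambda>v. ?g' (f x) (?f' x v))) (at x)" if "x \<in> S" for x
    using has_derivative_compose[OF td_has_derivative[OF Suc.prems(1) that], of g "?g' (f x)"]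
      td_has_derivative[OF Suc.prems(2), of "f x"] assms(3) that by auto
  \<comment> \<open>Expanding the inner derivative in \<open>Basis\<close> leaves partial
    derivatives of \<open>g\<close> composed with \<open>f\<close>, to which the induction
    hypothesis applies.\<close>
  have "td n S (\<lambda>x. \<Sum>i\<in>Basis. (?f' x v \<bullet> i) *\<^sub>R ?g' (f x) i)" for v
  proof (intro td_sum assms(1) bounded_bilinear.td_bilinear[OF bounded_bilinear_scaleR])
    fix i
    show "td n S (\<lambda>x. ?f' x v \<bullet> i)"
      using Suc.prems(1) by (intro td_linear_compose[OF bounded_linear_inner_left] assms(1)) simp
    show "td n S (\<lambda>x. ?g' (f x) i)"
      using Suc.prems(2) by (intro Suc.IH td_SucD[OF Suc.prems(1)]) simp
  qed
  moreover have "?g' (f x) (?f' x v) = (\<Sum>i\<in>Basis. (?f' x v \<bullet> i) *\<^sub>R ?g' (f x) i)" if "x \<in> S" for x v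
  proof -
    interpret linear "?g' (f x)"
      using td_has_derivative[OF Suc.prems(2), of "f x"] assms(3) that
      by (auto dest!: has_derivative_linear)
    show ?thesis
      by (subst (1) euclidean_representation[symmetric]) (simp only: sum scale)
  qed
  ultimately have "td n S (\<lambda>x. ?g' (f x) (?f' x v))" for v
    using td_cong[OF assms(1)] by (metis (no_types, lifting))
  then show ?case using td_Suc_iff[OF assms(1) der] by blast
qed

lemma td_inverse: "td n (- {0::real}) inverse"
proof (induction n)
  case 0
  then show ?case by (auto intro!: continuous_intros)
next
  case (Suc n)
  have "(inverse has_derivative (\<lambda>v. - (inverse x * v * inverse x))) (at x)" if "x \<in> - {0::real}" for x
    using that by (auto intro!: derivative_eq_intros)
  moreover have "td n (- {0::real}) (\<lambda>x. - (inverse x * v * inverse x))" for v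
    by (intro td_linear_compose[of uminus] bounded_linear_minus bounded_linear_ident
        bounded_bilinear.td_bilinear[OF bounded_bilinear_mult] Suc td_const) auto
  ultimately show ?case by (subst td_Suc_iff) auto
qed

lemma smooth_on_td: "smooth_on S f \<Longrightarrow> td n S f"
  by (simp add: smooth_on_def)

lemma smooth_on_cong: "open S \<Longrightarrow> (\<And>x. x \<in> S \<Longrightarrow> f x = g x) \<Longrightarrow> smooth_on S f = smooth_on S g"
  unfolding smooth_on_def using td_cong by blast

lemma smooth_on_subset: "smooth_on S f \<Longrightarrow> T \<subseteq> S \<Longrightarrow> smooth_on T f"
  unfolding smooth_on_def using td_subset by blast

lemma smooth_on_local:
  "(\<And>x. x \<in> S \<Longrightarrow> \<exists>U. open U \<and> x \<in> U \<and> smooth_on U f) \<Longrightarrow> smooth_on S f"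
  unfolding smooth_on_def by (meson td_local)

lemma smooth_on_continuous: "smooth_on S f \<Longrightarrow> continuous_on S f"
  unfolding smooth_on_def using td_continuous by blast

lemma smooth_on_has_derivative:
  "smooth_on S f \<Longrightarrow> x \<in> S \<Longrightarrow> (f has_derivative frechet_derivative f (at x)) (at x)"
  unfolding smooth_on_def using td_has_derivative by blast

lemma smooth_on_derivative: "smooth_on S f \<Longrightarrow> smooth_on S (\<lambda>x. frechet_derivative f (at x) v)"
  unfolding smooth_on_def by (metis times_differentiable_on.simps(2))

lemma smooth_on_differentiable: "smooth_on S f \<Longrightarrow> x \<in> S \<Longrightarrow> f differentiable (at x)"
  unfolding smooth_on_def by (metis times_differentiable_on.simps(2))

lemma smooth_on_const: "open S \<Longrightarrow> smooth_on S (\<lambda>x. c)"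
  by (simp add: smooth_on_def td_const)

lemma smooth_on_linear_compose:
  "bounded_linear L \<Longrightarrow> open S \<Longrightarrow> smooth_on S f \<Longrightarrow> smooth_on S (\<lambda>x. L (f x))"
  by (simp add: smooth_on_def td_linear_compose)

lemma smooth_on_bounded_linear: "bounded_linear L \<Longrightarrow> open S \<Longrightarrow> smooth_on S L"
  by (simp add: smooth_on_def td_bounded_linear)

lemma smooth_on_ident: "open S \<Longrightarrow> smooth_on S (\<lambda>x. x)"
  by (rule smooth_on_bounded_linear[OF bounded_linear_ident])

lemma smooth_on_add: "open S \<Longrightarrow> smooth_on S f \<Longrightarrow> smooth_on S g \<Longrightarrow> smooth_on S (\<lambda>x. f x + g x)"
  by (simp add: smooth_on_def td_add)

lemma smooth_on_minus: "open S \<Longrightarrow> smooth_on S f \<Longrightarrow> smooth_on S (\<lambda>x. - f x)"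
  by (rule smooth_on_linear_compose[OF bounded_linear_minus[OF bounded_linear_ident]])

lemma smooth_on_diff: "open S \<Longrightarrow> smooth_on S f \<Longrightarrow> smooth_on S g \<Longrightarrow> smooth_on S (\<lambda>x. f x - g x)"
  using smooth_on_add[of S f "\<lambda>x. - g x"] smooth_on_minus[of S g] by simp

lemma smooth_on_sum: "open S \<Longrightarrow> (\<And>i. i \<in> I \<Longrightarrow> smooth_on S (f i)) \<Longrightarrow> smooth_on S (\<lambda>x. \<Sum>i\<in>I. f i x)"
  by (simp add: smooth_on_def td_sum)

lemma smooth_on_bilinear:
  "bounded_bilinear B \<Longrightarrow> open S \<Longrightarrow> smooth_on S f \<Longrightarrow> smooth_on S g \<Longrightarrow> smooth_on S (\<lambda>x. B (f x) (g x))"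
  by (simp add: smooth_on_def bounded_bilinear.td_bilinear)

lemmas smooth_on_scaleR = smooth_on_bilinear[OF bounded_bilinear_scaleR]
  and smooth_on_mult = smooth_on_bilinear[OF bounded_bilinear_mult]
  and smooth_on_inner = smooth_on_bilinear[OF bounded_bilinear_inner]

lemma smooth_on_compose:
  fixes f :: "'e::real_normed_vector \<Rightarrow> 'b::euclidean_space"
  shows "smooth_on S f \<Longrightarrow> smooth_on T g \<Longrightarrow> open S \<Longrightarrow> open T \<Longrightarrow> f ` S \<subseteq> T \<Longrightarrow> smooth_on S (\<lambda>x. g (f x))"
  by (simp add: smooth_on_def td_compose)

lemma smooth_on_inverse:
  "open S \<Longrightarrow> smooth_on S f \<Longrightarrow> (\<And>x. x \<in> S \<Longrightarrow> f x \<noteq> 0) \<Longrightarrow> smooth_on S (\<lambda>x. inverse (f x :: real))"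
  by (rule smooth_on_compose[of S f "- {0}" inverse]) (auto simp: smooth_on_def td_inverse)

lemma smooth_on_divide:
  "open S \<Longrightarrow> smooth_on S f \<Longrightarrow> smooth_on S g \<Longrightarrow> (\<And>x. x \<in> S \<Longrightarrow> g x \<noteq> 0) \<Longrightarrow> smooth_on S (\<lambda>x. f x / g x :: real)"
  by (simp add: divide_inverse smooth_on_mult smooth_on_inverse)

lemma smooth_on_componentwise:
  fixes f :: "'e::real_normed_vector \<Rightarrow> 'b::euclidean_space"
  assumes "open S" "\<And>i. i \<in> Basis \<Longrightarrow> smooth_on S (\<lambda>x. f x \<bullet> i)"
  shows "smooth_on S f"
proof -
  have "smooth_on S (\<lambda>x. \<Sum>i\<in>Basis. (f x \<bullet> i) *\<^sub>R i)"
    by (intro smooth_on_sum smooth_on_scaleR smooth_on_const assms)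
  then show ?thesis by (simp add: euclidean_representation)
qed

text \<open>Changes of chart enter in this form: a linear map whose smoothness in the point is known
  only at fixed vectors is applied to a varying vector, which is expanded in
  \<open>Basis\<close>.\<close>

lemma smooth_on_apply_linear:
  fixes f :: "'e::real_normed_vector \<Rightarrow> 'b::euclidean_space"
  assumes "open S" "smooth_on S f" "\<And>x. x \<in> S \<Longrightarrow> linear (L x)" "\<And>v. smooth_on S (\<lambda>x. L x v)"
  shows "smooth_on S (\<lambda>x. L x (f x))"
proof -
  have "L x (f x) = (\<Sum>i\<in>Basis. (f x \<bullet> i) *\<^sub>R L x i)" if "x \<in> S" for x
  proof -
    interpret linear "L x" using assms(3)[OF that] .
    show ?thesis by (subst (1) euclidean_representation[of "f x", symmetric]) (simp only: sum scale)
  qed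
  moreover have "smooth_on S (\<lambda>x. \<Sum>i\<in>Basis. (f x \<bullet> i) *\<^sub>R L x i)"
    by (intro smooth_on_sum smooth_on_scaleR smooth_on_inner smooth_on_const assms)
  ultimately show ?thesis using smooth_on_cong[OF assms(1)] by (metis (no_types, lifting))
qed

section \<open>Smooth dependence of fixed points on parameters\<close>

text \<open>Implicit differentiation of \<open>\<zeta> w = T (w, \<zeta> w)\<close>. The contraction
  in the second argument serves twice: it makes the linearised equation uniquely solvable, which
  produces the derivative, and it absorbs the unknown increment of \<open>\<zeta>\<close> in the
  estimates. For flows the second argument is a whole curve.\<close>

lemma fixed_point_has_derivative:
  fixes T :: "'e::real_normed_vector \<times> 'x::banach \<Rightarrow> 'x"
  assumes W: "open W" "w \<in> W"
    and fp: "\<And>w. w \<in> W \<Longrightarrow> \<zeta> w = T (w, \<zeta> w)"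
    and contr: "\<And>w u u'. w \<in> W \<Longrightarrow> norm (T (w, u) - T (w, u')) \<le> norm (u - u') / 2"
    and der: "(T has_derivative T') (at (w, \<zeta> w))"
    and contr': "\<And>u. norm (T' (0, u)) \<le> norm u / 2"
  shows "\<exists>D. (\<zeta> has_derivative D) (at w) \<and> (\<forall>v. D v = T' (v, 0) + T' (0, D v))"
proof -
  interpret T': bounded_linear T' using der by (rule has_derivative_bounded_linear)
  have split: "T' (h, k) = T' (h, 0) + T' (0, k)" for h k
    using T'.add[of "(h, 0)" "(0, k)"] by simp
  \<comment> \<open>The derivative in direction \<open>v\<close> has to solve this contraction
    equation; uniqueness of the solution then gives linearity in \<open>v\<close>.\<close>
  have "\<exists>!d. T' (v, 0) + T' (0, d) = d" for v
  proof (rule banach_fix_type[where c = "1/2"])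
    show "\<forall>x y. dist (T' (v, 0) + T' (0, x)) (T' (v, 0) + T' (0, y)) \<le> 1 / 2 * dist x y"
      using contr' by (auto simp: dist_norm simp flip: T'.diff)
  qed auto
  then obtain D where D: "\<And>v. T' (v, 0) + T' (0, D v) = D v"
    and uniq: "\<And>v d. T' (v, 0) + T' (0, d) = d \<Longrightarrow> d = D v" by metis
  obtain B where B: "\<And>x. norm (T' x) \<le> norm x * B" "B \<ge> 0" using T'.nonneg_bounded by blast
  have blD: "bounded_linear D"
  proof (rule bounded_linear_intro)
    fix x y :: 'e and r :: real
    have "T' (x + y, 0) + T' (0, D x + D y) = D x + D y"
      using T'.add[of "(x, 0)" "(y, 0)"] T'.add[of "(0, D x)" "(0, D y)"] D[of x] D[of y]
      by (simp add: algebra_simps)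
    then show "D (x + y) = D x + D y" using uniq by metis
    have "T' (r *\<^sub>R x, 0) + T' (0, r *\<^sub>R D x) = r *\<^sub>R D x"
      using T'.scaleR[of r "(x, 0)"] T'.scaleR[of r "(0, D x)"] D[of x]
      by (simp add: scaleR_add_right[symmetric])
    then show "D (r *\<^sub>R x) = r *\<^sub>R D x" using uniq by metis
    have "norm (D x) \<le> norm x * B + norm (D x) / 2"
      using norm_triangle_ineq[of "T' (x, 0)" "T' (0, D x)"] D[of x] B(1)[of "(x, 0)"] contr'[of "D x"]
      by (simp add: norm_Pair)
    then show "norm (D x) \<le> norm x * (2 * B)" by simp
  qed
  have alt: "\<And>e. e > 0 \<Longrightarrow> \<exists>d>0. \<forall>y. norm (y - (w, \<zeta> w)) < d \<longrightarrow>
      norm (T y - T (w, \<zeta> w) - T' (y - (w, \<zeta> w))) \<le> e * norm (y - (w, \<zeta> w))"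
    using der unfolding has_derivative_at_alt by blast
  obtain d0 where d0: "d0 > 0" "ball w d0 \<subseteq> W" using W open_contains_ball by blast
  obtain d1 where d1: "d1 > 0" "\<And>y. norm (y - (w, \<zeta> w)) < d1 \<Longrightarrow>
      norm (T y - T (w, \<zeta> w) - T' (y - (w, \<zeta> w))) \<le> 1 * norm (y - (w, \<zeta> w))"
    using alt[of 1] by auto
  \<comment> \<open>\<open>1 + B\<close> bounds the variation of \<open>T\<close> in its first
    argument near \<open>w\<close>: the remainder is at most the increment, the linear part at most
    \<open>B\<close> times it. The factor 2 comes from absorbing half of the increment of
    \<open>\<zeta>\<close>.\<close>
  define C where "C = 2 * (1 + B)"
  have lip: "norm (\<zeta> y - \<zeta> w) \<le> C * norm (y - w)" if "norm (y - w) < min d0 d1" for y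
  proof -
    have y: "y \<in> W" using that d0 by (auto simp: dist_norm norm_minus_commute)
    have *: "norm ((y, \<zeta> w) - (w, \<zeta> w)) = norm (y - w)" by (simp add: norm_Pair)
    have "norm (T (y, \<zeta> w) - T (w, \<zeta> w)) \<le>
        norm (T (y, \<zeta> w) - T (w, \<zeta> w) - T' ((y, \<zeta> w) - (w, \<zeta> w))) + norm (T' ((y, \<zeta> w) - (w, \<zeta> w)))"
      by (metis norm_triangle_sub add.commute)
    also have "\<dots> \<le> norm (y - w) + norm (y - w) * B"
      using d1(2)[of "(y, \<zeta> w)"] that B(1)[of "(y, \<zeta> w) - (w, \<zeta> w)"] unfolding * by auto
    finally have 1: "norm (T (y, \<zeta> w) - T (w, \<zeta> w)) \<le> norm (y - w) * (1 + B)" by (simp add: algebra_simps)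
    have "\<zeta> y - \<zeta> w = (T (y, \<zeta> y) - T (y, \<zeta> w)) + (T (y, \<zeta> w) - T (w, \<zeta> w))"
      using fp[OF y] fp[OF W(2)] by simp
    then have "norm (\<zeta> y - \<zeta> w) \<le> norm (\<zeta> y - \<zeta> w) / 2 + norm (y - w) * (1 + B)"
      using norm_triangle_ineq[of "T (y, \<zeta> y) - T (y, \<zeta> w)" "T (y, \<zeta> w) - T (w, \<zeta> w)"]
        contr[OF y, of "\<zeta> y" "\<zeta> w"] 1 by simp
    then show ?thesis by (simp add: C_def algebra_simps)
  qed
  have "(\<zeta> has_derivative D) (at w)"
    unfolding has_derivative_at_alt
  proof (intro conjI allI impI blD)
    fix e :: real assume "e > 0"
    have C: "1 + C > 0" using B(2) by (simp add: C_def)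
    \<comment> \<open>The joint increment is at most \<open>1 + C\<close> times that of
      \<open>w\<close>, and the final absorption costs a factor 2.\<close>
    define e' where "e' = e / (2 * (1 + C))"
    have "e' > 0" using \<open>e > 0\<close> C by (simp add: e'_def)
    then obtain d2 where d2: "d2 > 0" "\<And>y. norm (y - (w, \<zeta> w)) < d2 \<Longrightarrow>
        norm (T y - T (w, \<zeta> w) - T' (y - (w, \<zeta> w))) \<le> e' * norm (y - (w, \<zeta> w))"
      using alt by blast
    show "\<exists>d>0. \<forall>y. norm (y - w) < d \<longrightarrow> norm (\<zeta> y - \<zeta> w - D (y - w)) \<le> e * norm (y - w)"
    proof (intro exI conjI allI impI)
      show "min (min d0 d1) (d2 / (1 + C)) > 0" using d0 d1 d2 C by simp
      fix y assume y: "norm (y - w) < min (min d0 d1) (d2 / (1 + C))"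
      then have yW: "y \<in> W" using d0 by (auto simp: dist_norm norm_minus_commute)
      define k where "k = \<zeta> y - \<zeta> w"
      define \<rho> where "\<rho> = T (y, \<zeta> y) - T (w, \<zeta> w) - T' (y - w, k)"
      have nk: "norm (y - w, k) \<le> (1 + C) * norm (y - w)"
        using norm_Pair_le[of "y - w" k] lip[of y] y by (simp add: k_def algebra_simps)
      also have "\<dots> < d2" using y C by (simp add: field_simps)
      finally have "norm \<rho> \<le> e' * norm (y - w, k)"
        using d2(2)[of "(y, \<zeta> y)"] by (simp add: \<rho>_def k_def)
      also have "\<dots> \<le> e' * ((1 + C) * norm (y - w))" using nk \<open>e' > 0\<close> by simp
      also have "\<dots> = e / 2 * norm (y - w)" using C by (simp add: e'_def field_simps)
      finally have \<rho>: "norm \<rho> \<le> e / 2 * norm (y - w)" .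
      \<comment> \<open>The error solves the linearised equation with the Taylor remainder
        \<open>\<rho>\<close> as source, hence is at most twice as large as
        \<open>\<rho>\<close>.\<close>
      have "k - D (y - w) = \<rho> + T' (0, k - D (y - w))"
      proof -
        have k: "k = \<rho> + T' (y - w, 0) + T' (0, k)"
          using split[of "y - w" k] by (simp add: \<rho>_def k_def flip: fp[OF yW] fp[OF W(2)])
        have "k - D (y - w) = (\<rho> + T' (y - w, 0) + T' (0, k)) - (T' (y - w, 0) + T' (0, D (y - w)))"
          by (metis k D)
        also have "\<dots> = \<rho> + (T' (0, k) - T' (0, D (y - w)))" by simp
        also have "\<dots> = \<rho> + T' (0, k - D (y - w))" by (simp flip: T'.diff)
        finally show ?thesis .
      qed
      then have "norm (k - D (y - w)) \<le> norm \<rho> + norm (k - D (y - w)) / 2"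
        using norm_triangle_ineq[of \<rho> "T' (0, k - D (y - w))"] contr'[of "k - D (y - w)"] by simp
      then show "norm (\<zeta> y - \<zeta> w - D (y - w)) \<le> e * norm (y - w)"
        using \<rho> unfolding k_def by simp
    qed
  qed
  then show ?thesis using D by metis
qed

text \<open>Differentiating \<open>V = b + A V\<close> gives an equation of the same form for each
  directional derivative of \<open>V\<close>, with source \<open>b' + A' V\<close>. That source has
  one order less, so an induction over all \<open>b\<close> and \<open>V\<close> works.\<close>

lemma td_linear_fixed_point:
  fixes A :: "'e::real_normed_vector \<Rightarrow> 'x \<Rightarrow>\<^sub>L 'x::banach"
  assumes "open W" "td n W A" "td n W b"
    and le: "\<And>w. w \<in> W \<Longrightarrow> norm (A w) \<le> 1/2"
    and fp: "\<And>w. w \<in> W \<Longrightarrow> V w = b w + A w (V w)"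
  shows "td n W V"
  using assms(2,3) fp
proof (induction n arbitrary: b V)
  case 0
  have "continuous (at w) V" if w: "w \<in> W" for w
  proof -
    \<comment> \<open>The term \<open>A y (V y - V w)\<close> is at most half of the left side and
      is absorbed there; what remains tends to 0 by continuity of \<open>A\<close> and
      \<open>b\<close>.\<close>
    have bound: "norm (V y - V w) \<le> 2 * (norm (b y - b w) + norm (A y - A w) * norm (V w))" if "y \<in> W" for y
    proof -
      have "V y - V w = (b y - b w) + (A y - A w) (V w) + A y (V y - V w)"
      proof -
        have "V y - V w = (b y + A y (V y)) - (b w + A w (V w))"
          by (simp only: 0(3)[OF that, symmetric] 0(3)[OF w, symmetric])
        also have "\<dots> = (b y - b w) + (A y - A w) (V w) + A y (V y - V w)"
          by (simp add: blinfun.bilinear_simps)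
        finally show ?thesis .
      qed
      then have "norm (V y - V w) \<le> norm (b y - b w) + norm ((A y - A w) (V w)) + norm (A y (V y - V w))"
        by (metis norm_triangle_mono norm_triangle_ineq order_refl)
      also have "\<dots> \<le> norm (b y - b w) + norm (A y - A w) * norm (V w) + norm (V y - V w) / 2"
        using norm_blinfun[of "A y - A w" "V w"] norm_blinfun[of "A y" "V y - V w"]
          mult_right_mono[OF le[OF that], of "norm (V y - V w)"] by simp
      finally show ?thesis by simp
    qed
    have lim: "((\<lambda>y. 2 * (norm (b y - b w) + norm (A y - A w) * norm (V w))) \<longlongrightarrow>
        2 * (norm (b w - b w) + norm (A w - A w) * norm (V w))) (at w)"
    proof -
      have "(A \<longlongrightarrow> A w) (at w)" "(b \<longlongrightarrow> b w) (at w)"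
        using 0(1,2) w \<open>open W\<close> by (simp_all add: continuous_on_eq_continuous_at continuous_at)
      then show ?thesis by (intro tendsto_intros)
    qed
    have ev: "\<forall>\<^sub>F y in at w. norm (V y - V w) \<le> 2 * (norm (b y - b w) + norm (A y - A w) * norm (V w))"
      using eventually_at_in_open'[OF \<open>open W\<close> w] by eventually_elim (rule bound)
    have "((\<lambda>y. norm (V y - V w)) \<longlongrightarrow> 0) (at w)"
      by (rule tendsto_sandwich[OF _ ev tendsto_const]) (use lim in simp_all)
    then have "((\<lambda>y. V y - V w) \<longlongrightarrow> 0) (at w)" by (rule tendsto_norm_zero_cancel)
    then show ?thesis unfolding continuous_at by (rule LIM_zero_cancel)
  qed
  then show ?case by (simp add: continuous_at_imp_continuous_on)
next
  case (Suc n)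
  let ?b' = "\<lambda>w. frechet_derivative b (at w)" and ?A' = "\<lambda>w. frechet_derivative A (at w)"
  have "td n W V"
    using Suc.IH[OF td_SucD td_SucD] Suc.prems by blast
  have "\<exists>D. (V has_derivative D) (at w) \<and> (\<forall>v. D v = (?b' w v + ?A' w v (V w)) + A w (D v))"
    if w: "w \<in> W" for w
  proof -
    have der: "((\<lambda>p. b (fst p) + A (fst p) (snd p)) has_derivative
        (\<lambda>h. ?b' w (fst h) + (A w (snd h) + ?A' w (fst h) (V w)))) (at (w, V w))"
    proof (intro has_derivative_add)
      show "((\<lambda>p. b (fst p)) has_derivative (\<lambda>h. ?b' w (fst h))) (at (w, V w))"
        using has_derivative_compose[OF has_derivative_fst[OF has_derivative_ident]
            , of b "?b' w" "(w, V w)"] td_has_derivative[OF Suc.prems(2) w] by simp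
      have "((\<lambda>p. A (fst p)) has_derivative (\<lambda>h. ?A' w (fst h))) (at (w, V w))"
        using has_derivative_compose[OF has_derivative_fst[OF has_derivative_ident]
            , of A "?A' w" "(w, V w)"] td_has_derivative[OF Suc.prems(1) w] by simp
      from blinfun.FDERIV[OF this has_derivative_snd[OF has_derivative_ident]]
      show "((\<lambda>p. A (fst p) (snd p)) has_derivative
          (\<lambda>h. (A w (snd h) + ?A' w (fst h) (V w)))) (at (w, V w))" by simp
    qed
    have bd: "norm (A y u) \<le> norm u / 2" if "y \<in> W" for y u
      using norm_blinfun[of "A y" u] mult_right_mono[OF le[OF that], of "norm u"] by simp
    have b0: "?b' w 0 = 0" and A0: "?A' w 0 = 0"
      using td_has_derivative[OF Suc.prems(2) w] td_has_derivative[OF Suc.prems(1) w]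
      by (auto dest!: has_derivative_linear intro: linear_0)
    have "\<exists>D. (V has_derivative D) (at w) \<and> (\<forall>v. D v = (?b' w v + (A w 0 + ?A' w v (V w))) + (?b' w 0 + (A w (D v) + ?A' w 0 (V w))))"
      using fixed_point_has_derivative[where \<zeta> = V and T = "\<lambda>p. b (fst p) + A (fst p) (snd p)"
          and T' = "\<lambda>h. ?b' w (fst h) + (A w (snd h) + ?A' w (fst h) (V w))", OF \<open>open W\<close> w _ _ der]
        Suc.prems(3) bd b0 A0 w
      by (simp add: blinfun.bilinear_simps flip: blinfun.diff_right)
    then show ?thesis using b0 A0 by (simp add: blinfun.bilinear_simps)
  qed
  then obtain D where D: "\<And>w. w \<in> W \<Longrightarrow> (V has_derivative D w) (at w)"
    "\<And>w v. w \<in> W \<Longrightarrow> D w v = (?b' w v + ?A' w v (V w)) + A w (D w v)" by metis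
  have "td n W (\<lambda>w. D w v)" for v
  proof (rule Suc.IH[where b = "\<lambda>w. ?b' w v + ?A' w v (V w)", OF td_SucD[OF Suc.prems(1)]])
    show "td n W (\<lambda>w. ?b' w v + blinfun_apply (?A' w v) (V w))"
      using Suc.prems \<open>td n W V\<close>
      by (intro td_add assms(1) bounded_bilinear.td_bilinear[OF bounded_bilinear_blinfun_apply]) auto
  qed (rule D(2))
  then show ?case using td_Suc_iff[OF assms(1) D(1)] by simp
qed


section \<open>Curves solving ordinary differential equations\<close>

type_synonym 'e curve = "real \<Rightarrow>\<^sub>C 'e"

lemma apply_Bcontfun:
  "continuous_on UNIV f \<Longrightarrow> bounded (range f) \<Longrightarrow> apply_bcontfun (Bcontfun f) = f"
  by (simp add: Bcontfun_inverse bcontfun_def)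

text \<open>The superposition, or Nemytskii, operator. The values of a bounded curve have compact
  closure, so a continuous \<open>R\<close> yields a bounded curve again.\<close>

definition superpose :: "('e::euclidean_space \<Rightarrow> 'e) \<Rightarrow> 'e curve \<Rightarrow> 'e curve" where
  "superpose R \<gamma> = Bcontfun (\<lambda>t. R (\<gamma> t))"

lemma superpose_apply:
  assumes "continuous_on UNIV R"
  shows "superpose R \<gamma> t = R (\<gamma> t)"
proof -
  have "compact (R ` closure (range \<gamma>))"
    by (intro compact_continuous_image continuous_on_subset[OF assms]) auto
  then have "bounded (range (\<lambda>t. R (\<gamma> t)))"
    by (rule bounded_subset[OF compact_imp_bounded]) (use closure_subset[of "range \<gamma>"] in auto)
  moreover have "continuous_on UNIV (\<lambda>t. R (\<gamma> t))"
    by (rule continuous_on_compose2[OF assms]) auto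
  ultimately show ?thesis by (simp add: superpose_def apply_Bcontfun)
qed

text \<open>The derivative of \<open>superpose R\<close> multiplies a curve of linear maps with a
  curve of vectors; splitting it into components keeps all factors in one Banach space of
  curves.\<close>

definition component_mult :: "'e::euclidean_space \<Rightarrow> 'e curve \<Rightarrow> 'e curve \<Rightarrow> 'e curve" where
  "component_mult i h g = Bcontfun (\<lambda>t. (h t \<bullet> i) *\<^sub>R g t)"

lemma component_mult_apply: "component_mult i h g t = (h t \<bullet> i) *\<^sub>R g t"
proof -
  have "bounded (range (\<lambda>t. (h t \<bullet> i) *\<^sub>R g t))"
    by (rule boundedI[of _ "(norm h * norm i) * norm g"])
      (auto intro!: mult_mono order_trans[OF Cauchy_Schwarz_ineq2] norm_bounded)
  then show ?thesis
    by (simp add: component_mult_def apply_Bcontfun continuous_intros)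
qed

lemma bounded_bilinear_component_mult: "bounded_bilinear (component_mult i)"
proof (rule bounded_bilinear.intro)
  show "\<exists>K. \<forall>a b. norm (component_mult i a b) \<le> norm a * norm b * K"
  proof (intro exI allI norm_bound)
    fix a b :: "'a curve" and t
    have "norm (component_mult i a b t) = \<bar>a t \<bullet> i\<bar> * norm (b t)" by (simp add: component_mult_apply)
    also have "\<dots> \<le> (norm a * norm i) * norm b"
      by (intro mult_mono order_trans[OF Cauchy_Schwarz_ineq2] mult_right_mono norm_bounded) auto
    finally show "norm (component_mult i a b t) \<le> norm a * norm b * norm i" by (simp add: ac_simps)
  qed
qed (auto intro!: bcontfun_eqI simp: component_mult_apply algebra_simps)

lemma norm_component_mult: "i \<in> Basis \<Longrightarrow> norm (component_mult i a b) \<le> norm a * norm b"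
  by (intro norm_bound)
    (auto simp: component_mult_apply intro!: mult_mono order_trans[OF Basis_le_norm] norm_bounded)

text \<open>Curves are defined for all times, so that they form the Banach space of bounded
  continuous functions; time is frozen outside the unit interval.\<close>

definition unit_clamp :: "real \<Rightarrow> real" where "unit_clamp t = max 0 (min 1 t)"

definition integral_curve :: "'e::euclidean_space curve \<Rightarrow> 'e curve" where
  "integral_curve \<gamma> = Bcontfun (\<lambda>t. integral {0..unit_clamp t} \<gamma>)"

lemma integral_curve_apply: "integral_curve \<gamma> t = integral {0..unit_clamp t} \<gamma>"
proof -
  have cont: "continuous_on {0..1} (\<lambda>t. integral {0..t} \<gamma>)"
    by (intro indefinite_integral_continuous_1 integrable_continuous_real) simp
  have "continuous_on UNIV (\<lambda>t. integral {0..unit_clamp t} \<gamma>)"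
    by (rule continuous_on_compose2[OF cont])
      (auto simp: unit_clamp_def intro!: continuous_intros)
  moreover have "bounded (range (\<lambda>t. integral {0..unit_clamp t} \<gamma>))"
    using compact_imp_bounded[OF compact_continuous_image[OF cont compact_Icc]]
    by (rule bounded_subset) (auto simp: unit_clamp_def)
  ultimately show ?thesis by (simp add: integral_curve_def apply_Bcontfun)
qed

lemma norm_integral_curve: "norm (integral_curve \<gamma>) \<le> norm \<gamma>"
proof (rule norm_bound)
  fix t
  have "norm (integral {0..unit_clamp t} \<gamma>) \<le> norm \<gamma> * (unit_clamp t - 0)"
    by (rule integral_bound) (auto simp: unit_clamp_def norm_bounded)
  also have "\<dots> \<le> norm \<gamma> * 1" by (intro mult_left_mono) (auto simp: unit_clamp_def)
  finally show "norm (integral_curve \<gamma> t) \<le> norm \<gamma>" by (simp add: integral_curve_apply)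
qed

lemma bounded_linear_integral_curve: "bounded_linear (integral_curve :: 'e::euclidean_space curve \<Rightarrow> _)"
proof (rule bounded_linear_intro[where K = 1])
  fix x y :: "'e curve" and r :: real
  have int: "z integrable_on {0..unit_clamp t}" for t and z :: "'e curve"
    by (intro integrable_continuous_real) simp
  show "integral_curve (x + y) = integral_curve x + integral_curve y"
    by (rule bcontfun_eqI) (use int in \<open>simp add: integral_curve_apply integral_add\<close>)
  show "integral_curve (r *\<^sub>R x) = r *\<^sub>R integral_curve x"
    by (rule bcontfun_eqI) (simp add: integral_curve_apply)
qed (simp add: norm_integral_curve)

lemma integral_curve_deriv:
  assumes "t \<in> {0..1}"
  shows "(integral_curve \<gamma> has_vector_derivative \<gamma> t) (at t within {0..1})"
proof -
  have "((\<lambda>t. integral {0..t} \<gamma>) has_vector_derivative \<gamma> t) (at t within {0..1})"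
    by (rule integral_has_vector_derivative) (use assms in auto)
  then show ?thesis
    by (rule has_vector_derivative_transform[rotated 2])
      (use assms in \<open>auto simp: integral_curve_apply unit_clamp_def\<close>)
qed

text \<open>The pointwise linearisation of \<open>R\<close> becomes uniform in time: the values of
  nearby curves stay in one compact ball, where the partial derivatives are uniformly
  continuous.\<close>

lemma superpose_has_derivative:
  fixes R :: "'e::euclidean_space \<Rightarrow> 'e"
  assumes R: "smooth_on UNIV R"
  shows "(superpose R has_derivative
    (\<lambda>h. \<Sum>i\<in>Basis. component_mult i h (superpose (\<lambda>z. frechet_derivative R (at z) i) \<gamma>))) (at \<gamma>)"
    (is "(_ has_derivative ?D) _")
proof -
  let ?R' = "\<lambda>z. frechet_derivative R (at z)"
  have der: "(R has_derivative ?R' z) (at z)" for z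
    using smooth_on_has_derivative[OF R] by simp
  have cont: "continuous_on UNIV (\<lambda>z. ?R' z i)" for i
    using smooth_on_continuous[OF smooth_on_derivative[OF R]] .
  have rep: "?R' z v = (\<Sum>i\<in>Basis. (v \<bullet> i) *\<^sub>R ?R' z i)" for z v
  proof -
    interpret linear "?R' z" using der by (rule has_derivative_linear)
    show ?thesis by (subst (1) euclidean_representation[of v, symmetric]) (simp only: sum scale)
  qed
  have D: "?D h t = ?R' (\<gamma> t) (h t)" for h t
  proof -
    have sum_apply: "(\<Sum>i\<in>I. f i) t = (\<Sum>i\<in>I. f i t)" if "finite I" for I :: "'e set" and f :: "'e \<Rightarrow> 'e curve"
      using that by induction auto
    show ?thesis using rep[of "\<gamma> t" "h t"]
      by (simp add: sum_apply component_mult_apply superpose_apply[OF cont])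
  qed
  have blD: "bounded_linear ?D"
    by (intro bounded_linear_sum bounded_bilinear.bounded_linear_left[OF bounded_bilinear_component_mult])
  show ?thesis
    unfolding has_derivative_at_alt
  proof (intro conjI blD allI impI)
    fix e :: real assume "e > 0"
    define n where "n = real DIM('e)"
    have "n > 0" by (simp add: n_def)
    \<comment> \<open>The radius covers the values of \<open>\<gamma>\<close> and of the segments to
      curves at distance less than 1, which is why \<open>d0\<close> is taken at most 1.\<close>
    define M where "M = norm \<gamma> + 1"
    have "\<exists>d>0. \<forall>x\<in>cball 0 M. \<forall>y\<in>cball 0 M. dist y x < d \<longrightarrow> dist (?R' y i) (?R' x i) < e / n" for i
      using compact_uniformly_continuous[OF continuous_on_subset[OF cont[of i], of "cball 0 M"]] \<open>e > 0\<close> \<open>n > 0\<close>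
      unfolding uniformly_continuous_on_def by (metis compact_cball divide_pos_pos subset_UNIV)
    then obtain d where d: "\<And>i. d i > 0"
      "\<And>i x y. x \<in> cball 0 M \<Longrightarrow> y \<in> cball 0 M \<Longrightarrow> dist y x < d i \<Longrightarrow> dist (?R' y i) (?R' x i) < e / n"
      by metis
    define d0 where "d0 = min 1 (Min (d ` Basis))"
    have "d0 > 0" using d(1) by (simp add: d0_def)
    have d0: "d0 \<le> 1" "\<And>i. i \<in> Basis \<Longrightarrow> d0 \<le> d i" by (auto simp: d0_def min_le_iff_disj)
    show "\<exists>d>0. \<forall>\<gamma>'. norm (\<gamma>' - \<gamma>) < d \<longrightarrow>
        norm (superpose R \<gamma>' - superpose R \<gamma> - ?D (\<gamma>' - \<gamma>)) \<le> e * norm (\<gamma>' - \<gamma>)"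
    proof (intro exI conjI allI impI norm_bound)
      fix \<gamma>' :: "'e curve" and t
      assume lt: "norm (\<gamma>' - \<gamma>) < d0"
      have nt: "norm (\<gamma>' t - \<gamma> t) \<le> norm (\<gamma>' - \<gamma>)" using norm_bounded[of "\<gamma>' - \<gamma>" t] by simp
      have *: "norm (R (\<gamma>' t) - R (\<gamma> t) - ?R' (\<gamma> t) (\<gamma>' t - \<gamma> t)) \<le> norm (\<gamma>' t - \<gamma> t) * e"
      proof (rule differentiable_bound_linearization[where S = "ball (\<gamma> t) d0" and f' = ?R'])
        fix x assume x: "x \<in> ball (\<gamma> t) d0"
        have "norm (\<gamma> t) \<le> norm \<gamma>" by (rule norm_bounded)
        moreover have "norm x \<le> norm (\<gamma> t) + dist (\<gamma> t) x"
          by (metis dist_norm norm_triangle_sub dist_commute add.commute)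
        ultimately have mem: "\<gamma> t \<in> cball 0 M" "x \<in> cball 0 M" using x d0 by (auto simp: M_def)
        show "onorm (?R' x - ?R' (\<gamma> t)) \<le> e"
        proof (rule onorm_le)
          fix v
          have "(?R' x - ?R' (\<gamma> t)) v = (\<Sum>i\<in>Basis. (v \<bullet> i) *\<^sub>R (?R' x i - ?R' (\<gamma> t) i))"
            by (simp add: rep[of x v] rep[of "\<gamma> t" v] sum_subtractf scaleR_diff_right)
          also have "norm \<dots> \<le> (\<Sum>i\<in>(Basis::'e set). norm v * (e / n))"
          proof (rule sum_norm_le)
            fix i :: 'e assume i: "i \<in> Basis"
            have "dist x (\<gamma> t) < d i" using x d0(2)[OF i] by (simp add: dist_commute)
            then have "norm (?R' x i - ?R' (\<gamma> t) i) \<le> e / n"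
              using d(2)[OF mem, of i] by (simp add: dist_norm)
            then show "norm ((v \<bullet> i) *\<^sub>R (?R' x i - ?R' (\<gamma> t) i)) \<le> norm v * (e / n)"
              using Basis_le_norm[OF i, of v] by (simp only: norm_scaleR) (intro mult_mono; simp)
          qed
          also have "\<dots> = e * norm v" using \<open>n > 0\<close> by (simp add: n_def)
          finally show "norm ((?R' x - ?R' (\<gamma> t)) v) \<le> e * norm v" .
        qed
        show "(R has_derivative ?R' x) (at x within ball (\<gamma> t) d0)"
          using der has_derivative_at_withinI by blast
      next
        fix s :: real assume "s \<in> {0..1}"
        then have "norm (s *\<^sub>R (\<gamma>' t - \<gamma> t)) \<le> 1 * norm (\<gamma>' - \<gamma>)"
          using nt by (simp only: norm_scaleR) (intro mult_mono; simp)
        then show "\<gamma> t + s *\<^sub>R (\<gamma>' t - \<gamma> t) \<in> ball (\<gamma> t) d0" using lt by (simp add: dist_norm)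
      qed (use \<open>d0 > 0\<close> in simp)
      have "norm ((superpose R \<gamma>' - superpose R \<gamma> - ?D (\<gamma>' - \<gamma>)) t) \<le> norm (\<gamma>' t - \<gamma> t) * e"
        using * by (simp add: D superpose_apply[OF smooth_on_continuous[OF R]])
      also have "\<dots> \<le> norm (\<gamma>' - \<gamma>) * e" using nt \<open>e > 0\<close> by simp
      finally show "norm ((superpose R \<gamma>' - superpose R \<gamma> - ?D (\<gamma>' - \<gamma>)) t) \<le> e * norm (\<gamma>' - \<gamma>)"
        by (simp add: mult.commute)
    qed (fact \<open>d0 > 0\<close>)
  qed
qed

text \<open>The induction runs over all \<open>R\<close>, because the derivative brings in the
  superposition operators of the partial derivatives of \<open>R\<close>.\<close>

lemma td_superpose:
  fixes R :: "'e::euclidean_space \<Rightarrow> 'e"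
  assumes "open W" "smooth_on UNIV R" "td n W \<zeta>"
  shows "td n W (\<lambda>w. superpose R (\<zeta> w))"
  using assms(2,3)
proof (induction n arbitrary: R)
  case 0
  have "continuous_on UNIV (superpose R)"
    by (intro continuous_at_imp_continuous_on ballI has_derivative_continuous[OF superpose_has_derivative[OF 0(1)]])
  then show ?case using 0 by (auto intro: continuous_on_compose2)
next
  case (Suc n)
  let ?D = "\<lambda>w v. \<Sum>i\<in>Basis. component_mult i (frechet_derivative \<zeta> (at w) v)
      (superpose (\<lambda>z. frechet_derivative R (at z) i) (\<zeta> w))"
  have der: "((\<lambda>w. superpose R (\<zeta> w)) has_derivative ?D w) (at w)" if "w \<in> W" for w
    by (rule has_derivative_compose[OF td_has_derivative[OF Suc.prems(2) that]
          superpose_has_derivative[OF Suc.prems(1)]])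
  have "td n W (\<lambda>w. ?D w v)" for v
    using Suc.prems
    by (intro td_sum assms(1) bounded_bilinear.td_bilinear[OF bounded_bilinear_component_mult]
        Suc.IH smooth_on_derivative td_SucD[OF Suc.prems(2)]) auto
  then show ?case using td_Suc_iff[OF assms(1) der] by blast
qed

section \<open>Bump functions on Euclidean space\<close>

text \<open>The classical flat function is the case \<open>k = 0\<close>; the factors
  \<open>inverse x ^ k\<close> make the family closed under differentiation up to linear
  combinations.\<close>

definition flat :: "nat \<Rightarrow> real \<Rightarrow> real" where
  "flat k x = (if x > 0 then exp (- inverse x) * inverse x ^ k else 0)"

lemma flat_tendsto: "(flat k \<longlongrightarrow> 0) (at 0)"
proof (rule filterlim_split_at)
  show "(flat k \<longlongrightarrow> 0) (at_left 0)"
    by (rule tendsto_eventually) (auto simp: eventually_at_filter flat_def)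
  have "((\<lambda>x. inverse x ^ k / exp (inverse x)) \<longlongrightarrow> 0) (at_right (0::real))"
    by (rule filterlim_compose[OF tendsto_power_div_exp_0 filterlim_inverse_at_top_right])
  then show "(flat k \<longlongrightarrow> 0) (at_right 0)"
    by (rule Lim_transform_eventually)
      (auto simp: eventually_at_filter flat_def exp_minus field_simps)
qed

lemma flat_deriv:
  "(flat k has_real_derivative flat (k + 2) x - real k * flat (k + 1) x) (at x)"
proof -
  consider "x > 0" | "x < 0" | "x = 0" by linarith
  then show ?thesis
  proof cases
    case 1
    have "((\<lambda>x. exp (- inverse x) * inverse x ^ k) has_real_derivative flat (k + 2) x - real k * flat (k + 1) x) (at x)"
    proof (cases k)
      case 0
      then show ?thesis using 1
        by (auto intro!: derivative_eq_intros simp: flat_def power2_eq_square algebra_simps)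
    next
      case (Suc m)
      then show ?thesis using 1
        by (auto intro!: derivative_eq_intros
            simp: flat_def power2_eq_square algebra_simps power_eq_if[of "inverse x" m])
    qed
    then show ?thesis
      by (rule has_field_derivative_transform_within_open[of _ _ _ "{0<..}"]) (use 1 in \<open>auto simp: flat_def\<close>)
  next
    case 2
    have "((\<lambda>x. 0) has_real_derivative flat (k + 2) x - real k * flat (k + 1) x) (at x)"
      using 2 by (simp add: flat_def)
    then show ?thesis
      by (rule has_field_derivative_transform_within_open[of _ _ _ "{..<0}"]) (use 2 in \<open>auto simp: flat_def\<close>)
  next
    case 3
    \<comment> \<open>At the origin the difference quotient of \<open>flat k\<close> is the next
      member of the family, so its limit is an instance of \<open>flat_tendsto\<close>.\<close>
    have eq: "flat (Suc k) = (\<lambda>h. (flat k (0 + h) - flat k 0) / h)"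
      by (rule ext) (simp add: flat_def field_simps)
    have v: "flat (k + 2) 0 - real k * flat (k + 1) 0 = 0" by (simp add: flat_def)
    show ?thesis
      using flat_tendsto[of "Suc k"] unfolding 3 v DERIV_def eq .
  qed
qed

lemma smooth_on_flat: "smooth_on UNIV (flat k)"
proof -
  have "td n UNIV (flat k)" for n
  proof (induction n arbitrary: k)
    case 0
    then show ?case
      using flat_deriv by (auto intro!: continuous_at_imp_continuous_on DERIV_isCont)
  next
    case (Suc n)
    have "(flat k has_derivative (\<lambda>v. (flat (k + 2) x - real k * flat (k + 1) x) * v)) (at x)" for x
      using flat_deriv[of k x] by (rule has_field_derivative_imp_has_derivative)
    moreover have "td n UNIV (\<lambda>x. (flat (k + 2) x - real k * flat (k + 1) x) * v)" for v
    proof -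
      have "td n UNIV (\<lambda>x. flat (k + 2) x * v + flat (k + 1) x * (- real k * v))"
        by (intro td_add bounded_bilinear.td_bilinear[OF bounded_bilinear_mult] td_const Suc.IH) auto
      then show ?thesis by (simp add: algebra_simps)
    qed
    ultimately show ?case by (subst td_Suc_iff) auto
  qed
  then show ?thesis by (simp add: smooth_on_def)
qed

lemma euclidean_bump:
  fixes z0 :: "'e::euclidean_space"
  assumes "r > 0"
  obtains \<beta> :: "'e \<Rightarrow> real" where "smooth_on UNIV \<beta>"
    "\<And>z. dist z z0 \<le> r \<Longrightarrow> \<beta> z = 1" "\<And>z. dist z z0 \<ge> 2 * r \<Longrightarrow> \<beta> z = 0"
proof -
  \<comment> \<open>An affine function of the squared distance, which is smooth where the norm is
    not, with value 1 at distance \<open>r\<close> and 0 at distance \<open>2 * r\<close>.\<close>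
  define s where "s = (\<lambda>z::'e. (4 * r\<^sup>2 - (z - z0) \<bullet> (z - z0)) / (3 * r\<^sup>2))"
  define \<beta> where "\<beta> z = flat 0 (s z) / (flat 0 (s z) + flat 0 (1 - s z))" for z
  have nn: "flat 0 x \<ge> 0" "x > 0 \<Longrightarrow> flat 0 x > 0" "x \<le> 0 \<Longrightarrow> flat 0 x = 0" for x
    by (auto simp: flat_def)
  \<comment> \<open>One of \<open>x\<close> and \<open>1 - x\<close> is positive, so the quotient
    defining \<open>\<beta>\<close> never divides by zero.\<close>
  have pos: "flat 0 x + flat 0 (1 - x) > 0" for x
    using nn[of x] nn[of "1 - x"] by (cases "x > 0") (auto intro: add_pos_nonneg add_nonneg_pos)
  have s: "smooth_on UNIV s"
    unfolding s_def using assms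
    by (intro smooth_on_divide smooth_on_diff smooth_on_const smooth_on_inner smooth_on_ident) auto
  have "smooth_on UNIV (\<lambda>z. flat 0 (s z))"
    by (rule smooth_on_compose[OF s smooth_on_flat]) auto
  moreover have "smooth_on UNIV (\<lambda>z. flat 0 (1 - s z))"
    by (rule smooth_on_compose[OF _ smooth_on_flat]) (auto intro!: smooth_on_diff smooth_on_const s)
  ultimately have "smooth_on UNIV \<beta>"
    unfolding \<beta>_def using pos by (intro smooth_on_divide smooth_on_add) (auto simp: less_imp_neq[THEN not_sym])
  moreover have "\<beta> z = 1" if "dist z z0 \<le> r" for z
  proof -
    have "(z - z0) \<bullet> (z - z0) \<le> r\<^sup>2"
      using power_mono[OF that, of 2] by (simp add: dist_norm power2_norm_eq_inner)
    then have "s z \<ge> 1" using assms by (simp add: s_def field_simps)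
    then show ?thesis using nn(2)[of "s z"] nn(3)[of "1 - s z"] by (simp add: \<beta>_def)
  qed
  moreover have "\<beta> z = 0" if "dist z z0 \<ge> 2 * r" for z
  proof -
    have "(z - z0) \<bullet> (z - z0) \<ge> 4 * r\<^sup>2"
      using power_mono[OF that, of 2] assms by (simp add: dist_norm power2_norm_eq_inner power_mult_distrib)
    then have "s z \<le> 0" using assms by (simp add: s_def field_simps)
    then show ?thesis using nn by (simp add: \<beta>_def)
  qed
  ultimately show thesis by (rule that)
qed

text \<open>The product vanishes on the open complement of \<open>K\<close>, which together with
  \<open>V\<close> covers the space.\<close>

lemma smooth_on_bump_mult:
  fixes f :: "'e::real_normed_vector \<Rightarrow> 'b::real_normed_vector"
  assumes "open V" "closed K" "K \<subseteq> V" "smooth_on UNIV \<beta>" "\<And>z. z \<notin> K \<Longrightarrow> \<beta> z = 0" "smooth_on V f"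
  shows "smooth_on UNIV (\<lambda>z. \<beta> z *\<^sub>R f z)"
proof (rule smooth_on_local)
  fix x
  show "\<exists>U. open U \<and> x \<in> U \<and> smooth_on U (\<lambda>z. \<beta> z *\<^sub>R f z)"
  proof (cases "x \<in> K")
    case True
    then show ?thesis
      using assms smooth_on_scaleR[OF \<open>open V\<close> smooth_on_subset[OF assms(4)] assms(6)] by blast
  next
    case False
    have "smooth_on (- K) (\<lambda>z. \<beta> z *\<^sub>R f z) \<longleftrightarrow> smooth_on (- K) (\<lambda>z. 0 :: 'b)"
      by (rule smooth_on_cong) (use assms in auto)
    then show ?thesis using False assms(2) smooth_on_const[of "- K" "0 :: 'b"] by blast
  qed
qed

section \<open>The parametrised flow\<close>

instance bcontfun :: (metric_space, banach) banach ..

lemma bounded_linear_const_bcontfun: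
  "bounded_linear (const_bcontfun :: 'e::real_normed_vector \<Rightarrow> ('a::topological_space \<Rightarrow>\<^sub>C 'e))"
  by (rule bounded_linear_intro[where K = 1]) (auto intro!: bcontfun_eqI norm_bound)

lemma bounded_linear_eval:
  "bounded_linear (\<lambda>\<gamma> :: 'a::topological_space \<Rightarrow>\<^sub>C 'e::real_normed_vector. apply_bcontfun \<gamma> t)"
  by (rule bounded_linear_intro[where K = 1]) (auto simp: norm_bounded)

lemma sum_bcontfun_apply:
  "apply_bcontfun (\<Sum>i\<in>I. f i) t = (\<Sum>i\<in>I. apply_bcontfun (f i) t)"
  by (rule bounded_linear.linear[OF bounded_linear_eval, THEN linear_sum])

text \<open>
  The integral equation of \<open>z' = (\<Sum>j. (P w \<bullet> j) R\<^sub>j(z))\<close>, \<open>z(0) = z0 + Q w\<close>, and of its linearisation.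
\<close>

definition flow_map ::
    "('e::euclidean_space \<Rightarrow> 'e) \<Rightarrow> ('e \<Rightarrow> 'e) \<Rightarrow> ('e \<Rightarrow> 'e \<Rightarrow> 'e) \<Rightarrow> 'e \<Rightarrow> 'e \<Rightarrow> 'e curve \<Rightarrow> 'e curve" where
  "flow_map P Q R z0 w \<gamma> = const_bcontfun (z0 + Q w)
     + (\<Sum>j\<in>Basis. (P w \<bullet> j) *\<^sub>R integral_curve (superpose (R j) \<gamma>))"

definition flow_source ::
    "('e::euclidean_space \<Rightarrow> 'e) \<Rightarrow> ('e \<Rightarrow> 'e) \<Rightarrow> ('e \<Rightarrow> 'e \<Rightarrow> 'e) \<Rightarrow> 'e \<Rightarrow> 'e curve \<Rightarrow> 'e curve" where
  "flow_source P Q R v \<gamma> = const_bcontfun (Q v)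
     + (\<Sum>j\<in>Basis. (P v \<bullet> j) *\<^sub>R integral_curve (superpose (R j) \<gamma>))"

definition flow_linearisation ::
    "('e::euclidean_space \<Rightarrow> 'e) \<Rightarrow> ('e \<Rightarrow> 'e \<Rightarrow> 'e) \<Rightarrow> 'e \<Rightarrow> 'e curve \<Rightarrow> 'e curve \<Rightarrow> 'e curve" where
  "flow_linearisation P R w \<gamma> u = (\<Sum>j\<in>Basis. (P w \<bullet> j) *\<^sub>R integral_curve
     (\<Sum>i\<in>Basis. component_mult i u (superpose (\<lambda>z. frechet_derivative (R j) (at z) i) \<gamma>)))"

text \<open>
  The last clause identifies the derivatives of \<open>\<zeta>\<close> with arbitrary solutions of the linearised equation.
\<close>

lemma parametrised_flow:
  fixes R :: "'e::euclidean_space \<Rightarrow> 'e \<Rightarrow> 'e"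
  assumes P: "bounded_linear P" and Q: "bounded_linear Q"
    and R: "\<And>j. j \<in> Basis \<Longrightarrow> smooth_on UNIV (R j)"
    and L: "\<And>i j z. i \<in> Basis \<Longrightarrow> j \<in> Basis \<Longrightarrow> norm (frechet_derivative (R j) (at z) i) \<le> L"
  obtains \<delta> \<zeta> where "\<delta> > 0" "\<And>w. w \<in> ball 0 \<delta> \<Longrightarrow> \<zeta> w = flow_map P Q R z0 w (\<zeta> w)"
    "smooth_on (ball 0 \<delta>) \<zeta>"
    "\<And>w v u. w \<in> ball 0 \<delta> \<Longrightarrow> u = flow_source P Q R v (\<zeta> w) + flow_linearisation P R w (\<zeta> w) u
       \<Longrightarrow> u = frechet_derivative \<zeta> (at w) v"
proof -
  let ?R' = "\<lambda>j z. frechet_derivative (R j) (at z)"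
  define n where "n = real DIM('e)"
  have n: "n \<ge> 1" using DIM_positive[where 'a='e] by (simp add: n_def Suc_le_eq)
  have "L \<ge> 0" using L[OF SOME_Basis SOME_Basis] norm_ge_zero order_trans by blast
  obtain K where K: "K > 0" "\<And>w. norm (P w) \<le> norm w * K"
    using bounded_linear.pos_bounded[OF P] by blast
  \<comment> \<open>Makes the flow map a contraction with factor 1/2: one \<open>n\<close> counts
    the fields \<open>R j\<close>, the other the partial derivatives in the Lipschitz constant
    \<open>n * L\<close>; \<open>L + 1\<close> avoids a division by zero.\<close>
  define \<delta> where "\<delta> = 1 / (2 * n * n * (L + 1) * K)"
  have "\<delta> > 0" using n \<open>L \<ge> 0\<close> K by (simp add: \<delta>_def)
  have Pw: "n * norm (P w) * (n * L) \<le> 1 / 2" if "w \<in> ball 0 \<delta>" for w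
  proof -
    have "norm (P w) \<le> \<delta> * K"
      using K(1) K(2)[of w] that by (auto intro: order_trans[OF _ mult_right_mono])
    then have "n * norm (P w) * (n * L) \<le> n * (\<delta> * K) * (n * (L + 1))"
      using n \<open>L \<ge> 0\<close> \<open>\<delta> > 0\<close> K(1) by (intro mult_mono) auto
    also have "\<dots> = \<delta> * (2 * n * n * (L + 1) * K) / 2" by (simp add: algebra_simps)
    also have "\<dots> = 1 / 2"
    proof -
      have "2 * n * n * (L + 1) * K \<noteq> 0" using n K \<open>L \<ge> 0\<close> by simp
      then show ?thesis unfolding \<delta>_def by (simp only: nonzero_eq_divide_eq) simp
    qed
    finally show ?thesis .
  qed
  have der: "(R j has_derivative ?R' j z) (at z)" if "j \<in> Basis" for j z
    using smooth_on_has_derivative[OF R[OF that]] by simp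
  have cR: "continuous_on UNIV (R j)" if "j \<in> Basis" for j
    using smooth_on_continuous[OF R[OF that]] .
  have cR': "continuous_on UNIV (\<lambda>z. ?R' j z i)" if "j \<in> Basis" for i j
    using smooth_on_continuous[OF smooth_on_derivative[OF R[OF that]]] .
  have lip: "norm (R j x - R j y) \<le> n * L * norm (x - y)" if j: "j \<in> Basis" for j x y
  proof (rule differentiable_bound[OF convex_UNIV])
    show "onorm (?R' j z) \<le> n * L" for z
    proof (rule onorm_le)
      fix v
      interpret linear "?R' j z" using der[OF j] by (rule has_derivative_linear)
      have "?R' j z v = (\<Sum>i\<in>Basis. (v \<bullet> i) *\<^sub>R ?R' j z i)"
        by (subst (1) euclidean_representation[of v, symmetric]) (simp only: sum scale)
      also have "norm \<dots> \<le> (\<Sum>i\<in>(Basis::'e set). norm v * L)"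
        by (rule sum_norm_le, simp only: norm_scaleR)
          (intro mult_mono L j; simp add: Basis_le_norm)
      finally show "norm (?R' j z v) \<le> n * L * norm v" by (simp add: n_def mult_ac)
    qed
  qed (use der j in auto)
  have contr: "norm (flow_map P Q R z0 w u - flow_map P Q R z0 w u') \<le> norm (u - u') / 2"
    if w: "w \<in> ball 0 \<delta>" for w u u'
  proof -
    have sup: "norm (superpose (R j) u - superpose (R j) u') \<le> n * L * norm (u - u')" if "j \<in> Basis" for j
    proof (rule norm_bound)
      fix t
      have "norm (R j (u t) - R j (u' t)) \<le> n * L * norm (u t - u' t)" by (rule lip[OF that])
      also have "\<dots> \<le> n * L * norm (u - u')"
        using norm_bounded[of "u - u'" t] n \<open>L \<ge> 0\<close> by (intro mult_left_mono) auto
      finally show "norm ((superpose (R j) u - superpose (R j) u') t) \<le> n * L * norm (u - u')"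
        by (simp add: superpose_apply[OF cR[OF that]])
    qed
    have "flow_map P Q R z0 w u - flow_map P Q R z0 w u' =
        (\<Sum>j\<in>Basis. (P w \<bullet> j) *\<^sub>R integral_curve (superpose (R j) u - superpose (R j) u'))"
      by (simp add: flow_map_def sum_subtractf scaleR_diff_right
          linear_diff[OF bounded_linear.linear[OF bounded_linear_integral_curve]])
    also have "norm \<dots> \<le> (\<Sum>j\<in>(Basis::'e set). norm (P w) * (n * L * norm (u - u')))"
      by (rule sum_norm_le, simp only: norm_scaleR)
        (intro mult_mono order_trans[OF norm_integral_curve] sup; simp add: Basis_le_norm)
    also have "\<dots> = n * norm (P w) * (n * L) * norm (u - u')" by (simp add: n_def)
    also have "\<dots> \<le> 1 / 2 * norm (u - u')" by (intro mult_right_mono Pw w) simp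
    finally show ?thesis by simp
  qed
  have "\<exists>!z. flow_map P Q R z0 w z = z" if "w \<in> ball 0 \<delta>" for w
    by (rule banach_fix_type[where c = "1/2"]) (use contr[OF that] in \<open>auto simp: dist_norm\<close>)
  then obtain \<zeta> where fp: "\<And>w. w \<in> ball 0 \<delta> \<Longrightarrow> \<zeta> w = flow_map P Q R z0 w (\<zeta> w)" by metis
  \<comment> \<open>The linearisation must depend differentiably on \<open>w\<close> in operator
    norm, so the multiplication and integral operators are recast as bounded linear maps between
    curves.\<close>
  define cm :: "'e \<Rightarrow> 'e curve \<Rightarrow> ('e curve \<Rightarrow>\<^sub>L 'e curve)" where
    "cm i g = Blinfun (\<lambda>u. component_mult i u g)" for i g
  define ic :: "'e curve \<Rightarrow>\<^sub>L 'e curve" where "ic = Blinfun integral_curve"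
  have cm: "blinfun_apply (cm i g) u = component_mult i u g" for i g u
    by (simp add: cm_def bounded_linear_Blinfun_apply
        bounded_bilinear.bounded_linear_left[OF bounded_bilinear_component_mult])
  have ic: "blinfun_apply ic u = integral_curve u" for u
    by (simp add: ic_def bounded_linear_Blinfun_apply bounded_linear_integral_curve)
  have norm_cm: "norm (cm i g) \<le> norm g" if "i \<in> Basis" for i g
    by (rule norm_blinfun_bound)
      (use norm_component_mult[OF that, of _ g] in \<open>auto simp: cm mult.commute\<close>)
  have norm_ic: "norm ic \<le> 1"
    by (rule norm_blinfun_bound) (auto simp: ic norm_integral_curve)
  have bl_cm: "bounded_linear (cm i)" if "i \<in> Basis" for i
  proof (rule bounded_linear_intro[where K = 1])
    interpret bounded_bilinear "component_mult i" by (rule bounded_bilinear_component_mult)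
    show "cm i (x + y) = cm i x + cm i y" for x y
      by (rule blinfun_eqI) (simp add: cm add_right blinfun.add_left)
    show "cm i (r *\<^sub>R x) = r *\<^sub>R cm i x" for r x
      by (rule blinfun_eqI) (simp add: cm scaleR_right blinfun.scaleR_left)
  qed (simp add: norm_cm that)
  define B where "B w j i = ic o\<^sub>L cm i (superpose (\<lambda>z. ?R' j z i) (\<zeta> w))" for w i j
  define A where "A w = (\<Sum>j\<in>Basis. \<Sum>i\<in>Basis. (P w \<bullet> j) *\<^sub>R B w j i)" for w
  have A: "A w u = flow_linearisation P R w (\<zeta> w) u" for w u
    by (simp add: A_def B_def flow_linearisation_def blinfun.sum_left blinfun.scaleR_left cm ic
        scaleR_sum_right linear_sum[OF bounded_linear.linear[OF bounded_linear_integral_curve]])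
  have normA: "norm (A w) \<le> 1 / 2" if w: "w \<in> ball 0 \<delta>" for w
  proof -
    have nB: "norm (B w j i) \<le> L" if "i \<in> Basis" "j \<in> Basis" for i j
    proof -
      have "norm (superpose (\<lambda>z. ?R' j z i) (\<zeta> w)) \<le> L"
        by (rule norm_bound) (simp add: superpose_apply[OF cR'[OF that(2)]] L that)
      then have "norm (cm i (superpose (\<lambda>z. ?R' j z i) (\<zeta> w))) \<le> L"
        using norm_cm[OF that(1)] order_trans by blast
      then have "norm ic * norm (cm i (superpose (\<lambda>z. ?R' j z i) (\<zeta> w))) \<le> 1 * L"
        using norm_ic by (intro mult_mono) auto
      then show ?thesis unfolding B_def using norm_blinfun_compose order_trans by fastforce
    qed
    have "norm (A w) \<le> (\<Sum>j\<in>(Basis::'e set). \<Sum>i\<in>(Basis::'e set). norm (P w) * L)"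
      unfolding A_def
      by (intro sum_norm_le) (simp only: norm_scaleR, intro mult_mono nB; simp add: Basis_le_norm)
    also have "\<dots> = n * norm (P w) * (n * L)" by (simp add: n_def)
    finally show ?thesis using Pw[OF w] by simp
  qed
  have der_map: "((\<lambda>p. flow_map P Q R z0 (fst p) (snd p)) has_derivative
      (\<lambda>h. flow_source P Q R (fst h) (\<zeta> w) + A w (snd h))) (at (w, \<zeta> w))" for w
  proof -
    have a: "((\<lambda>p. const_bcontfun (z0 + Q (fst p))) has_derivative
        (\<lambda>h. const_bcontfun (Q (fst h)))) (at (w, \<zeta> w))"
      using has_derivative_add[OF has_derivative_const
          bounded_linear.has_derivative[OF Q has_derivative_fst[OF has_derivative_ident]]]
      by (intro bounded_linear.has_derivative[OF bounded_linear_const_bcontfun]) simp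
    have b: "((\<lambda>p. \<Sum>j\<in>Basis. (P (fst p) \<bullet> j) *\<^sub>R integral_curve (superpose (R j) (snd p))) has_derivative
       (\<lambda>h. \<Sum>j\<in>Basis. (P w \<bullet> j) *\<^sub>R integral_curve
            (\<Sum>i\<in>Basis. component_mult i (snd h) (superpose (\<lambda>z. ?R' j z i) (\<zeta> w)))
         + (P (fst h) \<bullet> j) *\<^sub>R integral_curve (superpose (R j) (\<zeta> w)))) (at (w, \<zeta> w))"
    proof (rule has_derivative_sum)
      fix j :: 'e assume j: "j \<in> Basis"
      have 1: "((\<lambda>p. P (fst p) \<bullet> j) has_derivative (\<lambda>h. P (fst h) \<bullet> j)) (at (w, \<zeta> w))"
        by (intro bounded_linear.has_derivative[OF bounded_linear_inner_left]
            bounded_linear.has_derivative[OF P] has_derivative_fst has_derivative_ident)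
      have 2: "((\<lambda>p. integral_curve (superpose (R j) (snd p))) has_derivative (\<lambda>h. integral_curve
            (\<Sum>i\<in>Basis. component_mult i (snd h) (superpose (\<lambda>z. ?R' j z i) (\<zeta> w))))) (at (w, \<zeta> w))"
        by (intro bounded_linear.has_derivative[OF bounded_linear_integral_curve]
            has_derivative_compose[OF has_derivative_snd[OF has_derivative_ident]])
          (use superpose_has_derivative[OF R[OF j], of "\<zeta> w"] in simp)
      from bounded_bilinear.FDERIV[OF bounded_bilinear_scaleR 1 2]
      show "((\<lambda>p. (P (fst p) \<bullet> j) *\<^sub>R integral_curve (superpose (R j) (snd p))) has_derivative
       (\<lambda>h. (P w \<bullet> j) *\<^sub>R integral_curve
            (\<Sum>i\<in>Basis. component_mult i (snd h) (superpose (\<lambda>z. ?R' j z i) (\<zeta> w)))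
         + (P (fst h) \<bullet> j) *\<^sub>R integral_curve (superpose (R j) (\<zeta> w)))) (at (w, \<zeta> w))" by simp
    qed
    show ?thesis
      using has_derivative_add[OF a b] unfolding flow_map_def A flow_source_def flow_linearisation_def
      by (simp add: sum.distrib add_ac)
  qed
  have source0: "flow_source P Q R 0 \<gamma> = 0" for \<gamma>
    by (simp add: flow_source_def linear_0 bounded_linear.linear[OF P] bounded_linear.linear[OF Q])
  have bdA: "norm (A w u) \<le> norm u / 2" if "w \<in> ball 0 \<delta>" for w u
    using norm_blinfun[of "A w" u] mult_right_mono[OF normA[OF that], of "norm u"] by simp
  have "\<exists>D. (\<zeta> has_derivative D) (at w) \<and> (\<forall>v. D v = flow_source P Q R v (\<zeta> w) + A w (D v))"
    if w: "w \<in> ball 0 \<delta>" for w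
  proof -
    have "\<exists>D. (\<zeta> has_derivative D) (at w) \<and>
        (\<forall>v. D v = (flow_source P Q R (fst (v, 0::'e curve)) (\<zeta> w) + A w (snd (v, 0)))
          + (flow_source P Q R (fst (0, D v)) (\<zeta> w) + A w (snd (0::'e, D v))))"
      by (rule fixed_point_has_derivative[where \<zeta> = \<zeta> and T = "\<lambda>p. flow_map P Q R z0 (fst p) (snd p)"
            and T' = "\<lambda>h. flow_source P Q R (fst h) (\<zeta> w) + A w (snd h)", OF open_ball w _ _ der_map])
        (use fp contr bdA[OF w] source0 in auto)
    then show ?thesis using source0 by simp
  qed
  then obtain D where D: "\<And>w. w \<in> ball 0 \<delta> \<Longrightarrow> (\<zeta> has_derivative D w) (at w)"
    and D_eq: "\<And>w v. w \<in> ball 0 \<delta> \<Longrightarrow> D w v = flow_source P Q R v (\<zeta> w) + A w (D w v)" by metis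
  \<comment> \<open>If \<open>\<zeta>\<close> has order \<open>k\<close>, so have the source and the
    operator of the linearised equation, hence also its solution, which is the derivative of
    \<open>\<zeta>\<close>.\<close>
  have "td k (ball 0 \<delta>) \<zeta>" for k
  proof (induction k)
    case 0
    show ?case using D by (auto intro!: continuous_at_imp_continuous_on has_derivative_continuous)
  next
    case (Suc k)
    have src: "td k (ball 0 \<delta>) (\<lambda>w. flow_source P Q R v (\<zeta> w))" for v
      unfolding flow_source_def
      by (intro td_add td_sum td_const bounded_bilinear.td_bilinear[OF bounded_bilinear_scaleR]
          td_linear_compose[OF bounded_linear_integral_curve] td_superpose R Suc.IH) auto
    have tA: "td k (ball 0 \<delta>) A"
      unfolding A_def B_def
      by (intro td_sum bounded_bilinear.td_bilinear[OF bounded_bilinear_scaleR] td_const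
          td_linear_compose[OF bounded_linear_inner_left] td_bounded_linear[OF P]
          bounded_bilinear.td_bilinear[OF bounded_bilinear_blinfun_compose]
          td_linear_compose[OF bl_cm] td_superpose smooth_on_derivative R Suc.IH) auto
    have "td k (ball 0 \<delta>) (\<lambda>w. D w v)" for v
      by (rule td_linear_fixed_point[OF open_ball tA src normA D_eq])
    then show ?case using td_Suc_iff[OF open_ball D] by blast
  qed
  \<comment> \<open>The difference of two solutions is fixed by \<open>A w\<close>, which halves
    norms.\<close>
  moreover have "u = frechet_derivative \<zeta> (at w) v" if w: "w \<in> ball 0 \<delta>"
    and u: "u = flow_source P Q R v (\<zeta> w) + flow_linearisation P R w (\<zeta> w) u" for w v u
  proof -
    have "u - D w v = A w (u - D w v)"
      using u D_eq[OF w, of v] unfolding A[symmetric] by (metis add_diff_cancel_left blinfun.diff_right)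
    then have "norm (u - D w v) \<le> norm (u - D w v) / 2" by (metis bdA[OF w])
    then have "u = D w v" by simp
    then show ?thesis using frechet_derivative_at[OF D[OF w]] by simp
  qed
  ultimately show thesis
    using that[of \<delta> \<zeta>] \<open>\<delta> > 0\<close> fp by (auto simp: smooth_on_def)
qed

section \<open>The Frobenius theorem in Euclidean space\<close>

text \<open>Time enters the integral equation only through \<open>unit_clamp\<close>, so solutions
  need comparing only on the unit interval.\<close>

lemma flow_curve_constant:
  assumes "\<zeta> = flow_map P Q R z0 w \<zeta>"
  shows "\<zeta> (unit_clamp t) = \<zeta> t"
proof -
  have "unit_clamp (unit_clamp t) = unit_clamp t" by (simp add: unit_clamp_def)
  then have "flow_map P Q R z0 w \<zeta> (unit_clamp t) = flow_map P Q R z0 w \<zeta> t"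
    by (simp add: flow_map_def sum_bcontfun_apply integral_curve_apply)
  then show ?thesis using assms by simp
qed

lemma frechet_derivative_linear_rep:
  fixes f :: "'e::euclidean_space \<Rightarrow> 'b::real_normed_vector"
  assumes "f differentiable (at z)"
  shows "frechet_derivative f (at z) v = (\<Sum>i\<in>Basis. (v \<bullet> i) *\<^sub>R frechet_derivative f (at z) i)"
proof -
  interpret linear "frechet_derivative f (at z)" using assms by (rule linear_frechet_derivative)
  show ?thesis by (subst (1) euclidean_representation[of v, symmetric]) (simp only: sum scale)
qed

text \<open>
  The flow of \<open>R (P w)\<close> at time \<open>1\<close> from \<open>z0 + (w - P w)\<close>. For \<open>v\<close> in the range of \<open>P\<close>, the curve
  \<open>t R v (\<zeta> w t)\<close> solves the linearised equation because the fields commute, so it is the derivative of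
  \<open>\<zeta> w t\<close> in the direction \<open>v\<close>.
\<close>

lemma frobenius_flow:
  fixes R :: "'e::euclidean_space \<Rightarrow> 'e \<Rightarrow> 'e"
  assumes P: "bounded_linear P" "\<And>v. P (P v) = P v"
    and V: "open V" "z0 \<in> V"
    and smooth: "\<And>v. smooth_on V (R v)"
    and linear: "\<And>z. z \<in> V \<Longrightarrow> linear (\<lambda>v. R v z)"
    and RP: "\<And>v z. z \<in> V \<Longrightarrow> R (P v) z = R v z"
    and R0: "\<And>v. R v z0 = P v"
    and comm: "\<And>z u v. z \<in> V \<Longrightarrow>
      frechet_derivative (R v) (at z) (R u z) = frechet_derivative (R u) (at z) (R v z)"
  obtains \<delta> \<Phi> where "\<delta> > 0" "smooth_on (ball 0 \<delta>) \<Phi>" "\<Phi> 0 = z0" "\<Phi> ` ball 0 \<delta> \<subseteq> V"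
    "\<And>v. frechet_derivative \<Phi> (at 0) v = v"
    "\<And>w v. w \<in> ball 0 \<delta> \<Longrightarrow> P v = v \<Longrightarrow> frechet_derivative \<Phi> (at w) v = R v (\<Phi> w)"
proof -
  obtain r0 where r0: "r0 > 0" "cball z0 r0 \<subseteq> V" using V open_contains_cball by blast
  define r where "r = r0 / 2"
  have r: "r > 0" "cball z0 (2 * r) \<subseteq> V" using r0 by (auto simp: r_def)
  obtain \<beta> :: "'e \<Rightarrow> real" where \<beta>: "smooth_on UNIV \<beta>" "\<And>z. dist z z0 \<le> r \<Longrightarrow> \<beta> z = 1"
    "\<And>z. dist z z0 \<ge> 2 * r \<Longrightarrow> \<beta> z = 0" using euclidean_bump[OF r(1), of z0] by blast
  \<comment> \<open>The cut-off makes the fields global with bounded derivatives, as the contraction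
    argument requires; for small parameters the curves stay where the cut-off is 1.\<close>
  define S where "S j z = \<beta> z *\<^sub>R R j z" for j z
  have smS: "smooth_on UNIV (S j)" for j
    unfolding S_def by (rule smooth_on_bump_mult[OF V(1) closed_cball r(2) \<beta>(1) _ smooth])
      (auto simp: \<beta>(3) dist_commute)
  have inV: "z \<in> V" if "z \<in> ball z0 r" for z using that r by auto
  have SR: "S j z = R j z" if "z \<in> ball z0 r" for z j
    using that \<beta>(2)[of z] by (simp add: S_def dist_commute)
  have derR: "(R v has_derivative frechet_derivative (R v) (at z)) (at z)" if "z \<in> V" for v z
    using smooth_on_has_derivative[OF smooth that] .
  have derS: "frechet_derivative (S j) (at z) = frechet_derivative (R j) (at z)" if z: "z \<in> ball z0 r" for z j
  proof -
    have "(S j has_derivative frechet_derivative (R j) (at z)) (at z)"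
      by (rule has_derivative_transform_within_open[OF derR[OF inV[OF z]] open_ball z]) (simp add: SR)
    from frechet_derivative_at[OF this] show ?thesis by (rule sym)
  qed
  have R_rep: "R v z = (\<Sum>j\<in>Basis. (v \<bullet> j) *\<^sub>R R j z)" if "z \<in> V" for v z
  proof -
    interpret linear "\<lambda>v. R v z" using linear[OF that] .
    show ?thesis by (subst (1) euclidean_representation[of v, symmetric]) (simp only: sum scale)
  qed
  have DR_rep: "frechet_derivative (R v) (at z) y = (\<Sum>j\<in>Basis. (v \<bullet> j) *\<^sub>R frechet_derivative (R j) (at z) y)"
    if z: "z \<in> V" for v z y
  proof -
    have "((\<lambda>z. \<Sum>j\<in>Basis. (v \<bullet> j) *\<^sub>R R j z) has_derivative
        (\<lambda>y. \<Sum>j\<in>Basis. (v \<bullet> j) *\<^sub>R frechet_derivative (R j) (at z) y)) (at z)"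
      by (intro has_derivative_sum has_derivative_scaleR_right derR z)
    then have "(R v has_derivative
        (\<lambda>y. \<Sum>j\<in>Basis. (v \<bullet> j) *\<^sub>R frechet_derivative (R j) (at z) y)) (at z)"
      by (rule has_derivative_transform_within_open[OF _ V(1) z]) (simp add: R_rep[symmetric])
    from frechet_derivative_at[OF this] show ?thesis by metis
  qed
  \<comment> \<open>A continuous majorant of all partial derivatives, bounded on the compact ball;
    outside it the fields \<open>S j\<close> vanish.\<close>
  define g where "g z = (\<Sum>j\<in>(Basis::'e set). \<Sum>i\<in>(Basis::'e set). norm (frechet_derivative (S j) (at z) i))" for z
  have "continuous_on (cball z0 (2 * r)) g"
    unfolding g_def
    by (intro continuous_on_sum continuous_on_norm continuous_on_subset[OF smooth_on_continuous[OF smooth_on_derivative[OF smS]]]) auto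
  then have "bounded (g ` cball z0 (2 * r))"
    by (intro compact_imp_bounded compact_continuous_image compact_cball)
  then obtain L0 where L0: "\<And>z. z \<in> cball z0 (2 * r) \<Longrightarrow> norm (g z) \<le> L0"
    unfolding bounded_iff by blast
  have L: "norm (frechet_derivative (S j) (at z) i) \<le> max 0 L0" if ij: "i \<in> Basis" "j \<in> Basis" for i j z
  proof (cases "z \<in> cball z0 (2 * r)")
    case True
    have "norm (frechet_derivative (S j) (at z) i) \<le> (\<Sum>i\<in>(Basis::'e set). norm (frechet_derivative (S j) (at z) i))"
      using ij by (intro member_le_sum) auto
    also have "\<dots> \<le> g z"
      unfolding g_def using ij
      by (intro member_le_sum[where f = "\<lambda>j. \<Sum>i\<in>(Basis::'e set). norm (frechet_derivative (S j) (at z) i)"] sum_nonneg) auto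
    finally show ?thesis using L0[OF True] by (auto simp: le_max_iff_disj)
  next
    case False
    have "(S j has_derivative (\<lambda>_. 0)) (at z)"
      by (rule has_derivative_transform_within_open[of "\<lambda>_. 0" _ _ _ "- cball z0 (2 * r)"])
        (use False in \<open>auto simp: S_def \<beta>(3) dist_commute\<close>)
    from frechet_derivative_at[OF this] show ?thesis by (metis max.cobounded1 norm_zero)
  qed
  \<comment> \<open>The complementary part of \<open>w\<close> moves the initial point, so that
    \<open>\<Phi>\<close> fills a neighbourhood and not just one orbit.\<close>
  define Q where "Q w = w - P w" for w
  have Q: "bounded_linear Q" unfolding Q_def by (intro bounded_linear_sub bounded_linear_ident P)
  obtain \<delta>0 \<zeta> where \<delta>0: "\<delta>0 > 0" and fp: "\<And>w. w \<in> ball 0 \<delta>0 \<Longrightarrow> \<zeta> w = flow_map P Q S z0 w (\<zeta> w)"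
    and sm\<zeta>: "smooth_on (ball 0 \<delta>0) \<zeta>"
    and D\<zeta>: "\<And>w v u. w \<in> ball 0 \<delta>0 \<Longrightarrow> u = flow_source P Q S v (\<zeta> w) + flow_linearisation P S w (\<zeta> w) u
       \<Longrightarrow> u = frechet_derivative \<zeta> (at w) v"
    by (rule parametrised_flow[where ?z0.0 = z0, OF P(1) Q smS L]) blast+
  have P0: "P 0 = 0" and Q0: "Q 0 = 0" using P(1) by (auto simp: Q_def bounded_linear.linear linear_0)
  have \<zeta>0: "\<zeta> 0 = const_bcontfun z0"
    using fp[of 0] \<delta>0 by (simp add: flow_map_def P0 Q0)
  have "continuous (at 0) \<zeta>"
    using smooth_on_continuous[OF sm\<zeta>] \<delta>0 by (simp add: continuous_on_eq_continuous_at)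
  then obtain d where d: "d > 0" "\<And>w. dist w 0 < d \<Longrightarrow> dist (\<zeta> w) (\<zeta> 0) < r"
    using r(1) unfolding continuous_at_eps_delta by blast
  define \<delta> where "\<delta> = min \<delta>0 d"
  have \<delta>: "\<delta> > 0" "ball 0 \<delta> \<subseteq> ball (0::'e) \<delta>0" using \<delta>0 d by (auto simp: \<delta>_def)
  have near: "\<zeta> w t \<in> ball z0 r" if "w \<in> ball 0 \<delta>" for w t
  proof -
    have "dist (\<zeta> w t) (\<zeta> 0 t) \<le> dist (\<zeta> w) (\<zeta> 0)" by (rule dist_bounded)
    also have "\<dots> < r" using d(2)[of w] that by (simp add: \<delta>_def)
    finally show ?thesis by (simp add: \<zeta>0 dist_commute)
  qed
  define \<Phi> where "\<Phi> w = \<zeta> w 1" for w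
  have D\<Phi>: "frechet_derivative \<Phi> (at w) v = frechet_derivative \<zeta> (at w) v 1" if "w \<in> ball 0 \<delta>" for w v
  proof -
    have "(\<Phi> has_derivative (\<lambda>v. frechet_derivative \<zeta> (at w) v 1)) (at w)"
      unfolding \<Phi>_def using that \<delta>
      by (intro bounded_linear.has_derivative[OF bounded_linear_eval] smooth_on_has_derivative[OF sm\<zeta>]) auto
    from frechet_derivative_at[OF this] show ?thesis by metis
  qed
  show thesis
  proof (rule that[of \<delta> \<Phi>])
    show "\<delta> > 0" by fact
    show "smooth_on (ball 0 \<delta>) \<Phi>"
      unfolding \<Phi>_def
      by (intro smooth_on_linear_compose[OF bounded_linear_eval] smooth_on_subset[OF sm\<zeta>] \<delta>) auto
    show "\<Phi> 0 = z0" by (simp add: \<Phi>_def \<zeta>0)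
    show "\<Phi> ` ball 0 \<delta> \<subseteq> V" unfolding \<Phi>_def using near inV by blast
  next
    fix v
    \<comment> \<open>At \<open>w = 0\<close> the linearisation vanishes, so the source alone is the
      derivative.\<close>
    define u where "u = flow_source P Q S v (\<zeta> 0)"
    have "u = frechet_derivative \<zeta> (at 0) v"
      using \<delta>0 by (intro D\<zeta>) (auto simp: u_def flow_linearisation_def P0)
    then have "frechet_derivative \<Phi> (at 0) v = u 1" using D\<Phi>[of 0] \<delta>(1) by simp
    also have "\<dots> = Q v + (\<Sum>j\<in>Basis. (P v \<bullet> j) *\<^sub>R S j z0)"
    proof -
      have "superpose (S j) (const_bcontfun z0) = const_bcontfun (S j z0)" for j
        by (rule bcontfun_eqI) (simp add: superpose_apply[OF smooth_on_continuous[OF smS]])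
      then show ?thesis
        by (simp add: u_def flow_source_def \<zeta>0 sum_bcontfun_apply integral_curve_apply unit_clamp_def)
    qed
    also have "\<dots> = v"
      using R_rep[OF V(2), of "P v"] r(1) by (simp add: SR R0 P(2) Q_def)
    finally show "frechet_derivative \<Phi> (at 0) v = v" .
  next
    fix w v :: 'e assume w: "w \<in> ball 0 \<delta>" and v: "P v = v"
    have w0: "w \<in> ball 0 \<delta>0" using w \<delta> by blast
    let ?Z = "\<zeta> w"
    \<comment> \<open>Clamping the factor \<open>t\<close> keeps the curve bounded and constant
      outside the unit interval, like the integral terms it is compared with.\<close>
    define u0 where "u0 t = unit_clamp t *\<^sub>R R v (?Z t)" for t
    have cont_RZ: "continuous_on UNIV (\<lambda>t. R v (?Z t))"
      by (rule continuous_on_compose2[OF smooth_on_continuous[OF smooth[of v]]]) (use near[OF w] inV in auto)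
    have cont_u0: "continuous_on UNIV u0"
      unfolding u0_def unit_clamp_def by (intro continuous_intros cont_RZ)
    have u0_clamp: "u0 (unit_clamp t) = u0 t" for t
      using flow_curve_constant[OF fp[OF w0], of t] by (simp add: u0_def unit_clamp_def)
    have "compact (u0 ` {0..1})" by (intro compact_continuous_image continuous_on_subset[OF cont_u0]) auto
    moreover have "u0 t \<in> u0 ` {0..1}" for t
      by (subst u0_clamp[symmetric], rule imageI) (simp add: unit_clamp_def)
    ultimately have "bounded (range u0)"
      by (metis bounded_subset compact_imp_bounded image_subsetI)
    define U where "U = Bcontfun u0"
    have U: "U t = unit_clamp t *\<^sub>R R v (?Z t)" for t
      by (simp add: U_def apply_Bcontfun[OF cont_u0 \<open>bounded (range u0)\<close>] u0_def)
    define rhs where "rhs = flow_source P Q S v ?Z + flow_linearisation P S w ?Z U"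
    have derZ: "(?Z has_vector_derivative R w (?Z t)) (at t within {0..1})" if t: "t \<in> {0..1}" for t
    proof -
      have "((\<lambda>t. (z0 + Q w) + (\<Sum>j\<in>Basis. (P w \<bullet> j) *\<^sub>R integral_curve (superpose (S j) ?Z) t))
          has_vector_derivative 0 + (\<Sum>j\<in>Basis. (P w \<bullet> j) *\<^sub>R superpose (S j) ?Z t)) (at t within {0..1})"
        by (intro has_vector_derivative_add has_vector_derivative_const has_vector_derivative_sum
            bounded_linear.has_vector_derivative[OF bounded_linear_scaleR_right] integral_curve_deriv t)
      moreover have "(\<lambda>t. (z0 + Q w) + (\<Sum>j\<in>Basis. (P w \<bullet> j) *\<^sub>R integral_curve (superpose (S j) ?Z) t)) = ?Z"
        by (subst (2) fp[OF w0]) (simp add: flow_map_def sum_bcontfun_apply fun_eq_iff)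
      moreover have "0 + (\<Sum>j\<in>Basis. (P w \<bullet> j) *\<^sub>R superpose (S j) ?Z t) = R w (?Z t)"
        using R_rep[OF inV[OF near[OF w]], of "P w" t] RP[OF inV[OF near[OF w]], of w t]
        by (simp add: superpose_apply[OF smooth_on_continuous[OF smS]] SR[OF near[OF w]])
      ultimately show ?thesis by simp
    qed
    let ?D = "\<lambda>v z. frechet_derivative (R v) (at z)"
    have der_lhs: "(U has_vector_derivative R v (?Z t) + t *\<^sub>R ?D v (?Z t) (R w (?Z t))) (at t within {0..1})"
      if t: "t \<in> {0..1}" for t
    proof -
      have "((\<lambda>t. R v (?Z t)) has_derivative (\<lambda>h. ?D v (?Z t) (h *\<^sub>R R w (?Z t)))) (at t within {0..1})"
        by (rule has_derivative_compose[OF derZ[OF t, unfolded has_vector_derivative_def] derR[OF inV[OF near[OF w]]]])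
      then have "((\<lambda>t. R v (?Z t)) has_vector_derivative ?D v (?Z t) (R w (?Z t))) (at t within {0..1})"
        unfolding has_vector_derivative_def
        by (simp add: linear_scale[OF has_derivative_linear[OF derR[OF inV[OF near[OF w]]]]])
      from has_vector_derivative_scaleR[OF DERIV_ident this]
      have "((\<lambda>t. t *\<^sub>R R v (?Z t)) has_vector_derivative R v (?Z t) + t *\<^sub>R ?D v (?Z t) (R w (?Z t))) (at t within {0..1})"
        by (simp add: add.commute)
      then show ?thesis
        by (rule has_vector_derivative_transform[rotated 2]) (use t in \<open>auto simp: U unit_clamp_def\<close>)
    qed
    have der_rhs: "(rhs has_vector_derivative R v (?Z t) + t *\<^sub>R ?D w (?Z t) (R v (?Z t))) (at t within {0..1})"
      if t: "t \<in> {0..1}" for t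
    proof -
      let ?c = "\<lambda>j. \<Sum>i\<in>Basis. component_mult i U (superpose (\<lambda>z. frechet_derivative (S j) (at z) i) ?Z)"
      have "((\<lambda>t. Q v + (\<Sum>j\<in>Basis. (P v \<bullet> j) *\<^sub>R integral_curve (superpose (S j) ?Z) t)
            + (\<Sum>j\<in>Basis. (P w \<bullet> j) *\<^sub>R integral_curve (?c j) t)) has_vector_derivative
          0 + (\<Sum>j\<in>Basis. (P v \<bullet> j) *\<^sub>R superpose (S j) ?Z t) + (\<Sum>j\<in>Basis. (P w \<bullet> j) *\<^sub>R ?c j t)) (at t within {0..1})"
        by (intro has_vector_derivative_add has_vector_derivative_const has_vector_derivative_sum
            bounded_linear.has_vector_derivative[OF bounded_linear_scaleR_right] integral_curve_deriv t)
      moreover have "(\<lambda>t. Q v + (\<Sum>j\<in>Basis. (P v \<bullet> j) *\<^sub>R integral_curve (superpose (S j) ?Z) t)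
            + (\<Sum>j\<in>Basis. (P w \<bullet> j) *\<^sub>R integral_curve (?c j) t)) = rhs"
        by (simp add: rhs_def flow_source_def flow_linearisation_def sum_bcontfun_apply fun_eq_iff)
      moreover have "(\<Sum>j\<in>Basis. (P v \<bullet> j) *\<^sub>R superpose (S j) ?Z t) = R v (?Z t)"
        using R_rep[OF inV[OF near[OF w]], of v t]
        by (simp add: superpose_apply[OF smooth_on_continuous[OF smS]] SR[OF near[OF w]] v)
      moreover have "(\<Sum>j\<in>Basis. (P w \<bullet> j) *\<^sub>R ?c j t) = t *\<^sub>R ?D w (?Z t) (R v (?Z t))"
      proof -
        have "?c j t = ?D j (?Z t) (U t)" for j
          using frechet_derivative_linear_rep[OF smooth_on_differentiable[OF smooth inV[OF near[OF w]]], of j t "U t"]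
          by (simp add: sum_bcontfun_apply component_mult_apply
              superpose_apply[OF smooth_on_continuous[OF smooth_on_derivative[OF smS]]] derS[OF near[OF w]])
        then have "(\<Sum>j\<in>Basis. (P w \<bullet> j) *\<^sub>R ?c j t) = ?D (P w) (?Z t) (U t)"
          using DR_rep[OF inV[OF near[OF w]], of "P w" t] by simp
        also have "?D (P w) (?Z t) = ?D w (?Z t)"
        proof -
          have "(R (P w) has_derivative ?D w (?Z t)) (at (?Z t))"
            by (rule has_derivative_transform_within_open[OF derR V(1)]) (use RP near[OF w] inV in auto)
          from frechet_derivative_at[OF this] show ?thesis by (rule sym)
        qed
        also have "?D w (?Z t) (U t) = t *\<^sub>R ?D w (?Z t) (R v (?Z t))"
          using t by (simp add: U unit_clamp_def linear_scale[OF has_derivative_linear[OF derR[OF inV[OF near[OF w]]]]])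
        finally show ?thesis .
      qed
      ultimately show ?thesis by simp
    qed
    \<comment> \<open>The derivatives of the two sides contain \<open>?D v\<close> applied to
      \<open>R w\<close> and \<open>?D w\<close> applied to \<open>R v\<close>, equal by
      commutation; at time 0 both sides vanish because \<open>P v = v\<close>.\<close>
    have "((\<lambda>t. U t - rhs t) has_vector_derivative 0) (at t within {0..1})" if t: "t \<in> {0..1}" for t
      using has_vector_derivative_diff[OF der_lhs[OF t] der_rhs[OF t]]
        comm[OF inV[OF near[OF w]], of v t w] by simp
    then obtain c where c: "\<And>t. t \<in> {0..1} \<Longrightarrow> U t - rhs t = c"
      using has_vector_derivative_zero_constant[of "{0..1::real}" "\<lambda>t. U t - rhs t"] by auto
    have "Q v = 0" by (simp add: Q_def v)
    then have "U 0 - rhs 0 = 0"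
      by (simp add: U rhs_def flow_source_def flow_linearisation_def sum_bcontfun_apply
          integral_curve_apply unit_clamp_def)
    then have "U t = rhs t" if "t \<in> {0..1}" for t using c[of 0] c[OF that] by simp
    moreover have "U (unit_clamp t) = U t" "rhs (unit_clamp t) = rhs t" for t
      using u0_clamp[of t] flow_curve_constant[OF fp[OF w0], of t]
      by (simp_all add: U rhs_def flow_source_def flow_linearisation_def sum_bcontfun_apply
          integral_curve_apply unit_clamp_def)
    ultimately have "U = rhs"
      by (intro bcontfun_eqI) (metis atLeastAtMost_iff max.bounded_iff max.cobounded1 min.cobounded1 unit_clamp_def zero_le_one)
    then have "U = frechet_derivative \<zeta> (at w) v"
      by (intro D\<zeta> w0) (unfold rhs_def[symmetric])
    then show "frechet_derivative \<Phi> (at w) v = R v (\<Phi> w)"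
      using D\<Phi>[OF w, of v] U[of 1] by (simp add: \<Phi>_def unit_clamp_def)
  qed
qed


section \<open>The smooth inverse function theorem\<close>

text \<open>The C1 theorem supplies the inverse \<open>g\<close>. Its derivative
  \<open>x = g' y v\<close> solves \<open>x = v + (id_blinfun - f' (g y)) x\<close>; on a ball where
  \<open>f'\<close> is within 1/2 of the identity, \<open>td_linear_fixed_point\<close> raises the
  order of \<open>g\<close> step by step.\<close>

lemma smooth_inverse_function:
  fixes \<Phi> :: "'e::euclidean_space \<Rightarrow> 'e"
  assumes W: "open W" "w0 \<in> W" and smooth: "smooth_on W \<Phi>"
    and id: "\<And>v. frechet_derivative \<Phi> (at w0) v = v"
  obtains \<epsilon> where "\<epsilon> > 0" "ball w0 \<epsilon> \<subseteq> W" "inj_on \<Phi> (ball w0 \<epsilon>)" "open (\<Phi> ` ball w0 \<epsilon>)"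
    "smooth_on (\<Phi> ` ball w0 \<epsilon>) (inv_into (ball w0 \<epsilon>) \<Phi>)"
proof -
  \<comment> \<open>Assembling the derivative from partial derivatives makes it smooth as an
    operator-valued map.\<close>
  define f' :: "'e \<Rightarrow> 'e \<Rightarrow>\<^sub>L 'e" where
    "f' w = (\<Sum>i\<in>Basis. blinfun_scaleR_left (frechet_derivative \<Phi> (at w) i) o\<^sub>L blinfun_inner_left i)" for w
  have f': "f' w v = frechet_derivative \<Phi> (at w) v" if "w \<in> W" for w v
    using frechet_derivative_linear_rep[OF smooth_on_differentiable[OF smooth that], of v]
    by (simp add: f'_def blinfun.sum_left)
  have f'_eq: "blinfun_apply (f' w) = frechet_derivative \<Phi> (at w)" if "w \<in> W" for w
    using f'[OF that] by (rule ext)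
  have sm_f': "smooth_on W f'"
    unfolding f'_def
    by (intro smooth_on_sum smooth_on_bilinear[OF bounded_bilinear_blinfun_compose] smooth_on_const
        smooth_on_linear_compose[OF bounded_linear_blinfun_scaleR_left] smooth_on_derivative smooth W)
  have der: "(\<Phi> has_derivative f' w) (at w)" if "w \<in> W" for w
    using smooth_on_has_derivative[OF smooth that] by (simp add: f'_eq[OF that])
  have "f' w0 = id_blinfun" by (rule blinfun_eqI) (simp add: f'[OF W(2)] id)
  then have inv: "id_blinfun o\<^sub>L f' w0 = id_blinfun" by (simp add: blinfun_eqI)
  obtain U V g g' where U: "open U" "U \<subseteq> W" "w0 \<in> U" and V: "open V" "homeomorphism U V \<Phi> g"
    and g: "\<And>y. y \<in> V \<Longrightarrow> (g has_derivative (g' y)) (at y)"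
      "\<And>y. y \<in> V \<Longrightarrow> g' y = inv (blinfun_apply (f'(g y)))"
      "\<And>y. y \<in> V \<Longrightarrow> bij (blinfun_apply (f'(g y)))"
    by (rule inverse_function_theorem[OF W(1) der smooth_on_continuous[OF sm_f'] W(2) inv])
      (assumption, (rule that; assumption))
  have hom: "\<And>x. x \<in> U \<Longrightarrow> g (\<Phi> x) = x" "\<And>y. y \<in> V \<Longrightarrow> \<Phi> (g y) = y" "\<Phi> ` U = V" "g ` V = U"
    "continuous_on V g" using V(2) by (auto simp: homeomorphism_def)
  have "continuous (at w0) f'"
    using smooth_on_continuous[OF sm_f'] W by (simp add: continuous_on_eq_continuous_at)
  then obtain d where d: "d > 0" "\<And>w. dist w w0 < d \<Longrightarrow> dist (f' w) (f' w0) < 1 / 2"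
    unfolding continuous_at_eps_delta by (metis half_gt_zero_iff zero_less_one)
  obtain e where e: "e > 0" "ball w0 e \<subseteq> U" using U open_contains_ball by blast
  define \<epsilon> where "\<epsilon> = min d e"
  let ?B = "ball w0 \<epsilon>"
  have "\<epsilon> > 0" using d e by (simp add: \<epsilon>_def)
  have BU: "?B \<subseteq> U" using e by (auto simp: \<epsilon>_def)
  have inj: "inj_on \<Phi> ?B" by (rule inj_on_inverseI[of _ g]) (use hom(1) BU in blast)
  have img: "\<Phi> ` ?B = g -` ?B \<inter> V"
    using hom(1-4) BU by (auto simp: image_iff subset_iff)
  have op: "open (\<Phi> ` ?B)" unfolding img
    by (metis Int_commute continuous_on_open_vimage hom(5) V(1) open_ball)
  have g_img: "g ` (\<Phi> ` ?B) \<subseteq> ?B" unfolding img by auto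
  have imgV: "\<Phi> ` ?B \<subseteq> V" unfolding img by auto
  have le: "norm (id_blinfun - f' (g y)) \<le> 1 / 2" if "y \<in> \<Phi> ` ?B" for y
  proof -
    have "g y \<in> ?B" using g_img that by blast
    then have "dist (f' (g y)) (f' w0) < 1 / 2"
      by (intro d(2)) (auto simp: \<epsilon>_def dist_commute)
    then show ?thesis using \<open>f' w0 = id_blinfun\<close> by (simp add: dist_norm norm_minus_commute)
  qed
  have "td n (\<Phi> ` ?B) g" for n
  proof (induction n)
    case 0
    show ?case using hom(5) imgV by (auto intro: continuous_on_subset)
  next
    case (Suc n)
    have "td n (\<Phi> ` ?B) (\<lambda>y. g' y v)" for v
    proof (rule td_linear_fixed_point[OF op _ _ le])
      have "td n (\<Phi> ` ?B) (\<lambda>y. f' (g y))"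
        by (rule td_compose[OF op W(1) _ Suc.IH smooth_on_td[OF sm_f']]) (use g_img BU U(2) in blast)
      then have "td n (\<Phi> ` ?B) (\<lambda>y. id_blinfun + - f' (g y))"
        by (intro td_add op td_const td_linear_compose[OF bounded_linear_minus[OF bounded_linear_ident]])
      then show "td n (\<Phi> ` ?B) (\<lambda>y. id_blinfun - f' (g y))" by simp
      show "td n (\<Phi> ` ?B) (\<lambda>y. v)" by (rule td_const[OF op])
      fix y assume "y \<in> \<Phi> ` ?B"
      then have "y \<in> V" using imgV by blast
      then have "f' (g y) (g' y v) = v" using g(2,3) by (simp add: bij_is_surj surj_f_inv_f)
      then show "g' y v = v + (id_blinfun - f' (g y)) (g' y v)" by (simp add: blinfun.diff_left)
    qed
    then show ?case using td_Suc_iff[OF op g(1)] imgV by blast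
  qed
  moreover have "g y = inv_into ?B \<Phi> y" if "y \<in> \<Phi> ` ?B" for y
    using that inj g_img imgV hom(2) by (metis f_inv_into_f image_subset_iff inj_on_eq_iff inv_into_into subset_iff)
  ultimately have "smooth_on (\<Phi> ` ?B) (inv_into ?B \<Phi>)"
    using smooth_on_cong[OF op, of g "inv_into ?B \<Phi>"] by (simp add: smooth_on_def)
  then show thesis using that[of \<epsilon>] \<open>\<epsilon> > 0\<close> BU U(2) inj op by blast
qed

section \<open>Smooth frames\<close>

text \<open>A biorthogonal family: a witness of linear independence that can be chosen smoothly. The
  vectors \<open>b i\<close> may lie outside the span of the \<open>x j\<close>.\<close>

definition dual_family :: "nat \<Rightarrow> (nat \<Rightarrow> 'b::real_inner) \<Rightarrow> (nat \<Rightarrow> 'b) \<Rightarrow> bool" where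
  "dual_family k x b \<longleftrightarrow> (\<forall>i<k. \<forall>j<k. x j \<bullet> b i = (if i = j then 1 else 0))"

lemma dual_familyD: "dual_family k x b \<Longrightarrow> i < k \<Longrightarrow> j < k \<Longrightarrow> x j \<bullet> b i = (if i = j then 1 else 0)"
  by (simp add: dual_family_def)

lemma dual_family_coefficient:
  assumes "dual_family k x b" "i < k"
  shows "(\<Sum>j<k. c j *\<^sub>R x j) \<bullet> b i = c i"
proof -
  have "(\<Sum>j<k. c j *\<^sub>R x j) \<bullet> b i = (\<Sum>j<k. if j = i then c j else 0)"
    unfolding inner_sum_left using assms by (intro sum.cong) (auto simp: dual_familyD)
  then show ?thesis using assms by simp
qed

lemma span_family: "span (x ` {..<k::nat}) = {\<Sum>j<k. c j *\<^sub>R x j | c. True}"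
proof (induction k)
  case (Suc k)
  have "span (x ` {..<Suc k}) = {v. \<exists>c. v - c *\<^sub>R x k \<in> span (x ` {..<k})}"
    by (simp add: lessThan_Suc span_insert)
  also have "\<dots> = {\<Sum>j<Suc k. c j *\<^sub>R x j | c. True}"
  proof (safe)
    fix v c assume "v - c *\<^sub>R x k \<in> span (x ` {..<k})"
    then obtain d where d: "v - c *\<^sub>R x k = (\<Sum>j<k. d j *\<^sub>R x j)" unfolding Suc by blast
    have "v = (\<Sum>j<Suc k. (d(k := c)) j *\<^sub>R x j)" using d by (simp add: algebra_simps)
    then show "\<exists>c. v = (\<Sum>j<Suc k. c j *\<^sub>R x j) \<and> True" by blast
  next
    fix c :: "nat \<Rightarrow> real"
    have "(\<Sum>j<Suc k. c j *\<^sub>R x j) - c k *\<^sub>R x k \<in> span (x ` {..<k})" unfolding Suc by auto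
    then show "\<exists>d. (\<Sum>j<Suc k. c j *\<^sub>R x j) - d *\<^sub>R x k \<in> span (x ` {..<k})" by blast
  qed
  finally show ?case .
qed simp

lemma sum_in_span_family: "(\<Sum>j<k. c j *\<^sub>R x j) \<in> span (x ` {..<k::nat})"
  by (intro span_sum span_scale span_base) auto

lemma in_span_familyE:
  assumes "v \<in> span (x ` {..<k::nat})"
  obtains c where "v = (\<Sum>j<k. c j *\<^sub>R x j)"
  using assms unfolding span_family by blast

text \<open>Membership in the span becomes an equation that is continuous in all data.\<close>

lemma dual_family_span_iff:
  assumes "dual_family k x b"
  shows "u \<in> span (x ` {..<k}) \<longleftrightarrow> u = (\<Sum>i<k. (u \<bullet> b i) *\<^sub>R x i)"
proof
  assume "u \<in> span (x ` {..<k})"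
  then obtain c where "u = (\<Sum>j<k. c j *\<^sub>R x j)" unfolding span_family by blast
  then show "u = (\<Sum>i<k. (u \<bullet> b i) *\<^sub>R x i)" using dual_family_coefficient[OF assms] by simp
qed (auto simp: span_family)

text \<open>Dimension \<open>k\<close> for a family of length \<open>k\<close> records injectivity
  and independence at once; frames are stated in this way throughout.\<close>

lemma dim_family_Suc:
  fixes x :: "nat \<Rightarrow> 'b::euclidean_space"
  shows "dim (x ` {..<Suc k}) = Suc k \<longleftrightarrow> dim (x ` {..<k}) = k \<and> x k \<notin> span (x ` {..<k})"
proof -
  have "dim (x ` {..<k}) \<le> k" using dim_le_card'[of "x ` {..<k}"] card_image_le[of "{..<k}" x] by simp
  then show ?thesis by (auto simp: lessThan_Suc dim_insert)
qed

lemma dual_family_dim: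
  fixes x :: "nat \<Rightarrow> 'b::euclidean_space"
  shows "dual_family k x b \<Longrightarrow> dim (x ` {..<k}) = k"
proof (induction k)
  case (Suc k)
  have d: "dual_family k x b" using Suc.prems by (simp add: dual_family_def)
  have "x k \<notin> span (x ` {..<k})"
  proof
    assume "x k \<in> span (x ` {..<k})"
    then have "x k = (\<Sum>i<k. (x k \<bullet> b i) *\<^sub>R x i)" using dual_family_span_iff[OF d] by blast
    also have "\<dots> = 0" using Suc.prems by (intro sum.neutral) (auto simp: dual_familyD)
    finally show False using dual_familyD[OF Suc.prems, of k k] by simp
  qed
  then show ?case using Suc.IH[OF d] by (simp only: dim_family_Suc simp_thms)
qed simp

text \<open>Independence at one point persists nearby: the dual family is extended by one vector at
  a time, as in the Gram-Schmidt process, dividing only by the squared length of a residue.\<close>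

lemma smooth_dual_family:
  fixes X :: "nat \<Rightarrow> 'e::euclidean_space \<Rightarrow> 'b::euclidean_space"
  assumes "open V" "z0 \<in> V" "\<And>i. i < k \<Longrightarrow> smooth_on V (X i)" "dim ((\<lambda>i. X i z0) ` {..<k}) = k"
  shows "\<exists>U b. open U \<and> z0 \<in> U \<and> U \<subseteq> V \<and> (\<forall>i<k. smooth_on U (b i)) \<and>
    (\<forall>z\<in>U. dual_family k (\<lambda>i. X i z) (\<lambda>i. b i z))"
  using assms(3,4)
proof (induction k)
  case 0
  then show ?case using assms by (auto simp: dual_family_def)
next
  case (Suc k)
  have k: "dim ((\<lambda>i. X i z0) ` {..<k}) = k" "X k z0 \<notin> span ((\<lambda>i. X i z0) ` {..<k})"
    using Suc.prems(2) unfolding dim_family_Suc by auto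
  have "\<exists>U b. open U \<and> z0 \<in> U \<and> U \<subseteq> V \<and> (\<forall>i<k. smooth_on U (b i)) \<and>
      (\<forall>z\<in>U. dual_family k (\<lambda>i. X i z) (\<lambda>i. b i z))"
    by (rule Suc.IH) (use Suc.prems(1) k(1) in auto)
  then obtain U b where U: "open U" "z0 \<in> U" "U \<subseteq> V"
    and b: "\<And>i. i < k \<Longrightarrow> smooth_on U (b i)"
    and dual: "\<And>z. z \<in> U \<Longrightarrow> dual_family k (\<lambda>i. X i z) (\<lambda>i. b i z)" by blast
  have X: "smooth_on U (X i)" if "i < Suc k" for i
    using Suc.prems(1)[OF that] U(3) smooth_on_subset by blast
  \<comment> \<open>The part of \<open>X k\<close> that its expansion in the earlier vectors misses;
    it is nonzero at \<open>z0\<close> by independence, hence nearby.\<close>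
  define Z where "Z z = X k z - (\<Sum>i<k. (X k z \<bullet> b i z) *\<^sub>R X i z)" for z
  have smZ: "smooth_on U Z"
    unfolding Z_def
    by (intro smooth_on_diff smooth_on_sum smooth_on_scaleR smooth_on_inner U(1) X b) auto
  define U' where "U' = U \<inter> Z -` (- {0})"
  have U': "open U'" "U' \<subseteq> U" unfolding U'_def
    using continuous_open_preimage[OF smooth_on_continuous[OF smZ] U(1), of "- {0}"] by auto
  have "Z z0 \<noteq> 0"
    using dual_family_span_iff[OF dual[OF U(2)], of "X k z0"] k(2) by (auto simp: Z_def)
  then have z0: "z0 \<in> U'" using U(2) by (simp add: U'_def)
  \<comment> \<open>The subtraction makes \<open>w\<close> orthogonal to the earlier vectors, the
    scaling gives it inner product 1 with \<open>X k\<close>.\<close>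
  define w where "w z = (1 / (Z z \<bullet> Z z)) *\<^sub>R (Z z - (\<Sum>i<k. (X i z \<bullet> Z z) *\<^sub>R b i z))" for z
  have smw: "smooth_on U' w"
    unfolding w_def
    by (intro smooth_on_diff smooth_on_sum smooth_on_scaleR smooth_on_inner smooth_on_divide smooth_on_const
        U' smooth_on_subset[OF X U'(2)] smooth_on_subset[OF b U'(2)] smooth_on_subset[OF smZ U'(2)])
      (auto simp: U'_def)
  define b' where "b' i z = (if i = k then w z else b i z - (X k z \<bullet> b i z) *\<^sub>R w z)" for i z
  have "smooth_on U' (b' i)" if "i < Suc k" for i
  proof (cases "i = k")
    case True
    then have "b' i = w" by (auto simp: b'_def)
    then show ?thesis using smw by simp
  next
    case False
    then have "b' i = (\<lambda>z. b i z - (X k z \<bullet> b i z) *\<^sub>R w z)" by (auto simp: b'_def)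
    moreover have "smooth_on U' \<dots>"
      using that False
      by (intro smooth_on_diff smooth_on_scaleR smooth_on_inner U'(1) smw
          smooth_on_subset[OF X U'(2)] smooth_on_subset[OF b U'(2)]) auto
    ultimately show ?thesis by simp
  qed
  moreover have "dual_family (Suc k) (\<lambda>i. X i z) (\<lambda>i. b' i z)" if z: "z \<in> U'" for z
  proof -
    have d: "dual_family k (\<lambda>i. X i z) (\<lambda>i. b i z)" and nz: "Z z \<noteq> 0"
      using z dual U' by (auto simp: U'_def)
    have wX: "X j z \<bullet> w z = 0" if "j < k" for j
    proof -
      have "X j z \<bullet> (\<Sum>i<k. (X i z \<bullet> Z z) *\<^sub>R b i z) = (\<Sum>i<k. if i = j then X i z \<bullet> Z z else 0)"
        unfolding inner_sum_right using that by (intro sum.cong) (auto simp: dual_familyD[OF d])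
      then show ?thesis using that by (simp add: w_def inner_diff_right)
    qed
    have "X k z \<bullet> (Z z - (\<Sum>i<k. (X i z \<bullet> Z z) *\<^sub>R b i z)) = Z z \<bullet> Z z"
      by (subst (3) Z_def) (simp add: inner_diff_left inner_diff_right inner_sum_left inner_sum_right mult.commute)
    then have wk: "X k z \<bullet> w z = 1" using nz by (simp add: w_def)
    show ?thesis
      unfolding dual_family_def
    proof (intro allI impI)
      fix i j assume ij: "i < Suc k" "j < Suc k"
      show "X j z \<bullet> b' i z = (if i = j then 1 else 0)"
        using ij wX wk
        by (cases "i = k"; cases "j = k") (auto simp: b'_def inner_diff_right dual_familyD[OF d])
    qed
  qed
  moreover have "U' \<subseteq> V" using U' U by blast
  ultimately show ?case using U'(1) z0 by blast
qed

lemma smooth_dual_familyE: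
  fixes X :: "nat \<Rightarrow> 'e::euclidean_space \<Rightarrow> 'b::euclidean_space"
  assumes "open V" "z0 \<in> V" "\<And>i. i < k \<Longrightarrow> smooth_on V (X i)" "dim ((\<lambda>i. X i z0) ` {..<k}) = k"
  obtains U b where "open U" "z0 \<in> U" "U \<subseteq> V" "\<And>i. i < k \<Longrightarrow> smooth_on U (b i)"
    "\<And>z. z \<in> U \<Longrightarrow> dual_family k (\<lambda>i. X i z) (\<lambda>i. b i z)"
proof -
  have "\<exists>U b. open U \<and> z0 \<in> U \<and> U \<subseteq> V \<and> (\<forall>i<k. smooth_on U (b i)) \<and>
      (\<forall>z\<in>U. dual_family k (\<lambda>i. X i z) (\<lambda>i. b i z))"
    by (rule smooth_dual_family) (use assms in auto)
  then obtain U b where "open U" "z0 \<in> U" "U \<subseteq> V" "\<forall>i<k. smooth_on U (b i)"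
      "\<forall>z\<in>U. dual_family k (\<lambda>i. X i z) (\<lambda>i. b i z)"
    by blast
  then show thesis by (intro that[of U b]) auto
qed

lemma smooth_family_open:
  fixes X :: "nat \<Rightarrow> 'e::euclidean_space \<Rightarrow> 'b::euclidean_space"
  assumes "open V" "z0 \<in> V" "\<And>i. i < k \<Longrightarrow> smooth_on V (X i)" "dim ((\<lambda>i. X i z0) ` {..<k}) = k"
  shows "\<exists>U. open U \<and> z0 \<in> U \<and> U \<subseteq> V \<and> (\<forall>z\<in>U. dim ((\<lambda>i. X i z) ` {..<k}) = k)"
proof -
  obtain U b where U: "open U" "z0 \<in> U" "U \<subseteq> V"
    and d: "\<And>z. z \<in> U \<Longrightarrow> dual_family k (\<lambda>i. X i z) (\<lambda>i. b i z)"
    by (rule smooth_dual_familyE[OF assms]) (assumption, (rule that; assumption))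
  show ?thesis using U dual_family_dim[OF d] by blast
qed

text \<open>The coefficients are inner products of \<open>Y\<close> with a smooth dual family, hence
  smooth even when \<open>g\<close> was obtained by pointwise choice.\<close>

lemma smooth_coefficients:
  fixes X :: "nat \<Rightarrow> 'e::euclidean_space \<Rightarrow> 'b::euclidean_space"
  assumes V: "open V" and X: "\<And>i. i < k \<Longrightarrow> smooth_on V (X i)"
    and dim: "\<And>z. z \<in> V \<Longrightarrow> dim ((\<lambda>i. X i z) ` {..<k}) = k"
    and Y: "smooth_on V Y" "\<And>z. z \<in> V \<Longrightarrow> Y z = (\<Sum>i<k. g i z *\<^sub>R X i z)" and i: "i < k"
  shows "smooth_on V (g i)"
proof (rule smooth_on_local)
  fix z0 assume z0: "z0 \<in> V"
  obtain U b where U: "open U" "z0 \<in> U" "U \<subseteq> V" and b: "\<And>i. i < k \<Longrightarrow> smooth_on U (b i)"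
    and d: "\<And>z. z \<in> U \<Longrightarrow> dual_family k (\<lambda>i. X i z) (\<lambda>i. b i z)"
    by (rule smooth_dual_familyE[OF V z0 X dim[OF z0]]) (assumption, (rule that; assumption))
  have "g i z = Y z \<bullet> b i z" if "z \<in> U" for z
    using Y(2)[of z] dual_family_coefficient[OF d[OF that] i] U(3) that by auto
  moreover have "smooth_on U (\<lambda>z. Y z \<bullet> b i z)"
    by (intro smooth_on_inner U(1) b i smooth_on_subset[OF Y(1) U(3)])
  ultimately have "smooth_on U (g i)"
    using smooth_on_cong[OF U(1), of "g i" "\<lambda>z. Y z \<bullet> b i z"] by simp
  then show "\<exists>U. open U \<and> z0 \<in> U \<and> smooth_on U (g i)" using U by blast
qed

text \<open>The residue of \<open>Y\<close> after expansion along a dual family is continuous and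
  vanishes exactly when \<open>Y\<close> lies in the span. Inclusions known at regular points reach
  the singular ones through this.\<close>

lemma in_span_closed:
  fixes X :: "nat \<Rightarrow> 'e::euclidean_space \<Rightarrow> 'b::euclidean_space"
  assumes V: "open V" "z0 \<in> V" and X: "\<And>i. i < k \<Longrightarrow> smooth_on V (X i)"
    and dim: "dim ((\<lambda>i. X i z0) ` {..<k}) = k"
    and Y: "continuous_on V Y" and clo: "z0 \<in> closure {z \<in> V. Y z \<in> span ((\<lambda>i. X i z) ` {..<k})}"
  shows "Y z0 \<in> span ((\<lambda>i. X i z0) ` {..<k})"
proof -
  obtain U b where U: "open U" "z0 \<in> U" "U \<subseteq> V" and b: "\<And>i. i < k \<Longrightarrow> smooth_on U (b i)"
    and d: "\<And>z. z \<in> U \<Longrightarrow> dual_family k (\<lambda>i. X i z) (\<lambda>i. b i z)"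
    by (rule smooth_dual_familyE[OF V X dim]) (assumption, (rule that; assumption))
  define F where "F z = Y z - (\<Sum>i<k. (Y z \<bullet> b i z) *\<^sub>R X i z)" for z
  have F: "F z = 0 \<longleftrightarrow> Y z \<in> span ((\<lambda>i. X i z) ` {..<k})" if "z \<in> U" for z
    using dual_family_span_iff[OF d[OF that], of "Y z"] by (simp add: F_def)
  have "continuous_on U F"
    unfolding F_def
    using smooth_on_continuous[OF b] smooth_on_continuous[OF X] U(3) Y
    by (intro continuous_intros) (auto intro: continuous_on_subset)
  then have op: "open (U \<inter> F -` (- {0}))" by (rule continuous_open_preimage[OF _ U(1)]) auto
  show ?thesis
  proof (rule ccontr)
    assume "Y z0 \<notin> span ((\<lambda>i. X i z0) ` {..<k})"
    then have "z0 \<in> U \<inter> F -` (- {0})" using F U(2) by auto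
    then have "(U \<inter> F -` (- {0})) \<inter> {z \<in> V. Y z \<in> span ((\<lambda>i. X i z) ` {..<k})} \<noteq> {}"
      using clo open_Int_closure_eq_empty[OF op] by blast
    then show False using F by auto
  qed
qed

section \<open>Involutive distributions in Euclidean space\<close>

definition smooth_distribution_on :: "nat \<Rightarrow> 'e::euclidean_space set \<Rightarrow> ('e \<Rightarrow> 'e set) \<Rightarrow> bool" where
  "smooth_distribution_on k V \<Delta> \<longleftrightarrow> (\<forall>z\<in>V. \<exists>U X. open U \<and> z \<in> U \<and> U \<subseteq> V \<and>
     (\<forall>i<k. smooth_on U (X i)) \<and>
     (\<forall>y\<in>U. \<Delta> y = span ((\<lambda>i. X i y) ` {..<k}) \<and> dim ((\<lambda>i. X i y) ` {..<k}) = k))"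

definition involutive_on :: "'e::euclidean_space set \<Rightarrow> ('e \<Rightarrow> 'e set) \<Rightarrow> bool" where
  "involutive_on V \<Delta> \<longleftrightarrow> (\<forall>U X Y. open U \<and> U \<subseteq> V \<and> smooth_on U X \<and> smooth_on U Y \<and>
     (\<forall>z\<in>U. X z \<in> \<Delta> z \<and> Y z \<in> \<Delta> z) \<longrightarrow>
     (\<forall>z\<in>U. frechet_derivative Y (at z) (X z) - frechet_derivative X (at z) (Y z) \<in> \<Delta> z))"

text \<open>Fields in \<open>\<Delta>\<close> with constant image under a fixed projection commute,
  and their flow straightens \<open>\<Delta>\<close>: the derivative of \<open>\<Phi>\<close>
  carries one subspace to \<open>\<Delta>\<close> at every point of the box.\<close>

lemma frobenius_box:
  fixes \<Delta> :: "'e::euclidean_space \<Rightarrow> 'e set"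
  assumes V: "open V" "z0 \<in> V" and dist: "smooth_distribution_on k V \<Delta>" and inv: "involutive_on V \<Delta>"
  obtains \<epsilon> \<Phi> where "\<epsilon> > 0" "\<Phi> 0 = z0" "smooth_on (ball 0 \<epsilon>) \<Phi>" "\<Phi> ` ball 0 \<epsilon> \<subseteq> V"
    "inj_on \<Phi> (ball 0 \<epsilon>)" "open (\<Phi> ` ball 0 \<epsilon>)"
    "smooth_on (\<Phi> ` ball 0 \<epsilon>) (inv_into (ball 0 \<epsilon>) \<Phi>)"
    "\<And>w. w \<in> ball 0 \<epsilon> \<Longrightarrow> \<Delta> (\<Phi> w) = frechet_derivative \<Phi> (at w) ` \<Delta> z0"
proof -
  obtain U X where U: "open U" "z0 \<in> U" "U \<subseteq> V" and X: "\<And>i. i < k \<Longrightarrow> smooth_on U (X i)"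
    and \<Delta>: "\<And>y. y \<in> U \<Longrightarrow> \<Delta> y = span ((\<lambda>i. X i y) ` {..<k})"
    and dimX: "\<And>y. y \<in> U \<Longrightarrow> dim ((\<lambda>i. X i y) ` {..<k}) = k"
    using dist V(2) unfolding smooth_distribution_on_def by metis
  obtain b where b: "dual_family k (\<lambda>i. X i z0) b"
    by (rule smooth_dual_familyE[OF U(1,2) X dimX[OF U(2)]]) (assumption, (rule that; assumption))
  \<comment> \<open>The projection onto \<open>\<Delta> z0\<close> along the orthogonal complement
    of the \<open>b i\<close>.\<close>
  define P where "P v = (\<Sum>i<k. (v \<bullet> b i) *\<^sub>R X i z0)" for v
  have P: "bounded_linear P" unfolding P_def
    by (intro bounded_linear_sum bounded_linear_scaleR_left[THEN bounded_linear_compose]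
        bounded_linear_inner_left)
  interpret P: bounded_linear P by (rule P)
  have P_mem: "P v \<in> \<Delta> z0" for v unfolding \<Delta>[OF U(2)] P_def by (rule sum_in_span_family)
  have P_id: "P v = v \<longleftrightarrow> v \<in> \<Delta> z0" for v
    using dual_family_span_iff[OF b, of v] by (auto simp: \<Delta>[OF U(2)] P_def)
  have smPX: "smooth_on U (\<lambda>z. P (X i z))" if "i < k" for i
    by (intro smooth_on_linear_compose[OF P] U X that)
  have X_mem: "X i y \<in> \<Delta> y" if "i < k" "y \<in> U" for i y
    using that by (simp add: \<Delta> span_base)
  have "(\<lambda>i. P (X i z0)) ` {..<k} = (\<lambda>i. X i z0) ` {..<k}"
    using P_id X_mem[OF _ U(2)] by (intro image_cong) auto
  then have dimPX: "dim ((\<lambda>i. P (X i z0)) ` {..<k}) = k" using dimX[OF U(2)] by simp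
  obtain U' c where U': "open U'" "z0 \<in> U'" "U' \<subseteq> U" and c: "\<And>i. i < k \<Longrightarrow> smooth_on U' (c i)"
    and dual: "\<And>z. z \<in> U' \<Longrightarrow> dual_family k (\<lambda>i. P (X i z)) (\<lambda>i. c i z)"
    by (rule smooth_dual_familyE[where X = "\<lambda>i z. P (X i z)", OF U(1,2) smPX dimPX])
      (assumption, (rule that; assumption))
  \<comment> \<open>The field in \<open>\<Delta>\<close> that \<open>P\<close> maps to
    \<open>P v\<close>, unique because \<open>P\<close> is injective on \<open>\<Delta>\<close> near
    \<open>z0\<close>.\<close>
  define R where "R v z = (\<Sum>i<k. (P v \<bullet> c i z) *\<^sub>R X i z)" for v z
  have span_PX: "span ((\<lambda>i. P (X i z)) ` {..<k}) = \<Delta> z0" if z: "z \<in> U'" for z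
  proof (rule subspace_dim_equal)
    show "span ((\<lambda>i. P (X i z)) ` {..<k}) \<subseteq> \<Delta> z0"
      unfolding \<Delta>[OF U(2)] by (rule span_minimal) (use P_mem \<Delta>[OF U(2)] in auto)
    show "dim (\<Delta> z0) \<le> dim (span ((\<lambda>i. P (X i z)) ` {..<k}))"
      using dual_family_dim[OF dual[OF z]] dimX[OF U(2)] by (simp add: \<Delta>[OF U(2)])
  qed (auto simp: \<Delta>[OF U(2)])
  have R_mem: "R v z \<in> \<Delta> z" if "z \<in> U'" for v z
    using that U'(3) unfolding R_def by (subst \<Delta>) (blast, rule sum_in_span_family)
  have PR: "P (R v z) = P v" if z: "z \<in> U'" for v z
  proof -
    have "P (R v z) = (\<Sum>i<k. (P v \<bullet> c i z) *\<^sub>R P (X i z))" by (simp add: R_def P.sum P.scaleR)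
    then show ?thesis using dual_family_span_iff[OF dual[OF z], of "P v"] P_mem span_PX[OF z] by simp
  qed
  have P_inj: "u = 0" if z: "z \<in> U'" and u: "u \<in> \<Delta> z" "P u = 0" for u z
  proof -
    obtain d where d: "u = (\<Sum>i<k. d i *\<^sub>R X i z)"
    proof (rule in_span_familyE)
      show "u \<in> span ((\<lambda>i. X i z) ` {..<k})" using u(1) \<Delta>[of z] z U'(3) by blast
    qed (rule that)
    have "d i = 0" if "i < k" for i
      using dual_family_coefficient[OF dual[OF z] that, of d] u(2) by (simp add: d P.sum P.scaleR)
    then show ?thesis by (simp add: d)
  qed
  have smR: "smooth_on U' (R v)" for v
    unfolding R_def
    by (intro smooth_on_sum smooth_on_scaleR smooth_on_inner smooth_on_const U' c smooth_on_subset[OF X U'(3)]) auto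
  have sub\<Delta>: "subspace (\<Delta> z)" if "z \<in> U'" for z using that U'(3) \<Delta> by auto
  have comm: "frechet_derivative (R v) (at z) (R u z) = frechet_derivative (R u) (at z) (R v z)"
    if z: "z \<in> U'" for z u v
  proof -
    \<comment> \<open>\<open>P (R v z)\<close> does not depend on \<open>z\<close>, so
      \<open>P\<close> kills every derivative of \<open>R v\<close>. The bracket also lies in
      \<open>\<Delta>\<close>, where \<open>P\<close> is injective, and therefore vanishes.\<close>
    have D: "P (frechet_derivative (R v) (at z) x) = 0" for v x
    proof -
      have "((\<lambda>z. P (R v z)) has_derivative (\<lambda>x. P (frechet_derivative (R v) (at z) x))) (at z)"
        by (rule P.has_derivative[OF smooth_on_has_derivative[OF smR z]])
      moreover have "((\<lambda>z. P (R v z)) has_derivative (\<lambda>x. 0)) (at z)"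
        by (rule has_derivative_transform_within_open[OF has_derivative_const U'(1) z]) (simp add: PR)
      ultimately show ?thesis by (metis has_derivative_unique)
    qed
    have "frechet_derivative (R v) (at z) (R u z) - frechet_derivative (R u) (at z) (R v z) \<in> \<Delta> z"
      using inv U U' smR R_mem z unfolding involutive_on_def by (meson order_trans)
    from P_inj[OF z this] show ?thesis by (simp add: P.diff D)
  qed
  have lin: "linear (\<lambda>v. R v z)" for z
    by (rule linearI) (simp_all add: R_def P.add P.scaleR inner_add_left scaleR_add_left sum.distrib scaleR_sum_right)
  have PP: "P (P v) = P v" for v using P_id P_mem by blast
  have R0: "R v z0 = P v" for v
    using PR[OF U'(2), of v] P_id R_mem[OF U'(2)] by metis
  obtain \<delta> \<Phi> where \<Phi>: "\<delta> > 0" "smooth_on (ball 0 \<delta>) \<Phi>" "\<Phi> 0 = z0" "\<Phi> ` ball 0 \<delta> \<subseteq> U'"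
    "\<And>v. frechet_derivative \<Phi> (at 0) v = v"
    "\<And>w v. w \<in> ball 0 \<delta> \<Longrightarrow> P v = v \<Longrightarrow> frechet_derivative \<Phi> (at w) v = R v (\<Phi> w)"
    by (rule frobenius_flow[OF P PP U'(1,2) smR lin _ R0 comm]) (auto simp: R_def PP)
  obtain \<epsilon> where \<epsilon>: "\<epsilon> > 0" "ball 0 \<epsilon> \<subseteq> ball (0::'e) \<delta>" "inj_on \<Phi> (ball 0 \<epsilon>)" "open (\<Phi> ` ball 0 \<epsilon>)"
    "smooth_on (\<Phi> ` ball 0 \<epsilon>) (inv_into (ball 0 \<epsilon>) \<Phi>)"
    by (rule smooth_inverse_function[OF open_ball _ \<Phi>(2), of 0]) (use \<Phi> in auto)
  have img: "\<Delta> (\<Phi> w) = frechet_derivative \<Phi> (at w) ` \<Delta> z0" if w: "w \<in> ball 0 \<epsilon>" for w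
  proof -
    have w': "w \<in> ball 0 \<delta>" using subsetD[OF \<epsilon>(2) w] .
    have z: "\<Phi> w \<in> U'" by (rule subsetD[OF \<Phi>(4) imageI[OF w']])
    have "u \<in> (\<lambda>v. R v (\<Phi> w)) ` \<Delta> z0" if u: "u \<in> \<Delta> (\<Phi> w)" for u
    proof -
      have "u - R (P u) (\<Phi> w) \<in> \<Delta> (\<Phi> w)"
        by (rule subspace_diff[OF sub\<Delta>[OF z] u R_mem[OF z]])
      moreover have "P (u - R (P u) (\<Phi> w)) = 0" by (simp add: P.diff PR[OF z] PP)
      ultimately have "u - R (P u) (\<Phi> w) = 0" by (rule P_inj[OF z])
      then show ?thesis by (intro image_eqI[OF _ P_mem[of u]]) simp
    qed
    moreover have "R v (\<Phi> w) \<in> \<Delta> (\<Phi> w)" for v by (rule R_mem[OF z])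
    ultimately have "\<Delta> (\<Phi> w) = (\<lambda>v. R v (\<Phi> w)) ` \<Delta> z0" by blast
    also have "\<dots> = frechet_derivative \<Phi> (at w) ` \<Delta> z0"
    proof (rule image_cong[OF refl])
      fix v assume "v \<in> \<Delta> z0"
      then show "R v (\<Phi> w) = frechet_derivative \<Phi> (at w) v" using \<Phi>(6)[OF w'] P_id by simp
    qed
    finally show ?thesis .
  qed
  have "\<Phi> ` ball 0 \<epsilon> \<subseteq> V" using \<Phi>(4) \<epsilon>(2) U(3) U'(3) by blast
  from that[OF \<epsilon>(1) \<Phi>(3) smooth_on_subset[OF \<Phi>(2) \<epsilon>(2)] this \<epsilon>(3-5) img] show thesis .
qed

section \<open>Charts\<close>

lemma chart_open: "is_chart c \<Longrightarrow> open (fst c)" "is_chart c \<Longrightarrow> open (snd c ` fst c)"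
  by (auto simp: is_chart_def)

lemma chart_inv_left: "is_chart c \<Longrightarrow> q \<in> fst c \<Longrightarrow> chart_inv c (snd c q) = q"
  by (auto simp: is_chart_def homeomorphism_def)

lemma chart_inv_right: "y \<in> snd c ` fst c \<Longrightarrow> snd c (chart_inv c y) = y"
  by (rule f_inv_into_f)

lemma chart_inv_mem: "y \<in> snd c ` fst c \<Longrightarrow> chart_inv c y \<in> fst c"
  by (rule inv_into_into)

lemma chart_image_open:
  assumes "is_chart c" "open U"
  shows "open (snd c ` (fst c \<inter> U))"
proof -
  have "openin (top_of_set (snd c ` fst c)) (snd c ` (fst c \<inter> U))"
    using assms unfolding is_chart_def by (auto intro!: homeomorphism_imp_open_map)
  then show ?thesis using chart_open(2)[OF assms(1)] openin_open_trans by blast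
qed

lemma chart_preimage_open:
  assumes "is_chart c" "open W"
  shows "open {q \<in> fst c. snd c q \<in> W}"
proof -
  have "continuous_on (fst c) (snd c)" using assms(1) by (simp add: is_chart_def homeomorphism_def)
  from continuous_open_preimage[OF this chart_open(1)[OF assms(1)] assms(2)]
  show ?thesis by (simp add: vimage_def Int_def)
qed

lemma chart_continuous: "is_chart c \<Longrightarrow> continuous_on (fst c) (snd c)"
  "is_chart c \<Longrightarrow> continuous_on (snd c ` fst c) (chart_inv c)"
  by (auto simp: is_chart_def homeomorphism_def)

lemma chart_image_subset:
  "is_chart c \<Longrightarrow> y \<in> snd c ` (fst c \<inter> U) \<longleftrightarrow> y \<in> snd c ` fst c \<and> chart_inv c y \<in> U"
  by (auto simp: chart_inv_left intro: rev_image_eqI[where x = "chart_inv c y"] inv_into_into chart_inv_right[symmetric])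

lemma is_chartI:
  assumes "open (fst c)" "open (snd c ` fst c)" "inj_on (snd c) (fst c)" "continuous_on (fst c) (snd c)"
    "continuous_on (snd c ` fst c) (chart_inv c)"
  shows "is_chart c"
  using assms by (auto simp: is_chart_def homeomorphism_def inv_into_into)

section \<open>Transition maps, tangent vectors and changes of coordinates\<close>

locale manifold =
  fixes A :: "('a::{t2_space, second_countable_topology}, 'e::euclidean_space) chart set"
  assumes atlas: "smooth_atlas A"
begin

abbreviation adm where "adm \<equiv> admissible_chart A"

lemma atlas_adm: "c \<in> A \<Longrightarrow> adm c"
  using atlas by (auto simp: smooth_atlas_def admissible_chart_def)

lemma adm_chart: "adm c \<Longrightarrow> is_chart c"
  by (simp add: admissible_chart_def)

lemma atlas_cover: "\<exists>c\<in>A. p \<in> fst c"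
  using atlas by (auto simp: smooth_atlas_def)

lemma chart_at: "chart_at A p \<in> A" "p \<in> fst (chart_at A p)" "adm (chart_at A p)"
proof -
  have "\<exists>c. c \<in> A \<and> p \<in> fst c" using atlas_cover by blast
  from someI_ex[OF this] show "chart_at A p \<in> A" "p \<in> fst (chart_at A p)" by (auto simp: chart_at_def)
  then show "adm (chart_at A p)" by (simp add: atlas_adm)
qed

text \<open>Admissible charts are compared only with the atlas; near a point, the transition between
  two of them factors through an atlas chart there.\<close>

lemma transition_smooth:
  assumes c: "adm c" and d: "adm d"
  shows "smooth_on (snd c ` (fst c \<inter> fst d)) (\<lambda>y. snd d (chart_inv c y))"
proof (rule smooth_on_local)
  fix y assume "y \<in> snd c ` (fst c \<inter> fst d)"
  then obtain p where p: "p \<in> fst c" "p \<in> fst d" "y = snd c p" by blast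
  define b where "b = chart_at A p"
  have b: "b \<in> A" "p \<in> fst b" "adm b" using chart_at by (auto simp: b_def)
  let ?N = "fst c \<inter> (fst d \<inter> fst b)"
  note ch = adm_chart[OF c] adm_chart[OF d] adm_chart[OF b(3)]
  have op: "open (snd c ` ?N)" using chart_open(1)[OF ch(2)] chart_open(1)[OF ch(3)] by (intro chart_image_open ch) auto
  have 1: "smooth_on (snd c ` ?N) (\<lambda>y. snd b (chart_inv c y))"
    using c b(1) unfolding admissible_chart_def smooth_transition_def comp_def
    by (auto elim!: ballE intro: smooth_on_subset)
  have 2: "smooth_on (snd b ` (fst b \<inter> fst d)) (\<lambda>y. snd d (chart_inv b y))"
    using d b(1) unfolding admissible_chart_def smooth_transition_def comp_def by auto
  have "smooth_on (snd c ` ?N) (\<lambda>y. snd d (chart_inv b (snd b (chart_inv c y))))"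
  proof (rule smooth_on_compose[OF 1 2 op])
    show "open (snd b ` (fst b \<inter> fst d))" by (intro chart_image_open ch chart_open)
    show "(\<lambda>y. snd b (chart_inv c y)) ` (snd c ` ?N) \<subseteq> snd b ` (fst b \<inter> fst d)"
      using chart_inv_left[OF ch(1)] by auto
  qed
  moreover have "snd d (chart_inv b (snd b (chart_inv c y))) = snd d (chart_inv c y)" if "y \<in> snd c ` ?N" for y
    using that chart_inv_left[OF ch(1)] chart_inv_left[OF ch(3)] by auto
  ultimately have "smooth_on (snd c ` ?N) (\<lambda>y. snd d (chart_inv c y))"
    using smooth_on_cong[OF op] by (metis (no_types, lifting))
  then show "\<exists>U. open U \<and> y \<in> U \<and> smooth_on U (\<lambda>y. snd d (chart_inv c y))"
    using op p b by blast
qed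

lemma coord_change_has_derivative:
  assumes "adm c" "adm d" "p \<in> fst c" "p \<in> fst d"
  shows "((\<lambda>y. snd d (chart_inv c y)) has_derivative coord_change c d p) (at (snd c p))"
  using smooth_on_has_derivative[OF transition_smooth[OF assms(1,2)], of "snd c p"] assms(3,4)
  by (auto simp: coord_change_def comp_def)

lemma coord_change_linear: "adm c \<Longrightarrow> adm d \<Longrightarrow> p \<in> fst c \<Longrightarrow> p \<in> fst d \<Longrightarrow> linear (coord_change c d p)"
  using coord_change_has_derivative has_derivative_linear by blast

lemma coord_change_compose:
  assumes c: "adm c" "p \<in> fst c" and d: "adm d" "p \<in> fst d" and b: "adm b" "p \<in> fst b"
  shows "coord_change d b p (coord_change c d p v) = coord_change c b p v"
proof -
  note ch = adm_chart[OF c(1)] adm_chart[OF d(1)] adm_chart[OF b(1)]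
  let ?N = "fst c \<inter> fst d"
  have op: "open (snd c ` ?N)" by (intro chart_image_open ch chart_open)
  have "((\<lambda>y. snd b (chart_inv d (snd d (chart_inv c y)))) has_derivative
      (\<lambda>v. coord_change d b p (coord_change c d p v))) (at (snd c p))"
    by (rule has_derivative_compose[OF coord_change_has_derivative[OF c(1) d(1) c(2) d(2)]])
      (use coord_change_has_derivative[OF d(1) b(1) d(2) b(2)] in \<open>simp add: chart_inv_left[OF ch(1) c(2)]\<close>)
  then have "((\<lambda>y. snd b (chart_inv c y)) has_derivative
      (\<lambda>v. coord_change d b p (coord_change c d p v))) (at (snd c p))"
    by (rule has_derivative_transform_within_open[OF _ op])
      (use c d in \<open>auto simp: chart_inv_left[OF ch(1)] chart_inv_left[OF ch(2)]\<close>)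
  with coord_change_has_derivative[OF c(1) b(1) c(2) b(2)] show ?thesis
    by (metis has_derivative_unique)
qed

lemma coord_change_self:
  assumes c: "adm c" "p \<in> fst c"
  shows "coord_change c c p v = v"
proof -
  note ch = adm_chart[OF c(1)]
  have "((\<lambda>y. snd c (chart_inv c y)) has_derivative (\<lambda>v. v)) (at (snd c p))"
    by (rule has_derivative_transform_within_open[OF has_derivative_ident chart_open(2)[OF ch]])
      (use c in \<open>auto simp: chart_inv_right\<close>)
  with coord_change_has_derivative[OF c(1) c(1) c(2) c(2)] show ?thesis
    by (metis has_derivative_unique)
qed

lemma dchart_linear: "adm c \<Longrightarrow> p \<in> fst c \<Longrightarrow> linear (dchart A c p)"
  "adm c \<Longrightarrow> p \<in> fst c \<Longrightarrow> linear (dchart_inv A c p)"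
  by (simp_all add: dchart_def dchart_inv_def coord_change_linear chart_at)

lemma dchart_inverse [simp]:
  "adm c \<Longrightarrow> p \<in> fst c \<Longrightarrow> dchart_inv A c p (dchart A c p v) = v"
  "adm c \<Longrightarrow> p \<in> fst c \<Longrightarrow> dchart A c p (dchart_inv A c p v) = v"
  by (simp_all add: dchart_def dchart_inv_def coord_change_compose coord_change_self chart_at)

lemma dchart_change:
  assumes "adm c" "adm d" "p \<in> fst c" "p \<in> fst d"
  shows "coord_change c d p (dchart A c p v) = dchart A d p v"
    "dchart_inv A d p (coord_change c d p v) = dchart_inv A c p v"
  using assms by (simp_all add: dchart_def dchart_inv_def coord_change_compose chart_at)

lemma dchart_at: "dchart A (chart_at A p) p v = v"
  by (simp add: dchart_def coord_change_self chart_at)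

lemma transition_derivative_smooth:
  assumes c: "adm c" and d: "adm d"
  shows "smooth_on (snd d ` (fst d \<inter> fst c)) (\<lambda>y. coord_change c d (chart_inv d y) v)"
    "smooth_on (snd d ` (fst d \<inter> fst c)) (\<lambda>y. coord_change d c (chart_inv d y) v)"
proof -
  note ch = adm_chart[OF c] adm_chart[OF d]
  have op: "open (snd d ` (fst d \<inter> fst c))" by (intro chart_image_open ch chart_open)
  have "smooth_on (snd d ` (fst d \<inter> fst c))
      (\<lambda>y. frechet_derivative (\<lambda>y. snd d (chart_inv c y)) (at (snd c (chart_inv d y))) v)"
  proof (rule smooth_on_compose[OF transition_smooth[OF d c] smooth_on_derivative[OF transition_smooth[OF c d]] op])
    show "open (snd c ` (fst c \<inter> fst d))" by (intro chart_image_open ch chart_open)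
  qed (use chart_inv_left[OF ch(2)] in auto)
  then show "smooth_on (snd d ` (fst d \<inter> fst c)) (\<lambda>y. coord_change c d (chart_inv d y) v)"
    by (simp add: coord_change_def comp_def)
  have "smooth_on (snd d ` (fst d \<inter> fst c)) (\<lambda>y. frechet_derivative (\<lambda>y. snd c (chart_inv d y)) (at y) v)"
    by (rule smooth_on_derivative[OF transition_smooth[OF d c]])
  moreover have "frechet_derivative (\<lambda>y. snd c (chart_inv d y)) (at y) v = coord_change d c (chart_inv d y) v"
    if "y \<in> snd d ` (fst d \<inter> fst c)" for y
  proof -
    have "snd d (chart_inv d y) = y" using that by (intro chart_inv_right) auto
    then show ?thesis by (simp add: coord_change_def comp_def)
  qed
  ultimately show "smooth_on (snd d ` (fst d \<inter> fst c)) (\<lambda>y. coord_change d c (chart_inv d y) v)"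
    using smooth_on_cong[OF op] by (metis (no_types, lifting))
qed

lemma transition_transfer:
  assumes c: "adm c" and d: "adm d" and U: "open U" and f: "smooth_on (snd c ` (fst c \<inter> U)) f"
  shows "smooth_on (snd d ` (fst d \<inter> (fst c \<inter> U))) (\<lambda>y. f (snd c (chart_inv d y)))"
proof -
  note ch = adm_chart[OF c] adm_chart[OF d]
  show ?thesis
  proof (rule smooth_on_compose[OF smooth_on_subset[OF transition_smooth[OF d c]] f])
    show "open (snd d ` (fst d \<inter> (fst c \<inter> U)))" "open (snd c ` (fst c \<inter> U))"
      using U by (auto intro!: chart_image_open ch chart_open)
  qed (use chart_inv_left[OF ch(2)] in auto)
qed

section \<open>Smooth functions, vector fields and forms\<close>

text \<open>The atlas charts differ from any admissible chart by smooth transitions, so one freely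
  chosen chart near each point decides smoothness.\<close>

lemma smooth_fun_onI:
  assumes "\<And>p. p \<in> U \<Longrightarrow> \<exists>c V. adm c \<and> open V \<and> p \<in> V \<and> p \<in> fst c \<and> smooth_on (snd c ` (fst c \<inter> V)) (\<lambda>y. f (chart_inv c y))"
  shows "smooth_fun_on A U f"
  unfolding smooth_fun_on_def comp_def
proof (intro ballI smooth_on_local)
  fix d y assume d: "d \<in> A" and "y \<in> snd d ` (fst d \<inter> U)"
  then obtain p where p: "p \<in> fst d" "p \<in> U" "y = snd d p" by blast
  then obtain c V where c: "adm c" "open V" "p \<in> V" "p \<in> fst c" and f: "smooth_on (snd c ` (fst c \<inter> V)) (\<lambda>y. f (chart_inv c y))"
    using assms by blast
  let ?N = "fst d \<inter> (fst c \<inter> V)"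
  note ch = adm_chart[OF c(1)] adm_chart[OF atlas_adm[OF d]]
  have op: "open (snd d ` ?N)" using c(2) by (intro chart_image_open open_Int ch chart_open)
  have "smooth_on (snd d ` ?N) (\<lambda>y. f (chart_inv c (snd c (chart_inv d y))))"
    by (rule transition_transfer[OF c(1) atlas_adm[OF d] c(2) f])
  then have "smooth_on (snd d ` ?N) (\<lambda>y. f (chart_inv d y))"
    by (subst smooth_on_cong[OF op, of _ "\<lambda>y. f (chart_inv c (snd c (chart_inv d y)))"])
      (auto simp: chart_inv_left[OF ch(1)] chart_inv_left[OF ch(2)])
  then show "\<exists>U. open U \<and> y \<in> U \<and> smooth_on U (\<lambda>y. f (chart_inv d y))"
    using op p c by blast
qed

lemma smooth_fun_on_chart:
  assumes "smooth_fun_on A U f" "open U" "adm c"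
  shows "smooth_on (snd c ` (fst c \<inter> U)) (\<lambda>y. f (chart_inv c y))"
proof (rule smooth_on_local)
  fix y assume "y \<in> snd c ` (fst c \<inter> U)"
  then obtain p where p: "p \<in> fst c" "p \<in> U" "y = snd c p" by blast
  define d where "d = chart_at A p"
  have d: "d \<in> A" "p \<in> fst d" "adm d" using chart_at by (auto simp: d_def)
  let ?N = "fst c \<inter> (fst d \<inter> U)"
  note ch = adm_chart[OF assms(3)] adm_chart[OF d(3)]
  have op: "open (snd c ` ?N)" using assms(2) by (intro chart_image_open open_Int ch chart_open)
  have "smooth_on (snd d ` (fst d \<inter> U)) (\<lambda>y. f (chart_inv d y))"
    using assms(1) d(1) by (auto simp: smooth_fun_on_def comp_def)
  then have "smooth_on (snd c ` ?N) (\<lambda>y. f (chart_inv d (snd d (chart_inv c y))))"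
    by (rule transition_transfer[OF d(3) assms(3,2)])
  then have "smooth_on (snd c ` ?N) (\<lambda>y. f (chart_inv c y))"
    by (subst smooth_on_cong[OF op, of _ "\<lambda>y. f (chart_inv d (snd d (chart_inv c y)))"])
      (auto simp: chart_inv_left[OF ch(1)] chart_inv_left[OF ch(2)])
  then show "\<exists>U. open U \<and> y \<in> U \<and> smooth_on U (\<lambda>y. f (chart_inv c y))"
    using op p d by blast
qed

lemma smooth_fun_on_local:
  assumes "\<And>p. p \<in> U \<Longrightarrow> \<exists>V. open V \<and> p \<in> V \<and> smooth_fun_on A V f"
  shows "smooth_fun_on A U f"
proof (rule smooth_fun_onI)
  fix p assume "p \<in> U"
  then obtain V where V: "open V" "p \<in> V" "smooth_fun_on A V f" using assms by blast
  from smooth_fun_on_chart[OF V(3,1) chart_at(3)[of p]]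
  show "\<exists>c V. adm c \<and> open V \<and> p \<in> V \<and> p \<in> fst c \<and> smooth_on (snd c ` (fst c \<inter> V)) (\<lambda>y. f (chart_inv c y))"
    using V(1,2) chart_at[of p] by blast
qed

lemma smooth_fun_on_subset: "smooth_fun_on A U f \<Longrightarrow> V \<subseteq> U \<Longrightarrow> smooth_fun_on A V f"
  unfolding smooth_fun_on_def by (blast intro: smooth_on_subset)

lemma atlas_image_open: "c \<in> A \<Longrightarrow> open U \<Longrightarrow> open (snd c ` (fst c \<inter> U))"
  by (intro chart_image_open adm_chart atlas_adm)

lemma smooth_fun_on_cong:
  assumes "open U" "\<And>p. p \<in> U \<Longrightarrow> f p = g p" "smooth_fun_on A U f"
  shows "smooth_fun_on A U g"
  unfolding smooth_fun_on_def comp_def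
proof
  fix c assume c: "c \<in> A"
  have "smooth_on (snd c ` (fst c \<inter> U)) (\<lambda>y. f (chart_inv c y))"
    using assms(3) c by (auto simp: smooth_fun_on_def comp_def)
  then show "smooth_on (snd c ` (fst c \<inter> U)) (\<lambda>y. g (chart_inv c y))"
    by (subst smooth_on_cong[OF atlas_image_open[OF c assms(1)], of _ "\<lambda>y. f (chart_inv c y)"])
      (auto simp: assms(2) chart_inv_left adm_chart atlas_adm c)
qed

lemma smooth_fun_on_const: "open U \<Longrightarrow> smooth_fun_on A U (\<lambda>p. r)"
  by (auto simp: smooth_fun_on_def comp_def intro!: smooth_on_const atlas_image_open)

lemma smooth_fun_on_add: "open U \<Longrightarrow> smooth_fun_on A U f \<Longrightarrow> smooth_fun_on A U g \<Longrightarrow> smooth_fun_on A U (\<lambda>p. f p + g p)"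
  by (auto simp: smooth_fun_on_def comp_def intro!: smooth_on_add atlas_image_open)

lemma smooth_fun_on_mult: "open U \<Longrightarrow> smooth_fun_on A U f \<Longrightarrow> smooth_fun_on A U g \<Longrightarrow> smooth_fun_on A U (\<lambda>p. f p * g p)"
  by (auto simp: smooth_fun_on_def comp_def intro!: smooth_on_mult atlas_image_open)

lemma smooth_fun_on_diff: "open U \<Longrightarrow> smooth_fun_on A U f \<Longrightarrow> smooth_fun_on A U g \<Longrightarrow> smooth_fun_on A U (\<lambda>p. f p - g p)"
  by (auto simp: smooth_fun_on_def comp_def intro!: smooth_on_diff atlas_image_open)

lemma smooth_fun_on_continuous:
  assumes "smooth_fun_on A U f" "open U"
  shows "continuous_on U f"
proof (rule continuous_at_imp_continuous_on, rule ballI)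
  fix p assume p: "p \<in> U"
  define c where "c = chart_at A p"
  have c: "p \<in> fst c" "adm c" using chart_at by (auto simp: c_def)
  note ch = adm_chart[OF c(2)]
  have "continuous_on (fst c \<inter> U) (\<lambda>q. f (chart_inv c (snd c q)))"
    by (rule continuous_on_compose2[OF smooth_on_continuous[OF smooth_fun_on_chart[OF assms c(2)]]])
      (auto intro: continuous_on_subset[OF chart_continuous(1)[OF ch]])
  moreover have "f (chart_inv c (snd c q)) = f q" if "q \<in> fst c \<inter> U" for q
    using that by (simp add: chart_inv_left[OF ch])
  ultimately have "continuous_on (fst c \<inter> U) f" by (metis (no_types, lifting) continuous_on_cong)
  then show "isCont f p"
    using p c assms(2) chart_open(1)[OF ch] by (metis IntI continuous_on_eq_continuous_at open_Int)
qed

lemma manifold_bump: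
  assumes "open U" "p \<in> U"
  obtains \<psi> V K where "smooth_fun_on A UNIV \<psi>" "open V" "p \<in> V" "V \<subseteq> K" "compact K" "K \<subseteq> U"
    "\<And>q. q \<in> V \<Longrightarrow> \<psi> q = 1" "\<And>q. q \<notin> K \<Longrightarrow> \<psi> q = 0"
proof -
  define c where "c = chart_at A p"
  have c: "p \<in> fst c" "adm c" using chart_at by (auto simp: c_def)
  note ch = adm_chart[OF c(2)]
  have "open (snd c ` (fst c \<inter> U))" "snd c p \<in> snd c ` (fst c \<inter> U)"
    using c assms by (auto intro: chart_image_open[OF ch])
  then obtain r0 where r0: "r0 > 0" "cball (snd c p) r0 \<subseteq> snd c ` (fst c \<inter> U)"
    using open_contains_cball by blast
  define r where "r = r0 / 2"
  have r: "r > 0" "cball (snd c p) (2 * r) \<subseteq> snd c ` (fst c \<inter> U)" using r0 by (auto simp: r_def)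
  obtain \<beta> :: "'e \<Rightarrow> real" where \<beta>: "smooth_on UNIV \<beta>" "\<And>z. dist z (snd c p) \<le> r \<Longrightarrow> \<beta> z = 1"
    "\<And>z. dist z (snd c p) \<ge> 2 * r \<Longrightarrow> \<beta> z = 0" using euclidean_bump[OF r(1), of "snd c p"] by blast
  define K where "K = chart_inv c ` cball (snd c p) (2 * r)"
  have sub: "cball (snd c p) (2 * r) \<subseteq> snd c ` fst c" using r by auto
  have K: "compact K" unfolding K_def
    by (intro compact_continuous_image continuous_on_subset[OF chart_continuous(2)[OF ch]] sub compact_cball)
  have KU: "K \<subseteq> fst c \<inter> U"
  proof
    fix q assume "q \<in> K"
    then obtain y where "y \<in> cball (snd c p) (2 * r)" and q: "q = chart_inv c y" unfolding K_def by blast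
    then obtain q' where "q' \<in> fst c \<inter> U" "y = snd c q'" using r(2) by blast
    then show "q \<in> fst c \<inter> U" using chart_inv_left[OF ch] q by auto
  qed
  define \<psi> where "\<psi> q = (if q \<in> fst c then \<beta> (snd c q) else 0)" for q
  have \<psi>0: "\<psi> q = 0" if "q \<notin> K" for q
  proof (cases "q \<in> fst c")
    case True
    have "snd c q \<notin> cball (snd c p) (2 * r)"
      using that chart_inv_left[OF ch True] unfolding K_def by (metis imageI)
    then show ?thesis using True \<beta>(3)[of "snd c q"] by (simp add: \<psi>_def dist_commute)
  qed (simp add: \<psi>_def)
  define V where "V = {q \<in> fst c. snd c q \<in> ball (snd c p) r}"
  have V: "open V" unfolding V_def by (rule chart_preimage_open[OF ch open_ball])
  have "smooth_fun_on A UNIV \<psi>"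
  proof (rule smooth_fun_on_local)
    fix q
    show "\<exists>V. open V \<and> q \<in> V \<and> smooth_fun_on A V \<psi>"
    proof (cases "q \<in> fst c")
      case True
      have "smooth_fun_on A (fst c) \<psi>"
      proof (rule smooth_fun_onI)
        fix x assume x: "x \<in> fst c"
        have "smooth_on (snd c ` (fst c \<inter> UNIV)) (\<lambda>y. \<psi> (chart_inv c y))"
          by (subst smooth_on_cong[of _ _ \<beta>])
            (auto simp: \<psi>_def chart_inv_left[OF ch] chart_open[OF ch] intro: smooth_on_subset[OF \<beta>(1)])
        then show "\<exists>c V. adm c \<and> open V \<and> x \<in> V \<and> x \<in> fst c \<and> smooth_on (snd c ` (fst c \<inter> V)) (\<lambda>y. \<psi> (chart_inv c y))"
          using c(2) x by blast
      qed
      then show ?thesis using True chart_open[OF ch] by blast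
    next
      case False
      then have "q \<in> - K" using KU by auto
      \<comment> \<open>The Hausdorff property enters here: a compact set is closed, so extension by
        zero is smooth off \<open>K\<close>.\<close>
      moreover have "open (- K)" using K compact_imp_closed by blast
      moreover have "smooth_fun_on A (- K) \<psi>"
        by (rule smooth_fun_on_cong[OF \<open>open (- K)\<close> _ smooth_fun_on_const[OF \<open>open (- K)\<close>, of 0]]) (simp add: \<psi>0)
      ultimately show ?thesis by blast
    qed
  qed
  moreover have "V \<subseteq> K"
  proof
    fix q assume "q \<in> V"
    then have q: "q \<in> fst c" "snd c q \<in> cball (snd c p) (2 * r)" using r(1) by (auto simp: V_def)
    then show "q \<in> K" unfolding K_def using chart_inv_left[OF ch q(1)] by (metis imageI)
  qed
  moreover have "\<psi> q = 1" if "q \<in> V" for q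
    using that \<beta>(2)[of "snd c q"] by (auto simp: V_def \<psi>_def dist_commute)
  ultimately show thesis
    using that[of \<psi> V K] V K KU \<psi>0 r(1) c(1) by (auto simp: V_def)
qed

lemma smooth_fun_on_bump_mult:
  assumes "smooth_fun_on A UNIV \<psi>" "closed K" "K \<subseteq> U" "open U" "\<And>q. q \<notin> K \<Longrightarrow> \<psi> q = 0" "smooth_fun_on A U g"
  shows "smooth_fun_on A UNIV (\<lambda>q. \<psi> q * g q)"
proof (rule smooth_fun_on_local)
  fix q
  show "\<exists>V. open V \<and> q \<in> V \<and> smooth_fun_on A V (\<lambda>q. \<psi> q * g q)"
  proof (cases "q \<in> U")
    case True
    then show ?thesis
      using assms smooth_fun_on_mult[OF \<open>open U\<close> smooth_fun_on_subset[OF assms(1)] assms(6)] by blast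
  next
    case False
    have op: "open (- K)" using assms(2) by blast
    have "smooth_fun_on A (- K) (\<lambda>q. \<psi> q * g q)"
      by (rule smooth_fun_on_cong[OF op _ smooth_fun_on_const[OF op, of 0]]) (simp add: assms(5))
    then show ?thesis using op False assms(3) by blast
  qed
qed

lemma smooth_vf_onI:
  assumes c: "adm c" and U: "open U" "U \<subseteq> fst c" and Y: "smooth_on (snd c ` U) Y"
    and X: "\<And>q. q \<in> U \<Longrightarrow> dchart A c q (X q) = Y (snd c q)"
  shows "smooth_vf_on A U X"
  unfolding smooth_vf_on_def
proof
  fix d assume "d \<in> A"
  then have d: "adm d" by (rule atlas_adm)
  note ch = adm_chart[OF c] adm_chart[OF d]
  have eq: "fst c \<inter> U = U" using U by blast
  have op: "open (snd d ` (fst d \<inter> U))" by (intro chart_image_open ch U)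
  have "smooth_on (snd d ` (fst d \<inter> U)) (\<lambda>y. coord_change c d (chart_inv d y) (Y (snd c (chart_inv d y))))"
  proof (rule smooth_on_apply_linear[where L = "\<lambda>y. coord_change c d (chart_inv d y)", OF op])
    show "smooth_on (snd d ` (fst d \<inter> U)) (\<lambda>y. Y (snd c (chart_inv d y)))"
      using transition_transfer[OF c d U(1)] Y by (simp add: eq)
    show "smooth_on (snd d ` (fst d \<inter> U)) (\<lambda>y. coord_change c d (chart_inv d y) v)" for v
      by (rule smooth_on_subset[OF transition_derivative_smooth(1)[OF c d]]) (use U in auto)
    show "linear (coord_change c d (chart_inv d y))" if "y \<in> snd d ` (fst d \<inter> U)" for y
      using that U by (intro coord_change_linear c d) (auto simp: chart_inv_left[OF ch(2)])
  qed
  moreover have "local_rep A d X y = coord_change c d (chart_inv d y) (Y (snd c (chart_inv d y)))"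
    if y: "y \<in> snd d ` (fst d \<inter> U)" for y
  proof -
    obtain q where q: "q \<in> fst d" "q \<in> U" "y = snd d q" using y by blast
    then have "dchart A d q (X q) = coord_change c d q (Y (snd c q))"
      using dchart_change(1)[OF c d, of q "X q"] X U by auto
    then show ?thesis by (simp add: local_rep_def q chart_inv_left[OF ch(2)])
  qed
  ultimately show "smooth_on (snd d ` (fst d \<inter> U)) (local_rep A d X)"
    using smooth_on_cong[OF op] by (metis (no_types, lifting))
qed

text \<open>Constant coordinate vectors of another chart vary when read in \<open>c\<close>;
  \<open>smooth_on_apply_linear\<close> deals with evaluating the form on them.\<close>

lemma smooth_formI:
  fixes \<alpha> :: "'a \<Rightarrow> 'e \<Rightarrow>\<^sub>L real"
  assumes "\<And>p. \<exists>c V. adm c \<and> open V \<and> p \<in> V \<and> p \<in> fst c \<and>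
    (\<forall>v. smooth_on (snd c ` (fst c \<inter> V)) (\<lambda>y. \<alpha> (chart_inv c y) (dchart_inv A c (chart_inv c y) v)))"
  shows "smooth_form A \<alpha>"
  unfolding smooth_form_def
proof (intro ballI allI smooth_on_local)
  fix d v y assume "d \<in> A" and y: "y \<in> snd d ` fst d"
  then have d: "adm d" by (simp add: atlas_adm)
  obtain p where p: "p \<in> fst d" "y = snd d p" using y by blast
  obtain c V where c: "adm c" "open V" "p \<in> V" "p \<in> fst c" and sm: "\<And>v. smooth_on (snd c ` (fst c \<inter> V))
      (\<lambda>y. \<alpha> (chart_inv c y) (dchart_inv A c (chart_inv c y) v))"
    using assms[of p] by blast
  note ch = adm_chart[OF c(1)] adm_chart[OF d]
  let ?N = "fst d \<inter> (fst c \<inter> V)"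
  have op: "open (snd d ` ?N)" using c(2) by (intro chart_image_open open_Int ch chart_open)
  define L where "L y u = \<alpha> (chart_inv d y) (dchart_inv A c (chart_inv d y) u)" for y u
  have "smooth_on (snd d ` ?N) (\<lambda>y. L y (coord_change d c (chart_inv d y) v))"
  proof (rule smooth_on_apply_linear[where L = L, OF op])
    show "smooth_on (snd d ` ?N) (\<lambda>y. coord_change d c (chart_inv d y) v)"
      by (rule smooth_on_subset[OF transition_derivative_smooth(2)[OF c(1) d]]) auto
    fix u
    have "smooth_on (snd d ` ?N) (\<lambda>y. \<alpha> (chart_inv c (snd c (chart_inv d y)))
        (dchart_inv A c (chart_inv c (snd c (chart_inv d y))) u))"
      by (rule transition_transfer[OF c(1) d c(2) sm])
    then show "smooth_on (snd d ` ?N) (\<lambda>y. L y u)"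
      by (subst smooth_on_cong[OF op, of _ "\<lambda>y. \<alpha> (chart_inv c (snd c (chart_inv d y)))
        (dchart_inv A c (chart_inv c (snd c (chart_inv d y))) u)"])
        (auto simp: L_def chart_inv_left[OF ch(1)] chart_inv_left[OF ch(2)])
  next
    fix y assume "y \<in> snd d ` ?N"
    then have "linear (dchart_inv A c (chart_inv d y))"
      by (intro dchart_linear c) (auto simp: chart_inv_left[OF ch(2)])
    then show "linear (L y)"
      unfolding L_def by (rule linear_compose[unfolded comp_def, OF _ bounded_linear.linear[OF blinfun.bounded_linear_right]])
  qed
  then have "smooth_on (snd d ` ?N) (\<lambda>y. \<alpha> (chart_inv d y) (dchart_inv A d (chart_inv d y) v))"
    by (subst smooth_on_cong[OF op, of _ "\<lambda>y. L y (coord_change d c (chart_inv d y) v)"])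
      (auto simp: L_def chart_inv_left[OF ch(2)] dchart_change(2)[OF d c(1)])
  then show "\<exists>U. open U \<and> y \<in> U \<and> smooth_on U (\<lambda>y. \<alpha> (chart_inv d y) (dchart_inv A d (chart_inv d y) v))"
    using op p c by blast
qed

end

section \<open>Leaves of involutive distributions\<close>

text \<open>Turns an inclusion of vectors into scalar equations, one for each normal
  \<open>u\<close>, to which one-variable calculus applies.\<close>

lemma mem_subspace_by_orthogonality:
  fixes S :: "'e::euclidean_space set"
  assumes "subspace S" "\<And>u. (\<And>s. s \<in> S \<Longrightarrow> s \<bullet> u = 0) \<Longrightarrow> x \<bullet> u = 0"
  shows "x \<in> S"
proof -
  obtain y z where yz: "y \<in> span S" "\<And>w. w \<in> span S \<Longrightarrow> orthogonal z w" "x = y + z"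
    using orthogonal_subspace_decomp_exists[of S x] by blast
  have zero: "s \<bullet> z = 0" if "s \<in> S" for s
    using yz(2)[of s] that by (simp add: orthogonal_def inner_commute span_base)
  have "y \<in> S" using yz(1) assms(1) by (metis span_eq_iff)
  then have "z \<bullet> z = 0" using assms(2)[OF zero] zero[of y] by (simp add: yz(3) inner_add_left)
  then show ?thesis using \<open>y \<in> S\<close> yz(3) by simp
qed

text \<open>Along the segment from \<open>y0\<close> to \<open>y\<close>, which stays in the affine
  slice, every component of \<open>h\<close> normal to \<open>S'\<close> has derivative
  zero.\<close>

lemma derivative_in_subspace_imp:
  fixes h :: "'e::euclidean_space \<Rightarrow> 'b::euclidean_space"
  assumes B: "convex B" "y0 \<in> B" and S: "subspace S" "subspace S'"
    and der: "\<And>y. y \<in> B \<Longrightarrow> y - y0 \<in> S \<Longrightarrow> (h has_derivative h' y) (at y)"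
    and h': "\<And>y v. y \<in> B \<Longrightarrow> y - y0 \<in> S \<Longrightarrow> v \<in> S \<Longrightarrow> h' y v \<in> S'"
    and y: "y \<in> B" "y - y0 \<in> S"
  shows "h y - h y0 \<in> S'"
proof (rule mem_subspace_by_orthogonality[OF S(2)])
  fix u assume u: "\<And>s. s \<in> S' \<Longrightarrow> s \<bullet> u = 0"
  define g where "g t = y0 + t *\<^sub>R (y - y0)" for t :: real
  have gB: "g t \<in> B" if "t \<in> {0..1}" for t
  proof -
    have "(1 - t) *\<^sub>R y0 + t *\<^sub>R y \<in> B" using B y(1) that by (intro convexD) auto
    then show ?thesis by (simp add: g_def algebra_simps)
  qed
  have gS: "g t - y0 \<in> S" for t using y(2) S(1) by (simp add: g_def subspace_scale)
  have "((\<lambda>t. h (g t) \<bullet> u) has_vector_derivative 0) (at t within {0..1})" if t: "t \<in> {0..1}" for t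
  proof -
    have "(g has_derivative (\<lambda>s. s *\<^sub>R (y - y0))) (at t within {0..1})"
      unfolding g_def by (auto intro!: derivative_eq_intros)
    from has_derivative_compose[OF this der[OF gB[OF t] gS]]
    have "((\<lambda>t. h (g t) \<bullet> u) has_derivative (\<lambda>s. h' (g t) (s *\<^sub>R (y - y0)) \<bullet> u)) (at t within {0..1})"
      by (rule bounded_linear.has_derivative[OF bounded_linear_inner_left])
    moreover have "h' (g t) (s *\<^sub>R (y - y0)) \<bullet> u = 0" for s
      using h'[OF gB[OF t] gS, of "s *\<^sub>R (y - y0)"] y(2) S(1) by (intro u) (simp add: subspace_scale)
    ultimately show ?thesis by (simp add: has_vector_derivative_def)
  qed
  then obtain c where "\<And>t. t \<in> {0..1} \<Longrightarrow> h (g t) \<bullet> u = c"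
    using has_vector_derivative_zero_constant[of "{0..1::real}" "\<lambda>t. h (g t) \<bullet> u"] by auto
  from this[of 0] this[of 1] show "(h y - h y0) \<bullet> u = 0" by (simp add: g_def inner_diff_left)
qed

section \<open>Slices and tangent spaces of immersed submanifolds\<close>

definition plaque :: "('a, 'e::euclidean_space) chart \<Rightarrow> 'e set \<Rightarrow> 'a \<Rightarrow> 'a set" where
  "plaque c S p = {q \<in> fst c. snd c q - snd c p \<in> S}"

lemma slice_at_plaque:
  "slice_at A L p c S \<longleftrightarrow> admissible_chart A c \<and> p \<in> fst c \<and> subspace S \<and>
    openin L (plaque c S p) \<and> subtopology L (plaque c S p) = top_of_set (plaque c S p)"
  by (simp add: slice_at_def plaque_def Let_def)

lemma plaque_self: "p \<in> fst c \<Longrightarrow> subspace S \<Longrightarrow> p \<in> plaque c S p"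
  by (simp add: plaque_def subspace_0)

lemma plaque_eq:
  assumes "subspace S" "q \<in> plaque c S p"
  shows "plaque c S q = plaque c S p"
proof -
  have q: "snd c q - snd c p \<in> S" using assms(2) by (simp add: plaque_def)
  have "snd c x - snd c q \<in> S \<longleftrightarrow> snd c x - snd c p \<in> S" for x
    using subspace_add[OF assms(1) _ q, of "snd c x - snd c q"]
      subspace_diff[OF assms(1) _ q, of "snd c x - snd c p"] by auto
  then show ?thesis by (simp add: plaque_def)
qed

lemma slice_at_move:
  assumes "slice_at A L p c S" "q \<in> plaque c S p"
  shows "slice_at A L q c S"
proof -
  have "subspace S" using assms(1) by (simp add: slice_at_plaque)
  then have "plaque c S q = plaque c S p" by (rule plaque_eq[OF _ assms(2)])
  moreover have "q \<in> fst c" using assms(2) by (simp add: plaque_def)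
  ultimately show ?thesis using assms(1) by (simp add: slice_at_plaque)
qed

context manifold
begin

lemma dim_dchart:
  assumes "adm c" "p \<in> fst c"
  shows "dim (dchart A c p ` V) = dim V"
  by (rule dim_image_eq[OF dchart_linear(1)[OF assms]])
    (metis assms dchart_inverse(1) inj_onI)

text \<open>Both slices are open in \<open>L\<close>, and on the first one \<open>L\<close> is the
  ambient topology, so near \<open>p\<close> the first slice lies in the second. A line in
  \<open>S\<close> through \<open>p\<close> is thus carried into the second slice, and its velocity
  into \<open>S'\<close>.\<close>

lemma slice_tangent_subset:
  assumes c: "slice_at A L p c S" and d: "slice_at A L p d S'" and v: "v \<in> S"
  shows "coord_change c d p v \<in> S'"
proof (rule mem_subspace_by_orthogonality)
  show "subspace S'" using d by (simp add: slice_at_plaque)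
  fix u assume u: "\<And>s. s \<in> S' \<Longrightarrow> s \<bullet> u = 0"
  have ad: "adm c" "adm d" "p \<in> fst c" "p \<in> fst d" and S: "subspace S" "subspace S'"
    using c d by (auto simp: slice_at_plaque)
  note ch = adm_chart[OF ad(1)] adm_chart[OF ad(2)]
  let ?N = "plaque c S p" and ?N' = "plaque d S' p"
  have "openin (subtopology L ?N) (?N' \<inter> ?N)"
    using d unfolding slice_at_plaque openin_subtopology by blast
  then have "openin (top_of_set ?N) (?N' \<inter> ?N)" using c by (simp add: slice_at_plaque)
  then obtain G where G: "open G" "?N' \<inter> ?N = ?N \<inter> G" unfolding openin_open by blast
  have "p \<in> ?N' \<inter> ?N" by (simp add: plaque_self ad S)
  then have p: "p \<in> G" unfolding G(2) by simp
  let ?h = "\<lambda>y. snd d (chart_inv c y)" and ?g = "\<lambda>t. snd c p + t *\<^sub>R v"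
  define T where "T = ?g -` (snd c ` (fst c \<inter> G))"
  have T: "open T" unfolding T_def
    by (intro open_vimage chart_image_open[OF ch(1)] G continuous_intros)
  have "0 \<in> T" using p ad by (auto simp: T_def)
  have "((\<lambda>t. ?h (?g t) \<bullet> u) has_derivative (\<lambda>s. coord_change c d p (s *\<^sub>R v) \<bullet> u)) (at 0)"
  proof (rule bounded_linear.has_derivative[OF bounded_linear_inner_left])
    have "(?g has_derivative (\<lambda>s. s *\<^sub>R v)) (at 0)" by (auto intro!: derivative_eq_intros)
    from has_derivative_compose[OF this] coord_change_has_derivative[OF ad]
    show "((\<lambda>t. ?h (?g t)) has_derivative (\<lambda>s. coord_change c d p (s *\<^sub>R v))) (at 0)" by simp
  qed
  moreover have "((\<lambda>t. ?h (?g t) \<bullet> u) has_derivative (\<lambda>s. 0)) (at 0)"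
  proof (rule has_derivative_transform_within_open[OF has_derivative_const[of "snd d p \<bullet> u"] T \<open>0 \<in> T\<close>])
    fix t assume "t \<in> T"
    then obtain q where q: "q \<in> fst c" "q \<in> G" "?g t = snd c q" by (auto simp: T_def)
    have "snd c q - snd c p = t *\<^sub>R v" using q(3) by (simp flip: q(3))
    then have "q \<in> ?N" using q(1) v S by (simp add: plaque_def subspace_scale)
    then have "q \<in> ?N' \<inter> ?N" unfolding G(2) using q(2) by simp
    then have "(snd d q - snd d p) \<bullet> u = 0" by (intro u) (simp add: plaque_def)
    then show "snd d p \<bullet> u = ?h (?g t) \<bullet> u"
      unfolding q(3) by (simp add: chart_inv_left[OF ch(1) q(1)] inner_diff_left)
  qed
  ultimately have "(\<lambda>s. coord_change c d p (s *\<^sub>R v) \<bullet> u) = (\<lambda>s. 0)" by (rule has_derivative_unique)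
  from fun_cong[OF this, of 1] show "coord_change c d p v \<bullet> u = 0" by simp
qed

text \<open>Any slice computes the tangent space: the existential quantifier in
  \<open>tangent_space\<close> hides no dependence on the chart.\<close>

lemma slice_tangent_space:
  assumes c: "slice_at A L p c S"
  shows "tangent_space A L p = {v. dchart A c p v \<in> S}"
proof
  show "tangent_space A L p \<subseteq> {v. dchart A c p v \<in> S}"
  proof
    fix v assume "v \<in> tangent_space A L p"
    then obtain d S' where d: "slice_at A L p d S'" "dchart A d p v \<in> S'"
      unfolding tangent_space_def by blast
    have "adm c" "adm d" "p \<in> fst c" "p \<in> fst d" using c d by (auto simp: slice_at_plaque)
    then have "coord_change d c p (dchart A d p v) = dchart A c p v" using dchart_change(1) by blast
    then show "v \<in> {v. dchart A c p v \<in> S}" using slice_tangent_subset[OF d(1) c d(2)] by simp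
  qed
  show "{v. dchart A c p v \<in> S} \<subseteq> tangent_space A L p" unfolding tangent_space_def using c by blast
qed

lemma slice_dim:
  assumes "slice_at A L p c S"
  shows "dim (tangent_space A L p) = dim S"
proof -
  have c: "adm c" "p \<in> fst c" using assms by (auto simp: slice_at_plaque)
  have "dchart A c p ` tangent_space A L p = S"
    unfolding slice_tangent_space[OF assms]
    by (auto simp: c intro: image_eqI[where x = "dchart_inv A c p _"])
  then show ?thesis using dim_dchart[OF c, of "tangent_space A L p"] by simp
qed

text \<open>Inclusion of tangent directions along the first slice integrates to a local inclusion of
  slices, by \<open>derivative_in_subspace_imp\<close> for the transition map on a ball.\<close>

lemma plaque_in_plaque:
  assumes c: "adm c" "p \<in> fst c" "subspace S" and d: "adm d" "p \<in> fst d" "subspace S'"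
    and sub: "\<And>q v. q \<in> fst c \<Longrightarrow> q \<in> fst d \<Longrightarrow> q \<in> plaque c S p \<Longrightarrow> v \<in> S \<Longrightarrow> coord_change c d q v \<in> S'"
  shows "\<exists>W. open W \<and> p \<in> W \<and> W \<inter> plaque c S p \<subseteq> plaque d S' p"
proof -
  note ch = adm_chart[OF c(1)] adm_chart[OF d(1)]
  have "open (snd c ` (fst c \<inter> fst d))" "snd c p \<in> snd c ` (fst c \<inter> fst d)"
    using c d chart_open(1)[OF ch(2)] by (auto intro: chart_image_open[OF ch(1)])
  then obtain r where r: "r > 0" "ball (snd c p) r \<subseteq> snd c ` (fst c \<inter> fst d)"
    using open_contains_ball by blast
  let ?B = "ball (snd c p) r"
  define W where "W = {q \<in> fst c. snd c q \<in> ?B}"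
  have pt: "chart_inv c y \<in> fst c" "chart_inv c y \<in> fst d" "snd c (chart_inv c y) = y" if "y \<in> ?B" for y
    using r(2) that chart_inv_left[OF ch(1)] by auto
  have "q \<in> plaque d S' p" if q: "q \<in> W" "q \<in> plaque c S p" for q
  proof -
    have qc: "q \<in> fst c" "snd c q \<in> ?B" using q(1) by (auto simp: W_def)
    have qi: "chart_inv c (snd c q) = q" using chart_inv_left[OF ch(1) qc(1)] .
    have "snd d (chart_inv c (snd c q)) - snd d (chart_inv c (snd c p)) \<in> S'"
    proof (rule derivative_in_subspace_imp[where B = ?B and h = "\<lambda>y. snd d (chart_inv c y)" and h' = "\<lambda>y. coord_change c d (chart_inv c y)",
          OF convex_ball _ c(3) d(3)])
      fix y assume y: "y \<in> ?B" "y - snd c p \<in> S"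
      show "((\<lambda>y. snd d (chart_inv c y)) has_derivative coord_change c d (chart_inv c y)) (at y)"
        using coord_change_has_derivative[OF c(1) d(1) pt(1,2)[OF y(1)]] pt(3)[OF y(1)] by simp
      show "coord_change c d (chart_inv c y) v \<in> S'" if "v \<in> S" for v
        using pt[OF y(1)] y(2) by (intro sub that) (auto simp: plaque_def)
    qed (use q qc r(1) in \<open>auto simp: plaque_def\<close>)
    then show ?thesis
      using pt(2)[OF qc(2)] by (simp add: plaque_def qi chart_inv_left[OF ch(1) c(2)])
  qed
  moreover have "open W" unfolding W_def by (rule chart_preimage_open[OF ch(1) open_ball])
  ultimately show ?thesis using c(2) r(1) by (intro exI[of _ W]) (auto simp: W_def)
qed

text \<open>A straightening chart: in its coordinates \<open>D\<close> is the constant subspace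
  \<open>S\<close>. Convexity of the image makes plaques connected, and \<open>Om\<close> confines
  the construction to the part where a singular distribution has its regular rank.\<close>

definition foliated :: "('a \<Rightarrow> 'e set) \<Rightarrow> 'a set \<Rightarrow> ('a, 'e) chart \<Rightarrow> 'e set \<Rightarrow> bool" where
  "foliated D Om d S \<longleftrightarrow> adm d \<and> fst d \<subseteq> Om \<and> convex (snd d ` fst d) \<and> subspace S \<and>
     (\<forall>q\<in>fst d. dchart A d q ` D q = S)"

text \<open>Plaques of two straightening charts through \<open>p\<close> have the same tangent
  spaces, given by \<open>D\<close>, so locally one lies in the other.\<close>

lemma foliated_compatible:
  assumes d: "foliated D Om d S" "p \<in> fst d" and d': "foliated D Om d' S'" "p \<in> fst d'"
  shows "\<exists>W. open W \<and> p \<in> W \<and> W \<inter> plaque d' S' p \<subseteq> plaque d S p"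
proof (rule plaque_in_plaque)
  fix q v assume q: "q \<in> fst d'" "q \<in> fst d" and v: "v \<in> S'"
  have "S' = dchart A d' q ` D q" using d'(1) q by (simp add: foliated_def)
  then obtain u where u: "u \<in> D q" "v = dchart A d' q u" using v by blast
  have "coord_change d' d q v = dchart A d q u"
    using d d' q unfolding u(2) by (intro dchart_change(1)) (auto simp: foliated_def)
  moreover have "dchart A d q ` D q = S" using d(1) q by (simp add: foliated_def)
  ultimately show "coord_change d' d q v \<in> S" using u(1) by blast
qed (use d d' in \<open>auto simp: foliated_def\<close>)

text \<open>The tangent spaces of an integral manifold are those of the plaques it meets. This local
  inclusion drives the maximality of leaves.\<close>

lemma integral_manifold_in_plaque:
  assumes N: "\<And>q. q \<in> topspace N \<Longrightarrow> tangent_space A N q = D q" and c: "slice_at A N p c S"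
    and d: "foliated D Om d S'" "p \<in> fst d"
  shows "\<exists>W. open W \<and> p \<in> W \<and> W \<inter> plaque c S p \<subseteq> plaque d S' p"
proof (rule plaque_in_plaque)
  fix q v assume q: "q \<in> fst c" "q \<in> fst d" "q \<in> plaque c S p" and v: "v \<in> S"
  have c': "adm c" and op: "openin N (plaque c S p)" using c by (auto simp: slice_at_plaque)
  have "q \<in> topspace N" using openin_subset[OF op] q(3) by blast
  moreover have "dchart_inv A c q v \<in> tangent_space A N q"
    unfolding slice_tangent_space[OF slice_at_move[OF c q(3)]] using v c' q(1) by simp
  ultimately have "dchart_inv A c q v \<in> D q" using N by blast
  moreover have "dchart A d q ` D q = S'" using d(1) q(2) by (simp add: foliated_def)
  moreover have "coord_change c d q v = dchart A d q (dchart_inv A c q v)"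
    using dchart_change(1)[OF c' _ q(1,2), of "dchart_inv A c q v"] d(1) c' q(1) by (simp add: foliated_def)
  ultimately show "coord_change c d q v \<in> S'" by auto
qed (use c d in \<open>auto simp: foliated_def slice_at_plaque\<close>)

text \<open>The topology on \<open>Om\<close> for which the plaques are open.\<close>

definition leaf_topology :: "('a \<Rightarrow> 'e set) \<Rightarrow> 'a set \<Rightarrow> 'a topology" where
  "leaf_topology D Om = topology (\<lambda>U. U \<subseteq> Om \<and> (\<forall>p\<in>U. \<forall>d S. foliated D Om d S \<and> p \<in> fst d \<longrightarrow>
     (\<exists>W. open W \<and> p \<in> W \<and> W \<inter> plaque d S p \<subseteq> U)))"

lemma openin_leaf_topology:
  "openin (leaf_topology D Om) U \<longleftrightarrow> U \<subseteq> Om \<and> (\<forall>p\<in>U. \<forall>d S. foliated D Om d S \<and> p \<in> fst d \<longrightarrow>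
     (\<exists>W. open W \<and> p \<in> W \<and> W \<inter> plaque d S p \<subseteq> U))"
proof -
  let ?P = "\<lambda>U. U \<subseteq> Om \<and> (\<forall>p\<in>U. \<forall>d S. foliated D Om d S \<and> p \<in> fst d \<longrightarrow>
     (\<exists>W. open W \<and> p \<in> W \<and> W \<inter> plaque d S p \<subseteq> U))"
  have "istopology ?P"
    unfolding istopology_def
  proof (intro conjI allI impI)
    fix U V assume U: "?P U" and V: "?P V"
    show "U \<inter> V \<subseteq> Om" using U by blast
    show "\<forall>p\<in>U \<inter> V. \<forall>d S. foliated D Om d S \<and> p \<in> fst d \<longrightarrow> (\<exists>W. open W \<and> p \<in> W \<and> W \<inter> plaque d S p \<subseteq> U \<inter> V)"
    proof (intro ballI allI impI)
      fix p d S assume p: "p \<in> U \<inter> V" "foliated D Om d S \<and> p \<in> fst d"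
      obtain W where "open W" "p \<in> W" "W \<inter> plaque d S p \<subseteq> U"
        using conjunct2[OF U, rule_format, of p d S] p by auto
      moreover obtain W' where "open W'" "p \<in> W'" "W' \<inter> plaque d S p \<subseteq> V"
        using conjunct2[OF V, rule_format, of p d S] p by auto
      ultimately show "\<exists>W. open W \<and> p \<in> W \<and> W \<inter> plaque d S p \<subseteq> U \<inter> V"
        by (intro exI[of _ "W \<inter> W'"]) auto
    qed
  next
    fix \<U> assume U: "\<forall>K\<in>\<U>. ?P K"
    show "\<Union> \<U> \<subseteq> Om" using U by blast
    show "\<forall>p\<in>\<Union> \<U>. \<forall>d S. foliated D Om d S \<and> p \<in> fst d \<longrightarrow> (\<exists>W. open W \<and> p \<in> W \<and> W \<inter> plaque d S p \<subseteq> \<Union> \<U>)"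
    proof (intro ballI allI impI)
      fix p d S assume p: "p \<in> \<Union> \<U>" "foliated D Om d S \<and> p \<in> fst d"
      then obtain K where K: "K \<in> \<U>" "p \<in> K" by blast
      then obtain W where "open W" "p \<in> W" "W \<inter> plaque d S p \<subseteq> K"
        using conjunct2[OF bspec[OF U K(1)], rule_format, of p d S] p(2) by auto
      then show "\<exists>W. open W \<and> p \<in> W \<and> W \<inter> plaque d S p \<subseteq> \<Union> \<U>" using K(1) by blast
    qed
  qed
  then show ?thesis by (simp add: leaf_topology_def topology_inverse')
qed

lemma topspace_leaf_topology: "topspace (leaf_topology D Om) = Om"
proof -
  have "openin (leaf_topology D Om) Om"
    unfolding openin_leaf_topology by (auto simp: foliated_def plaque_def intro!: exI[of _ UNIV])
  then show ?thesis
    by (metis openin_leaf_topology openin_subset openin_topspace subset_antisym)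
qed

lemma plaque_openin:
  assumes d: "foliated D Om d S"
  shows "openin (leaf_topology D Om) (plaque d S p)"
  unfolding openin_leaf_topology
proof (intro conjI ballI allI impI)
  show "plaque d S p \<subseteq> Om" using d by (auto simp: foliated_def plaque_def)
  fix q d' S' assume q: "q \<in> plaque d S p" and d': "foliated D Om d' S' \<and> q \<in> fst d'"
  have "plaque d S q = plaque d S p" using d q by (intro plaque_eq) (auto simp: foliated_def)
  then show "\<exists>W. open W \<and> q \<in> W \<and> W \<inter> plaque d' S' q \<subseteq> plaque d S p"
    using foliated_compatible[OF d _ conjunct1[OF d'] conjunct2[OF d']] q by (auto simp: plaque_def)
qed

text \<open>A plaque is also the plaque of each of its points, so a leaf-open set contains, within
  the plaque, an ambient neighbourhood of each of its points there.\<close>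

lemma plaque_subtopology:
  assumes d: "foliated D Om d S"
  shows "subtopology (leaf_topology D Om) (plaque d S p) = top_of_set (plaque d S p)"
proof (rule topology_eq[THEN iffD2], intro allI iffI)
  fix U
  assume "openin (subtopology (leaf_topology D Om) (plaque d S p)) U"
  then obtain T where T: "openin (leaf_topology D Om) T" "U = T \<inter> plaque d S p"
    unfolding openin_subtopology by blast
  show "openin (top_of_set (plaque d S p)) U"
    unfolding openin_contains_ball[symmetric] openin_subopen[of _ U]
  proof
    fix q assume q: "q \<in> U"
    then have eq: "plaque d S q = plaque d S p" using d T by (intro plaque_eq) (auto simp: foliated_def)
    have "q \<in> fst d" "q \<in> T" using q T by (auto simp: plaque_def)
    then obtain W where "open W" "q \<in> W" "W \<inter> plaque d S q \<subseteq> T"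
      using T(1) d unfolding openin_leaf_topology by blast
    then show "\<exists>V. openin (top_of_set (plaque d S p)) V \<and> q \<in> V \<and> V \<subseteq> U"
      using q T(2) eq by (intro exI[of _ "plaque d S p \<inter> W"]) (auto simp: openin_open_Int)
  qed
next
  fix U
  assume "openin (top_of_set (plaque d S p)) U"
  then obtain G where G: "open G" "U = plaque d S p \<inter> G" unfolding openin_open by blast
  have "openin (leaf_topology D Om) (G \<inter> Om)"
    unfolding openin_leaf_topology using G(1) by (auto simp: foliated_def plaque_def intro!: exI[of _ G])
  moreover have "U = (G \<inter> Om) \<inter> plaque d S p" using G d by (auto simp: foliated_def plaque_def)
  ultimately show "openin (subtopology (leaf_topology D Om) (plaque d S p)) U"
    unfolding openin_subtopology by blast
qed

text \<open>The plaque is the image of a convex slice under the inverse chart.\<close>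

lemma plaque_connectedin:
  assumes d: "foliated D Om d S"
  shows "connectedin (leaf_topology D Om) (plaque d S p)"
proof -
  have ch: "is_chart d" and S: "subspace S" and cv: "convex (snd d ` fst d)"
    using d by (auto simp: foliated_def adm_chart)
  let ?C = "snd d ` fst d \<inter> {y. y - snd d p \<in> S}"
  have "convex {y. y - snd d p \<in> S}"
  proof (rule convexI)
    fix x y and u v :: real
    assume *: "x \<in> {y. y - snd d p \<in> S}" "y \<in> {y. y - snd d p \<in> S}" "u + v = 1"
    have "u *\<^sub>R (x - snd d p) + v *\<^sub>R (y - snd d p) \<in> S"
      using S * by (intro subspace_add subspace_scale) auto
    also have "u *\<^sub>R (x - snd d p) + v *\<^sub>R (y - snd d p) = u *\<^sub>R x + v *\<^sub>R y - (u + v) *\<^sub>R snd d p"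
      by (simp add: algebra_simps)
    finally show "u *\<^sub>R x + v *\<^sub>R y \<in> {y. y - snd d p \<in> S}" using *(3) by simp
  qed
  then have "connected ?C" using cv by (intro convex_connected convex_Int)
  then have "connected (chart_inv d ` ?C)"
    by (rule connected_continuous_image[rotated]) (rule continuous_on_subset[OF chart_continuous(2)[OF ch]], simp)
  also have "chart_inv d ` ?C = plaque d S p"
  proof
    show "plaque d S p \<subseteq> chart_inv d ` ?C"
    proof
      fix q assume "q \<in> plaque d S p"
      then show "q \<in> chart_inv d ` ?C"
        by (intro image_eqI[where x = "snd d q"]) (auto simp: plaque_def chart_inv_left[OF ch])
    qed
  qed (auto simp: plaque_def chart_inv_left[OF ch])
  finally have "connected (plaque d S p)" .
  then have "connected_space (top_of_set (plaque d S p))"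
    unfolding connectedin_iff_connected[symmetric] connectedin_def by simp
  then show ?thesis
    using openin_subset[OF plaque_openin[OF d, of p]] by (simp add: connectedin_def plaque_subtopology[OF d])
qed

text \<open>The leaf is the connected component of \<open>p0\<close> in the leaf topology.
  Maximality concerns integral manifolds anywhere in the manifold; characterising \<open>Om\<close>
  by the rank of \<open>D\<close> keeps competitors inside \<open>Om\<close>.\<close>

lemma leaf_exists:
  assumes fol: "\<And>p. p \<in> Om \<Longrightarrow> \<exists>d S. foliated D Om d S \<and> p \<in> fst d"
    and dim: "\<And>p. p \<in> Om \<longleftrightarrow> dim (D p) = k" and p0: "p0 \<in> Om"
  shows "\<exists>L. leaf A D L \<and> p0 \<in> topspace L"
proof -
  let ?\<tau> = "leaf_topology D Om"
  define C where "C = connected_component_of_set ?\<tau> p0"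
  define L where "L = subtopology ?\<tau> C"
  have CO: "C \<subseteq> Om" using connected_component_of_subset_topspace[of ?\<tau> p0]
    by (simp add: C_def topspace_leaf_topology)
  have topL: "topspace L = C" using CO by (auto simp: L_def topspace_leaf_topology)
  have p0C: "p0 \<in> C" using p0 by (simp add: C_def connected_component_of_refl topspace_leaf_topology)
  have maxC: "S \<subseteq> C" if "connectedin ?\<tau> S" "p \<in> S" "p \<in> C" for S p
  proof -
    have "connected_component_of_set ?\<tau> p = C"
      using that(3) by (simp add: C_def connected_component_of_equiv)
    then show ?thesis using connected_component_of_maximal[OF that(1,2)] by simp
  qed
  have slice: "slice_at A L p d S" if d: "foliated D Om d S" "p \<in> fst d" and p: "p \<in> C" for p d S
  proof -
    have S: "adm d" "subspace S" using d by (auto simp: foliated_def)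
    have sub: "plaque d S p \<subseteq> C"
      by (rule maxC[OF plaque_connectedin[OF d(1)] plaque_self[OF d(2) S(2)] p])
    have "openin L (plaque d S p)"
      unfolding L_def openin_subtopology using plaque_openin[OF d(1), of p] sub by blast
    moreover have "subtopology L (plaque d S p) = top_of_set (plaque d S p)"
      using sub by (simp add: L_def subtopology_subtopology Int_absorb1 plaque_subtopology[OF d(1)])
    ultimately show ?thesis using S d by (simp add: slice_at_plaque)
  qed
  have tan: "tangent_space A L p = D p" if p: "p \<in> C" for p
  proof -
    obtain d S where d: "foliated D Om d S" "p \<in> fst d" using fol CO p by blast
    have S: "adm d" "dchart A d p ` D p = S" using d by (auto simp: foliated_def)
    have "v \<in> D p \<longleftrightarrow> dchart A d p v \<in> S" for v
      unfolding S(2)[symmetric]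
    proof
      assume "dchart A d p v \<in> dchart A d p ` D p"
      then obtain u where u: "u \<in> D p" "dchart A d p v = dchart A d p u" by blast
      then have "v = u" using dchart_inverse(1)[OF S(1) d(2)] by metis
      then show "v \<in> D p" using u(1) by simp
    qed simp
    then show ?thesis unfolding slice_tangent_space[OF slice[OF d p]] by blast
  qed
  have dimS: "dim S = k" if "foliated D Om d S" "p \<in> fst d" for p d S
    using that dim_dchart[of d p "D p"] dim[of p] by (auto simp: foliated_def)
  have cim: "connected_integral_manifold A D L"
    unfolding connected_integral_manifold_def immersed_submanifold_def topL
  proof (intro conjI ballI)
    show "\<exists>k. \<forall>p\<in>C. \<exists>c S. slice_at A L p c S \<and> dim S = k"
    proof (intro exI[of _ k] ballI)
      fix p assume "p \<in> C"
      then show "\<exists>c S. slice_at A L p c S \<and> dim S = k" using fol CO slice dimS by blast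
    qed
    show "connected_space L"
      using connectedin_connected_component_of[of ?\<tau> p0] by (simp add: L_def C_def connectedin_def)
  qed (use tan p0C in auto)
  moreover have "topspace N = C" if N: "connected_integral_manifold A D N" and sub: "C \<subseteq> topspace N" for N
  proof -
    obtain l where l: "immersed_submanifold A l N" and tN: "\<And>p. p \<in> topspace N \<Longrightarrow> tangent_space A N p = D p"
      and cN: "connected_space N" using N by (auto simp: connected_integral_manifold_def)
    have dl: "dim (D p) = l" if "p \<in> topspace N" for p
      using l slice_dim tN that unfolding immersed_submanifold_def by metis
    \<comment> \<open>An immersed submanifold has one dimension: containing \<open>p0\<close>, the
      competitor has rank \<open>k\<close> everywhere.\<close>
    have NO: "topspace N \<subseteq> Om"
      using dl[of p0] dl sub p0C p0 dim by (auto simp: subset_iff)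
    \<comment> \<open>The topology of an integral manifold is at least as fine as the leaf topology,
      so its connectedness is inherited by its image there.\<close>
    have "continuous_map N ?\<tau> (\<lambda>x. x)"
      unfolding continuous_map_def
    proof (intro conjI allI impI)
      show "(\<lambda>x. x) \<in> topspace N \<rightarrow> topspace ?\<tau>" using NO by (auto simp: topspace_leaf_topology)
      fix U assume U: "openin ?\<tau> U"
      show "openin N {x \<in> topspace N. x \<in> U}"
        unfolding openin_subopen[of N "{x \<in> topspace N. x \<in> U}"]
      proof
        fix p assume p: "p \<in> {x \<in> topspace N. x \<in> U}"
        obtain c S where c: "slice_at A N p c S" using l p unfolding immersed_submanifold_def by blast
        obtain d S' where d: "foliated D Om d S'" "p \<in> fst d" using fol NO p by blast
        obtain W where W: "open W" "p \<in> W" "W \<inter> plaque c S p \<subseteq> plaque d S' p"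
          using integral_manifold_in_plaque[OF tN c d] by blast
        obtain W' where W': "open W'" "p \<in> W'" "W' \<inter> plaque d S' p \<subseteq> U"
          using U d p unfolding openin_leaf_topology by blast
        have opc: "openin N (plaque c S p)" and "subtopology N (plaque c S p) = top_of_set (plaque c S p)"
          using c by (auto simp: slice_at_plaque)
        moreover have "openin (top_of_set (plaque c S p)) (plaque c S p \<inter> (W \<inter> W'))"
          using W W' by (intro openin_open_Int open_Int)
        ultimately have "openin N (plaque c S p \<inter> (W \<inter> W'))"
          by (metis openin_trans_full)
        moreover have "p \<in> plaque c S p" using c by (auto simp: slice_at_plaque plaque_self)
        ultimately show "\<exists>T. openin N T \<and> p \<in> T \<and> T \<subseteq> {x \<in> topspace N. x \<in> U}"
          using W W' openin_subset[OF opc] by (intro exI[of _ "plaque c S p \<inter> (W \<inter> W')"]) blast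
      qed
    qed
    then have "connectedin ?\<tau> ((\<lambda>x. x) ` topspace N)"
      using cN connectedin_continuous_map_image connectedin_topspace by blast
    then have "topspace N \<subseteq> C" using maxC[of "topspace N" p0] sub p0C by auto
    then show ?thesis using sub by blast
  qed
  ultimately have "leaf A D L" unfolding leaf_def topL by blast
  then show ?thesis using p0C topL by blast
qed

text \<open>The chart is \<open>c\<close> followed by the inverse of the Frobenius box, whose
  domain, a ball, becomes the convex chart image.\<close>

lemma foliated_chart_exists:
  assumes c: "adm c" "p \<in> fst c" and Om: "open Om" "p \<in> Om"
    and \<Delta>: "\<And>y. \<Delta> y = dchart A c (chart_inv c y) ` D (chart_inv c y)"
    and dist: "smooth_distribution_on k (snd c ` (fst c \<inter> Om)) \<Delta>"
    and inv: "involutive_on (snd c ` (fst c \<inter> Om)) \<Delta>"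
  shows "\<exists>d S. foliated D Om d S \<and> p \<in> fst d"
proof -
  note ch = adm_chart[OF c(1)]
  let ?V = "snd c ` (fst c \<inter> Om)"
  have V: "open ?V" "snd c p \<in> ?V" using c Om by (auto intro: chart_image_open[OF ch])
  obtain \<epsilon> and \<Phi> :: "'e \<Rightarrow> 'e" where \<Phi>: "\<epsilon> > 0" "\<Phi> 0 = snd c p" "smooth_on (ball 0 \<epsilon>) \<Phi>" "\<Phi> ` ball 0 \<epsilon> \<subseteq> ?V"
    "inj_on \<Phi> (ball 0 \<epsilon>)" "open (\<Phi> ` ball 0 \<epsilon>)"
    "smooth_on (\<Phi> ` ball 0 \<epsilon>) (inv_into (ball 0 \<epsilon>) \<Phi>)"
    "\<And>w. w \<in> ball 0 \<epsilon> \<Longrightarrow> \<Delta> (\<Phi> w) = frechet_derivative \<Phi> (at w) ` \<Delta> (snd c p)"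
    by (rule frobenius_box[OF V dist inv]) (rule that; assumption)
  let ?B = "ball (0::'e) \<epsilon>"
  let ?i = "inv_into ?B \<Phi>"
  define U where "U = chart_inv c ` \<Phi> ` ?B"
  define d where "d = (U, \<lambda>q. ?i (snd c q))"
  have BV: "y \<in> snd c ` fst c" if "y \<in> \<Phi> ` ?B" for y using \<Phi>(4) that by blast
  have U: "U = {q \<in> fst c. snd c q \<in> \<Phi> ` ?B}"
  proof
    show "U \<subseteq> {q \<in> fst c. snd c q \<in> \<Phi> ` ?B}"
    proof
      fix q assume "q \<in> U"
      then obtain y where y: "y \<in> \<Phi> ` ?B" "q = chart_inv c y" unfolding U_def by blast
      then show "q \<in> {q \<in> fst c. snd c q \<in> \<Phi> ` ?B}"
        using chart_inv_mem[OF BV[OF y(1)]] chart_inv_right[OF BV[OF y(1)]] by simp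
    qed
    show "{q \<in> fst c. snd c q \<in> \<Phi> ` ?B} \<subseteq> U"
    proof
      fix q assume q: "q \<in> {q \<in> fst c. snd c q \<in> \<Phi> ` ?B}"
      show "q \<in> U"
        unfolding U_def by (rule image_eqI[where x = "snd c q"]) (use q in \<open>auto simp: chart_inv_left[OF ch]\<close>)
    qed
  qed
  have opU: "open U" unfolding U by (rule chart_preimage_open[OF ch \<Phi>(6)])
  have i\<Phi>: "?i (\<Phi> w) = w" if "w \<in> ?B" for w using inv_into_f_f[OF \<Phi>(5) that] .
  have \<Phi>i: "\<Phi> (?i y) = y" "?i y \<in> ?B" if "y \<in> \<Phi> ` ?B" for y
    using that f_inv_into_f inv_into_into by metis+
  have pt: "chart_inv c (\<Phi> w) \<in> U" "snd c (chart_inv c (\<Phi> w)) = \<Phi> w" if "w \<in> ?B" for w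
    using that chart_inv_right[OF BV[OF imageI[OF that]]] by (auto simp: U_def)
  have img: "snd d ` fst d = ?B"
  proof
    show "snd d ` fst d \<subseteq> ?B" using \<Phi>i(2) by (auto simp: d_def U)
    show "?B \<subseteq> snd d ` fst d"
    proof
      fix w assume w: "w \<in> ?B"
      have "snd d (chart_inv c (\<Phi> w)) = w" by (simp add: d_def pt(2)[OF w] i\<Phi>[OF w])
      then show "w \<in> snd d ` fst d" using pt(1)[OF w] by (metis d_def fst_conv imageI)
    qed
  qed
  have injd: "inj_on (snd d) (fst d)"
  proof (rule inj_on_inverseI)
    fix q assume "q \<in> fst d"
    then show "chart_inv c (\<Phi> (snd d q)) = q"
      using \<Phi>i(1) chart_inv_left[OF ch] by (simp add: d_def U)
  qed
  have invd: "chart_inv d w = chart_inv c (\<Phi> w)" if w: "w \<in> ?B" for w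
  proof -
    have "snd d (chart_inv c (\<Phi> w)) = w" by (simp add: d_def pt(2)[OF w] i\<Phi>[OF w])
    then show ?thesis using pt(1)[OF w] inv_into_f_f[OF injd, of "chart_inv c (\<Phi> w)"] by (simp add: d_def)
  qed
  have chd: "is_chart d"
  proof (rule is_chartI)
    show "open (fst d)" using opU by (simp add: d_def)
    show "open (snd d ` fst d)" unfolding img by simp
    show "continuous_on (fst d) (snd d)"
      unfolding d_def fst_conv snd_conv
      by (rule continuous_on_compose2[OF smooth_on_continuous[OF \<Phi>(7)]])
        (auto simp: U intro: continuous_on_subset[OF chart_continuous(1)[OF ch]])
    have "continuous_on ?B (\<lambda>w. chart_inv c (\<Phi> w))"
      by (rule continuous_on_compose2[OF chart_continuous(2)[OF ch] smooth_on_continuous[OF \<Phi>(3)]])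
        (use BV in blast)
    then show "continuous_on (snd d ` fst d) (chart_inv d)"
      unfolding img using invd by (metis (no_types, lifting) continuous_on_cong)
  qed (rule injd)
  have Uc: "U \<subseteq> fst c" using U by blast
  have admd: "adm d"
    unfolding admissible_chart_def smooth_transition_def comp_def
  proof (intro conjI ballI chd)
    fix b assume "b \<in> A"
    then have b: "adm b" by (rule atlas_adm)
    note chb = adm_chart[OF b]
    have op1: "open (snd d ` (fst d \<inter> fst b))" by (intro chart_image_open chd chart_open chb)
    have eq1: "snd d ` (fst d \<inter> fst b) \<subseteq> ?B" using img by blast
    have "smooth_on (snd d ` (fst d \<inter> fst b)) (\<lambda>y. snd b (chart_inv c (\<Phi> y)))"
    proof (rule smooth_on_compose[OF smooth_on_subset[OF \<Phi>(3) eq1] transition_smooth[OF c(1) b] op1])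
      show "open (snd c ` (fst c \<inter> fst b))" by (intro chart_image_open ch chart_open chb)
      show "\<Phi> ` snd d ` (fst d \<inter> fst b) \<subseteq> snd c ` (fst c \<inter> fst b)"
        using \<Phi>i(1) by (auto simp: d_def U)
    qed
    then show "smooth_on (snd d ` (fst d \<inter> fst b)) (\<lambda>y. snd b (chart_inv d y))"
      by (subst smooth_on_cong[OF op1, of _ "\<lambda>y. snd b (chart_inv c (\<Phi> y))"]) (use eq1 invd in auto)
    have op2: "open (snd b ` (fst b \<inter> U))" by (intro chart_image_open chb opU)
    have "smooth_on (snd b ` (fst b \<inter> U)) (\<lambda>y. ?i (snd c (chart_inv b y)))"
    proof (rule smooth_on_compose[OF smooth_on_subset[OF transition_smooth[OF b c(1)]] \<Phi>(7) op2 \<Phi>(6)])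
      show "snd b ` (fst b \<inter> U) \<subseteq> snd b ` (fst b \<inter> fst c)" using Uc by blast
      show "(\<lambda>y. snd c (chart_inv b y)) ` snd b ` (fst b \<inter> U) \<subseteq> \<Phi> ` ?B"
        using chart_inv_left[OF chb] by (auto simp: U)
    qed
    then show "smooth_on (snd b ` (fst b \<inter> fst d)) (\<lambda>x. snd d (chart_inv b x))" by (simp add: d_def)
  qed
  let ?S = "\<Delta> (snd c p)"
  have pU: "p \<in> U" using c \<Phi>(1,2) by (auto simp: U image_iff intro!: bexI[of _ 0])
  have sub: "subspace ?S"
  proof -
    obtain W X where W: "snd c p \<in> W" "\<forall>y\<in>W. \<Delta> y = span ((\<lambda>i. X i y) ` {..<k})"
      using dist V(2) unfolding smooth_distribution_on_def by metis
    then show ?thesis by simp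
  qed
  have im: "dchart A d q ` D q = ?S" if q: "q \<in> fst d" for q
  proof -
    have qU: "q \<in> U" "q \<in> fst c" using q Uc by (auto simp: d_def)
    define w where "w = snd d q"
    have w: "w \<in> ?B" using img q by (auto simp: w_def)
    have \<Phi>w: "\<Phi> w = snd c q" using qU \<Phi>i(1) by (simp add: w_def d_def U)
    \<comment> \<open>\<open>\<Phi>\<close> is the transition from \<open>d\<close> to
      \<open>c\<close>, so the property of the box becomes a statement about differentials of
      charts.\<close>
    have "(\<Phi> has_derivative coord_change d c q) (at w)"
    proof (rule has_derivative_transform_within_open[of "\<lambda>y. snd c (chart_inv d y)" _ _ _ ?B])
      show "((\<lambda>y. snd c (chart_inv d y)) has_derivative coord_change d c q) (at w)"
        unfolding w_def by (rule coord_change_has_derivative[OF admd c(1) q qU(2)])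
      show "snd c (chart_inv d y) = \<Phi> y" if "y \<in> ?B" for y using invd[OF that] pt(2)[OF that] by simp
    qed (use w in auto)
    from frechet_derivative_at[OF this] have fr: "frechet_derivative \<Phi> (at w) = coord_change d c q" by simp
    have "dchart A c q ` D q = \<Delta> (\<Phi> w)" by (simp add: \<Delta> \<Phi>w chart_inv_left[OF ch qU(2)])
    also have "\<dots> = coord_change d c q ` ?S" using \<Phi>(8)[OF w] fr by simp
    finally have "coord_change c d q ` dchart A c q ` D q = coord_change c d q ` coord_change d c q ` ?S" by simp
    also have "\<dots> = ?S"
      using admd c(1) q qU(2) by (simp add: image_image coord_change_compose coord_change_self)
    also have "coord_change c d q ` dchart A c q ` D q = dchart A d q ` D q"
      using admd c(1) q qU(2) by (simp add: image_image dchart_change)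
    finally show ?thesis .
  qed
  have inOm: "fst d \<subseteq> Om"
  proof
    fix q assume "q \<in> fst d"
    then have q: "q \<in> fst c" and "snd c q \<in> ?V" using \<Phi>(4) by (auto simp: d_def U)
    then obtain x where x: "x \<in> fst c" "x \<in> Om" "snd c q = snd c x" by blast
    have "q = x"
      by (rule trans[OF chart_inv_left[OF ch q, symmetric]]) (simp only: x(3) chart_inv_left[OF ch x(1)])
    then show "q \<in> Om" using x(2) by simp
  qed
  show ?thesis
  proof (intro exI conjI)
    show "foliated D Om d ?S"
      unfolding foliated_def img by (intro conjI ballI admd inOm convex_ball sub im)
    show "p \<in> fst d" by (simp add: d_def pU)
  qed
qed

end

section \<open>Involutivity and frames\<close>

text \<open>Differentiated coefficients contribute only multiples of the frame fields, so the
  brackets of the frame fields decide.\<close>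

lemma involutive_on_frame:
  fixes X :: "nat \<Rightarrow> 'e::euclidean_space \<Rightarrow> 'e"
  assumes V: "open V" and X: "\<And>i. i < k \<Longrightarrow> smooth_on V (X i)"
    and \<Delta>: "\<And>z. z \<in> V \<Longrightarrow> \<Delta> z = span ((\<lambda>i. X i z) ` {..<k})"
    and dim: "\<And>z. z \<in> V \<Longrightarrow> dim ((\<lambda>i. X i z) ` {..<k}) = k"
    and bracket: "\<And>i j z. i < k \<Longrightarrow> j < k \<Longrightarrow> z \<in> V \<Longrightarrow>
      frechet_derivative (X j) (at z) (X i z) - frechet_derivative (X i) (at z) (X j z) \<in> \<Delta> z"
  shows "involutive_on V \<Delta>"
  unfolding involutive_on_def
proof (intro allI impI ballI)
  fix U Y Z z
  assume asm: "open U \<and> U \<subseteq> V \<and> smooth_on U Y \<and> smooth_on U Z \<and> (\<forall>z\<in>U. Y z \<in> \<Delta> z \<and> Z z \<in> \<Delta> z)"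
    and z: "z \<in> U"
  then have U: "open U" "U \<subseteq> V" and Y: "smooth_on U Y" and Z: "smooth_on U Z"
    and mem: "\<And>y. y \<in> U \<Longrightarrow> Y y \<in> span ((\<lambda>i. X i y) ` {..<k})" "\<And>y. y \<in> U \<Longrightarrow> Z y \<in> span ((\<lambda>i. X i y) ` {..<k})"
    using \<Delta> by auto
  have "\<exists>c. v = (\<Sum>i<k. c i *\<^sub>R X i y)" if "v \<in> span ((\<lambda>i. X i y) ` {..<k})" for v y
    using that by (rule in_span_familyE) blast
  then have "\<exists>c. Y y = (\<Sum>i<k. c i *\<^sub>R X i y)" "\<exists>c. Z y = (\<Sum>i<k. c i *\<^sub>R X i y)" if "y \<in> U" for y
    using mem that by blast+
  then obtain a' b' where a': "\<And>y. y \<in> U \<Longrightarrow> Y y = (\<Sum>i<k. a' y i *\<^sub>R X i y)"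
    and b': "\<And>y. y \<in> U \<Longrightarrow> Z y = (\<Sum>i<k. b' y i *\<^sub>R X i y)" by metis
  define a b where "a i y = a' y i" and "b i y = b' y i" for i y
  have XU: "smooth_on U (X i)" if "i < k" for i using smooth_on_subset[OF X[OF that] U(2)] .
  have dimU: "dim ((\<lambda>i. X i y) ` {..<k}) = k" if "y \<in> U" for y using dim U(2) that by blast
  have a: "smooth_on U (a i)" "smooth_on U (b i)" if "i < k" for i
    by (rule smooth_coefficients[OF U(1) XU dimU Y _ that]; simp add: a_def a')
      (rule smooth_coefficients[OF U(1) XU dimU Z _ that]; simp add: b_def b')
  let ?D = "\<lambda>f. frechet_derivative f (at z)"
  have lin: "linear (?D (X i))" if "i < k" for i
    using smooth_on_has_derivative[OF XU[OF that] z] has_derivative_linear by blast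
  have DY: "?D F v = (\<Sum>i<k. f i z *\<^sub>R ?D (X i) v + ?D (f i) v *\<^sub>R X i z)"
    if f: "\<And>i. i < k \<Longrightarrow> smooth_on U (f i)" and F: "\<And>y. y \<in> U \<Longrightarrow> F y = (\<Sum>i<k. f i y *\<^sub>R X i y)"
    for f :: "nat \<Rightarrow> 'e \<Rightarrow> real" and F v
  proof -
    have "((\<lambda>y. \<Sum>i<k. f i y *\<^sub>R X i y) has_derivative (\<lambda>v. \<Sum>i<k. f i z *\<^sub>R ?D (X i) v + ?D (f i) v *\<^sub>R X i z)) (at z)"
      by (intro has_derivative_sum has_derivative_scaleR smooth_on_has_derivative[OF f z] smooth_on_has_derivative[OF XU z]) auto
    then have "(F has_derivative (\<lambda>v. \<Sum>i<k. f i z *\<^sub>R ?D (X i) v + ?D (f i) v *\<^sub>R X i z)) (at z)"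
      by (rule has_derivative_transform_within_open[OF _ U(1) z]) (simp add: F)
    from fun_cong[OF frechet_derivative_at[OF this], of v] show ?thesis by (rule sym)
  qed
  have Yz: "Y z = (\<Sum>i<k. a i z *\<^sub>R X i z)" and Zz: "Z z = (\<Sum>i<k. b i z *\<^sub>R X i z)"
    using a' b' z by (simp_all add: a_def b_def)
  have DX: "?D (X j) (\<Sum>i<k. c i *\<^sub>R X i z) = (\<Sum>i<k. c i *\<^sub>R ?D (X j) (X i z))" if "j < k" for c j
    using lin[OF that] by (simp add: linear_sum linear_scale)
  \<comment> \<open>Both halves of the bracket are instances of this, with \<open>a\<close> and
    \<open>b\<close> exchanged; after one interchange of summation the double sums combine to
    brackets of frame fields.\<close>
  have D_eq: "?D F (G z) = (\<Sum>j<k. \<Sum>i<k. (f j z * g i z) *\<^sub>R ?D (X j) (X i z)) + (\<Sum>j<k. ?D (f j) (G z) *\<^sub>R X j z)"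
    if f: "\<And>i. i < k \<Longrightarrow> smooth_on U (f i)" and F: "\<And>y. y \<in> U \<Longrightarrow> F y = (\<Sum>i<k. f i y *\<^sub>R X i y)"
      and G: "G z = (\<Sum>i<k. g i z *\<^sub>R X i z)"
    for f g :: "nat \<Rightarrow> 'e \<Rightarrow> real" and F G :: "'e \<Rightarrow> 'e"
  proof -
    have "?D F (G z) = (\<Sum>j<k. f j z *\<^sub>R ?D (X j) (G z) + ?D (f j) (G z) *\<^sub>R X j z)"
      by (rule DY[of f F, OF f F])
    also have "\<dots> = (\<Sum>j<k. f j z *\<^sub>R (\<Sum>i<k. g i z *\<^sub>R ?D (X j) (X i z)) + ?D (f j) (G z) *\<^sub>R X j z)"
      by (rule sum.cong[OF refl]) (simp add: DX[symmetric] G[symmetric])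
    finally show ?thesis by (simp add: sum.distrib scaleR_sum_right)
  qed
  have 1: "?D Z (Y z) = (\<Sum>j<k. \<Sum>i<k. (b j z * a i z) *\<^sub>R ?D (X j) (X i z)) + (\<Sum>j<k. ?D (b j) (Y z) *\<^sub>R X j z)"
    by (rule D_eq[of b Z Y a]) (simp_all add: a(2) Yz, simp add: b_def b')
  have "?D Y (Z z) = (\<Sum>i<k. \<Sum>j<k. (a i z * b j z) *\<^sub>R ?D (X i) (X j z)) + (\<Sum>i<k. ?D (a i) (Z z) *\<^sub>R X i z)"
    by (rule D_eq[of a Y Z b]) (simp_all add: a(1) Zz, simp add: a_def a')
  also have "\<dots> = (\<Sum>j<k. \<Sum>i<k. (b j z * a i z) *\<^sub>R ?D (X i) (X j z)) + (\<Sum>i<k. ?D (a i) (Z z) *\<^sub>R X i z)"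
    by (subst sum.swap) (simp add: mult.commute)
  finally have 2: "?D Y (Z z) = (\<Sum>j<k. \<Sum>i<k. (b j z * a i z) *\<^sub>R ?D (X i) (X j z)) + (\<Sum>i<k. ?D (a i) (Z z) *\<^sub>R X i z)" .
  have "?D Z (Y z) - ?D Y (Z z) = (\<Sum>j<k. \<Sum>i<k. (b j z * a i z) *\<^sub>R (?D (X j) (X i z) - ?D (X i) (X j z)))
      + ((\<Sum>j<k. ?D (b j) (Y z) *\<^sub>R X j z) - (\<Sum>i<k. ?D (a i) (Z z) *\<^sub>R X i z))"
    unfolding 1 2 by (simp add: scaleR_diff_right sum_subtractf)
  moreover have zV: "z \<in> V" using z U(2) by blast
  have "subspace (\<Delta> z)" using \<Delta>[OF zV] by simp
  moreover have "(\<Sum>j<k. \<Sum>i<k. (b j z * a i z) *\<^sub>R (?D (X j) (X i z) - ?D (X i) (X j z))) \<in> \<Delta> z"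
    using \<open>subspace (\<Delta> z)\<close> by (intro subspace_sum subspace_scale bracket zV) auto
  moreover have "(\<Sum>j<k. c j *\<^sub>R X j z) \<in> \<Delta> z" for c
    unfolding \<Delta>[OF zV] by (rule sum_in_span_family)
  ultimately show "?D Z (Y z) - ?D Y (Z z) \<in> \<Delta> z"
    by (simp only:) (intro subspace_add subspace_diff)
qed

lemma involutive_on_local:
  assumes "\<And>z. z \<in> V \<Longrightarrow> \<exists>W. open W \<and> z \<in> W \<and> involutive_on W \<Delta>"
  shows "involutive_on V \<Delta>"
  unfolding involutive_on_def
proof (intro allI impI ballI)
  fix U Y Z z
  assume asm: "open U \<and> U \<subseteq> V \<and> smooth_on U Y \<and> smooth_on U Z \<and> (\<forall>z\<in>U. Y z \<in> \<Delta> z \<and> Z z \<in> \<Delta> z)"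
    and z: "z \<in> U"
  then obtain W where W: "open W" "z \<in> W" "involutive_on W \<Delta>" using assms by blast
  have "open (U \<inter> W) \<and> U \<inter> W \<subseteq> W \<and> smooth_on (U \<inter> W) Y \<and> smooth_on (U \<inter> W) Z \<and>
      (\<forall>z\<in>U \<inter> W. Y z \<in> \<Delta> z \<and> Z z \<in> \<Delta> z)"
    using asm W(1) by (auto intro: smooth_on_subset)
  then show "frechet_derivative Z (at z) (Y z) - frechet_derivative Y (at z) (Z z) \<in> \<Delta> z"
    using W(3)[unfolded involutive_on_def, rule_format, of "U \<inter> W" Y Z z] z W(2) by simp
qed

text \<open>The bracket of smooth fields is continuous and lying in the span of a frame is a closed
  condition, so values at points of \<open>G\<close> determine the rest.\<close>

lemma involutive_on_dense:
  fixes \<Delta> :: "'e::euclidean_space \<Rightarrow> 'e set"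
  assumes V: "open V" and dist: "smooth_distribution_on k V \<Delta>"
    and G: "open G" "involutive_on G \<Delta>" and dense: "\<And>W z. open W \<Longrightarrow> z \<in> W \<Longrightarrow> W \<subseteq> V \<Longrightarrow> W \<inter> G \<noteq> {}"
  shows "involutive_on V \<Delta>"
  unfolding involutive_on_def
proof (intro allI impI ballI)
  fix U Y Z z
  assume asm: "open U \<and> U \<subseteq> V \<and> smooth_on U Y \<and> smooth_on U Z \<and> (\<forall>z\<in>U. Y z \<in> \<Delta> z \<and> Z z \<in> \<Delta> z)"
    and z: "z \<in> U"
  then have "z \<in> V" by blast
  then obtain W X where W: "open W" "z \<in> W" "W \<subseteq> V" and X: "\<And>i. i < k \<Longrightarrow> smooth_on W (X i)"
    and \<Delta>: "\<And>y. y \<in> W \<Longrightarrow> \<Delta> y = span ((\<lambda>i. X i y) ` {..<k})"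
    and dimX: "\<And>y. y \<in> W \<Longrightarrow> dim ((\<lambda>i. X i y) ` {..<k}) = k"
    using dist unfolding smooth_distribution_on_def by metis
  let ?U = "U \<inter> W"
  have U: "open ?U" "z \<in> ?U" "?U \<subseteq> V" and sm: "smooth_on ?U Y" "smooth_on ?U Z"
    using asm W z by (auto intro: smooth_on_subset)
  define F where "F y = frechet_derivative Z (at y) (Y y) - frechet_derivative Y (at y) (Z y)" for y
  have lin: "linear (frechet_derivative Z (at y))" "linear (frechet_derivative Y (at y))" if "y \<in> ?U" for y
    using smooth_on_has_derivative[OF sm(1) that] smooth_on_has_derivative[OF sm(2) that] has_derivative_linear by blast+
  have 1: "smooth_on ?U (\<lambda>y. frechet_derivative Z (at y) (Y y))"
    by (rule smooth_on_apply_linear[where L = "\<lambda>y. frechet_derivative Z (at y)", OF U(1) sm(1) lin(1) smooth_on_derivative[OF sm(2)]])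
  have 2: "smooth_on ?U (\<lambda>y. frechet_derivative Y (at y) (Z y))"
    by (rule smooth_on_apply_linear[where L = "\<lambda>y. frechet_derivative Y (at y)", OF U(1) sm(2) lin(2) smooth_on_derivative[OF sm(1)]])
  have F: "continuous_on ?U F"
    unfolding F_def by (rule smooth_on_continuous[OF smooth_on_diff[OF U(1) 1 2]])
  have "F z \<in> span ((\<lambda>i. X i z) ` {..<k})"
  proof (rule in_span_closed[where V = ?U and X = X and k = k and Y = F])
    show "open ?U" "z \<in> ?U" "dim ((\<lambda>i. X i z) ` {..<k}) = k" "continuous_on ?U F"
      using U dimX[OF W(2)] F by auto
    show "smooth_on ?U (X i)" if "i < k" for i by (rule smooth_on_subset[OF X[OF that]]) blast
    show "z \<in> closure {y \<in> ?U. F y \<in> span ((\<lambda>i. X i y) ` {..<k})}"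
      unfolding closure_iff_nhds_not_empty
    proof (intro allI impI)
      fix T T' assume T: "T' \<subseteq> T" "open T'" "z \<in> T'"
      have "(?U \<inter> T') \<inter> G \<noteq> {}" using T(2,3) U by (intro dense[of _ z]) auto
      then obtain y where y: "y \<in> ?U" "y \<in> T'" "y \<in> G" by blast
      have "open (?U \<inter> G) \<and> ?U \<inter> G \<subseteq> G \<and> smooth_on (?U \<inter> G) Y \<and> smooth_on (?U \<inter> G) Z \<and>
          (\<forall>z\<in>?U \<inter> G. Y z \<in> \<Delta> z \<and> Z z \<in> \<Delta> z)"
        using asm U G(1) sm by (auto intro: smooth_on_subset)
      then have "F y \<in> \<Delta> y"
        unfolding F_def using G(2)[unfolded involutive_on_def, rule_format, of "?U \<inter> G" Y Z y] y by simp
      then show "{y \<in> ?U. F y \<in> span ((\<lambda>i. X i y) ` {..<k})} \<inter> T \<noteq> {}"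
        using y T(1) \<Delta>[of y] by auto
    qed
  qed
  then show "frechet_derivative Z (at z) (Y z) - frechet_derivative Y (at z) (Z z) \<in> \<Delta> z"
    using \<Delta>[OF W(2)] by (simp add: F_def)
qed

section \<open>Bivectors\<close>

lemma blinfun_separates:
  fixes v w :: "'e::euclidean_space"
  assumes "\<And>\<eta> :: 'e \<Rightarrow>\<^sub>L real. \<eta> v = \<eta> w"
  shows "v = w"
proof -
  have "v \<bullet> (v - w) = w \<bullet> (v - w)" using assms[of "blinfun_inner_left (v - w)"] by simp
  then have "(v - w) \<bullet> (v - w) = 0" by (simp add: inner_diff_left)
  then show ?thesis by simp
qed

text \<open>An explicit sum of vectors realises the contraction, and covectors separate vectors;
  hence the definite description in \<open>sharp\<close> denotes.\<close>

lemma sharp_wedge: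
  fixes \<pi> :: "'a \<Rightarrow> 'e::euclidean_space biform" and \<xi> \<eta> :: "'e \<Rightarrow>\<^sub>L real"
  assumes "\<pi> p \<in> wedge2 UNIV"
  shows "\<exists>(m::nat) v w. \<forall>\<xi> :: 'e \<Rightarrow>\<^sub>L real. sharp \<pi> p \<xi> = (\<Sum>i<m. \<xi> (v i) *\<^sub>R w i - \<xi> (w i) *\<^sub>R v i)"
    and "\<eta> (sharp \<pi> p \<xi>) = \<pi> p \<xi> \<eta>"
proof -
  obtain m :: nat and v w where \<pi>: "\<And>(\<xi> :: 'e \<Rightarrow>\<^sub>L real) (\<eta> :: 'e \<Rightarrow>\<^sub>L real). \<pi> p \<xi> \<eta> = (\<Sum>i<m. \<xi> (v i) * \<eta> (w i) - \<xi> (w i) * \<eta> (v i))"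
    using assms unfolding wedge2_def by blast
  let ?s = "\<lambda>\<xi> :: 'e \<Rightarrow>\<^sub>L real. \<Sum>i<m. \<xi> (v i) *\<^sub>R w i - \<xi> (w i) *\<^sub>R v i"
  have s: "blinfun_apply \<eta> (?s \<xi>) = \<pi> p \<xi> \<eta>" for \<xi> \<eta> by (simp add: \<pi> blinfun.sum_right blinfun.diff_right blinfun.scaleR_right)
  have eq: "sharp \<pi> p \<xi> = ?s \<xi>" for \<xi> :: "'e \<Rightarrow>\<^sub>L real"
    unfolding sharp_def
  proof (rule the_equality)
    show "\<forall>\<eta>. blinfun_apply \<eta> (?s \<xi>) = \<pi> p \<xi> \<eta>" using s by blast
    show "u = ?s \<xi>" if "\<forall>\<eta>. blinfun_apply \<eta> u = \<pi> p \<xi> \<eta>" for u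
      by (rule blinfun_separates) (simp only: that[rule_format] s)
  qed
  then show "\<exists>(m::nat) v w. \<forall>\<xi> :: 'e \<Rightarrow>\<^sub>L real. sharp \<pi> p \<xi> = (\<Sum>i<m. \<xi> (v i) *\<^sub>R w i - \<xi> (w i) *\<^sub>R v i)" by blast
  show "blinfun_apply \<eta> (sharp \<pi> p \<xi>) = \<pi> p \<xi> \<eta>" unfolding eq s ..
qed

lemma wedge2_skew: "b \<in> wedge2 V \<Longrightarrow> b \<xi> \<eta> = - b \<eta> \<xi>"
  by (auto simp: wedge2_def sum_negf[symmetric] intro!: sum.cong)

lemma linear_sharp:
  fixes \<pi> :: "'a \<Rightarrow> 'e::euclidean_space biform"
  assumes "\<pi> p \<in> wedge2 UNIV"
  shows "linear (sharp \<pi> p)"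
proof -
  obtain m :: nat and v w where s: "\<And>\<xi> :: 'e \<Rightarrow>\<^sub>L real. sharp \<pi> p \<xi> = (\<Sum>i<m. \<xi> (v i) *\<^sub>R w i - \<xi> (w i) *\<^sub>R v i)"
    using sharp_wedge(1)[of \<pi> p, OF assms] by blast
  show ?thesis
    by (rule linearI)
      (simp_all add: s blinfun.add_left blinfun.scaleR_left scaleR_add_left sum.distrib sum_subtractf
        scaleR_sum_right scaleR_diff_right)
qed

lemma sharp_skew:
  fixes \<pi> :: "'a \<Rightarrow> 'e::euclidean_space biform" and \<xi> \<eta> :: "'e \<Rightarrow>\<^sub>L real"
  assumes "\<pi> p \<in> wedge2 UNIV"
  shows "\<eta> (sharp \<pi> p \<xi>) = - \<xi> (sharp \<pi> p \<eta>)"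
  unfolding sharp_wedge(2)[of \<pi> p, OF assms] by (rule wedge2_skew[of "\<pi> p", OF assms])

text \<open>Pulling covectors back along a linear projection \<open>g\<close> onto \<open>V\<close>
  does not change \<pi>: in the second argument because the values of \<open>sharp\<close> lie in
  \<open>V\<close>, in the first by skewness. The pullback replaces the factors of the wedge
  products by vectors of \<open>V\<close>.\<close>

lemma wedge2_range_sharp:
  fixes \<pi> :: "'a \<Rightarrow> 'e::euclidean_space biform" and V :: "'e set"
  assumes \<pi>: "\<pi> p \<in> wedge2 UNIV" and V: "subspace V" "range (sharp \<pi> p) \<subseteq> V"
  shows "\<pi> p \<in> wedge2 V"
proof -
  obtain B where B: "B \<subseteq> V" "independent B" "V \<subseteq> span B"
    by (rule basis_exists[of V]) (rule that; assumption)
  have spB: "span B = V" using span_minimal[OF B(1) V(1)] B(3) by (rule subset_antisym)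
  obtain g where g: "linear g" "\<forall>x\<in>B. g x = id x" "range g = span (id ` B)"
    using linear_independent_extend_subspace[OF B(2), of id] by (elim exE conjE) (rule that)
  have gV: "g x \<in> V" for x using g(3) spB rangeI[of g x] by simp
  have gid: "g x = x" if "x \<in> V" for x
    using linear_eq_on[OF g(1) linear_id, of x B] g(2) that spB by simp
  have bl: "bounded_linear g" using g(1) by (simp add: linear_conv_bounded_linear)
  define pull where "pull \<xi> = \<xi> o\<^sub>L Blinfun g" for \<xi> :: "'e \<Rightarrow>\<^sub>L real"
  have pull: "pull \<xi> x = \<xi> (g x)" for \<xi> x by (simp add: pull_def bounded_linear_Blinfun_apply[OF bl])
  have pr: "\<pi> p \<xi> (pull \<eta>) = \<pi> p \<xi> \<eta>" for \<xi> \<eta>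
  proof -
    have "g (sharp \<pi> p \<xi>) = sharp \<pi> p \<xi>" using V(2) by (intro gid) auto
    then show ?thesis by (simp add: sharp_wedge(2)[of \<pi> p, OF \<pi>, symmetric] pull)
  qed
  have eq: "\<pi> p \<xi> \<eta> = \<pi> p (pull \<xi>) (pull \<eta>)" for \<xi> \<eta>
    using pr[of \<xi> \<eta>] pr[of "pull \<eta>" \<xi>]
      wedge2_skew[of "\<pi> p" UNIV \<xi> "pull \<eta>", OF \<pi>] wedge2_skew[of "\<pi> p" UNIV "pull \<eta>" "pull \<xi>", OF \<pi>]
    by simp
  obtain m :: nat and v w where \<pi>': "\<And>(\<xi> :: 'e \<Rightarrow>\<^sub>L real) (\<eta> :: 'e \<Rightarrow>\<^sub>L real). \<pi> p \<xi> \<eta> = (\<Sum>i<m. \<xi> (v i) * \<eta> (w i) - \<xi> (w i) * \<eta> (v i))"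
    using \<pi> unfolding wedge2_def by blast
  have "\<pi> p \<xi> \<eta> = (\<Sum>i<m. \<xi> (g (v i)) * \<eta> (g (w i)) - \<xi> (g (w i)) * \<eta> (g (v i)))" for \<xi> \<eta> :: "'e \<Rightarrow>\<^sub>L real"
    by (subst eq) (simp add: \<pi>' pull)
  then show ?thesis
    unfolding wedge2_def using gV by (intro CollectI exI[of _ m] exI[of _ "\<lambda>i. g (v i)"] exI[of _ "\<lambda>i. g (w i)"]) auto
qed

section \<open>Poisson manifolds in charts\<close>

locale poisson =
  fixes A :: "('a::{t2_space, second_countable_topology}, 'e::euclidean_space) chart set"
    and \<pi> :: "'a \<Rightarrow> 'e biform"
  assumes poisson_manifold: "poisson_manifold A \<pi>"

sublocale poisson \<subseteq> manifold A
  by unfold_locales (use poisson_manifold in \<open>simp add: poisson_manifold_def\<close>)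

context poisson
begin

lemma pi_wedge: "\<pi> p \<in> wedge2 UNIV"
  using poisson_manifold by (simp add: poisson_manifold_def smooth_bivector_def)

text \<open>The differential at \<open>q\<close> of the coordinate function
  \<open>\<lambda>x. snd c x \<bullet> u\<close>, that is, the covector with constant coordinates
  \<open>u\<close>.\<close>

definition cov :: "('a, 'e) chart \<Rightarrow> 'a \<Rightarrow> 'e \<Rightarrow> ('e \<Rightarrow>\<^sub>L real)" where
  "cov c q u = Blinfun (\<lambda>v. blinfun_apply (blinfun_inner_left u) (dchart A c q v))"

lemma cov_apply:
  assumes "adm c" "q \<in> fst c"
  shows "blinfun_apply (cov c q u) v = dchart A c q v \<bullet> u"
proof -
  have "bounded_linear (\<lambda>v. blinfun_apply (blinfun_inner_left u) (dchart A c q v))"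
    by (rule bounded_linear_compose[OF blinfun.bounded_linear_right])
      (use dchart_linear(1)[OF assms] in \<open>simp add: linear_conv_bounded_linear\<close>)
  then show ?thesis by (simp add: cov_def bounded_linear_Blinfun_apply)
qed

lemma cov_linear:
  assumes "adm c" "q \<in> fst c"
  shows "linear (cov c q)"
  by (rule linearI; rule blinfun_eqI)
    (simp_all add: cov_apply[OF assms] blinfun.add_left blinfun.scaleR_left inner_add_right)

lemma cov_surj:
  assumes "adm c" "q \<in> fst c"
  shows "\<xi> = cov c q (\<Sum>i\<in>Basis. blinfun_apply \<xi> (dchart_inv A c q i) *\<^sub>R i)"
proof (rule blinfun_eqI)
  fix v
  have "blinfun_apply \<xi> (dchart_inv A c q w) = w \<bullet> (\<Sum>i\<in>Basis. blinfun_apply \<xi> (dchart_inv A c q i) *\<^sub>R i)" for w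
  proof -
    have lin: "linear (\<lambda>w. blinfun_apply \<xi> (dchart_inv A c q w))"
      by (rule linear_compose[unfolded comp_def, OF dchart_linear(2)[OF assms] bounded_linear.linear[OF blinfun.bounded_linear_right]])
    have "blinfun_apply \<xi> (dchart_inv A c q w) = blinfun_apply \<xi> (dchart_inv A c q (\<Sum>i\<in>Basis. (w \<bullet> i) *\<^sub>R i))"
      by (simp add: euclidean_representation)
    also have "\<dots> = (\<Sum>i\<in>Basis. (w \<bullet> i) * blinfun_apply \<xi> (dchart_inv A c q i))"
      by (simp add: linear_sum[OF lin] linear_scale[OF lin])
    finally show ?thesis by (simp add: inner_sum_right mult.commute)
  qed
  from this[of "dchart A c q v"]
  show "blinfun_apply \<xi> v = blinfun_apply (cov c q (\<Sum>i\<in>Basis. blinfun_apply \<xi> (dchart_inv A c q i) *\<^sub>R i)) v"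
    by (simp add: cov_apply[OF assms] dchart_inverse(1)[OF assms])
qed

text \<open>The Hamiltonian vector field of the coordinate function \<open>y \<mapsto> y \<bullet> u\<close>.\<close>

definition ham :: "('a, 'e) chart \<Rightarrow> 'e \<Rightarrow> 'e \<Rightarrow> 'e" where
  "ham c u y = dchart A c (chart_inv c y) (sharp \<pi> (chart_inv c y) (cov c (chart_inv c y) u))"

lemma ham_at: "adm c \<Longrightarrow> q \<in> fst c \<Longrightarrow> ham c u (snd c q) = dchart A c q (sharp \<pi> q (cov c q u))"
  by (simp add: ham_def chart_inv_left adm_chart)

lemma ham_inner:
  assumes "adm c" "y \<in> snd c ` fst c"
  shows "ham c u y \<bullet> v = \<pi> (chart_inv c y) (cov c (chart_inv c y) u) (cov c (chart_inv c y) v)"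
  using cov_apply[OF assms(1) chart_inv_mem[OF assms(2)]] sharp_wedge(2)[of \<pi>, OF pi_wedge]
  by (metis ham_def)

lemma ham_skew: "adm c \<Longrightarrow> y \<in> snd c ` fst c \<Longrightarrow> ham c u y \<bullet> v = - (ham c v y \<bullet> u)"
  unfolding ham_inner by (rule wedge2_skew[of "\<pi> (chart_inv c y)", OF pi_wedge])

lemma ham_linear:
  assumes "adm c" "y \<in> snd c ` fst c"
  shows "linear (\<lambda>u. ham c u y)"
  unfolding ham_def
  by (intro linear_compose[unfolded comp_def, OF cov_linear linear_compose[unfolded comp_def, OF linear_sharp[of \<pi>, OF pi_wedge] dchart_linear(1)]]
      assms chart_inv_mem)

lemma ham_smooth:
  assumes "c \<in> A"
  shows "smooth_on (snd c ` fst c) (ham c u)"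
proof (rule smooth_on_componentwise)
  note ch = adm_chart[OF atlas_adm[OF assms]]
  show op: "open (snd c ` fst c)" by (rule chart_open(2)[OF ch])
  fix v :: 'e
  have "smooth_on (snd c ` fst c) (\<lambda>y. \<pi> (chart_inv c y) (cov c (chart_inv c y) u) (cov c (chart_inv c y) v))"
    using poisson_manifold assms unfolding poisson_manifold_def smooth_bivector_def cov_def by blast
  then show "smooth_on (snd c ` fst c) (\<lambda>y. ham c u y \<bullet> v)"
    by (subst smooth_on_cong[OF op]) (rule ham_inner[OF atlas_adm[OF assms]])
qed

text \<open>Every covector at \<open>q\<close> has the form \<open>cov c q u\<close>, so coordinate
  functions already produce the whole image of \<open>sharp\<close>.\<close>

lemma ham_range:
  assumes "adm c" "q \<in> fst c"
  shows "range (\<lambda>u. ham c u (snd c q)) = dchart A c q ` range (sharp \<pi> q)"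
proof -
  have "sharp \<pi> q \<xi> \<in> range (\<lambda>u. sharp \<pi> q (cov c q u))" for \<xi>
    using cov_surj[OF assms, of \<xi>] by (metis rangeI)
  then have "range (sharp \<pi> q) = range (\<lambda>u. sharp \<pi> q (cov c q u))" by blast
  then show ?thesis by (simp add: ham_at[OF assms] image_image)
qed

lemma sharp_rank_ham:
  "adm c \<Longrightarrow> q \<in> fst c \<Longrightarrow> sharp_rank \<pi> q = dim (range (\<lambda>u. ham c u (snd c q)))"
  by (simp add: ham_range dim_dchart sharp_rank_def)

lemma differential_chart:
  assumes c: "adm c" "q \<in> fst c" and f: "((\<lambda>y. f (chart_inv c y)) has_derivative f') (at (snd c q))"
  shows "blinfun_apply (differential A f q) v = f' (dchart A c q v)"
proof -
  define d where "d = chart_at A q"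
  have d: "q \<in> fst d" "adm d" using chart_at by (auto simp: d_def)
  note ch = adm_chart[OF c(1)] adm_chart[OF d(2)]
  have op: "open (snd d ` (fst d \<inter> fst c))" by (intro chart_image_open ch chart_open)
  have "((\<lambda>y. f (chart_inv c (snd c (chart_inv d y)))) has_derivative (\<lambda>v. f' (coord_change d c q v))) (at (snd d q))"
    by (rule has_derivative_compose[OF coord_change_has_derivative[OF d(2) c(1) d(1) c(2)]])
      (use f in \<open>simp add: chart_inv_left[OF ch(2) d(1)]\<close>)
  then have der: "((\<lambda>y. f (chart_inv d y)) has_derivative (\<lambda>v. f' (coord_change d c q v))) (at (snd d q))"
    by (rule has_derivative_transform_within_open[OF _ op])
      (use c d in \<open>auto simp: chart_inv_left[OF ch(1)] chart_inv_left[OF ch(2)]\<close>)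
  have "differential A f q = Blinfun (\<lambda>v. f' (coord_change d c q v))"
    using frechet_derivative_at[OF der] by (simp add: differential_def comp_def d_def)
  then show ?thesis
    using has_derivative_bounded_linear[OF der] by (simp add: bounded_linear_Blinfun_apply dchart_def d_def)
qed

text \<open>The Jacobi identity is given for functions on the whole manifold, so coordinates are cut
  off and agree with the chart near \<open>p\<close>.\<close>

lemma local_coordinate_functions:
  assumes c: "adm c" "p \<in> fst c"
  obtains f V where "open V" "p \<in> V" "V \<subseteq> fst c" "\<And>u. smooth_fun_on A UNIV (f u)"
    "\<And>u q. q \<in> V \<Longrightarrow> f u q = snd c q \<bullet> u"
proof -
  note ch = adm_chart[OF c(1)]
  obtain \<psi> V K where \<psi>: "smooth_fun_on A UNIV \<psi>" "open V" "p \<in> V" "V \<subseteq> K" "compact K" "K \<subseteq> fst c"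
    "\<And>q. q \<in> V \<Longrightarrow> \<psi> q = 1" "\<And>q. q \<notin> K \<Longrightarrow> \<psi> q = 0"
    by (rule manifold_bump[OF chart_open(1)[OF ch] c(2)]) (rule that; assumption)
  have sm: "smooth_fun_on A (fst c) (\<lambda>q. snd c q \<bullet> u)" for u
  proof (rule smooth_fun_onI)
    fix q assume q: "q \<in> fst c"
    have op: "open (snd c ` (fst c \<inter> fst c))" using chart_open(2)[OF ch] by simp
    have "smooth_on (snd c ` (fst c \<inter> fst c)) (\<lambda>y. y \<bullet> u)"
      by (rule smooth_on_bounded_linear[OF bounded_linear_inner_left op])
    then have "smooth_on (snd c ` (fst c \<inter> fst c)) (\<lambda>y. snd c (chart_inv c y) \<bullet> u)"
      by (subst smooth_on_cong[OF op, of _ "\<lambda>y. y \<bullet> u"]) (simp_all add: chart_inv_right)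
    then show "\<exists>d V. adm d \<and> open V \<and> q \<in> V \<and> q \<in> fst d \<and> smooth_on (snd d ` (fst d \<inter> V)) (\<lambda>y. snd c (chart_inv d y) \<bullet> u)"
      using c(1) q chart_open(1)[OF ch] by blast
  qed
  show thesis
  proof (rule that[of V "\<lambda>u q. \<psi> q * (snd c q \<bullet> u)"])
    show "smooth_fun_on A UNIV (\<lambda>q. \<psi> q * (snd c q \<bullet> u))" for u
      by (rule smooth_fun_on_bump_mult[OF \<psi>(1) compact_imp_closed[OF \<psi>(5)] \<psi>(6) chart_open(1)[OF ch] \<psi>(8) sm])
  qed (use \<psi> in auto)
qed

text \<open>The Jacobi identity for coordinate functions: an iterated bracket is the derivative of
  one Hamiltonian field along another, paired with a constant covector.\<close>

lemma jacobi_chart: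
  assumes c: "c \<in> A" "p \<in> fst c"
  shows "frechet_derivative (ham c v) (at (snd c p)) (ham c u (snd c p)) \<bullet> k
    + frechet_derivative (ham c k) (at (snd c p)) (ham c v (snd c p)) \<bullet> u
    + frechet_derivative (ham c u) (at (snd c p)) (ham c k (snd c p)) \<bullet> v = 0"
proof -
  have ad: "adm c" using c by (simp add: atlas_adm)
  note ch = adm_chart[OF ad]
  obtain f :: "'e \<Rightarrow> 'a \<Rightarrow> real" and V where V: "open V" "p \<in> V" "V \<subseteq> fst c" and f: "\<And>u. smooth_fun_on A UNIV (f u)"
    "\<And>u q. q \<in> V \<Longrightarrow> f u q = snd c q \<bullet> u"
    by (rule local_coordinate_functions[OF ad c(2)]) (rule that; assumption)
  let ?V = "snd c ` (fst c \<inter> V)"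
  have op: "open ?V" by (rule chart_image_open[OF ch V(1)])
  have inV: "chart_inv c y \<in> V" "chart_inv c y \<in> fst c" "snd c (chart_inv c y) = y" if "y \<in> ?V" for y
    using that chart_inv_left[OF ch] by auto
  have df: "differential A (f u) q = cov c q u" if q: "q \<in> V" for u q
  proof (rule blinfun_eqI)
    fix x
    have qc: "q \<in> fst c" "snd c q \<in> ?V" using q V(3) by auto
    have "((\<lambda>y. y \<bullet> u) has_derivative (\<lambda>y. y \<bullet> u)) (at (snd c q))"
      by (rule bounded_linear_imp_has_derivative[OF bounded_linear_inner_left])
    then have "((\<lambda>y. f u (chart_inv c y)) has_derivative (\<lambda>y. y \<bullet> u)) (at (snd c q))"
      by (rule has_derivative_transform_within_open[OF _ op qc(2)]) (simp add: f(2) inV)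
    from differential_chart[OF ad qc(1) this]
    show "blinfun_apply (differential A (f u) q) x = blinfun_apply (cov c q u) x"
      by (simp add: cov_apply[OF ad qc(1)])
  qed
  have br: "poisson_bracket A \<pi> (f k) (poisson_bracket A \<pi> (f u) (f v)) p
      = frechet_derivative (ham c u) (at (snd c p)) (ham c k (snd c p)) \<bullet> v" for u v k
  proof -
    let ?G = "poisson_bracket A \<pi> (f u) (f v)"
    have pV: "snd c p \<in> ?V" using V c by auto
    have "((\<lambda>y. ham c u y \<bullet> v) has_derivative (\<lambda>w. frechet_derivative (ham c u) (at (snd c p)) w \<bullet> v)) (at (snd c p))"
      using c by (intro bounded_linear.has_derivative[OF bounded_linear_inner_left] smooth_on_has_derivative[OF ham_smooth]) auto
    then have "((\<lambda>y. ?G (chart_inv c y)) has_derivative (\<lambda>w. frechet_derivative (ham c u) (at (snd c p)) w \<bullet> v)) (at (snd c p))"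
    proof (rule has_derivative_transform_within_open[OF _ op pV])
      fix y assume y: "y \<in> ?V"
      then show "ham c u y \<bullet> v = ?G (chart_inv c y)"
        using ham_inner[OF ad, of y u v] by (auto simp: poisson_bracket_def df inV[OF y])
    qed
    note dG = differential_chart[OF ad c(2) this]
    have "poisson_bracket A \<pi> (f k) ?G p = blinfun_apply (differential A ?G p) (sharp \<pi> p (cov c p k))"
      unfolding sharp_wedge(2)[of \<pi>, OF pi_wedge] by (simp add: poisson_bracket_def[of A \<pi> "f k" ?G] df[OF V(2)])
    then show ?thesis by (simp add: dG ham_at[OF ad c(2)])
  qed
  have "poisson_bracket A \<pi> (f u) (poisson_bracket A \<pi> (f v) (f k)) p
      + poisson_bracket A \<pi> (f v) (poisson_bracket A \<pi> (f k) (f u)) p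
      + poisson_bracket A \<pi> (f k) (poisson_bracket A \<pi> (f u) (f v)) p = 0"
    using poisson_manifold f(1) unfolding poisson_manifold_def by blast
  then show ?thesis unfolding br by simp
qed

text \<open>The Lie bracket of the Hamiltonian fields of two functions is the Hamiltonian field of
  their Poisson bracket.\<close>

lemma ham_bracket:
  assumes c: "c \<in> A" "p \<in> fst c"
  shows "frechet_derivative (ham c v) (at (snd c p)) (ham c u (snd c p))
    - frechet_derivative (ham c u) (at (snd c p)) (ham c v (snd c p)) \<in> range (\<lambda>t. ham c t (snd c p))"
proof -
  have ad: "adm c" using c by (simp add: atlas_adm)
  note ch = adm_chart[OF ad]
  let ?y = "snd c p"
  let ?D = "\<lambda>u. frechet_derivative (ham c u) (at ?y)"
  have y: "?y \<in> snd c ` fst c" using c by auto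
  have der: "(ham c u has_derivative ?D u) (at ?y)" for u
    by (rule smooth_on_has_derivative[OF ham_smooth[OF c(1)] y])
  have skew: "?D u w \<bullet> k = - (?D k w \<bullet> u)" for u k w
  proof -
    have "((\<lambda>y. ham c u y \<bullet> k) has_derivative (\<lambda>w. ?D u w \<bullet> k)) (at ?y)"
      by (rule bounded_linear.has_derivative[OF bounded_linear_inner_left der])
    moreover have "((\<lambda>y. - (ham c k y \<bullet> u)) has_derivative (\<lambda>w. - (?D k w \<bullet> u))) (at ?y)"
      by (intro has_derivative_minus bounded_linear.has_derivative[OF bounded_linear_inner_left der])
    then have "((\<lambda>y. ham c u y \<bullet> k) has_derivative (\<lambda>w. - (?D k w \<bullet> u))) (at ?y)"
      by (rule has_derivative_transform_within_open[OF _ chart_open(2)[OF ch] y]) (simp add: ham_skew[OF ad, of _ u k])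
    ultimately have "(\<lambda>w. ?D u w \<bullet> k) = (\<lambda>w. - (?D k w \<bullet> u))" by (rule has_derivative_unique)
    then show ?thesis by metis
  qed
  \<comment> \<open>The gradient at this point of \<open>\<lambda>y. ham c u y \<bullet> v\<close>,
    the Poisson bracket of the two coordinate functions. Its value at the point suffices, because
    \<open>ham\<close> depends only on the covector there.\<close>
  define t where "t = (\<Sum>i\<in>Basis. (?D u i \<bullet> v) *\<^sub>R i)"
  have t: "w \<bullet> t = ?D u w \<bullet> v" for w
  proof -
    have lin: "linear (?D u)" using der by (rule has_derivative_linear)
    have "?D u w \<bullet> v = (\<Sum>i\<in>Basis. (w \<bullet> i) * (?D u i \<bullet> v))"
      by (subst euclidean_representation[of w, symmetric])
        (simp add: linear_sum[OF lin] linear_scale[OF lin] inner_sum_left)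
    then show ?thesis by (simp add: t_def inner_sum_right mult.commute)
  qed
  have "(?D v (ham c u ?y) - ?D u (ham c v ?y)) \<bullet> k = ham c t ?y \<bullet> k" for k
  proof -
    have "(?D v (ham c u ?y) - ?D u (ham c v ?y)) \<bullet> k = ?D v (ham c u ?y) \<bullet> k + ?D k (ham c v ?y) \<bullet> u"
      using skew[of u "ham c v ?y" k] by (simp add: inner_diff_left)
    also have "\<dots> = - (?D u (ham c k ?y) \<bullet> v)" using jacobi_chart[OF c, of v u k] by linarith
    also have "\<dots> = ham c t ?y \<bullet> k" using t[of "ham c k ?y"] ham_skew[OF ad y, of t k] by simp
    finally show ?thesis .
  qed
  then have "?D v (ham c u ?y) - ?D u (ham c v ?y) = ham c t ?y" by (metis euclidean_eqI)
  then show ?thesis by blast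
qed

section \<open>The regular part\<close>

abbreviation rmax where "rmax \<equiv> Max (range (sharp_rank \<pi>))"

lemma finite_ranks: "finite (range (sharp_rank \<pi>))"
  by (rule finite_subset[of _ "{..DIM('e)}"]) (auto simp: sharp_rank_def dim_subset_UNIV)

lemma sharp_rank_le: "sharp_rank \<pi> p \<le> rmax"
  by (intro Max_ge finite_ranks rangeI)

lemma M_reg_iff: "p \<in> M_reg \<pi> \<longleftrightarrow> sharp_rank \<pi> p = rmax"
  by (simp add: M_reg_def)

lemma M_reg_nonempty: "M_reg \<pi> \<noteq> {}"
  using Max_in[OF finite_ranks] by (auto simp: M_reg_def)

text \<open>Hamiltonian fields that form a basis at \<open>p\<close> stay independent nearby, and
  since the rank is maximal they cannot miss any direction of the image. This also makes the regular
  part open.\<close>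

lemma reg_frame:
  assumes c: "c \<in> A" "p \<in> fst c" and p: "p \<in> M_reg \<pi>"
  obtains U u where "open U" "snd c p \<in> U" "U \<subseteq> snd c ` fst c"
    "\<And>y. y \<in> U \<Longrightarrow> dim ((\<lambda>j. ham c (u j) y) ` {..<rmax}) = rmax"
    "\<And>y. y \<in> U \<Longrightarrow> range (\<lambda>v. ham c v y) = span ((\<lambda>j. ham c (u j) y) ` {..<rmax})"
    "\<And>y. y \<in> U \<Longrightarrow> chart_inv c y \<in> M_reg \<pi>"
proof -
  have ad: "adm c" using c by (simp add: atlas_adm)
  note ch = adm_chart[OF ad]
  have y0: "snd c p \<in> snd c ` fst c" using c by auto
  let ?R = "\<lambda>y. range (\<lambda>v. ham c v y)"
  obtain B where B: "B \<subseteq> ?R (snd c p)" "independent B" "?R (snd c p) \<subseteq> span B" "card B = dim (?R (snd c p))"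
    by (rule basis_exists)
  have cB: "card B = rmax" using p B(4) sharp_rank_ham[OF ad c(2)] by (simp add: M_reg_iff)
  have "finite B" using B(2) by (rule finiteI_independent)
  then obtain h where h: "bij_betw h {..<rmax} B"
    using ex_bij_betw_nat_finite[of B] cB by (auto simp: atLeast0LessThan)
  have "\<exists>v. h j = ham c v (snd c p)" if "j < rmax" for j
    using bij_betwE[OF h] B(1) that by (metis (mono_tags, lifting) lessThan_iff rangeE subsetD)
  then obtain u where u: "\<And>j. j < rmax \<Longrightarrow> h j = ham c (u j) (snd c p)" by metis
  have "(\<lambda>j. ham c (u j) (snd c p)) ` {..<rmax} = h ` {..<rmax}"
    by (rule image_cong[OF refl]) (simp add: u)
  also have "\<dots> = B" using h by (simp add: bij_betw_def)
  finally have "(\<lambda>j. ham c (u j) (snd c p)) ` {..<rmax} = B" .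
  then have dim0: "dim ((\<lambda>j. ham c (u j) (snd c p)) ` {..<rmax}) = rmax"
    using B(2) cB by (simp add: dim_eq_card_independent)
  obtain U where U: "open U" "snd c p \<in> U" "U \<subseteq> snd c ` fst c"
    and d: "\<forall>y\<in>U. dim ((\<lambda>j. ham c (u j) y) ` {..<rmax}) = rmax"
    using smooth_family_open[where X = "\<lambda>j. ham c (u j)" and V = "snd c ` fst c" and k = rmax, OF chart_open(2)[OF ch] y0 ham_smooth[OF c(1)] dim0]
    by (elim exE conjE) (rule that)
  have rank: "?R y = span ((\<lambda>j. ham c (u j) y) ` {..<rmax})" "chart_inv c y \<in> M_reg \<pi>" if y: "y \<in> U" for y
  proof -
    have yc: "y \<in> snd c ` fst c" using U(3) y by blast
    have sub: "subspace (?R y)" by (intro linear_subspace_image[OF ham_linear[OF ad yc]] subspace_UNIV)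
    have le: "dim (?R y) \<le> rmax"
      using sharp_rank_le[of "chart_inv c y"] sharp_rank_ham[OF ad chart_inv_mem[OF yc]] chart_inv_right[OF yc] by simp
    have inc: "span ((\<lambda>j. ham c (u j) y) ` {..<rmax}) \<subseteq> ?R y" by (rule span_minimal[OF _ sub]) blast
    have dd: "dim (span ((\<lambda>j. ham c (u j) y) ` {..<rmax})) = rmax" using d y by simp
    have "span ((\<lambda>j. ham c (u j) y) ` {..<rmax}) = ?R y"
      by (rule subspace_dim_equal[OF subspace_span sub inc]) (simp only: dd le)
    then show eq: "?R y = span ((\<lambda>j. ham c (u j) y) ` {..<rmax})" ..
    show "chart_inv c y \<in> M_reg \<pi>"
      unfolding M_reg_iff sharp_rank_ham[OF ad chart_inv_mem[OF yc]] chart_inv_right[OF yc] eq by (rule dd)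
  qed
  show thesis by (rule that[OF U bspec[OF d] rank])
qed

lemma open_M_reg: "open (M_reg \<pi>)"
proof (subst open_subopen, rule ballI)
  fix p assume p: "p \<in> M_reg \<pi>"
  define c where "c = chart_at A p"
  have c: "c \<in> A" "p \<in> fst c" "adm c" using chart_at by (auto simp: c_def)
  obtain U u where U: "open U" "snd c p \<in> U" "U \<subseteq> snd c ` fst c"
    and reg: "\<And>y. y \<in> U \<Longrightarrow> chart_inv c y \<in> M_reg \<pi>"
    by (rule reg_frame[OF c(1,2) p]) (rule that; assumption)
  have "{q \<in> fst c. snd c q \<in> U} \<subseteq> M_reg \<pi>"
    using reg chart_inv_left[OF adm_chart[OF c(3)]] by force
  then show "\<exists>T. open T \<and> p \<in> T \<and> T \<subseteq> M_reg \<pi>"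
    using chart_preimage_open[OF adm_chart[OF c(3)] U(1)] c(2) U(2) by blast
qed

definition sharp_chart :: "('a, 'e) chart \<Rightarrow> 'e \<Rightarrow> 'e set" where
  "sharp_chart c y = dchart A c (chart_inv c y) ` range (sharp \<pi> (chart_inv c y))"

lemma sharp_chart_ham: "adm c \<Longrightarrow> y \<in> snd c ` fst c \<Longrightarrow> sharp_chart c y = range (\<lambda>u. ham c u y)"
  using ham_range[of c "chart_inv c y"] chart_inv_mem[of y c] chart_inv_right[of y c] by (simp add: sharp_chart_def)

lemma reg_distribution:
  assumes c: "c \<in> A"
  shows "smooth_distribution_on rmax (snd c ` (fst c \<inter> M_reg \<pi>)) (sharp_chart c)"
    and "involutive_on (snd c ` (fst c \<inter> M_reg \<pi>)) (sharp_chart c)"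
proof -
  have ad: "adm c" using c by (simp add: atlas_adm)
  note ch = adm_chart[OF ad]
  have sub: "U \<subseteq> snd c ` (fst c \<inter> M_reg \<pi>)"
    if "U \<subseteq> snd c ` fst c" "\<And>y. y \<in> U \<Longrightarrow> chart_inv c y \<in> M_reg \<pi>" for U
    using that chart_image_subset[OF ch] by blast
  show "smooth_distribution_on rmax (snd c ` (fst c \<inter> M_reg \<pi>)) (sharp_chart c)"
    unfolding smooth_distribution_on_def
  proof
    fix y assume "y \<in> snd c ` (fst c \<inter> M_reg \<pi>)"
    then obtain p where p: "p \<in> fst c" "p \<in> M_reg \<pi>" "y = snd c p" by blast
    obtain U u where U: "open U" "snd c p \<in> U" "U \<subseteq> snd c ` fst c"
      and fr: "\<And>y. y \<in> U \<Longrightarrow> dim ((\<lambda>j. ham c (u j) y) ` {..<rmax}) = rmax"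
       "\<And>y. y \<in> U \<Longrightarrow> range (\<lambda>v. ham c v y) = span ((\<lambda>j. ham c (u j) y) ` {..<rmax})"
       "\<And>y. y \<in> U \<Longrightarrow> chart_inv c y \<in> M_reg \<pi>"
      by (rule reg_frame[OF c p(1,2)]) (rule that; assumption)
    show "\<exists>U X. open U \<and> y \<in> U \<and> U \<subseteq> snd c ` (fst c \<inter> M_reg \<pi>) \<and> (\<forall>i<rmax. smooth_on U (X i)) \<and>
       (\<forall>y\<in>U. sharp_chart c y = span ((\<lambda>i. X i y) ` {..<rmax}) \<and> dim ((\<lambda>i. X i y) ` {..<rmax}) = rmax)"
    proof (intro exI conjI ballI allI impI)
      show "open U" "y \<in> U" "U \<subseteq> snd c ` (fst c \<inter> M_reg \<pi>)" using U p(3) sub[OF U(3) fr(3)] by auto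
      show "smooth_on U (ham c (u i))" for i by (rule smooth_on_subset[OF ham_smooth[OF c] U(3)])
      show "sharp_chart c z = span ((\<lambda>i. ham c (u i) z) ` {..<rmax})"
        "dim ((\<lambda>i. ham c (u i) z) ` {..<rmax}) = rmax" if z: "z \<in> U" for z
        using sharp_chart_ham[OF ad subsetD[OF U(3) z]] fr(1,2)[OF z] by simp_all
    qed
  qed
  show "involutive_on (snd c ` (fst c \<inter> M_reg \<pi>)) (sharp_chart c)"
  proof (rule involutive_on_local)
    fix y assume "y \<in> snd c ` (fst c \<inter> M_reg \<pi>)"
    then obtain p where p: "p \<in> fst c" "p \<in> M_reg \<pi>" "y = snd c p" by blast
    obtain U u where U: "open U" "snd c p \<in> U" "U \<subseteq> snd c ` fst c"
      and fr: "\<And>y. y \<in> U \<Longrightarrow> dim ((\<lambda>j. ham c (u j) y) ` {..<rmax}) = rmax"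
       "\<And>y. y \<in> U \<Longrightarrow> range (\<lambda>v. ham c v y) = span ((\<lambda>j. ham c (u j) y) ` {..<rmax})"
      by (rule reg_frame[OF c p(1,2)]) (rule that; assumption)
    have "involutive_on U (sharp_chart c)"
    proof (rule involutive_on_frame[where X = "\<lambda>j. ham c (u j)" and k = rmax])
      show "open U" by fact
      show "smooth_on U (ham c (u i))" for i by (rule smooth_on_subset[OF ham_smooth[OF c] U(3)])
      show "sharp_chart c z = span ((\<lambda>i. ham c (u i) z) ` {..<rmax})"
        "dim ((\<lambda>i. ham c (u i) z) ` {..<rmax}) = rmax" if z: "z \<in> U" for z
        using sharp_chart_ham[OF ad subsetD[OF U(3) z]] fr(1,2)[OF z] by simp_all
      fix i j z assume "z \<in> U"
      then have z: "z \<in> snd c ` fst c" using U(3) by blast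
      then obtain q where q: "q \<in> fst c" "z = snd c q" by blast
      show "frechet_derivative (ham c (u j)) (at z) (ham c (u i) z) - frechet_derivative (ham c (u i)) (at z) (ham c (u j) z) \<in> sharp_chart c z"
        unfolding sharp_chart_ham[OF ad z] unfolding q(2) by (rule ham_bracket[OF c q(1)])
    qed
    then show "\<exists>W. open W \<and> y \<in> W \<and> involutive_on W (sharp_chart c)" using U p(3) by blast
  qed
qed

text \<open>Regularity says that the image of \<open>sharp\<close> has dimension
  \<open>rmax\<close>, which is the characterisation of \<open>Om\<close> by rank that
  \<open>leaf_exists\<close> asks for.\<close>

lemma symplectic_leaf_exists:
  assumes p: "p \<in> M_reg \<pi>"
  shows "\<exists>L. symplectic_leaf A \<pi> L \<and> p \<in> topspace L \<and> tangent_space A L p = range (sharp \<pi> p)"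
proof -
  have "\<exists>L. leaf A (\<lambda>p. range (sharp \<pi> p)) L \<and> p \<in> topspace L"
  proof (rule leaf_exists[where Om = "M_reg \<pi>" and k = rmax, OF _ _ p])
    fix q assume q: "q \<in> M_reg \<pi>"
    define c where "c = chart_at A q"
    have c: "c \<in> A" "q \<in> fst c" "adm c" using chart_at by (auto simp: c_def)
    show "\<exists>d S. foliated (\<lambda>p. range (sharp \<pi> p)) (M_reg \<pi>) d S \<and> q \<in> fst d"
      by (rule foliated_chart_exists[OF c(3,2) open_M_reg q sharp_chart_def reg_distribution[OF c(1)]])
  next
    show "q \<in> M_reg \<pi> \<longleftrightarrow> dim (range (sharp \<pi> q)) = rmax" for q
      by (simp add: M_reg_iff sharp_rank_def)
  qed
  then obtain L where L: "leaf A (\<lambda>p. range (sharp \<pi> p)) L" "p \<in> topspace L" by blast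
  then have "tangent_space A L p = range (sharp \<pi> p)"
    by (simp add: leaf_def connected_integral_manifold_def)
  then show ?thesis using L unfolding symplectic_leaf_def by blast
qed

end

section \<open>Distributions extending the symplectic foliation\<close>

lemma involutive_on_cong:
  assumes "\<And>z. z \<in> V \<Longrightarrow> \<Delta> z = \<Delta>' z" "involutive_on V \<Delta>"
  shows "involutive_on V \<Delta>'"
  unfolding involutive_on_def
proof (intro allI impI ballI)
  fix U X Y z
  assume asm: "open U \<and> U \<subseteq> V \<and> smooth_on U X \<and> smooth_on U Y \<and> (\<forall>z\<in>U. X z \<in> \<Delta>' z \<and> Y z \<in> \<Delta>' z)" and z: "z \<in> U"
  have "\<forall>z\<in>U. \<Delta> z = \<Delta>' z" using asm assms(1) by blast
  then show "frechet_derivative Y (at z) (X z) - frechet_derivative X (at z) (Y z) \<in> \<Delta>' z"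
    using assms(2)[unfolded involutive_on_def, rule_format, of U X Y z] asm z by simp
qed

context manifold
begin

lemma local_rep_at: "adm c \<Longrightarrow> q \<in> fst c \<Longrightarrow> local_rep A c X (snd c q) = dchart A c q (X q)"
  by (simp add: local_rep_def chart_inv_left adm_chart)

lemma dchart_mem_iff:
  assumes "adm c" "q \<in> fst c"
  shows "dchart A c q v \<in> dchart A c q ` S \<longleftrightarrow> v \<in> S"
proof
  assume "dchart A c q v \<in> dchart A c q ` S"
  then obtain u where u: "u \<in> S" "dchart A c q v = dchart A c q u" by blast
  then have "v = u" using dchart_inverse(1)[OF assms] by metis
  then show "v \<in> S" using u(1) by simp
qed simp

lemma local_rep_span:
  assumes "adm c" "q \<in> fst c"
  shows "span ((\<lambda>i. local_rep A c (X i) (snd c q)) ` I) = dchart A c q ` span ((\<lambda>i. X i q) ` I)"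
    and "dim ((\<lambda>i. local_rep A c (X i) (snd c q)) ` I) = dim ((\<lambda>i. X i q) ` I)"
proof -
  have eq: "(\<lambda>i. local_rep A c (X i) (snd c q)) ` I = dchart A c q ` (\<lambda>i. X i q) ` I"
    by (simp add: local_rep_at[OF assms] image_image)
  show "span ((\<lambda>i. local_rep A c (X i) (snd c q)) ` I) = dchart A c q ` span ((\<lambda>i. X i q) ` I)"
    unfolding eq by (rule linear_span_image[OF dchart_linear(1)[OF assms]])
  show "dim ((\<lambda>i. local_rep A c (X i) (snd c q)) ` I) = dim ((\<lambda>i. X i q) ` I)"
    unfolding eq by (rule dim_dchart[OF assms])
qed

lemma smooth_vf_on_subset: "smooth_vf_on A U X \<Longrightarrow> V \<subseteq> U \<Longrightarrow> smooth_vf_on A V X"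
  unfolding smooth_vf_on_def by (blast intro: smooth_on_subset)

lemma smooth_vf_on_chart: "smooth_vf_on A U X \<Longrightarrow> c \<in> A \<Longrightarrow> smooth_on (snd c ` (fst c \<inter> U)) (local_rep A c X)"
  by (simp add: smooth_vf_on_def)

lemma smooth_coefficient_functions:
  assumes U: "open U" and X: "\<And>i. i < k \<Longrightarrow> smooth_vf_on A U (X i)"
    and dim: "\<And>q. q \<in> U \<Longrightarrow> dim ((\<lambda>i. X i q) ` {..<k}) = k"
    and Y: "smooth_vf_on A U Y" "\<And>q. q \<in> U \<Longrightarrow> Y q = (\<Sum>i<k. g i q *\<^sub>R X i q)" and i: "i < k"
  shows "smooth_fun_on A U (g i)"
  unfolding smooth_fun_on_def comp_def
proof
  fix c assume c: "c \<in> A"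
  note ch = adm_chart[OF atlas_adm[OF c]]
  let ?V = "snd c ` (fst c \<inter> U)"
  show "smooth_on ?V (\<lambda>y. g i (chart_inv c y))"
  proof (rule smooth_coefficients[where X = "\<lambda>i. local_rep A c (X i)" and Y = "local_rep A c Y"
        and g = "\<lambda>i y. g i (chart_inv c y)" and k = k])
    show "open ?V" by (rule atlas_image_open[OF c U])
    show "smooth_on ?V (local_rep A c (X i))" if "i < k" for i by (rule smooth_vf_on_chart[OF X[OF that] c])
    show "smooth_on ?V (local_rep A c Y)" by (rule smooth_vf_on_chart[OF Y(1) c])
    show "i < k" by fact
    fix z assume "z \<in> ?V"
    then obtain q where q: "q \<in> fst c" "q \<in> U" "z = snd c q" by blast
    show "dim ((\<lambda>i. local_rep A c (X i) z) ` {..<k}) = k"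
      unfolding q(3) local_rep_span(2)[OF atlas_adm[OF c] q(1)] by (rule dim[OF q(2)])
    have lin: "linear (dchart A c q)" by (rule dchart_linear(1)[OF atlas_adm[OF c] q(1)])
    show "local_rep A c Y z = (\<Sum>i<k. g i (chart_inv c z) *\<^sub>R local_rep A c (X i) z)"
      unfolding q(3) local_rep_at[OF atlas_adm[OF c] q(1)] chart_inv_left[OF ch q(1)] Y(2)[OF q(2)]
      by (simp add: linear_sum[OF lin] linear_scale[OF lin])
  qed
qed

definition dist_chart :: "('a \<Rightarrow> 'e set) \<Rightarrow> ('a, 'e) chart \<Rightarrow> 'e \<Rightarrow> 'e set" where
  "dist_chart D c y = dchart A c (chart_inv c y) ` D (chart_inv c y)"

lemma dist_chart_at: "adm c \<Longrightarrow> q \<in> fst c \<Longrightarrow> dist_chart D c (snd c q) = dchart A c q ` D q"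
  by (simp add: dist_chart_def chart_inv_left adm_chart)

lemma distribution_chart:
  assumes D: "distribution A k D" and c: "c \<in> A"
  shows "smooth_distribution_on k (snd c ` (fst c \<inter> UNIV)) (dist_chart D c)"
  unfolding smooth_distribution_on_def
proof
  note ad = atlas_adm[OF c]
  fix y assume "y \<in> snd c ` (fst c \<inter> UNIV)"
  then obtain p where p: "p \<in> fst c" "y = snd c p" by blast
  have "\<exists>U X. open U \<and> p \<in> U \<and> (\<forall>i<k. smooth_vf_on A U (X i)) \<and> (\<forall>q\<in>U. D q = span ((\<lambda>i. X i q) ` {..<k}))"
    and dimD: "\<And>q. dim (D q) = k"
    using D unfolding distribution_def by blast+
  then obtain U and X :: "nat \<Rightarrow> 'a \<Rightarrow> 'e" where U: "open U" "p \<in> U" and X: "\<forall>i<k. smooth_vf_on A U (X i)"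
    and DX: "\<forall>q\<in>U. D q = span ((\<lambda>i. X i q) ` {..<k})" by blast
  show "\<exists>V Y. open V \<and> y \<in> V \<and> V \<subseteq> snd c ` (fst c \<inter> UNIV) \<and> (\<forall>i<k. smooth_on V (Y i)) \<and>
     (\<forall>y\<in>V. dist_chart D c y = span ((\<lambda>i. Y i y) ` {..<k}) \<and> dim ((\<lambda>i. Y i y) ` {..<k}) = k)"
  proof (intro exI conjI ballI allI impI)
    show "open (snd c ` (fst c \<inter> U))" by (rule atlas_image_open[OF c U(1)])
    show "y \<in> snd c ` (fst c \<inter> U)" "snd c ` (fst c \<inter> U) \<subseteq> snd c ` (fst c \<inter> UNIV)" using p U by auto
    show "smooth_on (snd c ` (fst c \<inter> U)) (local_rep A c (X i))" if "i < k" for i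
      using X that c by (blast intro: smooth_vf_on_chart)
    fix z assume "z \<in> snd c ` (fst c \<inter> U)"
    then obtain q where q: "q \<in> fst c" "q \<in> U" "z = snd c q" by blast
    have Dq: "D q = span ((\<lambda>i. X i q) ` {..<k})" using DX q(2) by blast
    show "dist_chart D c z = span ((\<lambda>i. local_rep A c (X i) z) ` {..<k})"
      unfolding q(3) local_rep_span(1)[OF ad q(1)] dist_chart_at[OF ad q(1)] Dq ..
    show "dim ((\<lambda>i. local_rep A c (X i) z) ` {..<k}) = k"
      unfolding q(3) local_rep_span(2)[OF ad q(1)] using dimD[of q] by (simp add: Dq)
  qed
qed

end

context poisson
begin

abbreviation dense_reg where "dense_reg \<equiv> closure (M_reg \<pi>) = UNIV"

lemma dense_regD: "dense_reg \<Longrightarrow> open W \<Longrightarrow> W \<noteq> {} \<Longrightarrow> \<exists>q\<in>W. q \<in> M_reg \<pi>"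
  using open_Int_closure_eq_empty[of W "M_reg \<pi>"] by auto

text \<open>Every neighbourhood of \<open>p\<close> contains regular points, and independence of the
  frame at \<open>p\<close> makes lying in its span a closed condition there.\<close>

lemma in_span_at_regular_limit:
  assumes dense: dense_reg and U: "open U" "p \<in> U" and X: "\<And>i. i < k \<Longrightarrow> smooth_vf_on A U (X i)"
    and dim: "dim ((\<lambda>i. X i p) ` {..<k}) = k" and c: "c \<in> A" "p \<in> fst c"
    and Y: "continuous_on (snd c ` (fst c \<inter> U)) Y"
    and reg: "\<And>q. q \<in> fst c \<Longrightarrow> q \<in> U \<Longrightarrow> q \<in> M_reg \<pi> \<Longrightarrow> Y (snd c q) \<in> dchart A c q ` span ((\<lambda>i. X i q) ` {..<k})"
  shows "Y (snd c p) \<in> dchart A c p ` span ((\<lambda>i. X i p) ` {..<k})"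
proof -
  note ad = atlas_adm[OF c(1)]
  let ?V = "snd c ` (fst c \<inter> U)" and ?X = "\<lambda>i. local_rep A c (X i)"
  have "Y (snd c p) \<in> span ((\<lambda>i. ?X i (snd c p)) ` {..<k})"
  proof (rule in_span_closed[where V = ?V and X = ?X and k = k and Y = Y])
    show "open ?V" by (rule atlas_image_open[OF c(1) U(1)])
    show "snd c p \<in> ?V" using c U by auto
    show "smooth_on ?V (?X i)" if "i < k" for i by (rule smooth_vf_on_chart[OF X[OF that] c(1)])
    show "dim ((\<lambda>i. ?X i (snd c p)) ` {..<k}) = k" unfolding local_rep_span(2)[OF ad c(2)] by (rule dim)
    show "continuous_on ?V Y" by (rule Y)
    show "snd c p \<in> closure {z \<in> ?V. Y z \<in> span ((\<lambda>i. ?X i z) ` {..<k})}"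
      unfolding closure_iff_nhds_not_empty
    proof (intro allI impI)
      fix T T' assume T: "T' \<subseteq> T" "open T'" "snd c p \<in> T'"
      have "open ({q \<in> fst c. snd c q \<in> T'} \<inter> U)" using chart_preimage_open[OF adm_chart[OF ad] T(2)] U(1) by blast
      moreover have "p \<in> {q \<in> fst c. snd c q \<in> T'} \<inter> U" using c U T by auto
      ultimately obtain q where q: "q \<in> fst c" "snd c q \<in> T'" "q \<in> U" "q \<in> M_reg \<pi>"
        using dense_regD[OF dense] by blast
      have "Y (snd c q) \<in> span ((\<lambda>i. ?X i (snd c q)) ` {..<k})"
        unfolding local_rep_span(1)[OF ad q(1)] by (rule reg[OF q(1,3,4)])
      then show "{z \<in> ?V. Y z \<in> span ((\<lambda>i. ?X i z) ` {..<k})} \<inter> T \<noteq> {}" using q T(1) by auto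
    qed
  qed
  then show ?thesis unfolding local_rep_span(1)[OF ad c(2)] .
qed

text \<open>A local frame of the distribution to be found, stated without it: the \<open>X i\<close>
  stay independent at singular points, where the image of \<open>sharp\<close> has smaller
  dimension.\<close>

definition regular_frame :: "'a set \<Rightarrow> (nat \<Rightarrow> 'a \<Rightarrow> 'e) \<Rightarrow> bool" where
  "regular_frame U X \<longleftrightarrow> open U \<and> (\<forall>i<rmax. smooth_vf_on A U (X i)) \<and>
     (\<forall>q\<in>U. dim ((\<lambda>i. X i q) ` {..<rmax}) = rmax) \<and>
     (\<forall>q\<in>U \<inter> M_reg \<pi>. range (sharp \<pi> q) = span ((\<lambda>i. X i q) ` {..<rmax}))"

lemma regular_frameD:
  assumes "regular_frame U X"
  shows "open U" "\<And>i. i < rmax \<Longrightarrow> smooth_vf_on A U (X i)"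
    "\<And>q. q \<in> U \<Longrightarrow> dim ((\<lambda>i. X i q) ` {..<rmax}) = rmax"
    "\<And>q. q \<in> U \<Longrightarrow> q \<in> M_reg \<pi> \<Longrightarrow> range (sharp \<pi> q) = span ((\<lambda>i. X i q) ` {..<rmax})"
  using assms by (auto simp: regular_frame_def)

text \<open>Both spans equal the image of \<open>sharp\<close> at regular points, so by continuity
  they are nested everywhere. Applied in both orders, this makes \<open>D\<close> unique and lets
  local frames be glued.\<close>

lemma regular_frames_subset:
  assumes dense: dense_reg and X: "regular_frame U X" "p \<in> U" and X': "regular_frame U' X'" "p \<in> U'"
  shows "span ((\<lambda>i. X i p) ` {..<rmax}) \<subseteq> span ((\<lambda>i. X' i p) ` {..<rmax})"
proof
  fix v assume "v \<in> span ((\<lambda>i. X i p) ` {..<rmax})"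
  then obtain a where v: "v = (\<Sum>i<rmax. a i *\<^sub>R X i p)" by (rule in_span_familyE)
  define c where "c = chart_at A p"
  have c: "c \<in> A" "p \<in> fst c" "adm c" using chart_at by (auto simp: c_def)
  let ?U = "U \<inter> U'"
  define Y where "Y y = (\<Sum>i<rmax. a i *\<^sub>R local_rep A c (X i) y)" for y
  have Y_at: "Y (snd c q) = dchart A c q (\<Sum>i<rmax. a i *\<^sub>R X i q)" if "q \<in> fst c" for q
    using dchart_linear(1)[OF c(3) that] by (simp add: Y_def local_rep_at[OF c(3) that] linear_sum linear_scale)
  note RX = regular_frameD[OF X(1)] and RX' = regular_frameD[OF X'(1)]
  have U: "open ?U" "p \<in> ?U" using RX(1) RX'(1) X(2) X'(2) by auto
  have "Y (snd c p) \<in> dchart A c p ` span ((\<lambda>i. X' i p) ` {..<rmax})"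
  proof (rule in_span_at_regular_limit[where U = ?U, OF dense U])
    show "smooth_vf_on A ?U (X' i)" if "i < rmax" for i by (rule smooth_vf_on_subset[OF RX'(2)[OF that]]) blast
    show "dim ((\<lambda>i. X' i p) ` {..<rmax}) = rmax" by (rule RX'(3)[OF X'(2)])
    show "continuous_on (snd c ` (fst c \<inter> ?U)) Y"
      unfolding Y_def
    proof (intro continuous_intros smooth_on_continuous smooth_vf_on_chart[OF _ c(1)])
      show "smooth_vf_on A ?U (X i)" if "i \<in> {..<rmax}" for i
        by (rule smooth_vf_on_subset[OF RX(2)]) (use that in auto)
    qed
    fix q assume q: "q \<in> fst c" "q \<in> ?U" "q \<in> M_reg \<pi>"
    have "span ((\<lambda>i. X i q) ` {..<rmax}) = span ((\<lambda>i. X' i q) ` {..<rmax})"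
      using RX(4)[of q] RX'(4)[of q] q by simp
    then show "Y (snd c q) \<in> dchart A c q ` span ((\<lambda>i. X' i q) ` {..<rmax})"
      unfolding Y_at[OF q(1)] using sum_in_span_family[where x = "\<lambda>i. X i q" and c = a and k = rmax] by simp
  qed (use c in auto)
  then show "v \<in> span ((\<lambda>i. X' i p) ` {..<rmax})"
    unfolding Y_at[OF c(2)] dchart_mem_iff[OF c(3,2)] v[symmetric] .
qed

text \<open>The same limit argument, applied to Hamiltonian fields.\<close>

lemma range_sharp_subset_frame:
  assumes dense: dense_reg and X: "regular_frame U X" "p \<in> U"
  shows "range (sharp \<pi> p) \<subseteq> span ((\<lambda>i. X i p) ` {..<rmax})"
proof
  fix v assume v: "v \<in> range (sharp \<pi> p)"
  define c where "c = chart_at A p"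
  have c: "c \<in> A" "p \<in> fst c" "adm c" using chart_at by (auto simp: c_def)
  note RX = regular_frameD[OF X(1)]
  have "dchart A c p v \<in> range (\<lambda>u. ham c u (snd c p))" unfolding ham_range[OF c(3,2)] using v by blast
  then obtain u where u: "dchart A c p v = ham c u (snd c p)" by blast
  have "ham c u (snd c p) \<in> dchart A c p ` span ((\<lambda>i. X i p) ` {..<rmax})"
  proof (rule in_span_at_regular_limit[where U = U, OF dense RX(1) X(2) RX(2) RX(3)[OF X(2)] c(1,2)])
    show "continuous_on (snd c ` (fst c \<inter> U)) (ham c u)"
      by (rule smooth_on_continuous[OF smooth_on_subset[OF ham_smooth[OF c(1)]]]) blast
    fix q assume q: "q \<in> fst c" "q \<in> U" "q \<in> M_reg \<pi>"
    show "ham c u (snd c q) \<in> dchart A c q ` span ((\<lambda>i. X i q) ` {..<rmax})"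
      unfolding ham_at[OF c(3) q(1)] RX(4)[OF q(2,3), symmetric] by blast
  qed
  then show "v \<in> span ((\<lambda>i. X i p) ` {..<rmax})"
    unfolding u[symmetric] dchart_mem_iff[OF c(3,2)] .
qed

lemma extends_regular:
  assumes "extends_symplectic_foliation A \<pi> D" "p \<in> M_reg \<pi>"
  shows "D p = range (sharp \<pi> p)"
proof -
  obtain L where "symplectic_leaf A \<pi> L" "p \<in> topspace L" "tangent_space A L p = D p"
    using assms unfolding extends_symplectic_foliation_def by blast
  then show ?thesis by (simp add: symplectic_leaf_def leaf_def connected_integral_manifold_def)
qed

text \<open>The rank is read off at one regular point, which exists since only finitely many ranks
  occur.\<close>

lemma extends_distribution:
  assumes "extends_symplectic_foliation A \<pi> D"
  shows "distribution A rmax D"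
proof -
  obtain k where k: "distribution A k D" using assms unfolding extends_symplectic_foliation_def by blast
  obtain p where p: "p \<in> M_reg \<pi>" using M_reg_nonempty by blast
  have "k = dim (D p)" using k by (simp add: distribution_def)
  also have "\<dots> = rmax" using p by (simp add: extends_regular[OF assms p] M_reg_iff sharp_rank_def)
  finally show ?thesis using k by simp
qed

lemma extends_frame:
  assumes "extends_symplectic_foliation A \<pi> D"
  obtains U X where "regular_frame U X" "p \<in> U" "\<And>q. q \<in> U \<Longrightarrow> D q = span ((\<lambda>i. X i q) ` {..<rmax})"
proof -
  note D = extends_distribution[OF assms]
  have "\<exists>U X. open U \<and> p \<in> U \<and> (\<forall>i<rmax. smooth_vf_on A U (X i)) \<and> (\<forall>q\<in>U. D q = span ((\<lambda>i. X i q) ` {..<rmax}))"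
    and dimD: "\<And>q. dim (D q) = rmax"
    using D unfolding distribution_def by blast+
  then obtain U and X :: "nat \<Rightarrow> 'a \<Rightarrow> 'e" where U: "open U" "p \<in> U" and X: "\<forall>i<rmax. smooth_vf_on A U (X i)"
    and DX: "\<forall>q\<in>U. D q = span ((\<lambda>i. X i q) ` {..<rmax})" by blast
  have "dim ((\<lambda>i. X i q) ` {..<rmax}) = rmax" if "q \<in> U" for q
    using dimD[of q] DX that by simp
  moreover have "range (sharp \<pi> q) = span ((\<lambda>i. X i q) ` {..<rmax})" if "q \<in> U" "q \<in> M_reg \<pi>" for q
    using extends_regular[OF assms that(2)] DX that by simp
  ultimately have "regular_frame U X" using U X by (simp add: regular_frame_def)
  from that[OF this U(2) bspec[OF DX]] show thesis .
qed

lemma extends_unique: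
  assumes "dense_reg" "extends_symplectic_foliation A \<pi> D" "extends_symplectic_foliation A \<pi> D'"
  shows "D = D'"
proof
  fix p
  obtain U X where X: "regular_frame U X" "p \<in> U" and DX: "\<And>q. q \<in> U \<Longrightarrow> D q = span ((\<lambda>i. X i q) ` {..<rmax})"
    by (rule extends_frame[OF assms(2), of p]) (rule that; assumption)
  obtain U' X' where X': "regular_frame U' X'" "p \<in> U'" and DX': "\<And>q. q \<in> U' \<Longrightarrow> D' q = span ((\<lambda>i. X' i q) ` {..<rmax})"
    by (rule extends_frame[OF assms(3), of p]) (rule that; assumption)
  show "D p = D' p"
    unfolding DX[OF X(2)] DX'[OF X'(2)]
    using regular_frames_subset[OF assms(1) X(1,2) X'(1,2)] regular_frames_subset[OF assms(1) X'(1,2) X(1,2)]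
    by (rule subset_antisym)
qed

lemma range_sharp_subset:
  assumes "dense_reg" "extends_symplectic_foliation A \<pi> D"
  shows "range (sharp \<pi> p) \<subseteq> D p"
proof -
  obtain U X where X: "regular_frame U X" "p \<in> U" and DX: "\<And>q. q \<in> U \<Longrightarrow> D q = span ((\<lambda>i. X i q) ` {..<rmax})"
    by (rule extends_frame[OF assms(2), of p]) (rule that; assumption)
  show ?thesis unfolding DX[OF X(2)] by (rule range_sharp_subset_frame[OF assms(1) X(1,2)])
qed

text \<open>On the regular part \<open>D\<close> is the image of \<open>sharp\<close>, which is
  involutive by the Jacobi identity; density extends this to the whole chart.\<close>

lemma extends_involutive_chart:
  assumes "dense_reg" "extends_symplectic_foliation A \<pi> D" and c: "c \<in> A"
  shows "involutive_on (snd c ` (fst c \<inter> UNIV)) (dist_chart D c)"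
proof (rule involutive_on_dense[where G = "snd c ` (fst c \<inter> M_reg \<pi>)"])
  note ad = atlas_adm[OF c]
  show "open (snd c ` (fst c \<inter> UNIV))" "open (snd c ` (fst c \<inter> M_reg \<pi>))"
    by (intro atlas_image_open[OF c] open_UNIV open_M_reg)+
  show "smooth_distribution_on rmax (snd c ` (fst c \<inter> UNIV)) (dist_chart D c)"
    by (rule distribution_chart[OF extends_distribution[OF assms(2)] c])
  show "involutive_on (snd c ` (fst c \<inter> M_reg \<pi>)) (dist_chart D c)"
  proof (rule involutive_on_cong[OF _ reg_distribution(2)[OF c]])
    fix z assume "z \<in> snd c ` (fst c \<inter> M_reg \<pi>)"
    then obtain q where q: "q \<in> fst c" "q \<in> M_reg \<pi>" "z = snd c q" by blast
    show "sharp_chart c z = dist_chart D c z"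
      unfolding q(3) dist_chart_at[OF ad q(1)] extends_regular[OF assms(2) q(2)]
      by (simp add: sharp_chart_def chart_inv_left[OF adm_chart[OF ad] q(1)])
  qed
  fix W z assume W: "open W" "z \<in> W" "W \<subseteq> snd c ` (fst c \<inter> UNIV)"
  then obtain p where p: "p \<in> fst c" "z = snd c p" by blast
  have "open {q \<in> fst c. snd c q \<in> W}" by (rule chart_preimage_open[OF adm_chart[OF ad] W(1)])
  moreover have "{q \<in> fst c. snd c q \<in> W} \<noteq> {}" using p W(2) by blast
  ultimately obtain q where "q \<in> fst c" "snd c q \<in> W" "q \<in> M_reg \<pi>" using dense_regD[OF assms(1)] by blast
  then show "W \<inter> snd c ` (fst c \<inter> M_reg \<pi>) \<noteq> {}" by blast
qed

lemma extends_involutive: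
  assumes "dense_reg" "extends_symplectic_foliation A \<pi> D"
  shows "involutive A D"
  unfolding involutive_def
proof (intro allI impI ballI)
  fix U X Y p
  assume asm: "open U \<and> smooth_vf_on A U X \<and> smooth_vf_on A U Y \<and> (\<forall>p\<in>U. X p \<in> D p \<and> Y p \<in> D p)" and p: "p \<in> U"
  define c where "c = chart_at A p"
  have c: "c \<in> A" "p \<in> fst c" "adm c" using chart_at by (auto simp: c_def)
  let ?V = "snd c ` (fst c \<inter> U)"
  have mem: "local_rep A c X z \<in> dist_chart D c z \<and> local_rep A c Y z \<in> dist_chart D c z" if "z \<in> ?V" for z
    using that asm by (auto simp: local_rep_at[OF c(3)] dist_chart_at[OF c(3)])
  have "open ?V" "?V \<subseteq> snd c ` (fst c \<inter> UNIV)" "smooth_on ?V (local_rep A c X)" "smooth_on ?V (local_rep A c Y)" "snd c p \<in> ?V"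
    using asm p c atlas_image_open[OF c(1)] smooth_vf_on_chart[OF _ c(1)] by auto
  then have "frechet_derivative (local_rep A c Y) (at (snd c p)) (local_rep A c X (snd c p))
      - frechet_derivative (local_rep A c X) (at (snd c p)) (local_rep A c Y (snd c p)) \<in> dist_chart D c (snd c p)"
    using extends_involutive_chart[OF assms c(1)] mem unfolding involutive_on_def by blast
  then show "lie_bracket A X Y p \<in> D p"
    by (simp add: lie_bracket_def Let_def c_def dchart_at local_rep_at[OF chart_at(3,2)] dist_chart_at[OF chart_at(3,2)])
qed

lemma extends_integrable:
  assumes "dense_reg" "extends_symplectic_foliation A \<pi> D"
  shows "integrable_distribution A D"
  unfolding integrable_distribution_def
proof
  fix p
  show "\<exists>L. leaf A D L \<and> p \<in> topspace L"
  proof (rule leaf_exists[where Om = UNIV and k = rmax])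
    fix q :: 'a
    define c where "c = chart_at A q"
    have c: "c \<in> A" "q \<in> fst c" "adm c" using chart_at by (auto simp: c_def)
    show "\<exists>d S. foliated D UNIV d S \<and> q \<in> fst d"
      by (rule foliated_chart_exists[OF c(3,2) open_UNIV UNIV_I dist_chart_def
            distribution_chart[OF extends_distribution[OF assms(2)] c(1)] extends_involutive_chart[OF assms c(1)]])
    show "q \<in> UNIV \<longleftrightarrow> dim (D q) = rmax"
      using extends_distribution[OF assms(2)] by (simp add: distribution_def)
  qed simp
qed

text \<open>The tangent spaces of a leaf contain the image of \<open>sharp\<close>, and for a skew
  form this puts \<pi> into their second exterior power.\<close>

lemma leaf_poisson_submanifold:
  assumes "dense_reg" "extends_symplectic_foliation A \<pi> D" and P: "leaf A D P"
  shows "poisson_submanifold A \<pi> P"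
  unfolding poisson_submanifold_def
proof (intro conjI ballI)
  have cim: "connected_integral_manifold A D P" using P by (simp add: leaf_def)
  then show "\<exists>k. immersed_submanifold A k P" by (simp add: connected_integral_manifold_def)
  fix p assume "p \<in> topspace P"
  then have "tangent_space A P p = D p" using cim by (simp add: connected_integral_manifold_def)
  moreover have "subspace (D p)" using extends_distribution[OF assms(2)] by (simp add: distribution_def)
  ultimately show "\<pi> p \<in> wedge2 (tangent_space A P p)"
    using wedge2_range_sharp[of \<pi> p "D p", OF pi_wedge _ range_sharp_subset[OF assms(1,2)]] by simp
qed

end

section \<open>Compactly supported forms\<close>

lemma compact_supportI:
  fixes s :: "'a::t2_space \<Rightarrow> 'v::zero"
  assumes "compact K" "\<And>p. p \<notin> K \<Longrightarrow> s p = 0"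
  shows "compact_support s"
proof -
  have "closure {p. s p \<noteq> 0} \<subseteq> K"
    using assms compact_imp_closed by (intro closure_minimal) auto
  then have "closure {p. s p \<noteq> 0} = K \<inter> closure {p. s p \<noteq> 0}" by blast
  then show ?thesis unfolding compact_support_def using compact_Int_closed[OF assms(1) closed_closure] by metis
qed

lemma compact_supportE:
  assumes "compact_support s"
  obtains K where "compact K" "\<And>p. p \<notin> K \<Longrightarrow> s p = 0"
proof (rule that)
  show "compact (closure {p. s p \<noteq> 0})" using assms by (simp add: compact_support_def)
  show "s p = 0" if "p \<notin> closure {p. s p \<noteq> 0}" for p using that closure_subset[of "{p. s p \<noteq> 0}"] by auto
qed

lemma dual_family_exists:
  fixes x :: "nat \<Rightarrow> 'b::euclidean_space"
  assumes "dim (x ` {..<k}) = k"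
  shows "\<exists>b. dual_family k x b"
proof -
  obtain U b where "(0::'b) \<in> U" "\<And>z. z \<in> U \<Longrightarrow> dual_family k x (\<lambda>i. b i z)"
    by (rule smooth_dual_familyE[where X = "\<lambda>i _. x i" and V = UNIV and ?z0.0 = "0::'b" and k = k])
      (simp, simp, simp add: smooth_on_const, simp add: assms, (rule that; assumption))
  then show ?thesis by blast
qed

context manifold
begin

lemma smooth_form_chart:
  assumes "smooth_form A \<alpha>" "c \<in> A"
  shows "smooth_on (snd c ` fst c) (\<lambda>y. blinfun_apply (\<alpha> (chart_inv c y)) (dchart_inv A c (chart_inv c y) v))"
  using assms by (simp add: smooth_form_def)

lemma smooth_form_add:
  assumes "smooth_form A \<alpha>" "smooth_form A \<beta>"
  shows "smooth_form A (\<lambda>p. \<alpha> p + \<beta> p)"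
  unfolding smooth_form_def blinfun.add_left
proof (intro ballI allI)
  fix c v assume c: "c \<in> A"
  show "smooth_on (snd c ` fst c) (\<lambda>y. blinfun_apply (\<alpha> (chart_inv c y)) (dchart_inv A c (chart_inv c y) v)
      + blinfun_apply (\<beta> (chart_inv c y)) (dchart_inv A c (chart_inv c y) v))"
    by (rule smooth_on_add[OF chart_open(2)[OF adm_chart[OF atlas_adm[OF c]]] smooth_form_chart[OF assms(1) c] smooth_form_chart[OF assms(2) c]])
qed

lemma smooth_form_scale:
  assumes "smooth_fun_on A UNIV f" "smooth_form A \<alpha>"
  shows "smooth_form A (\<lambda>p. f p *\<^sub>R \<alpha> p)"
  unfolding smooth_form_def blinfun.scaleR_left
proof (intro ballI allI)
  fix c v assume c: "c \<in> A"
  have "smooth_on (snd c ` fst c) (\<lambda>y. f (chart_inv c y))"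
    using smooth_fun_on_chart[OF assms(1) open_UNIV atlas_adm[OF c]] by simp
  then show "smooth_on (snd c ` fst c) (\<lambda>y. f (chart_inv c y) *\<^sub>R blinfun_apply (\<alpha> (chart_inv c y)) (dchart_inv A c (chart_inv c y) v))"
    by (rule smooth_on_scaleR[OF chart_open(2)[OF adm_chart[OF atlas_adm[OF c]]] _ smooth_form_chart[OF assms(2) c]])
qed

lemma smooth_form_vf:
  assumes \<alpha>: "smooth_form A \<alpha>" and Y: "smooth_vf_on A U Y" and U: "open U"
  shows "smooth_fun_on A U (\<lambda>p. blinfun_apply (\<alpha> p) (Y p))"
  unfolding smooth_fun_on_def comp_def
proof
  fix c assume c: "c \<in> A"
  note ad = atlas_adm[OF c] and ch = adm_chart[OF atlas_adm[OF c]]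
  let ?V = "snd c ` (fst c \<inter> U)"
  define L where "L y v = blinfun_apply (\<alpha> (chart_inv c y)) (dchart_inv A c (chart_inv c y) v)" for y v
  have op: "open ?V" by (rule atlas_image_open[OF c U])
  have "smooth_on ?V (\<lambda>y. L y (local_rep A c Y y))"
  proof (rule smooth_on_apply_linear[where L = L, OF op smooth_vf_on_chart[OF Y c]])
    show "smooth_on ?V (\<lambda>y. L y v)" for v
      unfolding L_def by (rule smooth_on_subset[OF smooth_form_chart[OF \<alpha> c]]) blast
    fix y assume "y \<in> ?V"
    then have "linear (dchart_inv A c (chart_inv c y))"
      by (intro dchart_linear ad) (auto simp: chart_inv_left[OF ch])
    then show "linear (L y)"
      unfolding L_def by (rule linear_compose[unfolded comp_def, OF _ bounded_linear.linear[OF blinfun.bounded_linear_right]])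
  qed
  then show "smooth_on ?V (\<lambda>y. blinfun_apply (\<alpha> (chart_inv c y)) (Y (chart_inv c y)))"
    by (subst smooth_on_cong[OF op, of _ "\<lambda>y. L y (local_rep A c Y y)"])
      (auto simp: L_def chart_inv_left[OF ch] local_rep_at[OF ad] dchart_inverse(1)[OF ad])
qed

end

section \<open>The dual bundle of the extended distribution\<close>

lemma lookup_scaleR: "Poly_Mapping.lookup (r *\<^sub>R s) i = r *\<^sub>R Poly_Mapping.lookup s i"
proof -
  have "finite {i. r *\<^sub>R Poly_Mapping.lookup s i \<noteq> 0}"
    by (rule finite_subset[OF _ finite_lookup[of s]]) auto
  then show ?thesis by (simp add: scaleR_poly_mapping_def Abs_poly_mapping_inverse)
qed

lemma independent_by_functionals:
  fixes x :: "nat \<Rightarrow> 'v::real_vector"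
  assumes l: "\<And>i. i < k \<Longrightarrow> linear (l i)" and d: "\<And>i j. i < k \<Longrightarrow> j < k \<Longrightarrow> l i (x j) = (if i = j then 1 else 0 :: real)"
  shows "inj_on x {..<k}" "independent (x ` {..<k})"
proof -
  show inj: "inj_on x {..<k}"
  proof (rule inj_onI)
    fix i j assume "i \<in> {..<k}" "j \<in> {..<k}" "x i = x j"
    then show "i = j" using d[of i i] d[of i j] by (auto split: if_splits)
  qed
  show "independent (x ` {..<k})"
  proof
    assume "dependent (x ` {..<k})"
    then obtain u where u: "\<exists>v\<in>x ` {..<k}. u v \<noteq> 0" "(\<Sum>v\<in>x ` {..<k}. u v *\<^sub>R v) = 0"
      unfolding dependent_finite[OF finite_imageI[OF finite_lessThan]] by blast
    then obtain i where i: "i < k" "u (x i) \<noteq> 0" by blast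
    have "(\<Sum>j<k. u (x j) *\<^sub>R x j) = 0" using u(2) by (simp add: sum.reindex[OF inj])
    then have "l i (\<Sum>j<k. u (x j) *\<^sub>R x j) = 0" using linear_0[OF l[OF i(1)]] by simp
    then have "(\<Sum>j<k. u (x j) * l i (x j)) = 0" by (simp add: linear_sum[OF l[OF i(1)]] linear_scale[OF l[OF i(1)]])
    moreover have "(\<Sum>j<k. u (x j) * l i (x j)) = (\<Sum>j<k. if j = i then u (x j) else 0)"
      using d[OF i(1)] by (intro sum.cong) auto
    ultimately show False using i by simp
  qed
qed

locale poisson_extension = poisson A \<pi>
  for A :: "('a::{t2_space, second_countable_topology}, 'e::euclidean_space) chart set"
    and \<pi> :: "'a \<Rightarrow> 'e biform" +
  fixes D :: "'a \<Rightarrow> 'e set"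
  assumes dense: "closure (M_reg \<pi>) = UNIV" and extends: "extends_symplectic_foliation A \<pi> D"
begin

lemma D_subspace: "subspace (D p)" and D_dim: "dim (D p) = rmax"
  using extends_distribution[OF extends] by (auto simp: distribution_def)

text \<open>An orthonormal basis is its own dual family.\<close>

lemma onb_exists: "\<exists>b. dual_family rmax b b \<and> span (b ` {..<rmax}) = D p"
proof -
  obtain B where B: "B \<subseteq> D p" "pairwise orthogonal B" "\<And>x. x \<in> B \<Longrightarrow> norm x = 1" "independent B"
    "card B = dim (D p)" "span B = D p"
    by (rule orthonormal_basis_subspace[OF D_subspace]) (rule that; assumption)
  obtain h where h: "bij_betw h {..<rmax} B"
    using ex_bij_betw_nat_finite[OF finiteI_independent[OF B(4)]] B(5) D_dim by (auto simp: atLeast0LessThan)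
  have "dual_family rmax h h"
    unfolding dual_family_def
  proof (intro allI impI)
    fix i j assume ij: "i < rmax" "j < rmax"
    have hB: "h i \<in> B" "h j \<in> B" using bij_betwE[OF h] ij by auto
    show "h j \<bullet> h i = (if i = j then 1 else 0)"
    proof (cases "i = j")
      case True
      then show ?thesis using B(3)[OF hB(1)] by (simp add: dot_square_norm)
    next
      case False
      then have "h j \<noteq> h i" using bij_betw_imp_inj_on[OF h] ij by (auto simp: inj_on_def)
      then show ?thesis using B(2) hB False by (auto simp: pairwise_def orthogonal_def)
    qed
  qed
  moreover have "h ` {..<rmax} = B" using h by (simp add: bij_betw_def)
  ultimately show ?thesis using B(6) by blast
qed

definition onb :: "'a \<Rightarrow> nat \<Rightarrow> 'e" where
  "onb p = (SOME b. dual_family rmax b b \<and> span (b ` {..<rmax}) = D p)"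

lemma onb: "dual_family rmax (onb p) (onb p)" "span (onb p ` {..<rmax}) = D p"
  using someI_ex[OF onb_exists[of p]] by (auto simp: onb_def)

lemma D_expand: "u \<in> D p \<Longrightarrow> u = (\<Sum>i<rmax. (u \<bullet> onb p i) *\<^sub>R onb p i)"
  using dual_family_span_iff[OF onb(1), of u p] onb(2) by blast

text \<open>
  A functional on \<open>D p\<close> is recorded by its values \<open>l\<close> on the (not smoothly varying) orthonormal
  basis \<open>onb p\<close> of \<open>D p\<close>; \<open>riesz p l\<close> is the vector of \<open>D p\<close> representing it.
\<close>

definition fibre :: "(nat \<Rightarrow>\<^sub>0 real) set" where
  "fibre = {s. \<forall>i\<ge>rmax. Poly_Mapping.lookup s i = 0}"

definition riesz :: "'a \<Rightarrow> (nat \<Rightarrow>\<^sub>0 real) \<Rightarrow> 'e" where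
  "riesz p s = (\<Sum>i<rmax. Poly_Mapping.lookup s i *\<^sub>R onb p i)"

definition restr :: "('e \<Rightarrow> real) \<Rightarrow> 'a \<Rightarrow> (nat \<Rightarrow>\<^sub>0 real)" where
  "restr f p = (\<Sum>i<rmax. Poly_Mapping.single i (f (onb p i)))"

lemma lookup_restr: "Poly_Mapping.lookup (restr f p) i = (if i < rmax then f (onb p i) else 0)"
proof -
  have "Poly_Mapping.lookup (restr f p) i = (\<Sum>j<rmax. if j = i then f (onb p j) else 0)"
    unfolding restr_def lookup_sum by (intro sum.cong) (auto simp: lookup_single when_def)
  then show ?thesis by simp
qed

lemma restr_fibre: "restr f p \<in> fibre"
  by (simp add: fibre_def lookup_restr)

lemma riesz_restr:
  assumes "linear f" "u \<in> D p"
  shows "riesz p (restr f p) \<bullet> u = f u"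
proof -
  have "riesz p (restr f p) \<bullet> u = (\<Sum>i<rmax. f (onb p i) * (onb p i \<bullet> u))"
    by (simp add: riesz_def lookup_restr inner_sum_left)
  also have "\<dots> = (\<Sum>i<rmax. (u \<bullet> onb p i) * f (onb p i))" by (simp add: inner_commute mult.commute)
  also have "\<dots> = f (\<Sum>i<rmax. (u \<bullet> onb p i) *\<^sub>R onb p i)"
    by (simp add: linear_sum[OF assms(1)] linear_scale[OF assms(1)])
  also have "(\<Sum>i<rmax. (u \<bullet> onb p i) *\<^sub>R onb p i) = u" by (rule D_expand[OF assms(2), symmetric])
  finally show ?thesis .
qed

lemma riesz_mem: "riesz p s \<in> D p"
proof -
  have "riesz p s \<in> span (onb p ` {..<rmax})" unfolding riesz_def by (rule sum_in_span_family)
  then show ?thesis by (simp only: onb(2))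
qed

lemma riesz_inner_onb: "i < rmax \<Longrightarrow> riesz p s \<bullet> onb p i = Poly_Mapping.lookup s i"
  unfolding riesz_def by (rule dual_family_coefficient[OF onb(1)])

lemma riesz_inj:
  assumes "s \<in> fibre" "t \<in> fibre" "riesz p s = riesz p t"
  shows "s = t"
proof (rule poly_mapping_eqI)
  fix i
  show "Poly_Mapping.lookup s i = Poly_Mapping.lookup t i"
  proof (cases "i < rmax")
    case True
    then show ?thesis using assms(3) riesz_inner_onb by metis
  qed (use assms in \<open>simp add: fibre_def\<close>)
qed

lemma riesz_linear: "linear (riesz p)"
  by (rule linearI)
    (simp_all add: riesz_def lookup_add lookup_scaleR scaleR_add_left sum.distrib scaleR_sum_right)

lemma fibre_subspace: "subspace fibre"
  by (auto simp: subspace_def fibre_def lookup_add lookup_scaleR)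

text \<open>The \<open>b p i\<close> form the basis of the dual of \<open>D p\<close> that is dual
  to the frame \<open>X i p\<close>. The frame is recorded because it carries the smoothness, which
  the coordinates of \<open>b\<close> in the arbitrary bases \<open>onb p\<close> do not
  show.\<close>

definition coframe :: "'a set \<Rightarrow> (nat \<Rightarrow> 'a \<Rightarrow> 'e) \<Rightarrow> ('a \<Rightarrow> nat \<Rightarrow> (nat \<Rightarrow>\<^sub>0 real)) \<Rightarrow> bool" where
  "coframe U X b \<longleftrightarrow> open U \<and> (\<forall>i<rmax. smooth_vf_on A U (X i)) \<and>
     (\<forall>p\<in>U. D p = span ((\<lambda>i. X i p) ` {..<rmax}) \<and> (\<forall>i<rmax. b p i \<in> fibre) \<and>
        dual_family rmax (\<lambda>i. X i p) (\<lambda>i. riesz p (b p i)))"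

lemma coframeD:
  assumes "coframe U X b"
  shows "open U" "\<And>i. i < rmax \<Longrightarrow> smooth_vf_on A U (X i)"
    "\<And>p. p \<in> U \<Longrightarrow> D p = span ((\<lambda>i. X i p) ` {..<rmax})" "\<And>p i. p \<in> U \<Longrightarrow> i < rmax \<Longrightarrow> b p i \<in> fibre"
    "\<And>p. p \<in> U \<Longrightarrow> dual_family rmax (\<lambda>i. X i p) (\<lambda>i. riesz p (b p i))"
  using assms by (auto simp: coframe_def)

lemma coframe_subset:
  assumes "coframe U X b" "open V" "V \<subseteq> U"
  shows "coframe V X b"
  using assms smooth_vf_on_subset unfolding coframe_def by blast

lemma coframe_mem: "coframe U X b \<Longrightarrow> p \<in> U \<Longrightarrow> i < rmax \<Longrightarrow> X i p \<in> D p"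
  using coframeD(3) by (auto intro: span_base)

lemma coframe_exists: "\<exists>U X b. coframe U X b \<and> p \<in> U"
proof -
  obtain U X where X: "regular_frame U X" "p \<in> U" and DX: "\<And>q. q \<in> U \<Longrightarrow> D q = span ((\<lambda>i. X i q) ` {..<rmax})"
    by (rule extends_frame[OF extends, of p]) (rule that; assumption)
  note RX = regular_frameD[OF X(1)]
  have "\<exists>w. dual_family rmax (\<lambda>i. X i q) w" if "q \<in> U" for q
    by (rule dual_family_exists[OF RX(3)[OF that]])
  then obtain w where w: "\<And>q. q \<in> U \<Longrightarrow> dual_family rmax (\<lambda>i. X i q) (w q)" by metis
  define b where "b q i = restr (\<lambda>u. u \<bullet> w q i) q" for q i
  have lin: "linear (\<lambda>u. u \<bullet> x)" for x :: 'e by (rule bounded_linear.linear[OF bounded_linear_inner_left])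
  have "dual_family rmax (\<lambda>i. X i q) (\<lambda>i. riesz q (b q i))" if q: "q \<in> U" for q
    unfolding dual_family_def
  proof (intro allI impI)
    fix i j assume ij: "i < rmax" "j < rmax"
    have "X j q \<in> D q" unfolding DX[OF q] using ij by (auto intro: span_base)
    from riesz_restr[OF lin this, of "w q i"]
    show "X j q \<bullet> riesz q (b q i) = (if i = j then 1 else 0)"
      using dual_familyD[OF w[OF q] ij] by (simp add: b_def inner_commute)
  qed
  then have "coframe U X b"
    using RX(1,2) DX restr_fibre by (simp add: coframe_def b_def)
  then show ?thesis using X(2) by blast
qed

lemma coframe_coefficient:
  assumes "coframe U X b" "p \<in> U" "j < rmax"
  shows "riesz p (\<Sum>i<rmax. g i *\<^sub>R b p i) \<bullet> X j p = g j"
proof -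
  have "riesz p (\<Sum>i<rmax. g i *\<^sub>R b p i) \<bullet> X j p = (\<Sum>i<rmax. g i * (riesz p (b p i) \<bullet> X j p))"
    by (simp add: linear_sum[OF riesz_linear] linear_scale[OF riesz_linear] inner_sum_left)
  also have "\<dots> = (\<Sum>i<rmax. g i * (X j p \<bullet> riesz p (b p i)))" by (simp add: inner_commute)
  also have "\<dots> = (\<Sum>i<rmax. if i = j then g i else 0)"
    using dual_familyD[OF coframeD(5)[OF assms(1,2)] _ assms(3)] by (intro sum.cong) auto
  finally show ?thesis using assms(3) by simp
qed

lemma riesz_eqI:
  assumes "coframe U X b" "p \<in> U" "s \<in> fibre" "t \<in> fibre" "\<And>j. j < rmax \<Longrightarrow> riesz p s \<bullet> X j p = riesz p t \<bullet> X j p"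
  shows "s = t"
proof -
  define u where "u = riesz p s - riesz p t"
  have "u \<in> D p" unfolding u_def by (intro subspace_diff[OF D_subspace] riesz_mem)
  then obtain a where a: "u = (\<Sum>j<rmax. a j *\<^sub>R X j p)"
    unfolding coframeD(3)[OF assms(1,2)] by (rule in_span_familyE)
  have "u \<bullet> u = (\<Sum>j<rmax. a j * (u \<bullet> X j p))" by (subst (2) a) (simp add: inner_sum_right)
  also have "\<dots> = 0" using assms(5) by (intro sum.neutral) (auto simp: u_def inner_diff_left)
  finally have "riesz p s = riesz p t" by (simp add: u_def)
  then show ?thesis by (rule riesz_inj[OF assms(3,4)])
qed

lemma coframe_expand:
  assumes "coframe U X b" "p \<in> U" "s \<in> fibre"
  shows "s = (\<Sum>i<rmax. (riesz p s \<bullet> X i p) *\<^sub>R b p i)"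
proof (rule riesz_eqI[OF assms])
  show "(\<Sum>i<rmax. (riesz p s \<bullet> X i p) *\<^sub>R b p i) \<in> fibre"
    using coframeD(4)[OF assms(1,2)] by (intro subspace_sum[OF fibre_subspace] subspace_scale[OF fibre_subspace]) auto
  show "riesz p s \<bullet> X j p = riesz p (\<Sum>i<rmax. (riesz p s \<bullet> X i p) *\<^sub>R b p i) \<bullet> X j p" if "j < rmax" for j
    by (rule coframe_coefficient[OF assms(1,2) that, symmetric])
qed

text \<open>The coefficients in the dual basis are the values on the \<open>X i\<close>, so sections
  of the dual bundle can be tested on frame fields.\<close>

lemma smooth_combination_iff:
  assumes "coframe U X b" "\<And>p. p \<in> U \<Longrightarrow> s p \<in> fibre"
  shows "smooth_combination_on A rmax U b s \<longleftrightarrow> (\<forall>i<rmax. smooth_fun_on A U (\<lambda>p. riesz p (s p) \<bullet> X i p))"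
proof
  assume "smooth_combination_on A rmax U b s"
  then obtain g where g: "\<And>i. i < rmax \<Longrightarrow> smooth_fun_on A U (g i)" "\<And>p. p \<in> U \<Longrightarrow> s p = (\<Sum>i<rmax. g i p *\<^sub>R b p i)"
    unfolding smooth_combination_on_def by blast
  show "\<forall>i<rmax. smooth_fun_on A U (\<lambda>p. riesz p (s p) \<bullet> X i p)"
  proof (intro allI impI)
    fix i assume i: "i < rmax"
    show "smooth_fun_on A U (\<lambda>p. riesz p (s p) \<bullet> X i p)"
    proof (rule smooth_fun_on_cong[OF coframeD(1)[OF assms(1)] _ g(1)[OF i]])
      fix p assume p: "p \<in> U"
      show "g i p = riesz p (s p) \<bullet> X i p"
        unfolding g(2)[OF p] by (rule coframe_coefficient[OF assms(1) p i, symmetric])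
    qed
  qed
next
  assume "\<forall>i<rmax. smooth_fun_on A U (\<lambda>p. riesz p (s p) \<bullet> X i p)"
  then show "smooth_combination_on A rmax U b s"
    unfolding smooth_combination_on_def
    by (intro exI[of _ "\<lambda>i p. riesz p (s p) \<bullet> X i p"]) (use coframe_expand[OF assms(1) _ assms(2)] in auto)
qed

definition dual_atlas :: "('a set \<times> ('a \<Rightarrow> nat \<Rightarrow> (nat \<Rightarrow>\<^sub>0 real))) set" where
  "dual_atlas = {(U, b). \<exists>X. coframe U X b}"

lemma dual_bundle: "vector_bundle A rmax (\<lambda>_. fibre) dual_atlas"
  unfolding vector_bundle_def
proof (intro conjI)
  show "\<forall>(U, b)\<in>dual_atlas. open U \<and>
      (\<forall>p\<in>U. inj_on (b p) {..<rmax} \<and> independent (b p ` {..<rmax}) \<and> span (b p ` {..<rmax}) = fibre)"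
  proof (clarify, intro conjI ballI)
    fix U b assume "(U, b) \<in> dual_atlas"
    then obtain X where X: "coframe U X b" by (auto simp: dual_atlas_def)
    show "open U" by (rule coframeD(1)[OF X])
    fix p assume p: "p \<in> U"
    have lin: "linear (\<lambda>s. riesz p s \<bullet> X i p)" for i
      by (rule linear_compose[unfolded comp_def, OF riesz_linear bounded_linear.linear[OF bounded_linear_inner_left]])
    have d: "riesz p (b p j) \<bullet> X i p = (if i = j then 1 else 0)" if "i < rmax" "j < rmax" for i j
      using dual_familyD[OF coframeD(5)[OF X p] that(2,1)] by (simp add: inner_commute eq_commute)
    show "inj_on (b p) {..<rmax}" "independent (b p ` {..<rmax})"
      using independent_by_functionals[where l = "\<lambda>i s. riesz p s \<bullet> X i p" and x = "b p" and k = rmax, OF lin d] by auto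
    show "span (b p ` {..<rmax}) = fibre"
    proof
      show "span (b p ` {..<rmax}) \<subseteq> fibre"
        using coframeD(4)[OF X p] by (intro span_minimal fibre_subspace) auto
      show "fibre \<subseteq> span (b p ` {..<rmax})"
      proof
        fix s assume "s \<in> fibre"
        from coframe_expand[OF X p this] show "s \<in> span (b p ` {..<rmax})"
          by (rule ssubst) (rule sum_in_span_family)
      qed
    qed
  qed
  show "(\<Union>(U, b)\<in>dual_atlas. U) = UNIV"
  proof (rule sym, rule UNIV_eq_I)
    fix p
    obtain U X b where "coframe U X b" "p \<in> U" using coframe_exists by blast
    then have "(U, b) \<in> dual_atlas" by (auto simp: dual_atlas_def)
    then show "p \<in> (\<Union>(U, b)\<in>dual_atlas. U)" using \<open>p \<in> U\<close> by blast
  qed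
  show "\<forall>(U, b)\<in>dual_atlas. \<forall>(U', b')\<in>dual_atlas. \<forall>j<rmax. smooth_combination_on A rmax (U \<inter> U') b (\<lambda>p. b' p j)"
  proof (clarify)
    fix U b U' b' and j :: nat
    assume "(U, b) \<in> dual_atlas" "(U', b') \<in> dual_atlas" and j: "j < rmax"
    then obtain X X' where X: "coframe U X b" and X': "coframe U' X' b'" by (auto simp: dual_atlas_def)
    have op: "open (U \<inter> U')" using coframeD(1)[OF X] coframeD(1)[OF X'] by blast
    have Y: "coframe (U \<inter> U') X b" "coframe (U \<inter> U') X' b'"
      using coframe_subset[OF X op] coframe_subset[OF X' op] by auto
    show "smooth_combination_on A rmax (U \<inter> U') b (\<lambda>p. b' p j)"
    proof (subst smooth_combination_iff[OF Y(1)])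
      show "b' p j \<in> fibre" if "p \<in> U \<inter> U'" for p by (rule coframeD(4)[OF Y(2) that j])
      show "\<forall>i<rmax. smooth_fun_on A (U \<inter> U') (\<lambda>p. riesz p (b' p j) \<bullet> X i p)"
      proof (intro allI impI)
        fix i assume i: "i < rmax"
        \<comment> \<open>The transition functions of the dual frames are the coefficients of the
          frame \<open>X\<close> with respect to \<open>X'\<close>.\<close>
        show "smooth_fun_on A (U \<inter> U') (\<lambda>p. riesz p (b' p j) \<bullet> X i p)"
        proof (rule smooth_coefficient_functions[where X = X' and Y = "X i" and k = rmax
              and g = "\<lambda>j p. riesz p (b' p j) \<bullet> X i p", OF op coframeD(2)[OF Y(2)] _ coframeD(2)[OF Y(1) i] _ j])
          fix p assume p: "p \<in> U \<inter> U'"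
          show "dim ((\<lambda>i. X' i p) ` {..<rmax}) = rmax" by (rule dual_family_dim[OF coframeD(5)[OF Y(2) p]])
          have "X i p \<in> span ((\<lambda>i. X' i p) ` {..<rmax})"
            using coframe_mem[OF Y(1) p i] coframeD(3)[OF Y(2) p] by simp
          then show "X i p = (\<Sum>j<rmax. (riesz p (b' p j) \<bullet> X i p) *\<^sub>R X' j p)"
            unfolding dual_family_span_iff[OF coframeD(5)[OF Y(2) p]] by (simp add: inner_commute)
        qed
      qed
    qed
  qed
qed

abbreviation "sections \<equiv> compact_sections A rmax (\<lambda>_. fibre) dual_atlas"

lemma sections_iff:
  "s \<in> sections \<longleftrightarrow> (\<forall>p. s p \<in> fibre) \<and> compact_support s \<and>
     (\<forall>U X b. coframe U X b \<longrightarrow> (\<forall>i<rmax. smooth_fun_on A U (\<lambda>p. riesz p (s p) \<bullet> X i p)))"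
proof (cases "\<forall>p. s p \<in> fibre")
  case True
  have "(\<forall>(U, b)\<in>dual_atlas. smooth_combination_on A rmax U b s) \<longleftrightarrow>
      (\<forall>U X b. coframe U X b \<longrightarrow> smooth_combination_on A rmax U b s)"
    unfolding dual_atlas_def by blast
  also have "\<dots> \<longleftrightarrow> (\<forall>U X b. coframe U X b \<longrightarrow> (\<forall>i<rmax. smooth_fun_on A U (\<lambda>p. riesz p (s p) \<bullet> X i p)))"
    by (intro iff_allI imp_cong refl smooth_combination_iff) (use True in auto)
  finally show ?thesis using True unfolding compact_sections_def mem_Collect_eq by (simp only: conj_commute)
qed (auto simp: compact_sections_def)

lemma section_smooth:
  assumes "s \<in> sections" "coframe U X b" "i < rmax"
  shows "smooth_fun_on A U (\<lambda>p. riesz p (s p) \<bullet> X i p)"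
  using assms unfolding sections_iff by blast

section \<open>The isomorphism from sections of the dual bundle\<close>

definition sharp_dual :: "('a \<Rightarrow> (nat \<Rightarrow>\<^sub>0 real)) \<Rightarrow> 'a \<Rightarrow> 'e" where
  "sharp_dual s p = sharp \<pi> p (blinfun_inner_left (riesz p (s p)))"

text \<open>By skewness, pairing the two sides with \<open>\<zeta>\<close> evaluates the covectors
  on \<open>sharp \<pi> p \<zeta>\<close>, which lies in \<open>D p\<close>.\<close>

lemma sharp_restrict:
  assumes "\<And>v. v \<in> D p \<Longrightarrow> blinfun_apply \<xi> v = blinfun_apply \<eta> v"
  shows "sharp \<pi> p \<xi> = sharp \<pi> p \<eta>"
proof (rule blinfun_separates)
  fix \<zeta> :: "'e \<Rightarrow>\<^sub>L real"
  have "sharp \<pi> p \<zeta> \<in> D p" using range_sharp_subset[OF dense extends] by blast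
  then show "blinfun_apply \<zeta> (sharp \<pi> p \<xi>) = blinfun_apply \<zeta> (sharp \<pi> p \<eta>)"
    using assms sharp_skew[of \<pi> p, OF pi_wedge] by metis
qed

text \<open>Sections with the same image agree at regular points, where \<open>D\<close> is the
  image of \<open>sharp\<close>; density and continuity of their values on a frame do the
  rest.\<close>

lemma sharp_dual_injective:
  assumes s: "s \<in> sections" and t: "t \<in> sections" and eq: "sharp_dual s = sharp_dual t"
  shows "s = t"
proof
  have reg: "riesz q (s q) = riesz q (t q)" if q: "q \<in> M_reg \<pi>" for q
  proof -
    define u where "u = riesz q (s q) - riesz q (t q)"
    have "linear (\<lambda>x. sharp \<pi> q (blinfun_inner_left x))"
      by (rule linear_compose[unfolded comp_def, OF bounded_linear.linear[OF bounded_linear_blinfun_inner_left] linear_sharp[of \<pi>, OF pi_wedge]])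
    then have zero: "sharp \<pi> q (blinfun_inner_left u) = 0"
      using fun_cong[OF eq, of q] linear_diff[of "\<lambda>x. sharp \<pi> q (blinfun_inner_left x)" "riesz q (s q)" "riesz q (t q)"]
      by (simp add: u_def sharp_dual_def)
    have "u \<in> D q" unfolding u_def by (intro subspace_diff[OF D_subspace] riesz_mem)
    then obtain \<xi> where \<xi>: "u = sharp \<pi> q \<xi>" unfolding extends_regular[OF extends q] by blast
    \<comment> \<open>Writing one factor of \<open>u \<bullet> u\<close> as
      \<open>sharp \<pi> q \<xi>\<close>, skewness moves \<open>sharp\<close> to the other factor,
      where it gives zero.\<close>
    have "blinfun_apply (blinfun_inner_left u) u = - blinfun_apply \<xi> (sharp \<pi> q (blinfun_inner_left u))"
      by (subst (2) \<xi>) (rule sharp_skew[of \<pi> q, OF pi_wedge])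
    then have "u \<bullet> u = 0" by (simp add: zero)
    then show ?thesis by (simp add: u_def)
  qed
  fix p
  obtain U X b where X: "coframe U X b" "p \<in> U" using coframe_exists by blast
  show "s p = t p"
  proof (rule riesz_eqI[OF X])
    show "s p \<in> fibre" "t p \<in> fibre" using s t by (auto simp: sections_iff)
    fix j assume j: "j < rmax"
    define f where "f q = riesz q (s q) \<bullet> X j q - riesz q (t q) \<bullet> X j q" for q
    have "smooth_fun_on A U f"
      unfolding f_def
      by (rule smooth_fun_on_diff[OF coframeD(1)[OF X(1)] section_smooth[OF s X(1) j] section_smooth[OF t X(1) j]])
    then have cont: "continuous_on U f" by (rule smooth_fun_on_continuous[OF _ coframeD(1)[OF X(1)]])
    have "f p = 0"
    proof (rule ccontr)
      assume "f p \<noteq> 0"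
      have "open (U \<inter> f -` (- {0}))" by (rule continuous_open_preimage[OF cont coframeD(1)[OF X(1)]]) auto
      moreover have "p \<in> U \<inter> f -` (- {0})" using X(2) \<open>f p \<noteq> 0\<close> by simp
      ultimately obtain q where "q \<in> U \<inter> f -` (- {0})" "q \<in> M_reg \<pi>" using dense_regD[OF dense] by blast
      then show False using reg[of q] by (simp add: f_def)
    qed
    then show "riesz p (s p) \<bullet> X j p = riesz p (t p) \<bullet> X j p" by (simp add: f_def)
  qed
qed

text \<open>Extending a functional from \<open>D\<close> to the tangent space amounts to choosing a
  complement; the dual family \<open>\<beta>\<close> chooses one smoothly in coordinates. The
  cut-off is fixed before the section and serves all sections.\<close>

lemma local_lift:
  fixes p :: 'a
  shows "\<exists>V \<psi>. open V \<and> p \<in> V \<and> smooth_fun_on A UNIV \<psi> \<and> (\<forall>q\<in>V. \<psi> q = 1) \<and>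
    (\<forall>s\<in>sections. \<exists>\<alpha>. smooth_form A \<alpha> \<and> compact_support \<alpha> \<and>
      (\<forall>q. \<forall>v\<in>D q. blinfun_apply (\<alpha> q) v = \<psi> q * (riesz q (s q) \<bullet> v)))"
proof -
  obtain U0 X b where X0: "coframe U0 X b" "p \<in> U0" using coframe_exists by blast
  define c where "c = chart_at A p"
  have c: "c \<in> A" "p \<in> fst c" "adm c" using chart_at by (auto simp: c_def)
  note ch = adm_chart[OF c(3)]
  let ?V0 = "snd c ` (fst c \<inter> U0)"
  have V0: "open ?V0" "snd c p \<in> ?V0" using atlas_image_open[OF c(1) coframeD(1)[OF X0(1)]] c X0 by auto
  let ?X = "\<lambda>i. local_rep A c (X i)"
  have dimp: "dim ((\<lambda>i. ?X i (snd c p)) ` {..<rmax}) = rmax"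
    unfolding local_rep_span(2)[OF c(3,2)] by (rule dual_family_dim[OF coframeD(5)[OF X0]])
  obtain V1 \<beta> where V1: "open V1" "snd c p \<in> V1" "V1 \<subseteq> ?V0" and \<beta>: "\<And>i. i < rmax \<Longrightarrow> smooth_on V1 (\<beta> i)"
    and dual: "\<And>z. z \<in> V1 \<Longrightarrow> dual_family rmax (\<lambda>i. ?X i z) (\<lambda>i. \<beta> i z)"
    by (rule smooth_dual_familyE[OF V0 smooth_vf_on_chart[OF coframeD(2)[OF X0(1)] c(1)] dimp])
      (assumption, (rule that; assumption))
  define U where "U = {q \<in> fst c. snd c q \<in> V1}"
  have U: "open U" "p \<in> U" "U \<subseteq> fst c" unfolding U_def
    using chart_preimage_open[OF ch V1(1)] V1(2) c by auto
  have UU0: "U \<subseteq> U0"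
  proof
    fix q assume "q \<in> U"
    then have q: "q \<in> fst c" "snd c q \<in> ?V0" using V1(3) by (auto simp: U_def)
    then show "q \<in> U0" using chart_image_subset[OF ch] chart_inv_left[OF ch q(1)] by metis
  qed
  have X: "coframe U X b" by (rule coframe_subset[OF X0(1) U(1) UU0])
  obtain \<psi> V K where \<psi>: "smooth_fun_on A UNIV \<psi>" "open V" "p \<in> V" "V \<subseteq> K" "compact K" "K \<subseteq> U"
    "\<And>q. q \<in> V \<Longrightarrow> \<psi> q = 1" "\<And>q. q \<notin> K \<Longrightarrow> \<psi> q = 0"
    by (rule manifold_bump[OF U(1,2)]) (rule that; assumption)
  have "\<exists>\<alpha>. smooth_form A \<alpha> \<and> compact_support \<alpha> \<and> (\<forall>q. \<forall>v\<in>D q. blinfun_apply (\<alpha> q) v = \<psi> q * (riesz q (s q) \<bullet> v))"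
    if s: "s \<in> sections" for s
  proof -
    define g where "g i q = riesz q (s q) \<bullet> X i q" for i q
    have g: "smooth_fun_on A U (g i)" if "i < rmax" for i
      unfolding g_def by (rule section_smooth[OF s X that])
    \<comment> \<open>In coordinates \<open>\<beta>\<close> is dual to the frame, so on
      \<open>X i\<close> this form takes the value \<open>\<psi> q * g i q\<close> over
      \<open>U\<close>.\<close>
    define \<alpha> where "\<alpha> q = \<psi> q *\<^sub>R (\<Sum>i<rmax. g i q *\<^sub>R cov c q (\<beta> i (snd c q)))" for q
    have \<alpha>0: "\<alpha> q = 0" if "q \<notin> K" for q using \<psi>(8)[OF that] by (simp add: \<alpha>_def)
    have \<alpha>_apply: "blinfun_apply (\<alpha> q) v = \<psi> q * (\<Sum>i<rmax. g i q * (dchart A c q v \<bullet> \<beta> i (snd c q)))" if "q \<in> U" for q v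
      using that U(3) by (auto simp: \<alpha>_def blinfun.scaleR_left blinfun.sum_left cov_apply[OF c(3)])
    have "smooth_form A \<alpha>"
    proof (rule smooth_formI)
      fix q
      show "\<exists>d V. adm d \<and> open V \<and> q \<in> V \<and> q \<in> fst d \<and>
        (\<forall>v. smooth_on (snd d ` (fst d \<inter> V)) (\<lambda>y. blinfun_apply (\<alpha> (chart_inv d y)) (dchart_inv A d (chart_inv d y) v)))"
      proof (cases "q \<in> U")
        case True
        have eq: "snd c ` (fst c \<inter> U) = V1" using V1(3) by (auto simp: U_def)
        have "smooth_on V1 (\<lambda>y. blinfun_apply (\<alpha> (chart_inv c y)) (dchart_inv A c (chart_inv c y) v))" for v
        proof -
          have sg: "smooth_on V1 (\<lambda>y. g i (chart_inv c y))" if "i < rmax" for i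
            using smooth_fun_on_chart[OF g[OF that] U(1) c(3)] by (simp add: eq)
          have s\<psi>: "smooth_on V1 (\<lambda>y. \<psi> (chart_inv c y))"
            using smooth_fun_on_chart[OF smooth_fun_on_subset[OF \<psi>(1) subset_UNIV[of U]] U(1) c(3)] by (simp add: eq)
          have sm: "smooth_on V1 (\<lambda>y. \<psi> (chart_inv c y) * (\<Sum>i<rmax. g i (chart_inv c y) * (v \<bullet> \<beta> i y)))"
            using sg \<beta> by (intro smooth_on_mult smooth_on_sum smooth_on_inner smooth_on_const V1(1) s\<psi>) auto
          have "blinfun_apply (\<alpha> (chart_inv c y)) (dchart_inv A c (chart_inv c y) v)
              = \<psi> (chart_inv c y) * (\<Sum>i<rmax. g i (chart_inv c y) * (v \<bullet> \<beta> i y))" if y: "y \<in> V1" for y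
          proof -
            obtain x where x: "x \<in> fst c" "x \<in> U" "y = snd c x" using y eq by blast
            show ?thesis unfolding x(3) chart_inv_left[OF ch x(1)]
              by (simp add: \<alpha>_apply[OF x(2)] dchart_inverse(2)[OF c(3) x(1)])
          qed
          then show ?thesis using smooth_on_cong[OF V1(1)] sm by (metis (no_types, lifting))
        qed
        then show ?thesis using c(3) U True by (intro exI[of _ c] exI[of _ U]) (auto simp: eq)
      next
        case False
        define d where "d = chart_at A q"
        have d: "q \<in> fst d" "adm d" using chart_at by (auto simp: d_def)
        have opK: "open (- K)" using compact_imp_closed[OF \<psi>(5)] by blast
        have op: "open (snd d ` (fst d \<inter> - K))" by (rule chart_image_open[OF adm_chart[OF d(2)] opK])
        have "smooth_on (snd d ` (fst d \<inter> - K)) (\<lambda>y. blinfun_apply (\<alpha> (chart_inv d y)) (dchart_inv A d (chart_inv d y) v))" for v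
          by (subst smooth_on_cong[OF op, of _ "\<lambda>y. 0"])
            (auto simp: chart_inv_left[OF adm_chart[OF d(2)]] \<alpha>0 intro: smooth_on_const[OF op])
        then show ?thesis using d opK False \<psi>(6) by (intro exI[of _ d] exI[of _ "- K"]) auto
      qed
    qed
    moreover have "compact_support \<alpha>" by (rule compact_supportI[OF \<psi>(5) \<alpha>0])
    moreover have "blinfun_apply (\<alpha> q) v = \<psi> q * (riesz q (s q) \<bullet> v)" if v: "v \<in> D q" for q v
    proof (cases "q \<in> U")
      case True
      then have q: "q \<in> fst c" "snd c q \<in> V1" by (auto simp: U_def)
      obtain a where a: "v = (\<Sum>j<rmax. a j *\<^sub>R X j q)"
        using v unfolding coframeD(3)[OF X True] by (rule in_span_familyE)
      have "dchart A c q v = (\<Sum>j<rmax. a j *\<^sub>R ?X j (snd c q))"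
        using dchart_linear(1)[OF c(3) q(1)] by (simp add: a linear_sum linear_scale local_rep_at[OF c(3) q(1)])
      then have "dchart A c q v \<bullet> \<beta> i (snd c q) = a i" if "i < rmax" for i
        using dual_family_coefficient[OF dual[OF q(2)] that, of a] by simp
      then have "blinfun_apply (\<alpha> q) v = \<psi> q * (\<Sum>i<rmax. g i q * a i)" by (simp add: \<alpha>_apply[OF True])
      also have "(\<Sum>i<rmax. g i q * a i) = riesz q (s q) \<bullet> v"
        by (simp add: a g_def inner_sum_right mult.commute)
      finally show ?thesis .
    next
      case False
      then have "q \<notin> K" using \<psi>(6) by blast
      then show ?thesis using \<alpha>0 \<psi>(8) by simp
    qed
    ultimately show ?thesis by blast
  qed
  then show ?thesis using \<psi>(1,2,3,7) by blast
qed

text \<open>Local lifts are patched over a finite cover of the support. On \<open>D\<close> each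
  patched form is a function times \<open>s\<close>; in place of a partition of unity, this function
  is raised to 1 on one more set at a time.\<close>

lemma sections_lift:
  assumes s: "s \<in> sections"
  shows "\<exists>\<alpha>. smooth_form A \<alpha> \<and> compact_support \<alpha> \<and> (\<forall>q. \<forall>v\<in>D q. blinfun_apply (\<alpha> q) v = riesz q (s q) \<bullet> v)"
proof -
  obtain V \<psi> where V: "\<And>p. open (V p)" "\<And>p. p \<in> V p" and \<psi>: "\<And>p. smooth_fun_on A UNIV (\<psi> p)" "\<And>p q. q \<in> V p \<Longrightarrow> \<psi> p q = (1::real)"
    and lift: "\<And>p. \<exists>\<alpha>. smooth_form A \<alpha> \<and> compact_support \<alpha> \<and> (\<forall>q. \<forall>v\<in>D q. blinfun_apply (\<alpha> q) v = \<psi> p q * (riesz q (s q) \<bullet> v))"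
  proof -
    have "\<forall>p. \<exists>V \<psi>. open V \<and> p \<in> V \<and> smooth_fun_on A UNIV \<psi> \<and> (\<forall>q\<in>V. \<psi> q = 1) \<and>
      (\<exists>\<alpha>. smooth_form A \<alpha> \<and> compact_support \<alpha> \<and> (\<forall>q. \<forall>v\<in>D q. blinfun_apply (\<alpha> q) v = \<psi> q * (riesz q (s q) \<bullet> v)))"
    proof
      fix p
      from local_lift[of p] obtain V \<psi> where V: "open V" "p \<in> V" "smooth_fun_on A UNIV \<psi>" "\<forall>q\<in>V. \<psi> q = 1"
        and lift: "\<forall>s\<in>sections. \<exists>\<alpha>. smooth_form A \<alpha> \<and> compact_support \<alpha> \<and>
          (\<forall>q. \<forall>v\<in>D q. blinfun_apply (\<alpha> q) v = \<psi> q * (riesz q (s q) \<bullet> v))"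
        by (elim exE conjE) (rule that)
      show "\<exists>V \<psi>. open V \<and> p \<in> V \<and> smooth_fun_on A UNIV \<psi> \<and> (\<forall>q\<in>V. \<psi> q = 1) \<and>
        (\<exists>\<alpha>. smooth_form A \<alpha> \<and> compact_support \<alpha> \<and> (\<forall>q. \<forall>v\<in>D q. blinfun_apply (\<alpha> q) v = \<psi> q * (riesz q (s q) \<bullet> v)))"
        by (rule exI[of _ V], rule exI[of _ \<psi>]) (intro conjI V bspec[OF lift s])
    qed
    from choice[OF this] obtain V where "\<forall>p. \<exists>\<psi>. open (V p) \<and> p \<in> V p \<and> smooth_fun_on A UNIV \<psi> \<and> (\<forall>q\<in>V p. \<psi> q = 1) \<and>
      (\<exists>\<alpha>. smooth_form A \<alpha> \<and> compact_support \<alpha> \<and> (\<forall>q. \<forall>v\<in>D q. blinfun_apply (\<alpha> q) v = \<psi> q * (riesz q (s q) \<bullet> v)))" ..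
    from choice[OF this] obtain \<psi> where "\<forall>p. open (V p) \<and> p \<in> V p \<and> smooth_fun_on A UNIV (\<psi> p) \<and> (\<forall>q\<in>V p. \<psi> p q = 1) \<and>
      (\<exists>\<alpha>. smooth_form A \<alpha> \<and> compact_support \<alpha> \<and> (\<forall>q. \<forall>v\<in>D q. blinfun_apply (\<alpha> q) v = \<psi> p q * (riesz q (s q) \<bullet> v)))" ..
    then show thesis by (intro that[of V \<psi>]) simp_all
  qed
  have "compact_support s" using s unfolding sections_iff by (elim conjE)
  then obtain K where K: "compact K" "\<And>p. p \<notin> K \<Longrightarrow> s p = 0"
    by (rule compact_supportE) (rule that; assumption)
  obtain F where F: "finite F" "K \<subseteq> (\<Union>p\<in>F. V p)"
  proof -
    have "K \<subseteq> \<Union> (range V)" using V(2) by blast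
    then obtain \<F> where "\<F> \<subseteq> range V" "finite \<F>" "K \<subseteq> \<Union> \<F>"
      by (rule compactE[OF K(1)]) (use V(1) in auto)
    then obtain F where "finite F" "\<F> = V ` F" using finite_subset_image[of \<F> V UNIV] by auto
    then show thesis using that[of F] \<open>K \<subseteq> \<Union> \<F>\<close> by simp
  qed
  have "\<exists>\<alpha> \<eta>. smooth_form A \<alpha> \<and> compact_support \<alpha> \<and> smooth_fun_on A UNIV \<eta> \<and> (\<forall>q\<in>(\<Union>p\<in>F. V p). \<eta> q = 1) \<and>
      (\<forall>q. \<forall>v\<in>D q. blinfun_apply (\<alpha> q) v = \<eta> q * (riesz q (s q) \<bullet> v))"
    using F(1)
  proof (induction F)
    case empty
    have "smooth_form A (\<lambda>_. 0)" unfolding smooth_form_def by (auto intro!: smooth_on_const chart_open adm_chart atlas_adm)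
    moreover have "compact_support (\<lambda>x :: 'a. (0 :: 'e \<Rightarrow>\<^sub>L real))" by (rule compact_supportI[of "{}"]) auto
    ultimately show ?case
      by (intro exI[of _ "\<lambda>_. 0"] exI[of _ "\<lambda>_. 0 :: real"]) (auto intro: smooth_fun_on_const)
  next
    case (insert p F)
    from insert.IH obtain \<alpha> \<eta> where \<alpha>: "smooth_form A \<alpha>" "compact_support \<alpha>" "smooth_fun_on A UNIV \<eta>"
      and \<eta>: "\<forall>q\<in>(\<Union>p\<in>F. V p). \<eta> q = 1" and \<alpha>\<eta>: "\<forall>q. \<forall>v\<in>D q. blinfun_apply (\<alpha> q) v = \<eta> q * (riesz q (s q) \<bullet> v)"
      by (elim exE conjE) (rule that)
    from lift[of p] obtain \<beta> where \<beta>: "smooth_form A \<beta>" "compact_support \<beta>"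
      and \<beta>\<psi>: "\<forall>q. \<forall>v\<in>D q. blinfun_apply (\<beta> q) v = \<psi> p q * (riesz q (s q) \<bullet> v)" by (elim exE conjE) (rule that)
    \<comment> \<open>\<open>1 - \<eta>'\<close> is the product of \<open>1 - \<eta>\<close> and
      \<open>1 - \<psi> p\<close>, so \<open>\<eta>'\<close> is 1 wherever \<open>\<eta>\<close> or
      \<open>\<psi> p\<close> is.\<close>
    define \<eta>' where "\<eta>' q = \<eta> q + (1 - \<eta> q) * \<psi> p q" for q
    define \<alpha>' where "\<alpha>' q = \<alpha> q + (1 - \<eta> q) *\<^sub>R \<beta> q" for q
    have 1: "smooth_fun_on A UNIV (\<lambda>q. 1 - \<eta> q)"
      by (intro smooth_fun_on_diff smooth_fun_on_const open_UNIV \<alpha>(3))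
    have "smooth_form A \<alpha>'"
      unfolding \<alpha>'_def by (intro smooth_form_add smooth_form_scale 1 \<alpha>(1) \<beta>(1))
    moreover have "compact_support \<alpha>'"
    proof -
      obtain K1 where "compact K1" "\<And>p. p \<notin> K1 \<Longrightarrow> \<alpha> p = 0"
        by (rule compact_supportE[OF \<alpha>(2)]) (rule that; assumption)
      moreover obtain K2 where "compact K2" "\<And>p. p \<notin> K2 \<Longrightarrow> \<beta> p = 0"
        by (rule compact_supportE[OF \<beta>(2)]) (rule that; assumption)
      ultimately
      show ?thesis by (intro compact_supportI[of "K1 \<union> K2"]) (auto simp: \<alpha>'_def)
    qed
    moreover have "smooth_fun_on A UNIV \<eta>'"
      unfolding \<eta>'_def by (intro smooth_fun_on_add smooth_fun_on_mult 1 \<alpha>(3) \<psi>(1) open_UNIV)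
    moreover have "\<eta>' q = 1" if "q \<in> (\<Union>p\<in>insert p F. V p)" for q
    proof (cases "q \<in> V p")
      case True
      then show ?thesis by (simp add: \<eta>'_def \<psi>(2))
    next
      case False
      then have "q \<in> (\<Union>p\<in>F. V p)" using that by simp
      then show ?thesis by (simp add: \<eta>'_def bspec[OF \<eta>])
    qed
    moreover have "blinfun_apply (\<alpha>' q) v = \<eta>' q * (riesz q (s q) \<bullet> v)" if "v \<in> D q" for q v
      unfolding \<alpha>'_def \<eta>'_def blinfun.add_left blinfun.scaleR_left bspec[OF spec[OF \<alpha>\<eta>] that] bspec[OF spec[OF \<beta>\<psi>] that]
      by (simp add: algebra_simps)
    ultimately show ?case by (intro exI[of _ \<alpha>'] exI[of _ \<eta>'] conjI ballI allI)
  qed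
  then obtain \<alpha> \<eta> where \<alpha>: "smooth_form A \<alpha>" "compact_support \<alpha>" and \<eta>: "\<forall>q\<in>(\<Union>p\<in>F. V p). \<eta> q = (1::real)"
    and \<alpha>\<eta>: "\<forall>q. \<forall>v\<in>D q. blinfun_apply (\<alpha> q) v = \<eta> q * (riesz q (s q) \<bullet> v)" by (elim exE conjE) (rule that)
  have "blinfun_apply (\<alpha> q) v = riesz q (s q) \<bullet> v" if v: "v \<in> D q" for q v
  proof (cases "q \<in> K")
    case True
    then have "q \<in> (\<Union>p\<in>F. V p)" using F(2) by (rule set_rev_mp)
    then have "\<eta> q = 1" by (rule bspec[OF \<eta>])
    then show ?thesis using bspec[OF spec[OF \<alpha>\<eta>] v] by simp
  next
    case False
    then show ?thesis using bspec[OF spec[OF \<alpha>\<eta>] v] K(2)[OF False] linear_0[OF riesz_linear] by simp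
  qed
  then show ?thesis by (intro exI[of _ \<alpha>] conjI \<alpha> allI ballI)
qed

text \<open>The image lies in the module because sections lift to forms; it is all of it because
  \<open>sharp\<close> cannot distinguish a form from its restriction to \<open>D\<close>.\<close>

lemma almost_regular: "almost_regular A \<pi>"
proof -
  have "module_iso A sections (sharp_module A \<pi>) sharp_dual"
    unfolding module_iso_def
  proof (intro conjI ballI allI impI)
    show "bij_betw sharp_dual sections (sharp_module A \<pi>)"
      unfolding bij_betw_def
    proof
      show "inj_on sharp_dual sections" using sharp_dual_injective by (auto intro: inj_onI)
      show "sharp_dual ` sections = sharp_module A \<pi>"
      proof
        show "sharp_dual ` sections \<subseteq> sharp_module A \<pi>"
        proof (rule image_subsetI)
          fix s assume "s \<in> sections"
          from sections_lift[OF this] obtain \<alpha> where \<alpha>: "smooth_form A \<alpha>" "compact_support \<alpha>"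
            and \<alpha>s: "\<forall>q. \<forall>v\<in>D q. blinfun_apply (\<alpha> q) v = riesz q (s q) \<bullet> v" by (elim exE conjE) (rule that)
          have "sharp_dual s q = sharp \<pi> q (\<alpha> q)" for q
            unfolding sharp_dual_def by (rule sharp_restrict) (simp add: bspec[OF spec[OF \<alpha>s]] inner_commute)
          then have "sharp_dual s = (\<lambda>q. sharp \<pi> q (\<alpha> q))" by (rule HOL.ext)
          then show "sharp_dual s \<in> sharp_module A \<pi>" unfolding sharp_module_def
            by (intro CollectI exI[of _ \<alpha>] conjI \<alpha>)
        qed
        show "sharp_module A \<pi> \<subseteq> sharp_dual ` sections"
        proof
          fix Y assume "Y \<in> sharp_module A \<pi>"
          then obtain \<alpha> where \<alpha>: "smooth_form A \<alpha>" "compact_support \<alpha>" "Y = (\<lambda>p. sharp \<pi> p (\<alpha> p))"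
            unfolding sharp_module_def by (elim CollectE exE conjE) (rule that)
          define s where "s p = restr (blinfun_apply (\<alpha> p)) p" for p
          have rs: "riesz p (s p) \<bullet> v = blinfun_apply (\<alpha> p) v" if "v \<in> D p" for p v
            unfolding s_def by (rule riesz_restr[OF bounded_linear.linear[OF blinfun.bounded_linear_right] that])
          have "compact_support s"
          proof -
            obtain K where K: "compact K" "\<And>p. p \<notin> K \<Longrightarrow> \<alpha> p = 0" by (rule compact_supportE[OF \<alpha>(2)]) (rule that; assumption)
            show ?thesis
              by (rule compact_supportI[OF K(1)]) (simp add: s_def restr_def K(2))
          qed
          moreover have "smooth_fun_on A U (\<lambda>p. riesz p (s p) \<bullet> X i p)" if X: "coframe U X b" and i: "i < rmax" for U X b i
            by (rule smooth_fun_on_cong[OF coframeD(1)[OF X] _ smooth_form_vf[OF \<alpha>(1) coframeD(2)[OF X i] coframeD(1)[OF X]]])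
              (simp add: rs coframe_mem[OF X _ i])
          moreover have "s p \<in> fibre" for p by (simp add: s_def restr_fibre)
          ultimately have "s \<in> sections" unfolding sections_iff by (intro conjI allI impI)
          moreover have "Y = sharp_dual s"
          proof
            fix p
            show "Y p = sharp_dual s p"
              unfolding \<alpha>(3) sharp_dual_def by (rule sharp_restrict) (simp add: rs[symmetric] inner_commute)
          qed
          ultimately show "Y \<in> sharp_dual ` sections" by blast
        qed
      qed
    qed
    have lin: "linear (\<lambda>s. sharp \<pi> p (blinfun_inner_left (riesz p s)))" for p
      by (rule linear_compose[unfolded comp_def, OF riesz_linear
            linear_compose[unfolded comp_def, OF bounded_linear.linear[OF bounded_linear_blinfun_inner_left] linear_sharp[of \<pi>, OF pi_wedge]]])
    show "sharp_dual (\<lambda>p. s p + t p) = (\<lambda>p. sharp_dual s p + sharp_dual t p)" for s t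
      by (rule ext) (simp add: sharp_dual_def linear_add[OF lin])
    show "sharp_dual (\<lambda>p. f p *\<^sub>R s p) = (\<lambda>p. f p *\<^sub>R sharp_dual s p)" for f s
      by (rule ext) (simp add: sharp_dual_def linear_scale[OF lin])
  qed
  then show ?thesis unfolding almost_regular_def using dual_bundle by blast
qed

end

section \<open>Generators of the module of an almost regular Poisson manifold\<close>

text \<open>
  The hypothesis \<open>rel\<close> excludes nontrivial relations with smooth coefficients on open sets, which is weaker
  than pointwise independence. If \<open>y m\<close> were in the span of \<open>y 0, \<dots>, y (m - 1)\<close> on an open set where
  these are independent, its coefficients would be smooth and give such a relation.
\<close>

lemma weakly_independent_dense:
  fixes y :: "nat \<Rightarrow> 'e::euclidean_space \<Rightarrow> 'b::euclidean_space"
  assumes y: "\<And>k. k < r \<Longrightarrow> smooth_on V (y k)"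
    and rel: "\<And>N h k z. open N \<Longrightarrow> N \<subseteq> V \<Longrightarrow> (\<And>k. k < r \<Longrightarrow> smooth_on N (h k)) \<Longrightarrow>
      (\<And>z. z \<in> N \<Longrightarrow> (\<Sum>k<r. h k z *\<^sub>R y k z) = 0) \<Longrightarrow> k < r \<Longrightarrow> z \<in> N \<Longrightarrow> h k z = 0"
    and m: "m \<le> r" and N: "open N" "N \<subseteq> V" "N \<noteq> {}"
  shows "\<exists>z\<in>N. dim ((\<lambda>i. y i z) ` {..<m}) = m"
  using m N
proof (induction m arbitrary: N)
  case 0
  then show ?case by auto
next
  case (Suc m)
  obtain z0 where z0: "z0 \<in> N" "dim ((\<lambda>i. y i z0) ` {..<m}) = m"
    using Suc.IH[OF _ Suc.prems(2,3,4)] Suc.prems(1) by auto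
  have sm: "smooth_on N (y i)" if "i < r" for i
    by (rule smooth_on_subset[OF y[OF that] Suc.prems(3)])
  have "\<exists>U. open U \<and> z0 \<in> U \<and> U \<subseteq> N \<and> (\<forall>z\<in>U. dim ((\<lambda>i. y i z) ` {..<m}) = m)"
    by (rule smooth_family_open[where X = y and k = m, OF Suc.prems(2) z0(1) _ z0(2)]) (use sm Suc.prems(1) in auto)
  then obtain U where U: "open U" "z0 \<in> U" "U \<subseteq> N" and dimU: "\<And>z. z \<in> U \<Longrightarrow> dim ((\<lambda>i. y i z) ` {..<m}) = m"
    by (elim exE conjE) (rule that, assumption+, erule bspec)
  show ?case
  proof (cases "\<exists>z\<in>U. y m z \<notin> span ((\<lambda>i. y i z) ` {..<m})")
    case True
    then obtain z where z: "z \<in> U" "y m z \<notin> span ((\<lambda>i. y i z) ` {..<m})" by blast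
    then have "dim ((\<lambda>i. y i z) ` {..<Suc m}) = Suc m"
      using dimU[OF z(1)] by (simp add: dim_family_Suc[of "\<lambda>i. y i z"])
    then show ?thesis using z(1) U(3) by blast
  next
    case False
    have "\<exists>g. y m z = (\<Sum>i<m. g i *\<^sub>R y i z)" if "z \<in> U" for z
      using False that span_family[of "\<lambda>i. y i z" m] by auto
    then obtain g where g: "\<And>z. z \<in> U \<Longrightarrow> y m z = (\<Sum>i<m. g z i *\<^sub>R y i z)" by metis
    \<comment> \<open>The dependence rewritten as a relation among all \<open>r\<close> fields; the
      coefficient -1 at index \<open>m\<close> contradicts the absence of relations.\<close>
    define h where "h i z = (if i < m then g z i else if i = m then -1 else 0)" for i z
    have "smooth_on U (h i)" for i
    proof -
      have "smooth_on U (\<lambda>z. g z i)" if "i < m"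
        by (rule smooth_coefficients[where X = y and Y = "y m" and g = "\<lambda>i z. g z i", OF U(1) _ dimU _ g that])
          (use sm Suc.prems(1) in \<open>auto intro!: smooth_on_subset[OF _ U(3)]\<close>)
      then show ?thesis unfolding h_def by (cases "i < m") (auto intro: smooth_on_const[OF U(1)])
    qed
    moreover have "(\<Sum>k<r. h k z *\<^sub>R y k z) = 0" if z: "z \<in> U" for z
    proof -
      have "(\<Sum>k<r. h k z *\<^sub>R y k z) = (\<Sum>k<Suc m. h k z *\<^sub>R y k z)"
        by (rule sum.mono_neutral_right) (use Suc.prems(1) in \<open>auto simp: h_def\<close>)
      also have "\<dots> = (\<Sum>k<m. g z k *\<^sub>R y k z) - y m z"
        by (simp add: h_def)
      finally show ?thesis using g[OF z] by simp
    qed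
    ultimately have "h m z0 = 0"
      by (intro rel[OF U(1) _ _ _ _ U(2), of h m]) (use U(3) Suc.prems(1,3) in auto)
    then show ?thesis by (simp add: h_def)
  qed
qed

context poisson
begin

text \<open>The field \<open>a\<close> is the coordinate expression of a form whose image under
  \<open>sharp\<close> is \<open>Y\<close>.\<close>

lemma sharp_module_chart:
  assumes c: "c \<in> A" and Y: "Y \<in> sharp_module A \<pi>"
  shows "\<exists>a. smooth_on (snd c ` fst c) a \<and> (\<forall>z\<in>snd c ` fst c. local_rep A c Y z = ham c (a z) z)"
proof -
  obtain \<alpha> where \<alpha>: "smooth_form A \<alpha>" "Y = (\<lambda>p. sharp \<pi> p (\<alpha> p))"
    using Y unfolding sharp_module_def by (elim CollectE exE conjE) (rule that)
  define a where "a z = (\<Sum>i\<in>Basis. blinfun_apply (\<alpha> (chart_inv c z)) (dchart_inv A c (chart_inv c z) i) *\<^sub>R i)" for z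
  have op: "open (snd c ` fst c)" by (rule chart_open(2)[OF adm_chart[OF atlas_adm[OF c]]])
  have "smooth_on (snd c ` fst c) a"
    unfolding a_def
    by (intro smooth_on_sum[OF op] smooth_on_linear_compose[OF bounded_linear_scaleR_left op] smooth_form_chart[OF \<alpha>(1) c])
  moreover have "local_rep A c Y z = ham c (a z) z" if z: "z \<in> snd c ` fst c" for z
    unfolding local_rep_def ham_def a_def \<alpha>(2)
    by (simp only: cov_surj[OF atlas_adm[OF c] chart_inv_mem[OF z], symmetric])
  ultimately show ?thesis by blast
qed

lemma ham_smooth_field:
  assumes c: "c \<in> A" and V: "open V" "V \<subseteq> snd c ` fst c" and a: "smooth_on V a"
  shows "smooth_on V (\<lambda>z. ham c (a z) z)"
  by (rule smooth_on_apply_linear[OF V(1) a ham_linear[OF atlas_adm[OF c]] smooth_on_subset[OF ham_smooth[OF c] V(2)]])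
    (use V(2) in blast)

text \<open>The module consists of images of compactly supported forms, so coordinate differentials
  enter it after a cut-off.\<close>

lemma local_coordinate_form:
  assumes c: "c \<in> A" "p \<in> fst c"
  shows "\<exists>\<alpha> V. smooth_form A \<alpha> \<and> compact_support \<alpha> \<and> open V \<and> p \<in> V \<and> V \<subseteq> fst c \<and> (\<forall>q\<in>V. \<alpha> q = cov c q u)"
proof -
  have ac: "adm c" and ch: "is_chart c" using c atlas_adm adm_chart by auto
  obtain \<psi> V K where \<psi>: "smooth_fun_on A UNIV \<psi>" "open V" "p \<in> V" "V \<subseteq> K" "compact K" "K \<subseteq> fst c"
    "\<And>q. q \<in> V \<Longrightarrow> \<psi> q = 1" "\<And>q. q \<notin> K \<Longrightarrow> \<psi> q = 0"
    by (rule manifold_bump[OF chart_open(1)[OF ch] c(2)]) (rule that; assumption)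
  define \<alpha> where "\<alpha> q = \<psi> q *\<^sub>R cov c q u" for q
  have \<alpha>0: "\<alpha> q = 0" if "q \<notin> K" for q using \<psi>(8)[OF that] by (simp add: \<alpha>_def)
  have "smooth_form A \<alpha>"
  proof (rule smooth_formI)
    fix q
    show "\<exists>d V. adm d \<and> open V \<and> q \<in> V \<and> q \<in> fst d \<and>
      (\<forall>v. smooth_on (snd d ` (fst d \<inter> V)) (\<lambda>y. blinfun_apply (\<alpha> (chart_inv d y)) (dchart_inv A d (chart_inv d y) v)))"
    proof (cases "q \<in> fst c")
      case True
      have op: "open (snd c ` (fst c \<inter> UNIV))" using chart_open(2)[OF ch] by simp
      have "smooth_on (snd c ` (fst c \<inter> UNIV)) (\<lambda>y. blinfun_apply (\<alpha> (chart_inv c y)) (dchart_inv A c (chart_inv c y) v))" for v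
      proof (subst smooth_on_cong[OF op, of _ "\<lambda>y. \<psi> (chart_inv c y) * (v \<bullet> u)"])
        fix y assume "y \<in> snd c ` (fst c \<inter> UNIV)"
        then have "chart_inv c y \<in> fst c" using chart_inv_mem[of y c] by simp
        then show "blinfun_apply (\<alpha> (chart_inv c y)) (dchart_inv A c (chart_inv c y) v) = \<psi> (chart_inv c y) * (v \<bullet> u)"
          by (simp add: \<alpha>_def blinfun.scaleR_left cov_apply[OF ac] dchart_inverse(2)[OF ac])
      next
        show "smooth_on (snd c ` (fst c \<inter> UNIV)) (\<lambda>y. \<psi> (chart_inv c y) * (v \<bullet> u))"
          by (rule smooth_on_mult[OF op smooth_fun_on_chart[OF \<psi>(1) open_UNIV ac] smooth_on_const[OF op]])
      qed
      then show ?thesis using ac True by (intro exI[of _ c] exI[of _ UNIV] conjI allI) auto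
    next
      case False
      define d where "d = chart_at A q"
      have d: "q \<in> fst d" "adm d" using chart_at by (auto simp: d_def)
      have opK: "open (- K)" using compact_imp_closed[OF \<psi>(5)] by (simp add: open_Compl)
      have op: "open (snd d ` (fst d \<inter> - K))" by (rule chart_image_open[OF adm_chart[OF d(2)] opK])
      have "smooth_on (snd d ` (fst d \<inter> - K)) (\<lambda>y. blinfun_apply (\<alpha> (chart_inv d y)) (dchart_inv A d (chart_inv d y) v))" for v
        by (subst smooth_on_cong[OF op, of _ "\<lambda>y. 0"])
          (auto simp: chart_inv_left[OF adm_chart[OF d(2)]] \<alpha>0 intro: smooth_on_const[OF op])
      then show ?thesis using d opK False \<psi>(6) by (intro exI[of _ d] exI[of _ "- K"]) auto
    qed
  qed
  moreover have "compact_support \<alpha>" by (rule compact_supportI[OF \<psi>(5) \<alpha>0])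
  moreover have "\<alpha> q = cov c q u" if "q \<in> V" for q by (simp add: \<alpha>_def \<psi>(7)[OF that])
  moreover have "V \<subseteq> fst c" using \<psi>(4,6) by (rule subset_trans)
  ultimately show ?thesis using \<psi>(2,3) by (intro exI[of _ \<alpha>] exI[of _ V] conjI ballI)
qed

end

section \<open>The module of sections and its image under the isomorphism\<close>

locale regular_module = poisson A \<pi>
  for A :: "('a::{t2_space, second_countable_topology}, 'e::euclidean_space) chart set"
    and \<pi> :: "'a \<Rightarrow> 'e biform" +
  fixes r :: nat and E :: "'a \<Rightarrow> 'v::real_vector set" and T and \<Phi>
  assumes trivialised: "vector_bundle A r E T"
    and iso: "module_iso A (compact_sections A r E T) (sharp_module A \<pi>) \<Phi>"
begin

abbreviation "bundle_sections \<equiv> compact_sections A r E T"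

lemma trivialisation:
  assumes "(U, b) \<in> T"
  shows "open U" "p \<in> U \<Longrightarrow> inj_on (b p) {..<r}" "p \<in> U \<Longrightarrow> independent (b p ` {..<r})"
    "p \<in> U \<Longrightarrow> span (b p ` {..<r}) = E p"
  using assms trivialised unfolding vector_bundle_def by blast+

lemma trivialisation_change:
  assumes "(U, b) \<in> T" "(U', b') \<in> T" "j < r"
  shows "smooth_combination_on A r (U \<inter> U') b (\<lambda>p. b' p j)"
proof -
  have "\<forall>(U, b)\<in>T. \<forall>(U', b')\<in>T. \<forall>j<r. smooth_combination_on A r (U \<inter> U') b (\<lambda>p. b' p j)"
    using trivialised unfolding vector_bundle_def by (elim conjE)
  from bspec[OF this assms(1)] have "\<forall>(U', b')\<in>T. \<forall>j<r. smooth_combination_on A r (U \<inter> U') b (\<lambda>p. b' p j)"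
    by simp
  from bspec[OF this assms(2)] show ?thesis using assms(3) by simp
qed

lemma trivialisation_exists: "\<exists>U b. (U, b) \<in> T \<and> p \<in> U"
  using trivialised unfolding vector_bundle_def by blast

lemma fibre_subspace: "subspace (E p)"
  using trivialisation_exists[of p] trivialisation(4) subspace_span by metis

lemma trivialisation_unique:
  assumes "(U, b) \<in> T" "p \<in> U" "(\<Sum>i<r. g i *\<^sub>R b p i) = 0" "i < r"
  shows "g i = 0"
proof -
  note b = trivialisation[OF assms(1)]
  have "(\<Sum>v\<in>b p ` {..<r}. g (the_inv_into {..<r} (b p) v) *\<^sub>R v) = 0"
    unfolding sum.reindex[OF b(2)[OF assms(2)]] o_def
    using assms(3) by (simp add: the_inv_into_f_f[OF b(2)[OF assms(2)]])
  then have "g (the_inv_into {..<r} (b p) (b p i)) = 0"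
    using independentD[OF b(3)[OF assms(2)], of "b p ` {..<r}" "\<lambda>v. g (the_inv_into {..<r} (b p) v)" "b p i"] assms(4) by simp
  then show ?thesis using the_inv_into_f_f[OF b(2)[OF assms(2)]] assms(4) by simp
qed

lemma section_combination:
  assumes "s \<in> bundle_sections" "(U, b) \<in> T"
  obtains g where "\<And>i. i < r \<Longrightarrow> smooth_fun_on A U (g i)" "\<And>p. p \<in> U \<Longrightarrow> s p = (\<Sum>i<r. g i p *\<^sub>R b p i)"
proof -
  have "smooth_combination_on A r U b s" using assms unfolding compact_sections_def by blast
  then show thesis unfolding smooth_combination_on_def by (elim exE conjE) (rule that; simp)
qed

lemma section_zero: "(\<lambda>p. 0) \<in> bundle_sections"
  unfolding compact_sections_def smooth_combination_on_def
proof (intro CollectI conjI allI ballI)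
  show "0 \<in> E p" for p by (rule subspace_0[OF fibre_subspace])
  show "compact_support (\<lambda>p :: 'a. 0 :: 'v)" by (rule compact_supportI[of "{}"]) auto
  show "case x of (U, b) \<Rightarrow> \<exists>g. (\<forall>i<r. smooth_fun_on A U (g i)) \<and> (\<forall>p\<in>U. 0 = (\<Sum>i<r. g i p *\<^sub>R b p i))"
    if "x \<in> T" for x
  proof (cases x)
    case (Pair U b)
    have "\<exists>g. (\<forall>i<r. smooth_fun_on A U (g i)) \<and> (\<forall>p\<in>U. 0 = (\<Sum>i<r. g i p *\<^sub>R b p i))"
      by (rule exI[of _ "\<lambda>i p. 0"]) (use trivialisation(1) that Pair in \<open>auto intro: smooth_fun_on_const\<close>)
    then show ?thesis using Pair by simp
  qed
qed

lemma section_add: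
  assumes s: "s \<in> bundle_sections" and t: "t \<in> bundle_sections"
  shows "(\<lambda>p. s p + t p) \<in> bundle_sections"
  unfolding compact_sections_def smooth_combination_on_def
proof (intro CollectI conjI allI ballI)
  show "s p + t p \<in> E p" for p
    using s t by (intro subspace_add[OF fibre_subspace]) (auto simp: compact_sections_def)
  have "compact_support s" "compact_support t" using s t by (auto simp: compact_sections_def)
  then obtain K where K: "compact K" "\<And>p. p \<notin> K \<Longrightarrow> s p = 0" by (elim compact_supportE[of s]) (rule that; assumption)
  obtain K' where K': "compact K'" "\<And>p. p \<notin> K' \<Longrightarrow> t p = 0"
    by (rule compact_supportE[OF \<open>compact_support t\<close>]) (rule that; assumption)
  show "compact_support (\<lambda>p. s p + t p)"
    by (rule compact_supportI[OF compact_Un[OF K(1) K'(1)]]) (simp add: K K')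
  show "case x of (U, b) \<Rightarrow> \<exists>g. (\<forall>i<r. smooth_fun_on A U (g i)) \<and> (\<forall>p\<in>U. s p + t p = (\<Sum>i<r. g i p *\<^sub>R b p i))"
    if "x \<in> T" for x
  proof (cases x)
    case (Pair U b)
    then have Ub: "(U, b) \<in> T" using that by simp
    obtain g where g: "\<And>i. i < r \<Longrightarrow> smooth_fun_on A U (g i)" "\<And>p. p \<in> U \<Longrightarrow> s p = (\<Sum>i<r. g i p *\<^sub>R b p i)"
      by (rule section_combination[OF s Ub]) (rule that; assumption)
    obtain h where h: "\<And>i. i < r \<Longrightarrow> smooth_fun_on A U (h i)" "\<And>p. p \<in> U \<Longrightarrow> t p = (\<Sum>i<r. h i p *\<^sub>R b p i)"
      by (rule section_combination[OF t Ub]) (rule that; assumption)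
    have "\<exists>g. (\<forall>i<r. smooth_fun_on A U (g i)) \<and> (\<forall>p\<in>U. s p + t p = (\<Sum>i<r. g i p *\<^sub>R b p i))"
      by (rule exI[of _ "\<lambda>i p. g i p + h i p"])
        (simp add: g h smooth_fun_on_add[OF trivialisation(1)[OF Ub]] scaleR_add_left sum.distrib)
    then show ?thesis using Pair by simp
  qed
qed

lemma section_scale:
  assumes f: "smooth_fun_on A UNIV f" and s: "s \<in> bundle_sections"
  shows "(\<lambda>p. f p *\<^sub>R s p) \<in> bundle_sections"
  unfolding compact_sections_def smooth_combination_on_def
proof (intro CollectI conjI allI ballI)
  show "f p *\<^sub>R s p \<in> E p" for p
    using s by (intro subspace_scale[OF fibre_subspace]) (auto simp: compact_sections_def)
  have "compact_support s" using s by (auto simp: compact_sections_def)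
  then obtain K where K: "compact K" "\<And>p. p \<notin> K \<Longrightarrow> s p = 0" by (elim compact_supportE[of s]) (rule that; assumption)
  show "compact_support (\<lambda>p. f p *\<^sub>R s p)"
    by (rule compact_supportI[OF K(1)]) (simp add: K)
  show "case x of (U, b) \<Rightarrow> \<exists>g. (\<forall>i<r. smooth_fun_on A U (g i)) \<and> (\<forall>p\<in>U. f p *\<^sub>R s p = (\<Sum>i<r. g i p *\<^sub>R b p i))"
    if "x \<in> T" for x
  proof (cases x)
    case (Pair U b)
    then have Ub: "(U, b) \<in> T" using that by simp
    obtain g where g: "\<And>i. i < r \<Longrightarrow> smooth_fun_on A U (g i)" "\<And>p. p \<in> U \<Longrightarrow> s p = (\<Sum>i<r. g i p *\<^sub>R b p i)"
      by (rule section_combination[OF s Ub]) (rule that; assumption)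
    have "\<exists>g. (\<forall>i<r. smooth_fun_on A U (g i)) \<and> (\<forall>p\<in>U. f p *\<^sub>R s p = (\<Sum>i<r. g i p *\<^sub>R b p i))"
      by (rule exI[of _ "\<lambda>i p. f p * g i p"])
        (simp add: g smooth_fun_on_mult[OF trivialisation(1)[OF Ub] smooth_fun_on_subset[OF f subset_UNIV]] scaleR_sum_right)
    then show ?thesis using Pair by simp
  qed
qed

lemma iso_add: "s \<in> bundle_sections \<Longrightarrow> t \<in> bundle_sections \<Longrightarrow> \<Phi> (\<lambda>p. s p + t p) = (\<lambda>p. \<Phi> s p + \<Phi> t p)"
  using iso unfolding module_iso_def by blast

lemma iso_scale: "s \<in> bundle_sections \<Longrightarrow> smooth_fun_on A UNIV f \<Longrightarrow> \<Phi> (\<lambda>p. f p *\<^sub>R s p) = (\<lambda>p. f p *\<^sub>R \<Phi> s p)"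
  using iso unfolding module_iso_def by blast

lemma iso_zero: "\<Phi> (\<lambda>p. 0) = (\<lambda>p. 0)"
  using iso_scale[OF section_zero smooth_fun_on_const[OF open_UNIV, of 0]] by simp

lemma iso_bij: "bij_betw \<Phi> bundle_sections (sharp_module A \<pi>)"
  using iso unfolding module_iso_def by blast

lemma iso_combination:
  assumes "\<And>i. i < k \<Longrightarrow> s i \<in> bundle_sections" "\<And>i. i < k \<Longrightarrow> smooth_fun_on A UNIV (h i)"
  shows "(\<lambda>p. \<Sum>i<k. h i p *\<^sub>R s i p) \<in> bundle_sections \<and>
    \<Phi> (\<lambda>p. \<Sum>i<k. h i p *\<^sub>R s i p) = (\<lambda>p. \<Sum>i<k::nat. h i p *\<^sub>R \<Phi> (s i) p)"
  using assms
proof (induction k)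
  case 0
  then show ?case by (simp add: section_zero iso_zero)
next
  case (Suc k)
  then have IH: "(\<lambda>p. \<Sum>i<k. h i p *\<^sub>R s i p) \<in> bundle_sections"
      "\<Phi> (\<lambda>p. \<Sum>i<k. h i p *\<^sub>R s i p) = (\<lambda>p. \<Sum>i<k. h i p *\<^sub>R \<Phi> (s i) p)" by simp_all
  have hs: "(\<lambda>p. h k p *\<^sub>R s k p) \<in> bundle_sections" by (rule section_scale) (use Suc.prems in auto)
  show ?case
    using section_add[OF IH(1) hs] iso_add[OF IH(1) hs] iso_scale[of "s k" "h k"] Suc.prems by (simp add: IH(2))
qed

text \<open>The frame of a trivialisation is cut off to global sections and mapped by
  \<open>\<Phi>\<close>. Since \<open>\<Phi>\<close> is linear over functions on the whole manifold,
  all coefficients are global; an element \<open>Z\<close> is recovered only on a neighbourhood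
  \<open>W\<close> that depends on it.\<close>

lemma local_generators:
  fixes p0 :: 'a
  shows "\<exists>V Y. open V \<and> p0 \<in> V \<and> (\<forall>i<r. Y i \<in> sharp_module A \<pi>) \<and>
    (\<forall>Z\<in>sharp_module A \<pi>. \<exists>W g. open W \<and> p0 \<in> W \<and> (\<forall>i<r. smooth_fun_on A UNIV (g i)) \<and>
       (\<forall>q\<in>W. Z q = (\<Sum>i<r. g i q *\<^sub>R Y i q))) \<and>
    (\<forall>h. (\<forall>i<r. smooth_fun_on A UNIV (h i)) \<and> (\<forall>q. (\<Sum>i<r. h i q *\<^sub>R Y i q) = 0) \<longrightarrow> (\<forall>i<r. \<forall>q\<in>V. h i q = 0))"
proof -
  obtain U b where Ub: "(U, b) \<in> T" "p0 \<in> U" using trivialisation_exists by blast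
  note U = trivialisation(1)[OF Ub(1)]
  obtain \<psi> V K where \<psi>: "smooth_fun_on A UNIV \<psi>" "open V" "p0 \<in> V" "V \<subseteq> K" "compact K" "K \<subseteq> U"
    "\<And>q. q \<in> V \<Longrightarrow> \<psi> q = 1" "\<And>q. q \<notin> K \<Longrightarrow> \<psi> q = 0"
    by (rule manifold_bump[OF U Ub(2)]) (rule that; assumption)
  define \<sigma> where "\<sigma> i q = (if q \<in> U then \<psi> q *\<^sub>R b q i else 0)" for i q
  have \<sigma>V: "\<sigma> i q = b q i" if "q \<in> V" for i q
  proof -
    have "q \<in> U" using that \<psi>(4,6) by blast
    then show ?thesis by (simp add: \<sigma>_def \<psi>(7)[OF that])
  qed
  have \<sigma>: "\<sigma> i \<in> bundle_sections" if i: "i < r" for i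
    unfolding compact_sections_def smooth_combination_on_def
  proof (intro CollectI conjI allI ballI)
    fix p
    show "\<sigma> i p \<in> E p"
    proof (cases "p \<in> U")
      case True
      have "b p i \<in> E p"
        unfolding trivialisation(4)[OF Ub(1) True, symmetric] by (rule span_base) (use i in simp)
      then show ?thesis using True by (simp add: \<sigma>_def subspace_scale[OF fibre_subspace])
    next
      case False
      then show ?thesis by (simp add: \<sigma>_def subspace_0[OF fibre_subspace])
    qed
  next
    show "compact_support (\<sigma> i)"
      by (rule compact_supportI[OF \<psi>(5)]) (simp add: \<sigma>_def \<psi>(8))
  next
    fix x assume x: "x \<in> T"
    show "case x of (U, b) \<Rightarrow> \<exists>g. (\<forall>i<r. smooth_fun_on A U (g i)) \<and> (\<forall>p\<in>U. \<sigma> i p = (\<Sum>i<r. g i p *\<^sub>R b p i))"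
    proof (cases x)
      case (Pair U' b')
      then have Ub': "(U', b') \<in> T" using x by simp
      note U' = trivialisation(1)[OF Ub']
      have "smooth_combination_on A r (U' \<inter> U) b' (\<lambda>p. b p i)"
        by (rule trivialisation_change[OF Ub' Ub(1) i])
      then obtain f where f: "\<forall>j<r. smooth_fun_on A (U' \<inter> U) (f j)" "\<forall>p\<in>U' \<inter> U. b p i = (\<Sum>j<r. f j p *\<^sub>R b' p j)"
        unfolding smooth_combination_on_def by (elim exE conjE) (rule that)
      define g where "g j q = (if q \<in> U then \<psi> q * f j q else 0)" for j q
      have "smooth_fun_on A U' (g j)" if j: "j < r" for j
      proof (rule smooth_fun_on_local)
        fix q assume q: "q \<in> U'"
        show "\<exists>V. open V \<and> q \<in> V \<and> smooth_fun_on A V (g j)"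
        proof (cases "q \<in> U")
          case True
          have op: "open (U' \<inter> U)" using U U' by (rule open_Int[rotated])
          have "smooth_fun_on A (U' \<inter> U) (g j)"
            by (rule smooth_fun_on_cong[OF op _ smooth_fun_on_mult[OF op smooth_fun_on_subset[OF \<psi>(1) subset_UNIV] f(1)[rule_format, OF j]]])
              (simp add: g_def)
          then show ?thesis using op q True by blast
        next
          case False
          have op: "open (- K)" using compact_imp_closed[OF \<psi>(5)] by (simp add: open_Compl)
          have "smooth_fun_on A (- K) (g j)"
            by (rule smooth_fun_on_cong[OF op _ smooth_fun_on_const[OF op, of 0]]) (simp add: g_def \<psi>(8))
          then show ?thesis using op False \<psi>(6) by blast
        qed
      qed
      moreover have "\<sigma> i p = (\<Sum>j<r. g j p *\<^sub>R b' p j)" if "p \<in> U'" for p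
        using f(2) that by (auto simp: \<sigma>_def g_def scaleR_sum_right)
      ultimately show ?thesis using Pair by auto
    qed
  qed
  have span: "\<exists>W g. open W \<and> p0 \<in> W \<and> (\<forall>i<r. smooth_fun_on A UNIV (g i)) \<and> (\<forall>q\<in>W. Z q = (\<Sum>i<r. g i q *\<^sub>R \<Phi> (\<sigma> i) q))"
    if Z: "Z \<in> sharp_module A \<pi>" for Z
  proof -
    obtain \<tau> where \<tau>: "\<tau> \<in> bundle_sections" "Z = \<Phi> \<tau>"
      using Z iso_bij unfolding bij_betw_def by blast
    obtain g where g: "\<And>i. i < r \<Longrightarrow> smooth_fun_on A U (g i)" "\<And>p. p \<in> U \<Longrightarrow> \<tau> p = (\<Sum>i<r. g i p *\<^sub>R b p i)"
      by (rule section_combination[OF \<tau>(1) Ub(1)]) (rule that; assumption)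
    \<comment> \<open>This second cut-off, supported where the \<open>\<sigma> i\<close> equal the
      frame, turns \<open>\<tau>\<close> into a global combination of them, to which
      \<open>\<Phi>\<close> applies; on \<open>W\<close> the factor \<open>\<rho>\<close> disappears
      again.\<close>
    obtain \<rho> W L where \<rho>: "smooth_fun_on A UNIV \<rho>" "open W" "p0 \<in> W" "W \<subseteq> L" "compact L" "L \<subseteq> V"
      "\<And>q. q \<in> W \<Longrightarrow> \<rho> q = 1" "\<And>q. q \<notin> L \<Longrightarrow> \<rho> q = 0"
      by (rule manifold_bump[OF \<psi>(2,3)]) (rule that; assumption)
    have LU: "L \<subseteq> U" using \<rho>(6) \<psi>(4,6) by blast
    define h where "h i q = \<rho> q * g i q" for i q
    have h: "smooth_fun_on A UNIV (h i)" if "i < r" for i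
      unfolding h_def by (rule smooth_fun_on_bump_mult[OF \<rho>(1) compact_imp_closed[OF \<rho>(5)] LU U \<rho>(8) g(1)[OF that]])
    have "(\<lambda>q. \<rho> q *\<^sub>R \<tau> q) = (\<lambda>q. \<Sum>i<r. h i q *\<^sub>R \<sigma> i q)"
    proof (rule HOL.ext)
      fix q
      show "\<rho> q *\<^sub>R \<tau> q = (\<Sum>i<r. h i q *\<^sub>R \<sigma> i q)"
      proof (cases "q \<in> L")
        case True
        then have "q \<in> U" "q \<in> V" using LU \<rho>(6) by auto
        then show ?thesis by (simp add: h_def g(2) \<sigma>V scaleR_sum_right)
      next
        case False
        then show ?thesis by (simp add: h_def \<rho>(8))
      qed
    qed
    then have "(\<lambda>q. \<rho> q *\<^sub>R Z q) = (\<lambda>q. \<Sum>i<r. h i q *\<^sub>R \<Phi> (\<sigma> i) q)"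
      using iso_scale[OF \<tau>(1) \<rho>(1)] iso_combination[of r \<sigma> h, OF \<sigma> h] \<tau>(2) by simp
    then have "\<rho> q *\<^sub>R Z q = (\<Sum>i<r. h i q *\<^sub>R \<Phi> (\<sigma> i) q)" for q by (rule fun_cong)
    then have "Z q = (\<Sum>i<r. h i q *\<^sub>R \<Phi> (\<sigma> i) q)" if "q \<in> W" for q
      using \<rho>(7)[OF that] by (metis scaleR_one)
    then show ?thesis by (intro exI[of _ W] exI[of _ h] conjI \<rho>(2,3) allI impI ballI h)
  qed
  \<comment> \<open>By injectivity, a relation between the images comes from one between the
    \<open>\<sigma> i\<close>, and on \<open>V\<close> these are the independent frame.\<close>
  have indep: "h i q = 0" if h: "\<forall>i<r. smooth_fun_on A UNIV (h i)" "\<forall>q. (\<Sum>i<r. h i q *\<^sub>R \<Phi> (\<sigma> i) q) = 0" and i: "i < r" and q: "q \<in> V" for h i q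
  proof -
    have "\<Phi> (\<lambda>q. \<Sum>i<r. h i q *\<^sub>R \<sigma> i q) = \<Phi> (\<lambda>q. 0)" and *: "(\<lambda>q. \<Sum>i<r. h i q *\<^sub>R \<sigma> i q) \<in> bundle_sections"
      using iso_combination[of r \<sigma> h, OF \<sigma>] h by (simp_all add: iso_zero)
    then have "(\<lambda>q. \<Sum>i<r. h i q *\<^sub>R \<sigma> i q) = (\<lambda>q. 0)"
      using inj_onD[OF bij_betw_imp_inj_on[OF iso_bij] _ * section_zero] by simp
    from fun_cong[OF this, of q] have "(\<Sum>i<r. h i q *\<^sub>R b q i) = 0" by (simp add: \<sigma>V[OF q])
    moreover have "q \<in> U" using q \<psi>(4,6) by blast
    ultimately show ?thesis using trivialisation_unique[OF Ub(1) _ _ i, of q "\<lambda>i. h i q"] by simp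
  qed
  have "\<Phi> (\<sigma> i) \<in> sharp_module A \<pi>" if "i < r" for i
    using \<sigma>[OF that] iso_bij unfolding bij_betw_def by blast
  then show ?thesis
    by (intro exI[of _ V], intro exI[of _ "\<lambda>i. \<Phi> (\<sigma> i)"])
      (intro conjI allI impI ballI \<psi>(2,3); (erule span | erule conjE, rule indep; assumption | assumption))
qed

text \<open>A bump function at the point in question makes a local relation global without changing
  its coefficients there.\<close>

lemma local_relation:
  assumes c: "c \<in> A" and N: "open N" "N \<subseteq> snd c ` (fst c \<inter> V)"
    and rel: "\<And>h. (\<forall>i<r. smooth_fun_on A UNIV (h i)) \<and> (\<forall>q. (\<Sum>i<r. h i q *\<^sub>R Y i q) = 0) \<longrightarrow> (\<forall>i<r. \<forall>q\<in>V. h i q = 0)"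
    and h: "\<And>k. k < r \<Longrightarrow> smooth_on N (h k)" "\<And>z. z \<in> N \<Longrightarrow> (\<Sum>k<r. h k z *\<^sub>R local_rep A c (Y k) z) = 0"
    and k: "k < r" and z: "z \<in> N"
  shows "h k z = 0"
proof -
  have ac: "adm c" and ch: "is_chart c" using c atlas_adm adm_chart by auto
  define U where "U = {q \<in> fst c. snd c q \<in> N}"
  have U: "open U" "U \<subseteq> fst c" unfolding U_def using chart_preimage_open[OF ch N(1)] by auto
  obtain p where p: "p \<in> fst c" "p \<in> V" "z = snd c p" using z N(2) by blast
  have pU: "p \<in> U" using p z by (simp add: U_def)
  obtain \<psi> W K where \<psi>: "smooth_fun_on A UNIV \<psi>" "open W" "p \<in> W" "W \<subseteq> K" "compact K" "K \<subseteq> U"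
    "\<And>q. q \<in> W \<Longrightarrow> \<psi> q = 1" "\<And>q. q \<notin> K \<Longrightarrow> \<psi> q = 0"
    by (rule manifold_bump[OF U(1) pU]) (rule that; assumption)
  have eq: "snd c ` (fst c \<inter> U) = N" using N(2) by (auto simp: U_def)
  have hU: "smooth_fun_on A U (\<lambda>q. h k (snd c q))" if "k < r" for k
  proof (rule smooth_fun_onI)
    fix q assume q: "q \<in> U"
    have "smooth_on (snd c ` (fst c \<inter> U)) (\<lambda>y. h k (snd c (chart_inv c y)))"
      unfolding eq
    proof (subst smooth_on_cong[OF N(1), of _ "h k"])
      show "h k (snd c (chart_inv c y)) = h k y" if "y \<in> N" for y
        using chart_inv_right[of y c] that N(2) by auto
    qed (rule h(1)[OF that])
    then show "\<exists>d V. adm d \<and> open V \<and> q \<in> V \<and> q \<in> fst d \<and> smooth_on (snd d ` (fst d \<inter> V)) (\<lambda>y. h k (snd c (chart_inv d y)))"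
      using ac U q by (intro exI[of _ c] exI[of _ U]) auto
  qed
  define H where "H k q = \<psi> q * h k (snd c q)" for k q
  have "smooth_fun_on A UNIV (H k)" if "k < r" for k
    unfolding H_def by (rule smooth_fun_on_bump_mult[OF \<psi>(1) compact_imp_closed[OF \<psi>(5)] \<psi>(6) U(1) \<psi>(8) hU[OF that]])
  moreover have "(\<Sum>k<r. H k q *\<^sub>R Y k q) = 0" for q
  proof (cases "q \<in> U")
    case True
    then have q: "q \<in> fst c" "snd c q \<in> N" by (auto simp: U_def)
    have "dchart A c q (\<Sum>k<r. h k (snd c q) *\<^sub>R Y k q) = 0"
      using h(2)[OF q(2)] dchart_linear(1)[OF ac q(1)]
      by (simp add: linear_sum linear_scale local_rep_at[OF ac q(1)])
    then have "(\<Sum>k<r. h k (snd c q) *\<^sub>R Y k q) = 0"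
      using dchart_inverse(1)[OF ac q(1), of "\<Sum>k<r. h k (snd c q) *\<^sub>R Y k q"] linear_0[OF dchart_linear(2)[OF ac q(1)]] by simp
    then show ?thesis by (simp add: H_def scaleR_scaleR[symmetric] scaleR_sum_right[symmetric] del: scaleR_scaleR)
  next
    case False
    then have "q \<notin> K" using \<psi>(6) by blast
    then show ?thesis by (simp add: H_def \<psi>(8))
  qed
  ultimately have "H k p = 0" using rel[of H] k p(2) by blast
  then show ?thesis using \<psi>(7)[OF \<psi>(3)] p(3) by (simp add: H_def)
qed

text \<open>The Hamiltonian field of a coordinate agrees near \<open>p0\<close> with an element of
  the module.\<close>

lemma coordinate_field_expansion:
  assumes c: "c \<in> A" "p0 \<in> fst c"
    and span: "\<And>Z. Z \<in> sharp_module A \<pi> \<Longrightarrow> \<exists>W g. open W \<and> p0 \<in> W \<and> (\<forall>i<r. smooth_fun_on A UNIV (g i)) \<and>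
       (\<forall>q\<in>W. Z q = (\<Sum>i<r. g i q *\<^sub>R Y i q))"
  shows "\<exists>W g. open W \<and> p0 \<in> W \<and> W \<subseteq> fst c \<and> (\<forall>i<r. smooth_fun_on A UNIV (g i)) \<and>
       (\<forall>q\<in>W. sharp \<pi> q (cov c q u) = (\<Sum>i<r. g i q *\<^sub>R Y i q))"
proof -
  from local_coordinate_form[OF c, of u] obtain \<alpha> V where \<alpha>: "smooth_form A \<alpha>" "compact_support \<alpha>"
    and V: "open V" "p0 \<in> V" "V \<subseteq> fst c" and \<alpha>V: "\<forall>q\<in>V. \<alpha> q = cov c q u"
    by (elim exE conjE) (rule that)
  have "(\<lambda>q. sharp \<pi> q (\<alpha> q)) \<in> sharp_module A \<pi>"
    unfolding sharp_module_def by (intro CollectI exI[of _ \<alpha>] conjI \<alpha> refl)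
  from span[OF this] obtain W g where W: "open W" "p0 \<in> W" and g: "\<forall>i<r. smooth_fun_on A UNIV (g i)"
    and gW: "\<forall>q\<in>W. sharp \<pi> q (\<alpha> q) = (\<Sum>i<r. g i q *\<^sub>R Y i q)"
    by (elim exE conjE) (rule that)
  have "\<forall>q\<in>V \<inter> W. sharp \<pi> q (cov c q u) = (\<Sum>i<r. g i q *\<^sub>R Y i q)"
    using gW \<alpha>V by (metis IntD1 IntD2)
  then show ?thesis
    using V W g by (intro exI[of _ "V \<inter> W"] exI[of _ g]) auto
qed

text \<open>In coordinates \<open>sharp\<close> is the sum of the tensors of
  \<open>\<gamma> k\<close> with \<open>y k\<close>. The forms behind the generators are the
  \<open>a k\<close>; their duality with the \<open>\<gamma> k\<close> keeps the latter independent
  everywhere, while the \<open>y k\<close> are so only on a dense set.\<close>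

lemma local_structure:
  fixes p0 :: 'a
  obtains c V y \<gamma> a where "c \<in> A" "p0 \<in> fst c" "open V" "snd c p0 \<in> V" "V \<subseteq> snd c ` fst c"
    "\<And>k. k < r \<Longrightarrow> smooth_on V (\<gamma> k)"
    "\<And>z u. z \<in> V \<Longrightarrow> ham c u z = (\<Sum>k<r. (\<gamma> k z \<bullet> u) *\<^sub>R y k z)"
    "\<And>z k. z \<in> V \<Longrightarrow> k < r \<Longrightarrow> y k z \<in> range (\<lambda>u. ham c u z)"
    "\<And>z. z \<in> V \<Longrightarrow> dual_family r (\<lambda>k. \<gamma> k z) (\<lambda>k. a k z)"
    "\<And>N. open N \<Longrightarrow> N \<subseteq> V \<Longrightarrow> N \<noteq> {} \<Longrightarrow> \<exists>z\<in>N. dim ((\<lambda>i. y i z) ` {..<r}) = r"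
proof -
  define c where "c = chart_at A p0"
  have c: "c \<in> A" "p0 \<in> fst c" "adm c" using chart_at by (auto simp: c_def)
  have ch: "is_chart c" by (rule adm_chart[OF c(3)])
  from local_generators[of p0] obtain V0 Y where V0: "open V0" "p0 \<in> V0" and Y: "\<forall>i<r. Y i \<in> sharp_module A \<pi>"
    and span: "\<forall>Z\<in>sharp_module A \<pi>. \<exists>W g. open W \<and> p0 \<in> W \<and> (\<forall>i<r. smooth_fun_on A UNIV (g i)) \<and>
       (\<forall>q\<in>W. Z q = (\<Sum>i<r. g i q *\<^sub>R Y i q))"
    and rel: "\<forall>h. (\<forall>i<r. smooth_fun_on A UNIV (h i)) \<and> (\<forall>q. (\<Sum>i<r. h i q *\<^sub>R Y i q) = 0) \<longrightarrow> (\<forall>i<r. \<forall>q\<in>V0. h i q = 0)"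
    by (elim exE conjE) (rule that)
  have "\<forall>u. \<exists>W g. open W \<and> p0 \<in> W \<and> W \<subseteq> fst c \<and> (\<forall>i<r. smooth_fun_on A UNIV (g i)) \<and>
       (\<forall>q\<in>W. sharp \<pi> q (cov c q u) = (\<Sum>i<r. g i q *\<^sub>R Y i q))"
    by (rule allI, rule coordinate_field_expansion[OF c(1,2) bspec[OF span]])
  from choice[OF this] obtain W where "\<forall>u. \<exists>g. open (W u) \<and> p0 \<in> W u \<and> W u \<subseteq> fst c \<and> (\<forall>i<r. smooth_fun_on A UNIV (g i)) \<and>
       (\<forall>q\<in>W u. sharp \<pi> q (cov c q u) = (\<Sum>i<r. g i q *\<^sub>R Y i q))" ..
  from choice[OF this] obtain g where "\<forall>u. open (W u) \<and> p0 \<in> W u \<and> W u \<subseteq> fst c \<and> (\<forall>i<r. smooth_fun_on A UNIV (g u i)) \<and>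
       (\<forall>q\<in>W u. sharp \<pi> q (cov c q u) = (\<Sum>i<r. g u i q *\<^sub>R Y i q))" ..
  then have W: "\<And>u. open (W u)" "\<And>u. p0 \<in> W u" "\<And>u. W u \<subseteq> fst c" and g: "\<And>u i. i < r \<Longrightarrow> smooth_fun_on A UNIV (g u i)"
    and gW: "\<And>u q. q \<in> W u \<Longrightarrow> sharp \<pi> q (cov c q u) = (\<Sum>i<r. g u i q *\<^sub>R Y i q)"
    by simp_all
  \<comment> \<open>The neighbourhoods depend on \<open>u\<close>; linearity of \<open>ham\<close>
    in \<open>u\<close> allows restricting to the finitely many basis vectors.\<close>
  define W0 where "W0 = V0 \<inter> fst c \<inter> (\<Inter>u\<in>Basis. W u)"
  have W0: "open W0" "p0 \<in> W0" "W0 \<subseteq> fst c" "W0 \<subseteq> V0" "\<And>u. u \<in> Basis \<Longrightarrow> W0 \<subseteq> W u"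
    using V0 W(1,2) c(2) chart_open(1)[OF ch] unfolding W0_def by (auto intro!: open_INT)
  define V where "V = snd c ` (fst c \<inter> W0)"
  have V: "open V" "V \<subseteq> snd c ` fst c" "snd c p0 \<in> V" "V \<subseteq> snd c ` (fst c \<inter> V0)"
    unfolding V_def using chart_image_open[OF ch W0(1)] c(2) W0(2,4) by auto
  have "\<forall>k. k < r \<longrightarrow> (\<exists>a. smooth_on (snd c ` fst c) a \<and> (\<forall>z\<in>snd c ` fst c. local_rep A c (Y k) z = ham c (a z) z))"
    by (intro allI impI sharp_module_chart[OF c(1)] Y[rule_format])
  then have "\<forall>k. \<exists>a. k < r \<longrightarrow> smooth_on (snd c ` fst c) a \<and> (\<forall>z\<in>snd c ` fst c. local_rep A c (Y k) z = ham c (a z) z)"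
    by blast
  from choice[OF this] obtain a where "\<forall>k. k < r \<longrightarrow> smooth_on (snd c ` fst c) (a k) \<and> (\<forall>z\<in>snd c ` fst c. local_rep A c (Y k) z = ham c (a k z) z)" ..
  then have a: "\<And>k. k < r \<Longrightarrow> smooth_on V (a k)" and aY: "\<And>k z. k < r \<Longrightarrow> z \<in> V \<Longrightarrow> local_rep A c (Y k) z = ham c (a k z) z"
    using V(2) smooth_on_subset[OF _ V(2)] by auto
  define y where "y k = local_rep A c (Y k)" for k
  have ysm: "smooth_on V (y k)" if "k < r" for k
    unfolding y_def
    by (subst smooth_on_cong[OF V(1) aY[OF that]], assumption) (rule ham_smooth_field[OF c(1) V(1,2) a[OF that]])
  \<comment> \<open>Collects the coefficients of \<open>y k\<close> in the fields
    \<open>ham c e\<close> into one vector, so that the coefficient for general \<open>u\<close> is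
    an inner product with \<open>u\<close>.\<close>
  define \<gamma> where "\<gamma> k z = (\<Sum>e\<in>Basis. g e k (chart_inv c z) *\<^sub>R e)" for k z
  have \<gamma>sm: "smooth_on V (\<gamma> k)" if "k < r" for k
  proof -
    have "smooth_on V (\<lambda>z. g e k (chart_inv c z))" for e
      by (rule smooth_on_subset[OF smooth_fun_on_chart[OF g[OF that] open_UNIV c(3)]]) (use V(2) in simp)
    then show ?thesis unfolding \<gamma>_def
      by (intro smooth_on_sum[OF V(1)] smooth_on_linear_compose[OF bounded_linear_scaleR_left V(1)])
  qed
  have ham_y: "ham c u z = (\<Sum>k<r. (\<gamma> k z \<bullet> u) *\<^sub>R y k z)" if z: "z \<in> V" for u z
  proof -
    obtain q where q: "q \<in> fst c" "q \<in> W0" "z = snd c q" using z unfolding V_def by blast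
    have qz: "chart_inv c z = q" using chart_inv_left[OF ch q(1)] q(3) by simp
    have lin: "linear (\<lambda>u. ham c u z)" by (rule ham_linear[OF c(3)]) (use z V(2) in blast)
    have e: "ham c e z = (\<Sum>k<r. g e k q *\<^sub>R y k z)" if "e \<in> Basis" for e
    proof -
      have "q \<in> W e" using W0(5)[OF that] q(2) by blast
      then show ?thesis
        unfolding q(3) ham_at[OF c(3) q(1)] y_def local_rep_at[OF c(3) q(1)] gW[OF \<open>q \<in> W e\<close>]
        by (simp add: linear_sum[OF dchart_linear(1)[OF c(3) q(1)]] linear_scale[OF dchart_linear(1)[OF c(3) q(1)]])
    qed
    have "ham c u z = (\<Sum>e\<in>Basis. (u \<bullet> e) *\<^sub>R ham c e z)"
      using linear_sum[OF lin, of "\<lambda>e. (u \<bullet> e) *\<^sub>R e" Basis] by (simp add: euclidean_representation linear_scale[OF lin])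
    also have "\<dots> = (\<Sum>e\<in>Basis. \<Sum>k<r. ((u \<bullet> e) * g e k q) *\<^sub>R y k z)"
      by (intro sum.cong refl) (simp add: e scaleR_sum_right)
    also have "\<dots> = (\<Sum>k<r. \<Sum>e\<in>Basis. ((u \<bullet> e) * g e k q) *\<^sub>R y k z)" by (rule sum.swap)
    also have "\<dots> = (\<Sum>k<r. (\<gamma> k z \<bullet> u) *\<^sub>R y k z)"
      by (intro sum.cong refl)
        (simp add: \<gamma>_def qz inner_sum_left scaleR_sum_left inner_commute[of u] mult.commute)
    finally show ?thesis .
  qed
  have rel': "h k z = 0" if "open N" "N \<subseteq> V" "\<And>k. k < r \<Longrightarrow> smooth_on N (h k)"
    "\<And>z. z \<in> N \<Longrightarrow> (\<Sum>k<r. h k z *\<^sub>R y k z) = 0" "k < r" "z \<in> N" for N h k z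
    by (rule local_relation[where V = V0 and Y = Y and h = h, OF c(1) that(1) _ spec[OF rel] that(3) that(4)[unfolded y_def] that(5,6)])
      (use that(2) V(4) in blast)+
  have dual: "dual_family r (\<lambda>k. \<gamma> k z) (\<lambda>k. a k z)" if z: "z \<in> V" for z
    unfolding dual_family_def
  proof (intro allI impI)
    fix i j assume i: "i < r" and j: "j < r"
    \<comment> \<open>Expanding \<open>y i z = ham c (a i z) z\<close> in the generators and
      subtracting \<open>y i z\<close> gives a relation with these coefficients, which therefore
      vanish.\<close>
    define h where "h k z = \<gamma> k z \<bullet> a i z - (if i = k then 1 else 0)" for k z
    have "h j z = 0"
    proof (rule rel'[OF V(1) subset_refl _ _ j z, of h])
      show "smooth_on V (h k)" if "k < r" for k
        unfolding h_def by (intro smooth_on_diff[OF V(1)] smooth_on_inner[OF V(1)] \<gamma>sm[OF that] a[OF i] smooth_on_const[OF V(1)])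
      show "(\<Sum>k<r. h k z *\<^sub>R y k z) = 0" if "z \<in> V" for z
      proof -
        have "(\<Sum>k<r. h k z *\<^sub>R y k z) = ham c (a i z) z - (\<Sum>k<r. (if i = k then 1 else 0) *\<^sub>R y k z)"
          by (simp add: h_def ham_y[OF that] scaleR_diff_left sum_subtractf)
        also have "(\<Sum>k<r. (if i = k then 1 else 0) *\<^sub>R y k z) = (\<Sum>k<r. if i = k then y k z else 0)"
          by (rule sum.cong) auto
        also have "\<dots> = y i z" using i by simp
        finally show ?thesis using aY[OF i that] by (simp add: y_def)
      qed
    qed
    then show "\<gamma> j z \<bullet> a i z = (if i = j then 1 else 0)" by (simp add: h_def)
  qed
  show thesis
  proof (rule that[OF c(1,2) V(1,3,2) \<gamma>sm ham_y _ dual])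
    show "y k z \<in> range (\<lambda>u. ham c u z)" if "z \<in> V" "k < r" for z k
      unfolding y_def aY[OF that(2,1)] by (rule rangeI)
    show "\<exists>z\<in>N. dim ((\<lambda>i. y i z) ` {..<r}) = r" if "open N" "N \<subseteq> V" "N \<noteq> {}" for N
    proof (rule weakly_independent_dense[where V = V and y = y and r = r, OF _ _ le_refl that])
      fix N and h :: "nat \<Rightarrow> 'e \<Rightarrow> real" and k z
      assume "open N" "N \<subseteq> V" "\<And>k. k < r \<Longrightarrow> smooth_on N (h k)" "\<And>z. z \<in> N \<Longrightarrow> (\<Sum>k<r. h k z *\<^sub>R y k z) = 0" "k < r" "z \<in> N"
      then show "h k z = 0" by (rule rel'[of N h k z])
    qed (rule ysm)
  qed
qed

text \<open>The fields are those with coordinates \<open>\<gamma> k\<close>; the generators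
  \<open>y k\<close> may degenerate at singular points.\<close>

lemma local_frame:
  fixes p0 :: 'a
  shows "\<exists>U X. open U \<and> p0 \<in> U \<and> (\<forall>i<r. smooth_vf_on A U (X i)) \<and> (\<forall>q\<in>U. dim ((\<lambda>i. X i q) ` {..<r}) = r) \<and>
    (\<forall>q\<in>U. range (sharp \<pi> q) \<subseteq> span ((\<lambda>i. X i q) ` {..<r}))"
proof -
  obtain c V y \<gamma> a where c: "c \<in> A" "p0 \<in> fst c" and V: "open V" "snd c p0 \<in> V" "V \<subseteq> snd c ` fst c"
    and \<gamma>: "\<And>k. k < r \<Longrightarrow> smooth_on V (\<gamma> k)"
    and ham_y: "\<And>z u. z \<in> V \<Longrightarrow> ham c u z = (\<Sum>k<r. (\<gamma> k z \<bullet> u) *\<^sub>R y k z)"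
    and dual: "\<And>z. z \<in> V \<Longrightarrow> dual_family r (\<lambda>k. \<gamma> k z) (\<lambda>k. a k z)"
    by (rule local_structure) (rule that; assumption)
  have ac: "adm c" and ch: "is_chart c" using c(1) atlas_adm adm_chart by auto
  define U where "U = {q \<in> fst c. snd c q \<in> V}"
  define X where "X k q = dchart_inv A c q (\<gamma> k (snd c q))" for k q
  have U: "open U" "p0 \<in> U" "U \<subseteq> fst c" unfolding U_def using chart_preimage_open[OF ch V(1)] V(2) c(2) by auto
  have UV: "snd c ` U \<subseteq> V" by (auto simp: U_def)
  have X\<gamma>: "local_rep A c (X k) (snd c q) = \<gamma> k (snd c q)" if "q \<in> U" for k q
    using that U(3) by (simp add: local_rep_at[OF ac] X_def dchart_inverse(2)[OF ac] subset_eq)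
  have "smooth_vf_on A U (X k)" if "k < r" for k
  proof (rule smooth_vf_onI[OF ac U(1,3) smooth_on_subset[OF \<gamma>[OF that] UV]])
    show "dchart A c q (X k q) = \<gamma> k (snd c q)" if "q \<in> U" for q
      using that U(3) by (simp add: X_def dchart_inverse(2)[OF ac] subset_eq)
  qed
  moreover have "dim ((\<lambda>i. X i q) ` {..<r}) = r" if q: "q \<in> U" for q
  proof -
    have qc: "q \<in> fst c" "snd c q \<in> V" using q by (auto simp: U_def)
    show ?thesis
      using local_rep_span(2)[OF ac qc(1), of X "{..<r}"] dual_family_dim[OF dual[OF qc(2)]] by (simp add: X\<gamma>[OF q])
  qed
  moreover have "range (sharp \<pi> q) \<subseteq> span ((\<lambda>i. X i q) ` {..<r})" if q: "q \<in> U" for q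
  proof
    fix v assume "v \<in> range (sharp \<pi> q)"
    have qc: "q \<in> fst c" "snd c q \<in> V" using q by (auto simp: U_def)
    have z: "snd c q \<in> snd c ` fst c" using qc(1) by (rule imageI)
    have "dchart A c q v \<in> range (\<lambda>u. ham c u (snd c q))"
      unfolding ham_range[OF ac qc(1)] using \<open>v \<in> range (sharp \<pi> q)\<close> by (rule imageI)
    then obtain u where u: "dchart A c q v = ham c u (snd c q)" by (rule rangeE)
    \<comment> \<open>Skewness exchanges the two tensor factors: the image of \<open>sharp\<close>,
      contained in the span of the \<open>y k\<close>, is also expressed through the
      \<open>\<gamma> k\<close>.\<close>
    have "ham c u (snd c q) \<bullet> w = (\<Sum>k<r. (- (y k (snd c q) \<bullet> u)) *\<^sub>R \<gamma> k (snd c q)) \<bullet> w" for w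
      unfolding ham_skew[OF ac z, of u w] unfolding ham_y[OF qc(2)]
      by (simp add: inner_sum_left sum_negf[symmetric] mult.commute)
    then have "ham c u (snd c q) = (\<Sum>k<r. (- (y k (snd c q) \<bullet> u)) *\<^sub>R \<gamma> k (snd c q))"
      by (subst vector_eq_rdot[symmetric]) (rule allI)
    then have "dchart A c q v \<in> span ((\<lambda>k. \<gamma> k (snd c q)) ` {..<r})"
      unfolding u by (simp only: sum_in_span_family)
    also have "\<dots> = dchart A c q ` span ((\<lambda>i. X i q) ` {..<r})"
      using local_rep_span(1)[OF ac qc(1), of X "{..<r}"] by (simp add: X\<gamma>[OF q])
    finally show "v \<in> span ((\<lambda>i. X i q) ` {..<r})" unfolding dchart_mem_iff[OF ac qc(1)] .
  qed
  ultimately show ?thesis using U by (intro exI[of _ U] exI[of _ X] conjI allI impI ballI)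
qed

section \<open>Maximal rank, density and gluing of the frames\<close>

lemma sharp_rank_bound: "sharp_rank \<pi> p \<le> r"
proof -
  from local_frame[of p] obtain U X where p: "p \<in> U" and X: "\<forall>q\<in>U. dim ((\<lambda>i. X i q) ` {..<r}) = r"
    "\<forall>q\<in>U. range (sharp \<pi> q) \<subseteq> span ((\<lambda>i. X i q) ` {..<r})" by (elim exE conjE) (rule that)
  show ?thesis
    unfolding sharp_rank_def using dim_subset[OF bspec[OF X(2) p]] bspec[OF X(1) p] by (simp add: dim_span)
qed

text \<open>The \<open>y k\<close> take values in the image of \<open>sharp\<close> and are
  independent somewhere in every small open set, which forces rank at least \<open>r\<close>
  there.\<close>

lemma sharp_rank_dense:
  assumes "open N" "N \<noteq> {}"
  shows "\<exists>q\<in>N. sharp_rank \<pi> q = r"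
proof -
  obtain p0 where p0: "p0 \<in> N" using assms(2) by blast
  obtain c V y where c: "c \<in> A" "p0 \<in> fst c" and V: "open V" "snd c p0 \<in> V" "V \<subseteq> snd c ` fst c"
    and y: "\<And>z k. z \<in> V \<Longrightarrow> k < r \<Longrightarrow> y k z \<in> range (\<lambda>u. ham c u z)"
    and dense: "\<And>N. open N \<Longrightarrow> N \<subseteq> V \<Longrightarrow> N \<noteq> {} \<Longrightarrow> \<exists>z\<in>N. dim ((\<lambda>i. y i z) ` {..<r}) = r"
    by (rule local_structure[of p0]) (rule that; assumption)
  have ac: "adm c" and ch: "is_chart c" using c(1) atlas_adm adm_chart by auto
  have "\<exists>z\<in>V \<inter> snd c ` (fst c \<inter> N). dim ((\<lambda>i. y i z) ` {..<r}) = r"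
    by (rule dense) (use V c p0 chart_image_open[OF ch assms(1)] in auto)
  then obtain z where z: "z \<in> V" "z \<in> snd c ` (fst c \<inter> N)" "dim ((\<lambda>i. y i z) ` {..<r}) = r" by (elim bexE IntE) (rule that)
  from z(2) obtain q where "q \<in> fst c" "q \<in> N" "z = snd c q" by (elim imageE IntE) (rule that)
  with z have q: "q \<in> fst c" "q \<in> N" "snd c q \<in> V" "dim ((\<lambda>i. y i (snd c q)) ` {..<r}) = r" by simp_all
  have "(\<lambda>i. y i (snd c q)) ` {..<r} \<subseteq> range (\<lambda>u. ham c u (snd c q))"
    by (rule image_subsetI) (rule y[OF q(3)], simp)
  from dim_subset[OF this] have "r \<le> dim (range (\<lambda>u. ham c u (snd c q)))" by (simp only: q(4))
  then have "r \<le> sharp_rank \<pi> q" unfolding sharp_rank_ham[OF ac q(1)] .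
  then show ?thesis using sharp_rank_bound[of q] q(2) by (intro bexI[of _ q]) auto
qed

lemma rmax_eq: "rmax = r"
proof (rule Max_eqI[OF finite_ranks])
  show "r \<in> range (sharp_rank \<pi>)" using sharp_rank_dense[OF open_UNIV] by auto
qed (use sharp_rank_bound in auto)

lemma dense_regular: dense_reg
proof -
  have "- closure (M_reg \<pi>) = {}"
  proof (rule ccontr)
    assume "- closure (M_reg \<pi>) \<noteq> {}"
    then have "\<exists>q\<in>- closure (M_reg \<pi>). sharp_rank \<pi> q = r" by (intro sharp_rank_dense) auto
    then show False using closure_subset[of "M_reg \<pi>"] by (auto simp: M_reg_iff rmax_eq)
  qed
  then show ?thesis by auto
qed

lemma regular_frame_exists: "\<exists>U X. regular_frame U X \<and> p \<in> U"
proof -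
  from local_frame[of p] obtain U X where U: "open U" "p \<in> U" and X: "\<forall>i<r. smooth_vf_on A U (X i)"
    "\<forall>q\<in>U. dim ((\<lambda>i. X i q) ` {..<r}) = r"
    and sub: "\<forall>q\<in>U. range (sharp \<pi> q) \<subseteq> span ((\<lambda>i. X i q) ` {..<r})" by (elim exE conjE) (rule that)
  have "range (sharp \<pi> q) = span ((\<lambda>i. X i q) ` {..<r})" if "q \<in> U" "q \<in> M_reg \<pi>" for q
  proof (rule subspace_dim_equal)
    show "subspace (range (sharp \<pi> q))"
      by (rule linear_subspace_image[OF linear_sharp[of \<pi>, OF pi_wedge] subspace_UNIV])
    show "dim (span ((\<lambda>i. X i q) ` {..<r})) \<le> dim (range (sharp \<pi> q))"
      using that(2) bspec[OF X(2) that(1)] unfolding M_reg_iff rmax_eq by (simp add: sharp_rank_def dim_span)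
  qed (use sub that in auto)
  then have "regular_frame U X"
    unfolding regular_frame_def rmax_eq using U(1) X by auto
  then show ?thesis using U(2) by blast
qed

text \<open>One frame is chosen around each point; agreement of the spans makes every chosen frame a
  smooth frame of \<open>D\<close> on its whole domain.\<close>

lemma extension_exists: "\<exists>D. extends_symplectic_foliation A \<pi> D"
proof -
  from choice[OF allI[OF regular_frame_exists]] obtain U where "\<forall>p. \<exists>X. regular_frame (U p) X \<and> p \<in> U p" ..
  from choice[OF this] obtain X where X: "\<And>p. regular_frame (U p) (X p)" and U: "\<And>p. p \<in> U p" by blast
  define D where "D p = span ((\<lambda>i. X p i p) ` {..<rmax})" for p
  have frame: "D q = span ((\<lambda>i. X p i q) ` {..<rmax})" if "q \<in> U p" for p q
    unfolding D_def
    by (rule equalityI; rule regular_frames_subset[OF dense_regular]) (rule X U that)+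
  have "distribution A rmax D"
    unfolding distribution_def
  proof (intro allI conjI)
    fix p
    show "subspace (D p)" by (simp add: D_def)
    show "dim (D p) = rmax" unfolding D_def dim_span by (rule regular_frameD(3)[OF X U])
    show "\<exists>V Y. open V \<and> p \<in> V \<and> (\<forall>i<rmax. smooth_vf_on A V (Y i)) \<and> (\<forall>q\<in>V. D q = span ((\<lambda>i. Y i q) ` {..<rmax}))"
      by (intro exI[of _ "U p"] exI[of _ "X p"] conjI allI impI ballI regular_frameD(1,2)[OF X] U frame)
  qed
  moreover have "\<exists>L. symplectic_leaf A \<pi> L \<and> p \<in> topspace L \<and> tangent_space A L p = D p" if "p \<in> M_reg \<pi>" for p
    unfolding D_def regular_frameD(4)[OF X U that, symmetric] by (rule symplectic_leaf_exists[OF that])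
  ultimately have "extends_symplectic_foliation A \<pi> D"
    unfolding extends_symplectic_foliation_def by (intro conjI exI[of _ rmax] ballI)
  then show ?thesis by (rule exI[of _ D])
qed

end

section \<open>The equivalence and the properties of the distribution\<close>

lemma (in poisson) almost_regularD:
  assumes "almost_regular A \<pi>"
  shows "dense_reg" "\<exists>D. extends_symplectic_foliation A \<pi> D"
proof -
  obtain r and E :: "'a \<Rightarrow> (nat \<Rightarrow>\<^sub>0 real) set" and T \<Phi> where "vector_bundle A r E T"
    "module_iso A (compact_sections A r E T) (sharp_module A \<pi>) \<Phi>"
    using assms unfolding almost_regular_def by (elim exE conjE) (rule that)
  then interpret regular_module A \<pi> r E T \<Phi> by unfold_locales
  show "dense_reg" by (rule dense_regular)
  show "\<exists>D. extends_symplectic_foliation A \<pi> D" by (rule extension_exists)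
qed

lemma (in poisson) almost_regularI:
  assumes "dense_reg" "extends_symplectic_foliation A \<pi> D"
  shows "almost_regular A \<pi>"
proof -
  interpret poisson_extension A \<pi> D by unfold_locales (fact assms)+
  show ?thesis by (rule almost_regular)
qed

theorem theoremB:
  fixes A :: "('a::{t2_space, second_countable_topology}, 'e::euclidean_space) chart set"
    and \<pi> :: "'a \<Rightarrow> 'e biform"
  assumes "poisson_manifold A \<pi>"
  shows "(almost_regular A \<pi> \<longleftrightarrow>
            closure (M_reg \<pi>) = UNIV \<and> (\<exists>D. extends_symplectic_foliation A \<pi> D)) \<and>
         (almost_regular A \<pi> \<longrightarrow>
            (\<exists>!D. extends_symplectic_foliation A \<pi> D) \<and>
            (\<forall>D. extends_symplectic_foliation A \<pi> D \<longrightarrow>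
               involutive A D \<and> integrable_distribution A D \<and>
               (\<forall>P. leaf A D P \<longrightarrow> poisson_submanifold A \<pi> P)))"
proof -
  interpret poisson A \<pi> using assms by unfold_locales
  show ?thesis
  proof (intro conjI impI iffI allI)
    assume regular: "almost_regular A \<pi>"
    note dense = almost_regularD(1)[OF regular]
    show "closure (M_reg \<pi>) = UNIV" by (rule dense)
    show ex: "\<exists>D. extends_symplectic_foliation A \<pi> D" by (rule almost_regularD(2)[OF regular])
    then show "\<exists>!D. extends_symplectic_foliation A \<pi> D" by (rule ex_ex1I) (rule extends_unique[OF dense])
    fix D assume D: "extends_symplectic_foliation A \<pi> D"
    show "involutive A D" by (rule extends_involutive[OF dense D])
    show "integrable_distribution A D" by (rule extends_integrable[OF dense D])
    show "poisson_submanifold A \<pi> P" if "leaf A D P" for P by (rule leaf_poisson_submanifold[OF dense D that])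
  next
    assume "closure (M_reg \<pi>) = UNIV \<and> (\<exists>D. extends_symplectic_foliation A \<pi> D)"
    then show "almost_regular A \<pi>" by (elim conjE exE) (rule almost_regularI)
  qed
qed

end
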